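(* Let $n\ge1$, $a\ge0$ and $n_a=n+a>1$. There exists a constant $S(n,a,1)$ such that for any smooth function $f$ on $\overline\Omega=\mathbb R^{n-1}\times[0,\infty)$ with compact support in $\overline\Omega$, $$\|f\|_{L^{\frac{n_a}{n_a-1}}(\Omega,\omega)}\le S(n,a,1)\,\|\nabla f\|_{L^1(\Omega,\omega)}.$$ The best (smallest) constant $S(n,a,1)$ is given by $$S(n,a,1)=n_a^{-1}\left(\int_{B\cap\Omega}x_n^a\,dx\right)^{-\frac1{n_a}}.$$ The inequality extends to all functions $f$ of $\omega$-bounded variation, with $\|\nabla f\|_{L^1(\Omega,\omega)}$ replaced by $\int_\Omega\omega\,\|\nu_f\|_*\,d|Df|$; and (with the best constant) equality holds if $$f(x)=c\,h_{1,a}(\lambda(\overline x-\overline x_0,x_n))$$ for some $c\in\mathbb R$, $\lambda>0$, $\overline x_0\in\mathbb R^{n-1}$.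
   Context: $\Omega=\{x=(\overline x,x_n)\in\mathbb R^{n-1}\times\mathbb R: x_n>0\}$ and $\omega(x)=x_n^a$. $\|\cdot\|$ is an arbitrary norm on $\mathbb R^n$, $B=\{x\in\mathbb R^n:\|x\|\le1\}$, $\|x\|_*=\sup_{\|y\|\le1}x\cdot y$. $\|f\|_{L^r(\Omega,\omega)}=(\int_\Omega|f|^r\omega\,dx)^{1/r}$ and $\|\nabla f\|_{L^1(\Omega,\omega)}=\int_\Omega\|\nabla f\|_*\,\omega\,dx$. A function $f:\Omega\to\mathbb R$ is said to have $\omega$-bounded variation if $$\sup\left\{\int_\Omega f\,\mathrm{div}(g\omega)\,dx:\ g\in C_0^1(\Omega,\mathbb R^n),\ \|g(x)\|\le1\ \forall x\in\Omega\right\}<\infty .$$ Such $f$ has locally bounded variation on $\Omega$; $Df$ denotes the vector valued Radon measure on $\Omega$ with $\int_\Omega f\,\mathrm{div}\varphi\,dx=-\int_\Omega\varphi\cdot dDf$ for all $\varphi\in C_0^1(\Omega,\mathbb R^n)$, $|Df|$ its total variation, and $\nu_f:\Omega\to\mathbb R^n$ the $|Df|$-measurable function with $|\nu_f|=1$ $|Df|$-a.e. and $dDf=\nu_f\,d|Df|$. The supremum above equals $\int_\Omega\omega\|\nu_f\|_*\,d|Df|$, and this equals $\|\nabla f\|_{L^1(\Omega,\omega)}$ when the level sets $\{x\in\Omega:|f(x)|>t\}$, $t>0$, have finite $\omega\,dx$-measure and the distributional gradient of $f$ belongs to $L^1(\Omega,\omega)$. Finally, $$h_{1,a}(x)=\frac{\mathbf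 1_{B\cap\Omega}(x)}{\left(\int_{B\cap\Omega}x_n^a\,dx\right)^{\frac{n_a-1}{n_a}}}.$$
   Formalization: For functions of ω-bounded variation the inequality is proved when all level sets {|f|>t}, t>0, have finite ω dx-measure; without this it fails, e.g. for f=1, where Df=0 but the left-hand norm is infinite. *)

theory Defs
  imports "HOL-Analysis.Analysis"
begin

text \<open>
  \<open>\<real>\<^sup>n\<close> is \<^typ>\<open>real ^ 'n\<close> with \<open>n = CARD('n)\<close>, and an arbitrary index \<open>k\<close> plays the part
  of the last coordinate. This includes \<open>n = 1\<close>, which a product type \<open>'a \<times> real\<close> with a
  Euclidean space \<open>'a\<close> would exclude.
\<close>

definition halfspace :: "'n::finite \<Rightarrow> (real ^ 'n) set" where
  "halfspace k = {x. 0 < x $ k}"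

definition closed_halfspace :: "'n::finite \<Rightarrow> (real ^ 'n) set" where
  "closed_halfspace k = {x. 0 \<le> x $ k}"

definition weight :: "'n::finite \<Rightarrow> real \<Rightarrow> real ^ 'n \<Rightarrow> real" where
  "weight k a x = x $ k powr a"

definition wmeasure :: "'n::finite \<Rightarrow> real \<Rightarrow> (real ^ 'n) measure" where
  "wmeasure k a = density (lebesgue_on (halfspace k)) (\<lambda>x. ennreal (weight k a x))"

text \<open>The number \<open>n\<^sub>a = n + a\<close>; the index only supplies the dimension.\<close>

definition wdim :: "'n::finite \<Rightarrow> real \<Rightarrow> real" where
  "wdim (k::'n) a = real CARD('n) + a"

definition is_norm :: "('a::real_vector \<Rightarrow> real) \<Rightarrow> bool" where
  "is_norm N \<longleftrightarrow>
     (\<forall>x. 0 \<le> N x) \<and> (\<forall>x. N x = 0 \<longleftrightarrow> x = 0) \<and>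
     (\<forall>c x. N (c *\<^sub>R x) = \<bar>c\<bar> * N x) \<and> (\<forall>x y. N (x + y) \<le> N x + N y)"

definition dual_norm :: "('a::real_inner \<Rightarrow> real) \<Rightarrow> 'a \<Rightarrow> real" where
  "dual_norm N x = (SUP y\<in>{y. N y \<le> 1}. x \<bullet> y)"

definition gradient :: "(real ^ 'n \<Rightarrow> real) \<Rightarrow> real ^ 'n \<Rightarrow> real ^ 'n" where
  "gradient f x = (\<chi> i. frechet_derivative f (at x) (axis i 1))"

definition divergence :: "(real ^ 'n \<Rightarrow> real ^ 'n) \<Rightarrow> real ^ 'n \<Rightarrow> real" where
  "divergence g x = trace (jacobian g (at x))"

text \<open>
  \<open>C\<^sup>m\<close> functions on \<open>A\<close>. Derivatives are taken within \<open>A\<close>: on an open set these are the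
  ordinary ones, on the closed half-space this is differentiability up to the boundary (one-sided
  in the normal direction). On both kinds of set the gradient field is unique.
\<close>

primrec Cm_on :: "nat \<Rightarrow> (real ^ 'n) set \<Rightarrow> (real ^ 'n \<Rightarrow> real) \<Rightarrow> bool" where
  "Cm_on 0 A f \<longleftrightarrow> continuous_on A f"
| "Cm_on (Suc m) A f \<longleftrightarrow>
     (\<exists>G :: real ^ 'n \<Rightarrow> real ^ 'n.
        (\<forall>x\<in>A. (f has_derivative (\<lambda>h. G x \<bullet> h)) (at x within A)) \<and>
        (\<forall>i. Cm_on m A (\<lambda>x. G x $ i)))"

definition smooth_cs_closed_halfspace :: "'n::finite \<Rightarrow> (real ^ 'n \<Rightarrow> real) \<Rightarrow> bool" where
  "smooth_cs_closed_halfspace k f \<longleftrightarrow>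
     (\<forall>m. Cm_on m (closed_halfspace k) f) \<and>
     compact (closure {x \<in> closed_halfspace k. f x \<noteq> 0})"

text \<open>The vector fields in \<open>C\<^sub>0\<^sup>1(\<Omega>, \<real>\<^sup>n)\<close>; values outside \<open>\<Omega>\<close> are irrelevant.\<close>

definition test_field :: "'n::finite \<Rightarrow> (real ^ 'n \<Rightarrow> real ^ 'n) \<Rightarrow> bool" where
  "test_field k g \<longleftrightarrow>
     (\<forall>i. Cm_on 1 (halfspace k) (\<lambda>x. g x $ i)) \<and>
     (\<exists>K. compact K \<and> K \<subseteq> halfspace k \<and> (\<forall>x \<in> halfspace k - K. g x = 0))"

text \<open>
  Finiteness of the supremum is boundedness from above of the (nonempty) set. Local integrability
  on \<open>\<Omega>\<close> is what makes the integrals in the set meaningful. Every constant satisfies this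
  predicate (the integrals vanish), so a Sobolev inequality on this class needs in addition that the
  level sets \<open>{|f| > t}\<close> have finite \<open>\<omega> dx\<close>-measure.
\<close>

definition weighted_BV :: "(real ^ 'n \<Rightarrow> real) \<Rightarrow> 'n::finite \<Rightarrow> real \<Rightarrow> (real ^ 'n \<Rightarrow> real) \<Rightarrow> bool" where
  "weighted_BV N k a f \<longleftrightarrow>
     (\<forall>K. compact K \<and> K \<subseteq> halfspace k \<longrightarrow> f absolutely_integrable_on K) \<and>
     bdd_above {LINT x:halfspace k|lebesgue. f x * divergence (\<lambda>y. weight k a y *\<^sub>R g y) x
                | g. test_field k g \<and> (\<forall>x\<in>halfspace k. N (g x) \<le> 1)}"

text \<open>
  \<open>\<mu> = |Df|\<close> and \<open>\<nu> = \<nu>\<^sub>f\<close>: a Radon measure on \<open>\<Omega>\<close> (a Borel measure finite on compact sets) and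
  a unit field representing \<open>Df = \<nu> \<mu>\<close>. The integration by parts formula determines \<open>\<mu>\<close>, and
  it determines \<open>\<nu>\<close> up to a \<open>\<mu>\<close>-null set.
\<close>

definition derivative_measure ::
    "'n::finite \<Rightarrow> (real ^ 'n \<Rightarrow> real) \<Rightarrow> (real ^ 'n) measure \<Rightarrow> (real ^ 'n \<Rightarrow> real ^ 'n) \<Rightarrow> bool" where
  "derivative_measure k f \<mu> \<nu> \<longleftrightarrow>
     sets \<mu> = sets (restrict_space borel (halfspace k)) \<and>
     (\<forall>K. compact K \<and> K \<subseteq> halfspace k \<longrightarrow> emeasure \<mu> K < \<infinity>) \<and>
     \<nu> \<in> borel_measurable \<mu> \<and> (AE x in \<mu>. norm (\<nu> x) = 1) \<and>
     (\<forall>\<phi>. test_field k \<phi> \<longrightarrow>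
        (LINT x:halfspace k|lebesgue. f x * divergence \<phi> x) = - (LINT x|\<mu>. \<phi> x \<bullet> \<nu> x))"

definition ennreal_powr :: "ennreal \<Rightarrow> real \<Rightarrow> ennreal" where
  "ennreal_powr x p = (if x = \<infinity> then \<infinity> else ennreal (enn2real x powr p))"

text \<open>The norms below are \<open>[0, \<infinity>]\<close>-valued, so an upper bound by a finite quantity includes
  the finiteness of the norm.\<close>

definition weighted_Lp_norm :: "real \<Rightarrow> 'n::finite \<Rightarrow> real \<Rightarrow> (real ^ 'n \<Rightarrow> real) \<Rightarrow> ennreal" where
  "weighted_Lp_norm p k a f =
     ennreal_powr (\<integral>\<^sup>+x. ennreal (\<bar>f x\<bar> powr p) \<partial>wmeasure k a) (1 / p)"

definition weighted_grad_norm ::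
    "(real ^ 'n \<Rightarrow> real) \<Rightarrow> 'n::finite \<Rightarrow> real \<Rightarrow> (real ^ 'n \<Rightarrow> real) \<Rightarrow> ennreal" where
  "weighted_grad_norm N k a f = (\<integral>\<^sup>+x. ennreal (dual_norm N (gradient f x)) \<partial>wmeasure k a)"

definition weighted_variation ::
    "(real ^ 'n \<Rightarrow> real) \<Rightarrow> 'n::finite \<Rightarrow> real \<Rightarrow> (real ^ 'n) measure \<Rightarrow> (real ^ 'n \<Rightarrow> real ^ 'n) \<Rightarrow> ennreal" where
  "weighted_variation N k a \<mu> \<nu> = (\<integral>\<^sup>+x. ennreal (weight k a x * dual_norm N (\<nu> x)) \<partial>\<mu>)"

definition halfball_mass :: "(real ^ 'n \<Rightarrow> real) \<Rightarrow> 'n::finite \<Rightarrow> real \<Rightarrow> real" where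
  "halfball_mass N k a = (LINT x:{x. N x \<le> 1} \<inter> halfspace k|lebesgue. weight k a x)"

definition extremal :: "(real ^ 'n \<Rightarrow> real) \<Rightarrow> 'n::finite \<Rightarrow> real \<Rightarrow> real ^ 'n \<Rightarrow> real" where
  "extremal N k a x =
     indicator ({x. N x \<le> 1} \<inter> halfspace k) x
       / halfball_mass N k a powr ((wdim k a - 1) / wdim k a)"

definition is_sobolev_const ::
    "(real ^ 'n \<Rightarrow> real) \<Rightarrow> 'n::finite \<Rightarrow> real \<Rightarrow> ennreal \<Rightarrow> bool" where
  "is_sobolev_const N k a C \<longleftrightarrow>
     (\<forall>f. smooth_cs_closed_halfspace k f \<longrightarrow>
        weighted_Lp_norm (wdim k a / (wdim k a - 1)) k a f \<le> C * weighted_grad_norm N k a f)"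

end

theory Submission
  imports Defs
begin

text \<open>
  The inequality is the isoperimetric inequality for the half-space with the density \<open>x\<^sub>k\<^sup>a\<close>, integrated
  over the superlevel sets. Throughout, \<open>D = n\<^sub>a\<close>, \<open>p = D / (D - 1)\<close>, and \<open>m\<close> is the weighted mass of the unit
  half-ball.

  Its source is a Brunn--Minkowski inequality for subsets of the half-space, with exponent \<open>1 / D\<close>
  (\<open>brunn_minkowski_weighted\<close>). For boxes it reduces to superadditivity of a weighted geometric mean,
  and the argument of Hadwiger and Ohmann extends it to open sets, because the weight depends on one
  coordinate only. Applied to a set \<open>A\<close> and the half-ball of radius \<open>h\<close>, it says that enlarging \<open>A\<close> by the
  half-ball adds at least \<open>h D m\<^sup>1\<^sup>/\<^sup>D |A|\<^sup>1\<^sup>/\<^sup>p\<close> to the mass (\<open>weighted_enlargement\<close>). Enlarging the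
  superlevel sets of \<open>F\<close> is the same as replacing \<open>F\<close> by its supremum over translated half-balls, which
  increases \<open>F\<close> by about \<open>h \<parallel>\<nabla>F\<parallel>\<^sub>*\<close> at most. Comparing both sides as \<open>h\<close> tends to 0, and bounding the \<open>L\<^sup>p\<close> norm
  of \<open>F\<close> by the integral of \<open>|{F > t}|\<^sup>1\<^sup>/\<^sup>p\<close> over \<open>t\<close>, gives the inequality with the stated constant for
  Lipschitz functions (\<open>sobolev_upper_slope\<close>). Functions on the half-space need no boundary condition,
  since the half-ball points into the half-space.

  The constant is sharp because smooth functions approximate the indicator of the half-ball with gradient
  norms converging to \<open>D m\<close>, the derivative of \<open>m r\<^sup>D\<close> at \<open>r = 1\<close> (\<open>smooth_halfball_approx\<close>,
  \<open>sobolev_sharp\<close>).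

  A function of bounded weighted variation is mollified with a kernel supported above the boundary.
  As the weight increases with \<open>x\<^sub>k\<close>, this does not increase the weighted variation (\<open>slope_integral\<close>),
  and by the same monotonicity translations into the half-space are continuous with respect to the
  weighted \<open>L\<^sup>1\<close> norm (\<open>translation_estimate\<close>), so the mollified functions converge and the inequality
  passes to the limit (\<open>sobolev_bv\<close>).

  For the indicator of a half-ball of radius \<open>r\<close>, integration by parts against the same smooth
  approximations bounds the flux of every admissible field by \<open>D m r\<^sup>D\<^sup>-\<^sup>1\<close> (\<open>ball_divergence_bound\<close>). By
  duality (\<open>dual_norm_integral_le\<close>) this is an upper bound for the variation, and the inequality itself is
  the matching lower bound; hence equality holds.
\<close>

section \<open>The weighted measure of boxes\<close>

text \<open>The Borel version of \<open>\<omega> dx\<close>, living on the whole space. It has the same integrals as \<open>wmeasure\<close>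
  on Borel functions and is easier to combine with the Borel measurability tools.\<close>

definition weighted_lborel :: "'n::finite \<Rightarrow> real \<Rightarrow> (real ^ 'n) measure" where
  "weighted_lborel k a = density lborel (\<lambda>x. ennreal (indicator (halfspace k) x * weight k a x))"

lemma sets_weighted_lborel [simp, measurable_cong]: "sets (weighted_lborel k a) = sets borel"
  by (simp add: weighted_lborel_def)

lemma space_weighted_lborel [simp]: "space (weighted_lborel k a) = UNIV"
  by (simp add: weighted_lborel_def)

lemma open_halfspace [simp]: "open (halfspace k)"
  unfolding halfspace_def by (intro open_Collect_less continuous_intros)

lemma closed_closed_halfspace [simp]: "closed (closed_halfspace k)"
  unfolding closed_halfspace_def by (intro closed_Collect_le continuous_intros)

lemma borel_halfspace [measurable, simp]: "halfspace k \<in> sets borel"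
  by simp

lemma measurable_weight [measurable]: "weight k a \<in> borel_measurable borel"
  unfolding weight_def by measurable

lemma weight_nonneg [simp]: "0 \<le> weight k a x"
  by (simp add: weight_def)

lemma nn_integral_weighted_lborel:
  assumes [measurable]: "f \<in> borel_measurable borel"
  shows "(\<integral>\<^sup>+x. f x \<partial>weighted_lborel k a)
    = (\<integral>\<^sup>+x. ennreal (indicator (halfspace k) x * weight k a x) * f x \<partial>lborel)"
  unfolding weighted_lborel_def by (subst nn_integral_density) auto

lemma emeasure_weighted_lborel:
  assumes [measurable]: "A \<in> sets borel"
  shows "emeasure (weighted_lborel k a) A
    = (\<integral>\<^sup>+x. ennreal (indicator (halfspace k \<inter> A) x * weight k a x) \<partial>lborel)"
  unfolding weighted_lborel_def
  by (subst emeasure_density) (auto intro!: nn_integral_cong simp: indicator_def)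

lemma nn_integral_powr_interval:
  fixes u v a :: real
  assumes "0 \<le> u" "u \<le> v" "0 \<le> a"
  shows "(\<integral>\<^sup>+t. ennreal (indicator {u<..<v} t * (t powr a)) \<partial>lborel)
      = ennreal ((v powr (1 + a) - u powr (1 + a)) / (1 + a))"
proof -
  have c: "((\<lambda>x. x powr a) has_integral (c powr (a+1) / (a+1))) {0..c}" if "c \<ge> 0" for c
    using has_integral_powr_from_0[of a c] assms that by simp
  have "(\<lambda>x. x powr a) integrable_on {u..v}"
    by (rule integrable_subinterval_real[OF has_integral_integrable[OF c[of v]]]) (use assms in auto)
  then obtain i where i: "((\<lambda>x. x powr a) has_integral i) {u..v}" by (auto simp: integrable_on_def)
  have "((\<lambda>x. x powr a) has_integral (u powr (a+1) / (a+1) + i)) {0..v}"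
    by (rule has_integral_combine[OF assms(1,2) c i]) (use assms in auto)
  from has_integral_unique[OF this c[of v]] assms have "i = v powr (a+1) / (a+1) - u powr (a+1) / (a+1)"
    by simp
  then have i2: "((\<lambda>x. x powr a) has_integral ((v powr (1 + a) - u powr (1 + a)) / (1 + a))) {u..v}"
    using i by (simp add: diff_divide_distrib add.commute)
  have "(\<integral>\<^sup>+t. ennreal (indicator {u<..<v} t * (t powr a)) \<partial>lborel)
     = (\<integral>\<^sup>+t. ennreal (indicator {u..v} t * (t powr a)) \<partial>lborel)"
    by (intro nn_integral_cong_AE, rule AE_mp[OF AE_lborel_singleton[of u]],
        rule AE_mp[OF AE_lborel_singleton[of v]]) (auto simp: indicator_def)
  also have "\<dots> = ennreal ((v powr (1 + a) - u powr (1 + a)) / (1 + a))"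
    using nn_integral_has_integral_lebesgue[OF _ i2]
    by (simp add: nn_integral_completion)
  finally show ?thesis .
qed

lemma prod_Basis_vec:
  fixes f :: "real ^ 'n \<Rightarrow> 'b::comm_monoid_mult"
  shows "(\<Prod>b\<in>Basis. f b) = (\<Prod>i\<in>(UNIV::'n::finite set). f (axis i 1))"
proof -
  have B: "(Basis :: (real^'n) set) = range (\<lambda>i. axis i 1)" by (auto simp: Basis_vec_def)
  have "inj (\<lambda>i::'n. axis i (1::real))" by (simp add: inj_on_def axis_eq_axis)
  then show ?thesis unfolding B by (subst prod.reindex) (simp_all add: o_def)
qed

text \<open>The density \<open>x\<^sub>k\<^sup>a\<close> depends on one coordinate only, so the mass of a box factors over the
  coordinates.\<close>

lemma emeasure_weighted_box:
  fixes u v :: "real ^ 'n::finite"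
  assumes u: "0 \<le> u $ k" and uv: "\<And>i. u $ i \<le> v $ i" and a: "0 \<le> a"
  shows "emeasure (weighted_lborel k a) (box u v) = ennreal (\<Prod>i\<in>UNIV.
     if i = k then (v $ k powr (1 + a) - u $ k powr (1 + a)) / (1 + a) else v $ i - u $ i)"
proof -
  let ?f = "\<lambda>(b::real^'n) t. indicator {u \<bullet> b<..<v \<bullet> b} t * (if b = axis k 1 then t powr a else 1) :: real"
  have pow: "(\<Prod>i\<in>UNIV. (if i = k then x $ i powr a else 1)) = x $ k powr a" for x :: "real ^ 'n"
    by (simp add: prod.delta)
  have ind: "(\<Prod>i\<in>UNIV. indicator {u $ i<..<v $ i} (x $ i)) = (indicator (box u v) x :: real)" for x :: "real ^ 'n"
  proof (cases "x \<in> box u v")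
    case True then show ?thesis by (auto simp: mem_box_cart)
  next
    case False
    then obtain i where "\<not> (u $ i < x $ i \<and> x $ i < v $ i)" by (auto simp: mem_box_cart)
    with False show ?thesis by (auto intro!: prod_zero bexI[of _ i] simp: indicator_def)
  qed
  have "emeasure (weighted_lborel k a) (box u v) = (\<integral>\<^sup>+x. (\<Prod>b\<in>Basis. ?f b (x \<bullet> b)) \<partial>lborel)"
  proof (subst emeasure_weighted_lborel, simp, intro nn_integral_cong arg_cong[where f=ennreal])
    fix x :: "real ^ 'n"
    have "(\<Prod>b\<in>Basis. ?f b (x \<bullet> b)) = (\<Prod>i\<in>UNIV. indicator {u $ i<..<v $ i} (x $ i))
        * (\<Prod>i\<in>UNIV. (if i = k then x $ i powr a else 1))"
      by (subst prod_Basis_vec, subst prod.distrib[symmetric])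
        (auto intro!: prod.cong simp: inner_axis axis_eq_axis)
    also have "\<dots> = indicator (box u v) x * x $ k powr a" by (simp add: pow ind)
    also have "\<dots> = indicator (halfspace k \<inter> box u v) x * weight k a x"
      using u by (auto simp: indicator_def weight_def halfspace_def mem_box_cart intro: le_less_trans)
    finally show "indicator (halfspace k \<inter> box u v) x * weight k a x = (\<Prod>b\<in>Basis. ?f b (x \<bullet> b))" ..
  qed
  also have "\<dots> = (\<integral>\<^sup>+x. (\<Prod>b\<in>Basis. ennreal (?f b (x \<bullet> b))) \<partial>lborel)"
    by (intro nn_integral_cong prod_ennreal[symmetric]) auto
  also have "\<dots> = (\<Prod>b\<in>Basis. (\<integral>\<^sup>+t. ?f b t \<partial>lborel))"
    by (rule nn_integral_lborel_prod) auto
  also have "\<dots> = (\<Prod>i\<in>UNIV. (\<integral>\<^sup>+t. ?f (axis i 1) t \<partial>lborel))" by (rule prod_Basis_vec)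
  also have "\<dots> = (\<Prod>i\<in>UNIV. ennreal (if i = k then (v $ k powr (1 + a) - u $ k powr (1 + a)) / (1 + a) else v $ i - u $ i))"
  proof (rule prod.cong[OF refl])
    fix i :: 'n
    show "(\<integral>\<^sup>+t. ?f (axis i 1) t \<partial>lborel) = ennreal (if i = k then (v $ k powr (1 + a) - u $ k powr (1 + a)) / (1 + a) else v $ i - u $ i)"
    proof (cases "i = k")
      case True
      then show ?thesis using nn_integral_powr_interval[OF u uv a] by (simp add: inner_axis)
    next
      case False
      then show ?thesis using emeasure_lborel_Ioo[OF uv[of i]]
        by (simp add: inner_axis axis_eq_axis ennreal_indicator)
    qed
  qed
  also have "\<dots> = ennreal (\<Prod>i\<in>UNIV. if i = k then (v $ k powr (1 + a) - u $ k powr (1 + a)) / (1 + a) else v $ i - u $ i)"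
  proof (rule prod_ennreal)
    fix i :: 'n
    show "0 \<le> (if i = k then (v $ k powr (1 + a) - u $ k powr (1 + a)) / (1 + a) else v $ i - u $ i)"
      using uv u a powr_mono2[of "1+a" "u $ k" "v $ k"] by auto
  qed
  finally show ?thesis .
qed

text \<open>The endpoint \<open>0\<close> is included because boxes may touch the boundary hyperplane.\<close>

lemma convex_on_powr_nonneg:
  fixes q :: real
  assumes q: "1 \<le> q"
  shows "convex_on {0..} (\<lambda>x. x powr q)"
proof (rule convex_on_linorderI)
  fix t x y :: real
  assume t: "0 < t" "t < 1" and x: "x \<in> {0..}" "y \<in> {0..}" "x < y"
  show "((1 - t) *\<^sub>R x + t *\<^sub>R y) powr q \<le> (1 - t) * x powr q + t * y powr q"
  proof (cases "x = 0")
    case True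
    have "t powr q * y powr q \<le> t * y powr q"
      using powr_mono'[of 1 q t] q t by (intro mult_right_mono) auto
    then show ?thesis using True t x by (simp add: powr_mult)
  next
    case False
    have "convex_on {0<..} (\<lambda>x. x powr q)" by (rule powr_convex) (use q in auto)
    from convex_onD[OF this, of t x y] show ?thesis using t x False by auto
  qed
qed simp

text \<open>The quantity \<open>(d\<^sup>q - c\<^sup>q)\<^sup>1\<^sup>/\<^sup>q\<close> with \<open>q = 1 + a\<close> is, up to a constant factor, the \<open>q\<close>-th root of the
  weighted mass of the edge \<open>[c, d]\<close> in the direction of the weight. Its superadditivity is the
  triangle inequality of \<open>l\<^sup>q\<close> in the plane: \<open>(c, M)\<close> has \<open>l\<^sup>q\<close>-norm \<open>d\<close> when \<open>M\<close> is this quantity.\<close>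

lemma powr_diff_superadditive:
  fixes c d c' d' q :: real
  assumes q: "1 \<le> q" and cd: "0 \<le> c" "c < d" "0 \<le> c'" "c' < d'"
  shows "(d powr q - c powr q) powr (1 / q) + (d' powr q - c' powr q) powr (1 / q)
     \<le> ((d + d') powr q - (c + c') powr q) powr (1 / q)"
proof -
  define M M' where "M = (d powr q - c powr q) powr (1 / q)" and "M' = (d' powr q - c' powr q) powr (1 / q)"
  have Mq: "M powr q = d powr q - c powr q" "M' powr q = d' powr q - c' powr q"
    using cd q powr_mono2[of q c d] powr_mono2[of q c' d'] by (auto simp: M_def M'_def powr_powr)
  \<comment> \<open>The vectors \<open>(c, M) / d\<close> and \<open>(c', M') / d'\<close> have \<open>l\<^sup>q\<close>-norm 1; with the weights \<open>l\<close>, \<open>1 - l\<close> their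
      convex combination is \<open>(c + c', M + M') / (d + d')\<close>.\<close>
  define l where "l = d / (d + d')"
  have l: "0 < l" "l < 1" "1 - l = d' / (d + d')" using cd by (auto simp: l_def field_simps)
  have key: "((x + x') / (d + d')) powr q \<le> l * (x / d) powr q + (1 - l) * (x' / d') powr q"
    if "0 \<le> x" "0 \<le> x'" for x x'
  proof -
    have "(x + x') / (d + d') = (1 - (1 - l)) *\<^sub>R (x / d) + (1 - l) *\<^sub>R (x' / d')"
    proof -
      have "l * (x / d) = x / (d + d')" using cd by (simp add: l_def)
      moreover have "(1 - l) * (x' / d') = x' / (d + d')" using cd by (simp add: l(3))
      ultimately show ?thesis by (simp add: add_divide_distrib)
    qed
    also have "\<dots> powr q \<le> (1 - (1 - l)) * (x / d) powr q + (1 - l) * (x' / d') powr q"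
      by (rule convex_onD[OF convex_on_powr_nonneg[OF q]]) (use l(1,2) that cd in auto)
    finally show ?thesis by simp
  qed
  have "((c + c') / (d + d')) powr q + ((M + M') / (d + d')) powr q
     \<le> l * ((c / d) powr q + (M / d) powr q) + (1 - l) * ((c' / d') powr q + (M' / d') powr q)"
    using key[of c c'] key[of M M'] cd by (simp add: M_def M'_def algebra_simps)
  also have "(c / d) powr q + (M / d) powr q = 1"
    using cd Mq by (simp add: powr_divide M_def add_divide_distrib[symmetric])
  also have "(c' / d') powr q + (M' / d') powr q = 1"
    using cd Mq by (simp add: powr_divide M'_def add_divide_distrib[symmetric])
  finally have "(c + c') powr q + (M + M') powr q \<le> (d + d') powr q"
    using cd by (simp add: powr_divide M_def M'_def add_divide_distrib[symmetric])
  then have "((M + M') powr q) powr (1 / q) \<le> ((d + d') powr q - (c + c') powr q) powr (1 / q)"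
    using q by (intro powr_mono2) auto
  then show ?thesis using q by (simp add: powr_powr M_def M'_def)
qed

text \<open>Dividing by the right-hand side reduces this to the weighted inequality of arithmetic and
  geometric means for the ratios \<open>x\<^sub>i / (x\<^sub>i + y\<^sub>i)\<close> and \<open>y\<^sub>i / (x\<^sub>i + y\<^sub>i)\<close>, whose sum is 1.\<close>

lemma weighted_geometric_mean_superadditive:
  fixes x y w :: "'i \<Rightarrow> real"
  assumes fin: "finite I" and w: "\<And>i. i \<in> I \<Longrightarrow> 0 \<le> w i" "(\<Sum>i\<in>I. w i) = 1"
    and pos: "\<And>i. i \<in> I \<Longrightarrow> 0 < x i" "\<And>i. i \<in> I \<Longrightarrow> 0 < y i"
  shows "(\<Prod>i\<in>I. x i powr w i) + (\<Prod>i\<in>I. y i powr w i) \<le> (\<Prod>i\<in>I. (x i + y i) powr w i)"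
proof -
  have amgm: "(\<Prod>i\<in>I. t i powr w i) \<le> (\<Sum>i\<in>I. w i * t i)" if t: "\<And>i. i \<in> I \<Longrightarrow> 0 < t i" for t :: "'i \<Rightarrow> real"
  proof -
    have ne: "I \<noteq> {}" using w(2) by auto
    have "exp (\<Sum>i\<in>I. w i *\<^sub>R ln (t i)) \<le> (\<Sum>i\<in>I. w i * exp (ln (t i)))"
      by (rule convex_on_sum[of I UNIV exp w "\<lambda>i. ln (t i)"])
         (use fin ne w in \<open>auto intro!: exp_convex\<close>)
    also have "\<dots> = (\<Sum>i\<in>I. w i * t i)" using t by simp
    finally show ?thesis using t fin
      by (simp add: exp_sum powr_def mult.commute cong: prod.cong) (smt (verit) prod.cong order_less_irrefl)
  qed
  let ?P = "\<Prod>i\<in>I. (x i + y i) powr w i"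
  have P: "?P > 0" using pos by (intro prod_pos) (simp add: add_pos_pos less_imp_neq[symmetric])
  have "(\<Prod>i\<in>I. x i powr w i) / ?P + (\<Prod>i\<in>I. y i powr w i) / ?P
      = (\<Prod>i\<in>I. (x i / (x i + y i)) powr w i) + (\<Prod>i\<in>I. (y i / (x i + y i)) powr w i)"
    using pos by (simp add: prod_dividef[symmetric] powr_divide less_imp_le add_nonneg_nonneg cong: prod.cong)
  also have "\<dots> \<le> (\<Sum>i\<in>I. w i * (x i / (x i + y i))) + (\<Sum>i\<in>I. w i * (y i / (x i + y i)))"
    using pos by (intro add_mono amgm) (auto simp: add_pos_pos)
  also have "\<dots> = (\<Sum>i\<in>I. w i)"
  proof -
    have "w i * (x i / (x i + y i)) + w i * (y i / (x i + y i)) = w i" if "i \<in> I" for i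
      using pos(1)[OF that] pos(2)[OF that]
      by (simp add: distrib_left[symmetric] add_divide_distrib[symmetric])
    then show ?thesis by (simp add: sum.distrib[symmetric])
  qed
  finally show ?thesis using P w(2) by (simp add: add_divide_distrib[symmetric])
qed

section \<open>The weighted Brunn--Minkowski inequality\<close>

definition setplus :: "'a::plus set \<Rightarrow> 'a set \<Rightarrow> 'a set" where
  "setplus A B = (\<Union>x\<in>A. \<Union>y\<in>B. {x + y})"

lemma open_setplus: "open A \<Longrightarrow> open (setplus A (B :: 'a::real_normed_vector set))"
  unfolding setplus_def by (intro open_sums disjI1)

lemma setplus_mono: "A \<subseteq> A' \<Longrightarrow> B \<subseteq> B' \<Longrightarrow> setplus A B \<subseteq> setplus A' B'"
  unfolding setplus_def by blast

lemma setplus_commute: "setplus A B = setplus B (A :: 'a::ab_semigroup_add set)"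
proof -
  have "setplus X Y \<subseteq> setplus Y X" for X Y :: "'a set"
  proof
    fix z assume "z \<in> setplus X Y"
    then obtain x y where "x \<in> X" "y \<in> Y" "z = x + y" unfolding setplus_def by blast
    moreover from this have "z = y + x" by (simp add: add.commute)
    ultimately show "z \<in> setplus Y X" unfolding setplus_def by blast
  qed
  then show ?thesis by blast
qed

lemma bounded_setplus:
  fixes A B :: "'a::real_normed_vector set"
  assumes "bounded A" "bounded B" shows "bounded (setplus A B)"
proof -
  have "setplus A B = (\<lambda>(x, y). x + y) ` (A \<times> B)" by (auto simp: setplus_def)
  then show ?thesis using bounded_plus[OF assms] by simp
qed

lemma pos_less_add_mult:
  fixes u v t :: real
  assumes "0 < t" "t < 1" "u < v"
  shows "u < u + t * (v - u)" "u + t * (v - u) < v"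
proof -
  have "t * (v - u) < 1 * (v - u)" using assms by (intro mult_strict_right_mono) auto
  then show "u + t * (v - u) < v" by simp
qed (use assms in simp)

text \<open>A point of the sum box is written as a sum by cutting every edge of the two boxes in the ratio in
  which the point cuts the corresponding edge of the sum box.\<close>

lemma box_sum:
  fixes u v u' v' :: "real ^ 'n::finite"
  assumes "\<And>i. u $ i < v $ i" "\<And>i. u' $ i < v' $ i"
  shows "box (u + u') (v + v') \<subseteq> setplus (box u v) (box u' v')"
proof
  fix z assume z: "z \<in> box (u + u') (v + v')"
  define t where "t i = (z $ i - (u + u') $ i) / ((v + v') $ i - (u + u') $ i)" for i
  have pos: "(v + v') $ i - (u + u') $ i > 0" for i
    using assms(1)[of i] assms(2)[of i] by simp
  have t: "0 < t i" "t i < 1" for i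
  proof -
    have "(u + u') $ i < z $ i" "z $ i < (v + v') $ i" using z unfolding mem_box_cart by blast+
    then show "0 < t i" "t i < 1" using pos[of i] by (auto simp: t_def)
  qed
  define x y where "x = (\<chi> i. u $ i + t i * (v $ i - u $ i))" and "y = (\<chi> i. u' $ i + t i * (v' $ i - u' $ i))"
  have "t i * ((v + v') $ i - (u + u') $ i) = z $ i - (u + u') $ i" for i
    using pos[of i] by (simp add: t_def)
  then have "z = x + y"
    by (simp add: vec_eq_iff x_def y_def algebra_simps)
  moreover have "x \<in> box u v" "y \<in> box u' v'"
    unfolding mem_box_cart x_def y_def
    using t assms by (simp_all add: pos_less_add_mult)
  ultimately show "z \<in> setplus (box u v) (box u' v')" unfolding setplus_def by blast
qed

text \<open>The root of order \<open>n\<^sub>a\<close> of the mass of a box is a weighted geometric mean of edge lengths, where the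
  edge in the direction of the weight counts \<open>1 + a\<close> times and is measured by its own mass.\<close>

lemma measure_weighted_box_powr:
  fixes u v :: "real ^ 'n::finite"
  assumes u: "0 \<le> u $ k" and uv: "\<And>i. u $ i < v $ i" and a: "0 \<le> a"
  shows "measure (weighted_lborel k a) (box u v) powr (1 / wdim k a)
    = (1 / (1 + a)) powr (1 / wdim k a) * (\<Prod>i\<in>UNIV.
        (if i = k then (v $ k powr (1 + a) - u $ k powr (1 + a)) powr (1 / (1 + a)) else v $ i - u $ i)
          powr ((if i = k then 1 + a else 1) / wdim k a))" (is ?th1)
    and "0 < measure (weighted_lborel k a) (box u v)" (is ?th2)
proof -
  let ?g = "\<lambda>i. if i = k then (v $ k powr (1 + a) - u $ k powr (1 + a)) / (1 + a) else v $ i - u $ i"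
  have p: "0 < ?g i" for i
    using uv[of i] u a powr_less_mono2[of "1+a" "u $ k" "v $ k"] by auto
  have m: "measure (weighted_lborel k a) (box u v) = (\<Prod>i\<in>UNIV. ?g i)"
    using emeasure_weighted_box[OF u less_imp_le[OF uv] a]
    by (simp add: measure_def prod_nonneg less_imp_le[OF p])
  then show ?th2 using p by (simp add: prod_pos)
  have "(\<Prod>i\<in>UNIV. ?g i) powr (1 / wdim k a) = (\<Prod>i\<in>UNIV. ?g i powr (1 / wdim k a))"
    by (rule prod_powr_distrib)
  also have "\<dots> = (\<Prod>i\<in>UNIV. (if i = k then (1 / (1 + a)) powr (1 / wdim k a) else 1) *
     ((if i = k then (v $ k powr (1 + a) - u $ k powr (1 + a)) powr (1 / (1 + a)) else v $ i - u $ i)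
          powr ((if i = k then 1 + a else 1) / wdim k a)))"
  proof (rule prod.cong[OF refl])
    fix i :: 'n
    show "?g i powr (1 / wdim k a) = (if i = k then (1 / (1 + a)) powr (1 / wdim k a) else 1) *
     ((if i = k then (v $ k powr (1 + a) - u $ k powr (1 + a)) powr (1 / (1 + a)) else v $ i - u $ i)
          powr ((if i = k then 1 + a else 1) / wdim k a))"
      using a uv[of k] u powr_less_mono2[of "1+a" "u $ k" "v $ k"]
      by (auto simp: powr_powr powr_divide)
  qed
  also have "\<dots> = (1 / (1 + a)) powr (1 / wdim k a) * (\<Prod>i\<in>UNIV.
        (if i = k then (v $ k powr (1 + a) - u $ k powr (1 + a)) powr (1 / (1 + a)) else v $ i - u $ i)
          powr ((if i = k then 1 + a else 1) / wdim k a))"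
    by (simp add: prod.distrib)
  finally show ?th1 by (simp add: m)
qed

lemma sum_weights: "(\<Sum>i\<in>UNIV. (if i = k then 1 + a else 1)) = wdim (k::'n::finite) a"
proof -
  have "(\<Sum>i\<in>UNIV. (if i = k then 1 + a else 1)) = (\<Sum>i\<in>UNIV. 1 + (if i = k then a else 0))"
    by (intro sum.cong) auto
  also have "\<dots> = wdim k a" by (simp add: sum.distrib wdim_def)
  finally show ?thesis .
qed

text \<open>Both ingredients of \<open>measure_weighted_box_powr\<close> are superadditive: the geometric mean, and the weighted length of the edge in
  direction \<open>k\<close>.\<close>

lemma brunn_minkowski_box:
  fixes u v u' v' :: "real ^ 'n::finite"
  assumes u: "0 \<le> u $ k" "0 \<le> u' $ k" and uv: "\<And>i. u $ i < v $ i" "\<And>i. u' $ i < v' $ i"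
    and a: "0 \<le> a"
  shows "measure (weighted_lborel k a) (box u v) powr (1 / wdim k a)
      + measure (weighted_lborel k a) (box u' v') powr (1 / wdim k a)
     \<le> measure (weighted_lborel k a) (box (u + u') (v + v')) powr (1 / wdim k a)"
proof -
  let ?L = "\<lambda>u v (i::'n). if i = k then (v $ k powr (1 + a) - u $ k powr (1 + a)) powr (1 / (1 + a)) else v $ i - u $ i :: real"
  let ?w = "\<lambda>i::'n. (if i = k then 1 + a else 1) / wdim k a"
  have D: "wdim k a > 0" using a by (simp add: wdim_def add_pos_nonneg)
  have w: "0 \<le> ?w i" for i using D a by auto
  have w1: "(\<Sum>i\<in>UNIV. ?w i) = 1"
    using sum_weights[of k a] D by (simp add: sum_divide_distrib[symmetric])
  have pos: "0 < ?L u v i" if "\<And>i. u $ i < v $ i" "0 \<le> u $ k" for u v i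
    using that(1)[of i] that(2) a powr_less_mono2[of "1+a" "u $ k" "v $ k"] by auto
  have "(\<Prod>i\<in>UNIV. ?L u v i powr ?w i) + (\<Prod>i\<in>UNIV. ?L u' v' i powr ?w i)
     \<le> (\<Prod>i\<in>UNIV. (?L u v i + ?L u' v' i) powr ?w i)"
    by (rule weighted_geometric_mean_superadditive) (use w w1 pos uv u in auto)
  also have "\<dots> \<le> (\<Prod>i\<in>UNIV. ?L (u + u') (v + v') i powr ?w i)"
  proof (rule prod_mono, intro conjI powr_mono2)
    fix i :: 'n
    show "?L u v i + ?L u' v' i \<le> ?L (u + u') (v + v') i"
      using powr_diff_superadditive[of "1 + a" "u $ k" "v $ k" "u' $ k" "v' $ k"] a u uv by auto
    show "0 \<le> ?L u v i + ?L u' v' i" using pos[OF uv(1) u(1), of i] pos[OF uv(2) u(2), of i] by linarith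
  qed (use w in auto)
  finally have "(1 / (1 + a)) powr (1 / wdim k a) * ((\<Prod>i\<in>UNIV. ?L u v i powr ?w i) + (\<Prod>i\<in>UNIV. ?L u' v' i powr ?w i))
     \<le> (1 / (1 + a)) powr (1 / wdim k a) * (\<Prod>i\<in>UNIV. ?L (u + u') (v + v') i powr ?w i)"
    by (rule mult_left_mono) simp
  then show ?thesis
    using measure_weighted_box_powr(1)[OF u(1) uv(1) a] measure_weighted_box_powr(1)[OF u(2) uv(2) a]
      measure_weighted_box_powr(1)[of "u + u'" k "v + v'" a] u uv a
    by (simp add: distrib_left add_strict_mono)
qed

definition box_family :: "'n::finite \<Rightarrow> (real ^ 'n) set set \<Rightarrow> bool" where
  "box_family k F \<longleftrightarrow> finite F \<and> disjoint F \<and>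
     (\<forall>X\<in>F. \<exists>u v. X = box u v \<and> (\<forall>i. u $ i < v $ i) \<and> 0 \<le> u $ k)"

lemma null_sets_weighted:
  assumes "N \<in> null_sets lborel" shows "N \<in> null_sets (weighted_lborel k a)"
proof (rule null_setsI)
  have [measurable]: "N \<in> sets borel" using assms by (auto simp: null_sets_def)
  show "emeasure (weighted_lborel k a) N = 0"
    using AE_not_in[OF assms] by (subst emeasure_weighted_lborel) (auto simp: nn_integral_0_iff_AE)
qed (use assms in \<open>auto simp: null_sets_def\<close>)

lemma weighted_hyperplane_null:
  "emeasure (weighted_lborel k a) {x :: real ^ 'n::finite. x $ i = s} = 0"
proof -
  have "negligible {x :: real ^ 'n. axis i 1 \<bullet> x = s}"
    by (rule negligible_hyperplane) (simp add: axis_eq_0_iff)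
  then have "emeasure lborel {x :: real ^ 'n. x $ i = s} = 0"
    by (simp add: negligible_iff_emeasure0 inner_axis' emeasure_completion[symmetric])
  then have "AE x in lborel. x \<notin> {x :: real ^ 'n. x $ i = s}"
    by (intro AE_not_in) (auto intro!: null_setsI closed_Collect_eq continuous_intros borel_closed)
  moreover have [measurable]: "{x :: real ^ 'n. x $ i = s} \<in> sets borel"
    by (intro borel_closed closed_Collect_eq continuous_intros)
  ultimately show ?thesis
    by (subst emeasure_weighted_lborel) (auto simp: nn_integral_0_iff_AE)
qed

lemma emeasure_weighted_bounded_finite:
  fixes A :: "(real ^ 'n::finite) set"
  assumes "bounded A" and a: "0 \<le> a" 
  shows "emeasure (weighted_lborel k a) A < \<infinity>"
proof -
  obtain b where b: "A \<subseteq> cbox (-b) b" using bounded_subset_cbox_symmetric[OF assms(1)] by blast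
  obtain M where M: "\<And>x. x \<in> cbox (-b) b \<Longrightarrow> \<bar>x $ k\<bar> \<le> M" "M > 0"
    using bounded_cbox[of "-b" b] unfolding bounded_pos
    by (meson component_le_norm_cart order_trans real_norm_def)
  have "emeasure (weighted_lborel k a) A \<le> emeasure (weighted_lborel k a) (cbox (-b) b)"
    using b by (intro emeasure_mono) auto
  also have "\<dots> = (\<integral>\<^sup>+x. ennreal (indicator (halfspace k \<inter> cbox (-b) b) x * weight k a x) \<partial>lborel)"
    by (rule emeasure_weighted_lborel) simp
  also have "\<dots> \<le> (\<integral>\<^sup>+x. ennreal (M powr a) * indicator (cbox (-b) b) x \<partial>lborel)"
  proof (rule nn_integral_mono)
    fix x :: "real ^ 'n"
    show "ennreal (indicator (halfspace k \<inter> cbox (-b) b) x * weight k a x) \<le> ennreal (M powr a) * indicator (cbox (-b) b) x"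
      using M(1)[of x] a powr_mono2[of a "x $ k" M]
      by (auto simp: indicator_def weight_def halfspace_def)
  qed
  also have "\<dots> = ennreal (M powr a) * emeasure lborel (cbox (-b) b)"
    by (subst nn_integral_cmult_indicator) auto
  also have "\<dots> < \<infinity>" using emeasure_lborel_cbox_finite[of "-b" b]
    by (simp add: ennreal_mult_less_top)
  finally show ?thesis .
qed

lemma box_family_cut:
  fixes F :: "(real ^ 'n::finite) set set"
  assumes F: "box_family k F"
  shows "box_family k ((\<lambda>X. X \<inter> {x. x $ i < s}) ` F - {{}})" (is "box_family k ?L")
    and "box_family k ((\<lambda>X. X \<inter> {x. x $ i > s}) ` F - {{}})" (is "box_family k ?R")
    and "card ((\<lambda>X. X \<inter> {x. x $ i < s}) ` F - {{}}) \<le> card F"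
    and "card ((\<lambda>X. X \<inter> {x. x $ i > s}) ` F - {{}}) \<le> card F"
proof -
  have fin: "finite F" using F by (simp add: box_family_def)
  show "card ?L \<le> card F" "card ?R \<le> card F"
    using fin by (meson card_Diff1_le card_image_le finite_imageI le_trans card_mono Diff_subset)+
  have d: "disjoint ((\<lambda>X. X \<inter> Z) ` F - {{}})" for Z
    using F unfolding box_family_def disjoint_def by blast
  show "box_family k ?L" unfolding box_family_def
  proof (intro conjI ballI d)
    show "finite ?L" using fin by simp
    fix Y assume "Y \<in> ?L"
    then obtain X where X: "X \<in> F" "Y = X \<inter> {x. x $ i < s}" "Y \<noteq> {}" by auto
    then obtain u v where uv: "X = box u v" "0 \<le> u $ k" using F unfolding box_family_def by blast
    define v' where "v' = (\<chi> j. if j = i then min (v $ j) s else v $ j)"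
    have Y: "Y = box u v'" unfolding X(2) uv by (auto simp: mem_box_cart v'_def)
        (metis min_less_iff_conj)+
    then obtain y where "y \<in> box u v'" using X(3) by blast
    then have "\<forall>j. u $ j < v' $ j" unfolding mem_box_cart by (meson order_less_trans)
    then show "\<exists>u v. Y = box u v \<and> (\<forall>i. u $ i < v $ i) \<and> 0 \<le> u $ k" using Y uv by blast
  qed
  show "box_family k ?R" unfolding box_family_def
  proof (intro conjI ballI d)
    show "finite ?R" using fin by simp
    fix Y assume "Y \<in> ?R"
    then obtain X where X: "X \<in> F" "Y = X \<inter> {x. x $ i > s}" "Y \<noteq> {}" by auto
    then obtain u v where uv: "X = box u v" "0 \<le> u $ k" using F unfolding box_family_def by blast
    define u' where "u' = (\<chi> j. if j = i then max (u $ j) s else u $ j)"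
    have Y: "Y = box u' v" unfolding X(2) uv by (auto simp: mem_box_cart u'_def)
        (metis max_less_iff_conj)+
    then obtain y where "y \<in> box u' v" using X(3) by blast
    then have "\<forall>j. u' $ j < v $ j" unfolding mem_box_cart by (meson order_less_trans)
    moreover have "0 \<le> u' $ k" using uv by (auto simp: u'_def)
    ultimately show "\<exists>u v. Y = box u v \<and> (\<forall>i. u $ i < v $ i) \<and> 0 \<le> u $ k" using Y by blast
  qed
qed

lemma finite_measure_weighted:
  fixes A :: "(real ^ 'n::finite) set"
  assumes "bounded A" "0 \<le> a" 
  shows "emeasure (weighted_lborel k a) A = ennreal (measure (weighted_lborel k a) A)"
  using emeasure_weighted_bounded_finite[OF assms, of k]
  by (intro emeasure_eq_ennreal_measure) auto

lemma measure_weighted_mono: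
  fixes A B :: "(real ^ 'n::finite) set"
  assumes "A \<subseteq> B" "B \<in> sets borel" "bounded B" "0 \<le> a"
  shows "measure (weighted_lborel k a) A \<le> measure (weighted_lborel k a) B"
proof (cases "A \<in> sets borel")
  case True
  then show ?thesis
    using assms emeasure_weighted_bounded_finite[OF assms(3,4), of k]
    by (intro measure_mono_fmeasurable) (auto simp: fmeasurable_def)
next
  case False
  then show ?thesis by (simp add: measure_notin_sets)
qed

lemma measure_weighted_Un:
  fixes A B :: "(real ^ 'n::finite) set"
  assumes "A \<inter> B = {}" "A \<in> sets borel" "B \<in> sets borel" "bounded A" "bounded B" "0 \<le> a"
  shows "measure (weighted_lborel k a) (A \<union> B) = measure (weighted_lborel k a) A + measure (weighted_lborel k a) B"
  using emeasure_weighted_bounded_finite[OF assms(4,6), of k]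
    emeasure_weighted_bounded_finite[OF assms(5,6), of k] assms
  by (intro measure_Un3[THEN trans]) (auto simp: fmeasurable_def)

lemma measure_weighted_hyperplane_split:
  fixes A :: "(real ^ 'n::finite) set"
  assumes A: "A \<in> sets borel" "bounded A" and a: "0 \<le> a"
  shows "measure (weighted_lborel k a) A = measure (weighted_lborel k a) (A \<inter> {x. x $ i < s})
     + measure (weighted_lborel k a) (A \<inter> {x. x $ i > s})"
proof -
  let ?m = "measure (weighted_lborel k a)"
  have [measurable]: "{x :: real ^ 'n. x $ i < s} \<in> sets borel" "{x :: real ^ 'n. x $ i > s} \<in> sets borel"
     "{x :: real ^ 'n. x $ i = s} \<in> sets borel"
    by measurable
  have A0 [measurable]: "A \<in> sets borel" by fact
  have "emeasure (weighted_lborel k a) (A \<inter> {x. x $ i = s}) \<le> emeasure (weighted_lborel k a) {x. x $ i = s}"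
    by (rule emeasure_mono) auto
  then have z: "?m (A \<inter> {x. x $ i = s}) = 0"
    by (simp add: weighted_hyperplane_null measure_def)
  have "A = (A \<inter> {x. x $ i < s} \<union> A \<inter> {x. x $ i > s}) \<union> A \<inter> {x. x $ i = s}" by auto
  then have "?m A = ?m (A \<inter> {x. x $ i < s} \<union> A \<inter> {x. x $ i > s}) + ?m (A \<inter> {x. x $ i = s})"
    using A a by (subst measure_weighted_Un[symmetric]) (auto intro: bounded_subset)
  also have "?m (A \<inter> {x. x $ i < s} \<union> A \<inter> {x. x $ i > s}) = ?m (A \<inter> {x. x $ i < s}) + ?m (A \<inter> {x. x $ i > s})"
    using A a by (intro measure_weighted_Un) (auto intro: bounded_subset)
  finally show ?thesis using z by simp
qed

text \<open>Hyperplanes are null sets, so the mass to the left of a moving hyperplane has no jumps. This makes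
  it possible to cut a set in a prescribed proportion.\<close>

lemma continuous_weighted_cut:
  fixes A :: "(real ^ 'n::finite) set"
  assumes A [measurable]: "A \<in> sets borel" and b: "bounded A" and a: "0 \<le> a"
  shows "continuous_on UNIV (\<lambda>s. measure (weighted_lborel k a) (A \<inter> {x. x $ i < s}))"
  unfolding continuous_on_sequentially comp_def
proof (safe)
  fix s :: "nat \<Rightarrow> real" and t
  assume s: "s \<longlonglongrightarrow> t"
  let ?M = "weighted_lborel k a"
  have fin: "emeasure ?M A < \<infinity>" by (rule emeasure_weighted_bounded_finite[OF b a])
  have ae: "AE x in ?M. x $ i \<noteq> t"
    using weighted_hyperplane_null[of k a i t]
    by (intro AE_I[where N="{x. x $ i = t}"]) (auto intro!: borel_closed closed_Collect_eq continuous_intros)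
  have "(\<lambda>n. \<integral>x. indicator (A \<inter> {x. x $ i < s n}) x \<partial>?M) \<longlonglongrightarrow> (\<integral>x. indicator (A \<inter> {x. x $ i < t}) x \<partial>?M :: real)"
  proof (rule integral_dominated_convergence[where w="indicator A"])
    show "integrable ?M (indicator A :: _ \<Rightarrow> real)" using fin by simp
    show "AE x in ?M. (\<lambda>n. indicator (A \<inter> {x. x $ i < s n}) x) \<longlonglongrightarrow> (indicator (A \<inter> {x. x $ i < t}) x :: real)"
      using ae
    proof eventually_elim
      case (elim x)
      have "eventually (\<lambda>n. indicator (A \<inter> {x. x $ i < s n}) x = (indicator (A \<inter> {x. x $ i < t}) x :: real)) sequentially"
      proof (cases "x $ i < t")
        case True
        then have "eventually (\<lambda>n. x $ i < s n) sequentially" using order_tendstoD(1)[OF s] by blast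
        then show ?thesis by eventually_elim (use True in \<open>auto simp: indicator_def\<close>)
      next
        case False
        then have "t < x $ i" using elim by auto
        then have "eventually (\<lambda>n. s n < x $ i) sequentially" using order_tendstoD(2)[OF s] by blast
        then show ?thesis by eventually_elim (use False in \<open>auto simp: indicator_def\<close>)
      qed
      then show ?case by (rule tendsto_eventually)
    qed
  qed (auto simp: indicator_def)
  then show "(\<lambda>n. measure ?M (A \<inter> {x. x $ i < s n})) \<longlonglongrightarrow> measure ?M (A \<inter> {x. x $ i < t})"
    by simp
qed

lemma box_family_props:
  fixes F :: "(real ^ 'n::finite) set set"
  assumes F: "box_family k F"
  shows "open (\<Union>F)" "bounded (\<Union>F)" "{} \<notin> F"
proof -
  have "X \<in> F \<Longrightarrow> open X \<and> bounded X \<and> X \<noteq> {}" for X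
    using F unfolding box_family_def by (metis bounded_box interval_ne_empty_cart(2) open_box)
  then show "open (\<Union>F)" "bounded (\<Union>F)" "{} \<notin> F"
    using F unfolding box_family_def by (auto intro!: bounded_Union)
qed

lemma measure_box_family_pos:
  fixes F :: "(real ^ 'n::finite) set set"
  assumes F: "box_family k F" "F \<noteq> {}" and a: "0 \<le> a"
  shows "0 < measure (weighted_lborel k a) (\<Union>F)"
proof -
  obtain X where X: "X \<in> F" using F by blast
  then obtain u v where uv: "X = box u v" "\<And>i. u $ i < v $ i" "0 \<le> u $ k"
    using F unfolding box_family_def by blast
  have "0 < measure (weighted_lborel k a) X"
    unfolding uv(1) by (rule measure_weighted_box_powr(2)) (use uv a in auto)
  also have "\<dots> \<le> measure (weighted_lborel k a) (\<Union>F)"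
    using X box_family_props[OF F(1)] a by (intro measure_weighted_mono) auto
  finally show ?thesis .
qed

definition bm_holds :: "'n::finite \<Rightarrow> real \<Rightarrow> (real ^ 'n) set \<Rightarrow> (real ^ 'n) set \<Rightarrow> bool" where
  "bm_holds k a A B \<longleftrightarrow>
    measure (weighted_lborel k a) A powr (1 / wdim k a) + measure (weighted_lborel k a) B powr (1 / wdim k a)
     \<le> measure (weighted_lborel k a) (setplus A B) powr (1 / wdim k a)"

lemma disjoint_boxes_separated:
  fixes u v u' v' :: "real ^ 'n::finite"
  assumes "box u v \<inter> box u' v' = {}" "\<And>i. u $ i < v $ i" "\<And>i. u' $ i < v' $ i"
  shows "\<exists>i. v $ i \<le> u' $ i \<or> v' $ i \<le> u $ i"
proof (rule ccontr)
  assume "\<not> ?thesis"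
  then have h: "\<And>i. u' $ i < v $ i" "\<And>i. u $ i < v' $ i" by (auto simp: not_le)
  define z where "z = (\<chi> i. (max (u $ i) (u' $ i) + min (v $ i) (v' $ i)) / 2)"
  have "max (u $ i) (u' $ i) < min (v $ i) (v' $ i)" for i using h assms(2,3) by auto
  then have "max (u $ i) (u' $ i) < z $ i \<and> z $ i < min (v $ i) (v' $ i)" for i
    by (simp add: z_def field_simps) (smt (verit))
  then have "z \<in> box u v" "z \<in> box u' v'" unfolding mem_box_cart by simp_all
  with assms(1) show False by blast
qed

text \<open>The induction step of Hadwiger and Ohmann. Two disjoint boxes of \<open>F\<close> are separated by a coordinate
  hyperplane, which cuts \<open>\<Union>F\<close> into two families with fewer boxes each. A parallel hyperplane cuts
  \<open>\<Union>G\<close> in the same proportion \<open>\<theta> : 1 - \<theta>\<close>. The inequality for the two pairs of pieces, taken to the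
  power \<open>n\<^sub>a\<close>, then adds up to the inequality for the whole, because by the choice of the proportion both
  lower bounds are multiples of the same number.\<close>

lemma brunn_minkowski_cut:
  fixes F G :: "(real ^ 'n::finite) set set"
  assumes a: "0 \<le> a" and F: "box_family k F" and G: "box_family k G" and card: "2 \<le> card F" and Gne: "G \<noteq> {}"
    and IH: "\<And>F' G'. box_family k F' \<Longrightarrow> box_family k G' \<Longrightarrow> F' \<noteq> {} \<Longrightarrow> G' \<noteq> {} \<Longrightarrow>
       card F' + card G' < card F + card G \<Longrightarrow> bm_holds k a (\<Union>F') (\<Union>G')"
  shows "bm_holds k a (\<Union>F) (\<Union>G)"
proof -
  let ?m = "measure (weighted_lborel k a)"
  have D: "wdim k a > 0" using a by (simp add: wdim_def add_pos_nonneg)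
  have finF: "finite F" and finG: "finite G" using F G by (auto simp: box_family_def)
  obtain X Y where XY: "X \<in> F" "Y \<in> F" "X \<noteq> Y"
  proof -
    have "\<exists>X\<in>F. \<exists>Y\<in>F. X \<noteq> Y"
    proof (rule ccontr)
      assume "\<not> (\<exists>X\<in>F. \<exists>Y\<in>F. X \<noteq> Y)"
      then have "card F \<le> Suc 0" using card_le_Suc0_iff_eq[OF finF] by blast
      with card show False by simp
    qed
    then show ?thesis using that by blast
  qed
  obtain u v where uv: "X = box u v" "\<And>i. u $ i < v $ i" using F XY unfolding box_family_def by metis
  obtain u' v' where uv': "Y = box u' v'" "\<And>i. u' $ i < v' $ i" using F XY unfolding box_family_def by metis
  have "X \<inter> Y = {}" using F XY unfolding box_family_def disjoint_def by blast
  then obtain i where "v $ i \<le> u' $ i \<or> v' $ i \<le> u $ i"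
    using disjoint_boxes_separated[of u v u' v'] uv uv' by auto
  then obtain P Q s where PQ: "P \<in> F" "Q \<in> F" "P \<subseteq> {x. x $ i < s}" "Q \<subseteq> {x. x $ i > s}"
  proof
    assume "v $ i \<le> u' $ i"
    then have "X \<subseteq> {x. x $ i < v $ i}" "Y \<subseteq> {x. x $ i > v $ i}"
      unfolding uv(1) uv'(1) by (auto simp: mem_box_cart intro: le_less_trans)
    then show ?thesis using that[of X Y "v $ i"] XY by blast
  next
    assume "v' $ i \<le> u $ i"
    then have "Y \<subseteq> {x. x $ i < v' $ i}" "X \<subseteq> {x. x $ i > v' $ i}"
      unfolding uv(1) uv'(1) by (auto simp: mem_box_cart intro: le_less_trans)
    then show ?thesis using that[of Y X "v' $ i"] XY by blast
  qed
  have PQne: "P \<noteq> {}" "Q \<noteq> {}" using PQ box_family_props(3)[OF F] by auto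
  define A B where "A = \<Union>F" and "B = \<Union>G"
  define L R where "L = (\<lambda>t. {x::real^'n. x $ i < t})" and "R = (\<lambda>t. {x::real^'n. x $ i > t})"
  define F1 F2 where "F1 = (\<lambda>X. X \<inter> L s) ` F - {{}}" and "F2 = (\<lambda>X. X \<inter> R s) ` F - {{}}"
  have A: "open A" "bounded A" and B: "open B" "bounded B"
    using box_family_props[OF F] box_family_props[OF G] by (auto simp: A_def B_def)
  have F12: "box_family k F1" "box_family k F2" "\<Union>F1 = A \<inter> L s" "\<Union>F2 = A \<inter> R s"
    using box_family_cut[OF F] by (auto simp: F1_def F2_def L_def R_def A_def)
  have "P \<inter> L s = P" "Q \<inter> R s = Q" using PQ by (auto simp: L_def R_def)
  then have ne: "F1 \<noteq> {}" "F2 \<noteq> {}" using PQ PQne unfolding F1_def F2_def by blast+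
  have "F1 \<subseteq> (\<lambda>X. X \<inter> L s) ` (F - {Q})" "F2 \<subseteq> (\<lambda>X. X \<inter> R s) ` (F - {P})"
  proof -
    have "Q \<inter> L s = {}" "P \<inter> R s = {}" using PQ(3,4) by (force simp: L_def R_def)+
    then show "F1 \<subseteq> (\<lambda>X. X \<inter> L s) ` (F - {Q})" "F2 \<subseteq> (\<lambda>X. X \<inter> R s) ` (F - {P})"
      unfolding F1_def F2_def by blast+
  qed
  then have cF: "card F1 < card F" "card F2 < card F"
  proof -
    have "card F1 \<le> card (F - {Q})" "card F2 \<le> card (F - {P})"
      using \<open>F1 \<subseteq> _\<close> \<open>F2 \<subseteq> _\<close> finF by (auto intro: surj_card_le)
    then show "card F1 < card F" "card F2 < card F"
      using card_Diff1_less[OF finF PQ(1)] card_Diff1_less[OF finF PQ(2)] by linarith+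
  qed
  define \<theta> where "\<theta> = ?m (\<Union>F1) / ?m A"
  have mA: "?m A > 0" and mB: "?m B > 0" and mF: "?m (\<Union>F1) > 0" "?m (\<Union>F2) > 0"
    unfolding A_def B_def using measure_box_family_pos[OF F _ a] measure_box_family_pos[OF G Gne a] 
      measure_box_family_pos[OF F12(1) ne(1) a] measure_box_family_pos[OF F12(2) ne(2) a] PQ(1) by blast+
  have mA_split: "?m A = ?m (\<Union>F1) + ?m (\<Union>F2)"
    using measure_weighted_hyperplane_split[of A a k i s] A a by (simp add: F12 L_def R_def)
  have \<theta>: "0 < \<theta>" "\<theta> < 1" "?m (\<Union>F1) = \<theta> * ?m A" "?m (\<Union>F2) = (1 - \<theta>) * ?m A"
    using mA mF mA_split by (auto simp: \<theta>_def field_simps)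
  \<comment> \<open>The intermediate value theorem gives the hyperplane \<open>x\<^sub>i = t\<close> that cuts \<open>B\<close> in the proportion \<open>\<theta>\<close>.\<close>
  obtain b where b: "\<And>x. x \<in> B \<Longrightarrow> \<bar>x $ i\<bar> \<le> b"
    using B(2) unfolding bounded_iff by (meson component_le_norm_cart order_trans)
  have "\<exists>t. -b - 1 \<le> t \<and> t \<le> b + 1 \<and> ?m (B \<inter> L t) = \<theta> * ?m B"
  proof (rule IVT')
    have "B \<inter> L (-b-1) = {}" using b by (force simp: L_def)
    then show "?m (B \<inter> L (-b-1)) \<le> \<theta> * ?m B" using \<theta> by simp
    have "B \<inter> L (b+1) = B" using b by (force simp: L_def)
    then show "\<theta> * ?m B \<le> ?m (B \<inter> L (b+1))" using \<theta> mB by simp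
    show "continuous_on {-b-1..b+1} (\<lambda>t. ?m (B \<inter> L t))"
      unfolding L_def using continuous_weighted_cut[of B a k i] B a by (auto intro: continuous_on_subset)
    obtain X where "X \<in> G" "X \<noteq> {}" using Gne box_family_props(3)[OF G] by (metis ex_in_conv)
    then obtain x where "x \<in> B" unfolding B_def by blast
    then show "-b - 1 \<le> b + 1" using b[of x] by linarith
  qed
  then obtain t where t: "?m (B \<inter> L t) = \<theta> * ?m B" by blast
  define G1 G2 where "G1 = (\<lambda>X. X \<inter> L t) ` G - {{}}" and "G2 = (\<lambda>X. X \<inter> R t) ` G - {{}}"
  have G12: "box_family k G1" "box_family k G2" "\<Union>G1 = B \<inter> L t" "\<Union>G2 = B \<inter> R t"
    "card G1 \<le> card G" "card G2 \<le> card G"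
    using box_family_cut[OF G] by (auto simp: G1_def G2_def L_def R_def B_def)
  have mG: "?m (\<Union>G1) = \<theta> * ?m B" "?m (\<Union>G2) = (1 - \<theta>) * ?m B"
    using measure_weighted_hyperplane_split[of B a k i t] B a t by (simp_all add: G12 L_def R_def algebra_simps)
  have neG: "G1 \<noteq> {}" "G2 \<noteq> {}" using mG \<theta> mB by auto
  have bm: "bm_holds k a (\<Union>F1) (\<Union>G1)" "bm_holds k a (\<Union>F2) (\<Union>G2)"
    using G12(5,6) cF IH[OF F12(1) G12(1) ne(1) neG(1)] IH[OF F12(2) G12(2) ne(2) neG(2)] by linarith+
  let ?c = "?m A powr (1 / wdim k a) + ?m B powr (1 / wdim k a)"
  have scale: "q * ?c powr wdim k a \<le> ?m (setplus (\<Union>F') (\<Union>G'))"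
    if "bm_holds k a (\<Union>F') (\<Union>G')" "?m (\<Union>F') = q * ?m A" "?m (\<Union>G') = q * ?m B" "0 < q" for F' G' q
  proof -
    have "q powr (1 / wdim k a) * ?c \<le> ?m (setplus (\<Union>F') (\<Union>G')) powr (1 / wdim k a)"
      using that by (simp add: bm_holds_def powr_mult distrib_left)
    then have "(q powr (1 / wdim k a) * ?c) powr wdim k a \<le> (?m (setplus (\<Union>F') (\<Union>G')) powr (1 / wdim k a)) powr wdim k a"
      using D by (intro powr_mono2) auto
    then show ?thesis using D that by (simp add: powr_mult powr_powr)
  qed
  \<comment> \<open>These two sums lie on different sides of the hyperplane \<open>x\<^sub>i = s + t\<close>.\<close>
  let ?S1 = "setplus (\<Union>F1) (\<Union>G1)" and ?S2 = "setplus (\<Union>F2) (\<Union>G2)"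
  have S: "?S1 \<inter> ?S2 = {}" "?S1 \<union> ?S2 \<subseteq> setplus A B"
    unfolding F12 G12 setplus_def by (auto simp: L_def R_def dest!: arg_cong[where f="\<lambda>x. x $ i"]) 
  have op: "open ?S1" "open ?S2" "open (setplus A B)" "bounded ?S1" "bounded ?S2" "bounded (setplus A B)"
    using box_family_props(1,2)[OF F12(1)] box_family_props(1,2)[OF F12(2)] 
      box_family_props(2)[OF G12(1)] box_family_props(2)[OF G12(2)] A B(2)
    by (blast intro: open_setplus bounded_setplus)+
  have "?c powr wdim k a = \<theta> * ?c powr wdim k a + (1 - \<theta>) * ?c powr wdim k a" by (simp add: algebra_simps)
  also have "\<dots> \<le> ?m ?S1 + ?m ?S2"
    using scale[OF bm(1) \<theta>(3) mG(1)] scale[OF bm(2) \<theta>(4) mG(2)] \<theta> by simp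
  also have "\<dots> = ?m (?S1 \<union> ?S2)"
    using S op a by (intro measure_weighted_Un[symmetric]) auto
  also have "\<dots> \<le> ?m (setplus A B)"
    using S op a by (intro measure_weighted_mono) auto
  finally have "(?c powr wdim k a) powr (1 / wdim k a) \<le> ?m (setplus A B) powr (1 / wdim k a)"
    using D by (intro powr_mono2) auto
  then show ?thesis using D by (simp add: powr_powr bm_holds_def A_def B_def)
qed

lemma brunn_minkowski_box_families:
  fixes F G :: "(real ^ 'n::finite) set set"
  assumes a: "0 \<le> a" and "box_family k F" "box_family k G" "F \<noteq> {}" "G \<noteq> {}"
  shows "bm_holds k a (\<Union>F) (\<Union>G)"
  using assms(2-)
proof (induction "card F + card G" arbitrary: F G rule: less_induct)
  case less
  have pos: "card F \<ge> 1" "card G \<ge> 1"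
    using less.prems by (auto simp: box_family_def Suc_le_eq card_gt_0_iff)
  consider "2 \<le> card F" | "2 \<le> card G" | "card F = 1" "card G = 1" using pos by linarith
  then show ?case
  proof cases
    case 1
    show ?thesis
      by (rule brunn_minkowski_cut[OF a less.prems(1,2) 1 less.prems(4)]) (rule less.hyps)
  next
    case 2
    have "bm_holds k a (\<Union>G) (\<Union>F)"
      by (rule brunn_minkowski_cut[OF a less.prems(2,1) 2 less.prems(3)]) (rule less.hyps, simp_all)
    then show ?thesis by (simp add: bm_holds_def setplus_commute[of "\<Union>F"] add.commute)
  next
    case 3
    obtain X Y where XY: "F = {X}" "G = {Y}" using 3 card_1_singletonE by metis
    have "\<exists>u v. X = box u v \<and> (\<forall>i. u $ i < v $ i) \<and> 0 \<le> u $ k"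
      using less.prems(1) by (simp add: box_family_def XY)
    then obtain u v where uv: "X = box u v" "\<And>i. u $ i < v $ i" "0 \<le> u $ k" by auto
    have "\<exists>u v. Y = box u v \<and> (\<forall>i. u $ i < v $ i) \<and> 0 \<le> u $ k"
      using less.prems(2) by (simp add: box_family_def XY)
    then obtain u' v' where uv': "Y = box u' v'" "\<And>i. u' $ i < v' $ i" "0 \<le> u' $ k" by auto
    have D: "wdim k a > 0" using a by (simp add: wdim_def add_pos_nonneg)
    have "box (u + u') (v + v') \<subseteq> setplus X Y"
      unfolding uv(1) uv'(1) by (rule box_sum[OF uv(2) uv'(2)])
    moreover have "open (setplus X Y)" "bounded (setplus X Y)"
      unfolding uv(1) uv'(1) by (rule open_setplus[OF open_box], rule bounded_setplus[OF bounded_box bounded_box])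
    ultimately have "measure (weighted_lborel k a) (box (u + u') (v + v')) \<le> measure (weighted_lborel k a) (setplus X Y)"
      using a by (intro measure_weighted_mono) auto
    then have "measure (weighted_lborel k a) (box (u + u') (v + v')) powr (1 / wdim k a)
       \<le> measure (weighted_lborel k a) (setplus X Y) powr (1 / wdim k a)"
      using D by (intro powr_mono2) auto
    then show ?thesis
      using brunn_minkowski_box[OF uv(3) uv'(3) uv(2) uv'(2) a]
      by (simp add: bm_holds_def XY uv(1) uv'(1))
  qed
qed

text \<open>An open set is, up to a null set, a countable union of boxes with disjoint interiors; finitely many
  of them carry as much of its mass as desired.\<close>

lemma inner_box_family:
  fixes A :: "(real ^ 'n::finite) set"
  assumes A: "open A" "bounded A" "A \<subseteq> halfspace k" "A \<noteq> {}" and a: "0 \<le> a" and c: "c < measure (weighted_lborel k a) A"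
  obtains F where "box_family k F" "F \<noteq> {}" "\<Union>F \<subseteq> A" "c < measure (weighted_lborel k a) (\<Union>F)"
proof -
  let ?m = "measure (weighted_lborel k a)"
  obtain b where b: "A \<subseteq> cbox (-b) b" using bounded_subset_cbox_symmetric[OF A(2)] by blast
  have b': "A \<subseteq> cbox (-b - 1) (b + 1)" "box (-b - 1) (b + 1) \<noteq> {}"
  proof -
    obtain x where "x \<in> A" using A by blast
    then have "x \<in> cbox (-b) b" using b by blast
    then have "x \<in> box (-b - 1) (b + 1)" unfolding mem_box_cart by (auto) (smt (verit))+
    then show "box (-b - 1) (b + 1) \<noteq> {}" by blast
    show "A \<subseteq> cbox (-b - 1) (b + 1)" using b by (auto simp: mem_box_cart subset_iff) (smt (verit))+
  qed
  \<comment> \<open>With this gauge the covering lemma yields cells that are contained in \<open>A\<close>.\<close>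
  define g where "g x = (if x \<in> A then A else UNIV)" for x
  have "gauge g" using A by (auto simp: gauge_def g_def)
  then obtain \<D> where \<D>: "countable \<D>"
    "\<And>K. K \<in> \<D> \<Longrightarrow> interior K \<noteq> {} \<and> (\<exists>c d. K = cbox c d)"
    "pairwise (\<lambda>A B. interior A \<inter> interior B = {}) \<D>"
    "\<And>K. K \<in> \<D> \<Longrightarrow> \<exists>x \<in> A \<inter> K. K \<subseteq> g x" "A \<subseteq> \<Union>\<D>"
    using covering_lemma[OF b'] by metis
  have KA: "K \<subseteq> A" if "K \<in> \<D>" for K using \<D>(4)[OF that] by (auto simp: g_def)
  have ne: "\<D> \<noteq> {}" using \<D>(5) A(4) by auto
  define U where "U n = (\<Union>j\<le>n. interior (from_nat_into \<D> j))" for n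
  have inD: "from_nat_into \<D> j \<in> \<D>" for j using ne by (rule from_nat_into)
  have UA: "U n \<subseteq> A" for n unfolding U_def using KA[OF inD] interior_subset by blast
  have opU: "open (U n)" for n by (auto simp: U_def)
  have fam: "box_family k ((\<lambda>j. interior (from_nat_into \<D> j)) ` {..n})" for n
    unfolding box_family_def
  proof (intro conjI ballI)
    show "disjoint ((\<lambda>j. interior (from_nat_into \<D> j)) ` {..n})"
    proof (rule pairwiseI)
      fix X Y assume X: "X \<in> (\<lambda>j. interior (from_nat_into \<D> j)) ` {..n}"
        and Y: "Y \<in> (\<lambda>j. interior (from_nat_into \<D> j)) ` {..n}" and ne: "X \<noteq> Y"
      from X obtain j where jX: "X = interior (from_nat_into \<D> j)" by (rule imageE)
      from Y obtain j' where jY: "Y = interior (from_nat_into \<D> j')" by (rule imageE)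
      have j: "X = interior (from_nat_into \<D> j)" "Y = interior (from_nat_into \<D> j')"
        "from_nat_into \<D> j \<noteq> from_nat_into \<D> j'" using jX jY ne by auto
      show "disjnt X Y" using pairwiseD[OF \<D>(3) inD inD j(3)] j(1,2) by (simp add: disjnt_def)
    qed
    fix X assume "X \<in> (\<lambda>j. interior (from_nat_into \<D> j)) ` {..n}"
    then obtain j where "X = interior (from_nat_into \<D> j)" by (rule imageE)
    then obtain K where K: "K \<in> \<D>" "X = interior K" using inD[of j] by blast
    then obtain c d where cd: "K = cbox c d" using \<D>(2) by blast
    have X: "X = box c d" using K cd by (simp add: interior_cbox)
    have "box c d \<noteq> {}" using \<D>(2) K X by blast
    then have lt: "\<forall>i. c $ i < d $ i" by (simp add: interval_ne_empty_cart)
    then have "c \<in> cbox c d" by (simp add: mem_box_cart less_imp_le)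
    then have "c \<in> halfspace k" using KA[OF K(1)] cd A(3) by blast
    then show "\<exists>u v. X = box u v \<and> (\<forall>i. u $ i < v $ i) \<and> 0 \<le> u $ k"
      using X lt unfolding halfspace_def by (metis less_imp_le mem_Collect_eq)
  qed simp
  have lim: "(\<lambda>n. ?m (U n)) \<longlonglongrightarrow> ?m (\<Union>n. U n)"
  proof (rule Lim_measure_incseq)
    show "range U \<subseteq> sets (weighted_lborel k a)" using opU by auto
    show "incseq U" unfolding U_def incseq_def by (intro allI impI UN_mono) auto
    have "(\<Union>n. U n) \<subseteq> A" using UA by blast
    then have "bounded (\<Union>n. U n)" using A(2) bounded_subset by blast
    then show "emeasure (weighted_lborel k a) (\<Union>n. U n) \<noteq> \<infinity>"
      using emeasure_weighted_bounded_finite[OF _ a] by (metis less_irrefl)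
  qed
  have N: "(\<Union>K\<in>\<D>. frontier K) \<in> null_sets lborel"
  proof (rule null_sets_UN'[OF \<D>(1)])
    fix K assume "K \<in> \<D>"
    then obtain c d where "K = cbox c d" using \<D>(2) by blast
    then have "negligible (frontier K)" using negligible_convex_frontier[OF convex_box(1)[of c d]] by simp
    then have "frontier K \<in> null_sets (completion lborel)" by (simp add: negligible_iff_null_sets)
    then show "frontier K \<in> null_sets lborel" by (simp add: null_sets_completion_iff borel_closed)
  qed
  have "A - (\<Union>n. U n) \<subseteq> (\<Union>K\<in>\<D>. frontier K)"
  proof
    fix x assume x: "x \<in> A - (\<Union>n. U n)"
    then obtain K where K: "K \<in> \<D>" "x \<in> K" using \<D>(5) by blast
    obtain j where "from_nat_into \<D> j = K" using from_nat_into_surj[OF \<D>(1) K(1)] by blast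
    then have "x \<notin> interior K" using x by (auto simp: U_def)
    then show "x \<in> (\<Union>K\<in>\<D>. frontier K)" using K closure_subset by (auto simp: frontier_def)
  qed
  then have "AE x in weighted_lborel k a. x \<in> A \<longleftrightarrow> x \<in> (\<Union>n. U n)"
    using AE_not_in[OF null_sets_weighted[OF N, of k a]] UA by (auto elim!: eventually_mono)
  then have "?m A = ?m (\<Union>n. U n)"
    by (rule measure_eq_AE) (use A opU in auto)
  with lim c have "eventually (\<lambda>n. c < ?m (U n)) sequentially"
    by (metis order_tendstoD(1))
  then obtain n where n: "c < ?m (U n)" by (auto simp: eventually_sequentially)
  have U: "\<Union>((\<lambda>j. interior (from_nat_into \<D> j)) ` {..n}) = U n" by (simp add: U_def)
  show ?thesis
  proof (rule that[OF fam[of n]])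
    show "(\<lambda>j. interior (from_nat_into \<D> j)) ` {..n} \<noteq> {}" by simp
  qed (unfold U, fact UA, fact n)
qed

lemma measure_weighted_open_pos:
  fixes A :: "(real ^ 'n::finite) set"
  assumes A: "open A" "bounded A" "A \<subseteq> halfspace k" "A \<noteq> {}" and a: "0 \<le> a"
  shows "0 < measure (weighted_lborel k a) A"
proof -
  have "-1 < measure (weighted_lborel k a) A" by (rule less_le_trans[of _ 0]) auto
  obtain F where F: "box_family k F" "F \<noteq> {}" "\<Union>F \<subseteq> A"
    by (rule inner_box_family[OF A a \<open>-1 < _\<close>])
  have "0 < measure (weighted_lborel k a) (\<Union>F)" by (rule measure_box_family_pos[OF F(1,2) a])
  also have "\<dots> \<le> measure (weighted_lborel k a) A"
    by (rule measure_weighted_mono[OF F(3) _ A(2) a]) (use A in simp)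
  finally show ?thesis .
qed

text \<open>Finite families of boxes exhaust open sets from inside, and enlarging the summands enlarges their sum. The exponent \<open>1 / n\<^sub>a\<close> is the one for a homogeneous measure of degree \<open>n\<^sub>a = n + a\<close>.\<close>

theorem brunn_minkowski_weighted:
  fixes A B :: "(real ^ 'n::finite) set"
  assumes A: "open A" "bounded A" "A \<subseteq> halfspace k" "A \<noteq> {}"
    and B: "open B" "bounded B" "B \<subseteq> halfspace k" "B \<noteq> {}" and a: "0 \<le> a"
  shows "measure (weighted_lborel k a) A powr (1 / wdim k a) + measure (weighted_lborel k a) B powr (1 / wdim k a)
     \<le> measure (weighted_lborel k a) (setplus A B) powr (1 / wdim k a)"
proof -
  let ?m = "measure (weighted_lborel k a)"
  have D: "wdim k a > 0" using a by (simp add: wdim_def add_pos_nonneg)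
  have key: "c powr (1 / wdim k a) + d powr (1 / wdim k a) \<le> ?m (setplus A B) powr (1 / wdim k a)"
    if "0 \<le> c" "c < ?m A" "0 \<le> d" "d < ?m B" for c d
  proof -
    obtain F where F: "box_family k F" "F \<noteq> {}" "\<Union>F \<subseteq> A" "c < ?m (\<Union>F)"
      by (rule inner_box_family[OF A a \<open>c < ?m A\<close>])
    obtain G where G: "box_family k G" "G \<noteq> {}" "\<Union>G \<subseteq> B" "d < ?m (\<Union>G)"
      by (rule inner_box_family[OF B a \<open>d < ?m B\<close>])
    have "c powr (1 / wdim k a) + d powr (1 / wdim k a) \<le> ?m (\<Union>F) powr (1 / wdim k a) + ?m (\<Union>G) powr (1 / wdim k a)"
      using F G that D by (intro add_mono powr_mono2) auto
    also have "\<dots> \<le> ?m (setplus (\<Union>F) (\<Union>G)) powr (1 / wdim k a)"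
      using brunn_minkowski_box_families[OF a F(1) G(1) F(2) G(2)] by (simp add: bm_holds_def)
    also have "\<dots> \<le> ?m (setplus A B) powr (1 / wdim k a)"
      using D F G A B a
      by (intro powr_mono2 measure_weighted_mono setplus_mono) (auto intro!: borel_open open_setplus bounded_setplus)
    finally show ?thesis .
  qed
  have mA: "?m A > 0" and mB: "?m B > 0"
    using measure_weighted_open_pos[OF A a] measure_weighted_open_pos[OF B a] .
  have lim: "((\<lambda>t. (t * ?m A) powr (1 / wdim k a) + (t * ?m B) powr (1 / wdim k a))
     \<longlongrightarrow> (1 * ?m A) powr (1 / wdim k a) + (1 * ?m B) powr (1 / wdim k a)) (at_left 1)"
    using mA mB by (intro tendsto_intros) auto
  have "eventually (\<lambda>t. (t * ?m A) powr (1 / wdim k a) + (t * ?m B) powr (1 / wdim k a)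
     \<le> ?m (setplus A B) powr (1 / wdim k a)) (at_left 1)"
    using eventually_at_left_real[of 0 "1::real", OF zero_less_one]
    by (rule eventually_mono) (use mA mB in \<open>auto intro!: key\<close>)
  from tendsto_upperbound[OF lim this] show ?thesis by simp
qed

section \<open>Norms and half-balls\<close>

lemma is_normD:
  assumes "is_norm N"
  shows "0 \<le> N x" "N x = 0 \<longleftrightarrow> x = 0" "N (c *\<^sub>R x) = \<bar>c\<bar> * N x" "N (x + y) \<le> N x + N y"
    "N (- x) = N x" "N (x - y) = N (y - x)" "\<bar>N x - N y\<bar> \<le> N (x - y)"
proof -
  show 1: "0 \<le> N x" "N x = 0 \<longleftrightarrow> x = 0" and sc: "N (c *\<^sub>R x) = \<bar>c\<bar> * N x" "N (x + y) \<le> N x + N y" for c x y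
    using assms by (simp_all add: is_norm_def)
  show m: "N (- x) = N x" for x using sc(1)[of "-1" x] by simp
  show d: "N (x - y) = N (y - x)" for x y using m[of "x - y"] by simp
  show "\<bar>N x - N y\<bar> \<le> N (x - y)"
    using sc(2)[of "x - y" y] sc(2)[of "y - x" x] d[of x y] by simp
qed

text \<open>All norms are equivalent to the Euclidean one; this is one half, \<open>is_norm_lower\<close> the other.\<close>

lemma is_norm_upper:
  fixes N :: "real ^ 'n::finite \<Rightarrow> real"
  assumes N: "is_norm N"
  obtains C where "0 < C" "\<And>x. N x \<le> C * norm x"
proof -
  define C where "C = (\<Sum>i\<in>UNIV. N (axis i 1)) + 1"
  have C: "0 < C" using is_normD(1)[OF N] by (simp add: C_def sum_nonneg add_nonneg_pos)
  have sumN: "N (\<Sum>i\<in>I. g i) \<le> (\<Sum>i\<in>I. N (g i))" if "finite I" for I :: "'n set" and g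
    using that
  proof (induction I)
    case empty then show ?case using is_normD(2)[OF N, of 0] by simp
  next
    case (insert i I)
    then show ?case using is_normD(4)[OF N, of "g i" "\<Sum>i\<in>I. g i"] by simp
  qed
  have "N x \<le> C * norm x" for x
  proof -
    have "x = (\<Sum>i\<in>UNIV. x $ i *\<^sub>R axis i 1)"
      by (simp add: vec_eq_iff axis_def if_distrib[where f="\<lambda>y. _ * y"] cong: if_cong)
    then have "N x \<le> (\<Sum>i\<in>UNIV. N (x $ i *\<^sub>R axis i 1))" using sumN[of UNIV "\<lambda>i. x $ i *\<^sub>R axis i 1"] by simp
    also have "\<dots> \<le> (\<Sum>i\<in>UNIV. norm x * N (axis i 1))"
      by (intro sum_mono) (simp add: is_normD[OF N] component_le_norm_cart mult_right_mono)
    also have "\<dots> \<le> C * norm x" by (simp add: C_def sum_distrib_left[symmetric] algebra_simps)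
    finally show ?thesis .
  qed
  with C show ?thesis using that by blast
qed

lemma is_norm_continuous:
  fixes N :: "real ^ 'n::finite \<Rightarrow> real"
  assumes N: "is_norm N"
  shows "continuous_on A N"
proof -
  obtain C where C: "0 < C" "\<And>x. N x \<le> C * norm x" by (rule is_norm_upper[OF N]) blast
  have "C-lipschitz_on A N"
    using C order_trans[OF is_normD(7)[OF N] C(2)]
    by (intro lipschitz_onI) (auto simp: dist_norm)
  then show ?thesis by (rule lipschitz_on_continuous_on)
qed

lemma is_norm_measurable:
  fixes N :: "real ^ 'n::finite \<Rightarrow> real"
  assumes N: "is_norm N" and [measurable]: "f \<in> borel_measurable M"
  shows "(\<lambda>x. N (f x)) \<in> borel_measurable M"
  by (rule borel_measurable_continuous_on[OF is_norm_continuous[OF N]]) simp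

lemma is_norm_lower:
  fixes N :: "real ^ 'n::finite \<Rightarrow> real"
  assumes N: "is_norm N"
  obtains c where "0 < c" "\<And>x. c * norm x \<le> N x"
proof -
  have c: "compact (sphere (0::real^'n) 1)" by simp
  have ne: "sphere (0::real^'n) 1 \<noteq> {}" by simp
  obtain z where z: "z \<in> sphere 0 1" "\<And>y. y \<in> sphere 0 1 \<Longrightarrow> N z \<le> N y"
    using continuous_attains_inf[OF c ne is_norm_continuous[OF N]] by blast
  have "N z > 0" using z(1) is_normD(1,2)[OF N, of z] by (auto simp: less_le)
  moreover have "N z * norm x \<le> N x" for x
  proof (cases "x = 0")
    case False
    have "N z \<le> N ((1 / norm x) *\<^sub>R x)" using False by (intro z(2)) simp
    also have "\<dots> = N x / norm x" by (simp add: is_normD[OF N])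
    finally show ?thesis using False by (simp add: field_simps)
  qed (simp add: is_normD[OF N])
  ultimately show ?thesis using that by blast
qed

lemma bounded_is_norm_ball:
  fixes N :: "real ^ 'n::finite \<Rightarrow> real"
  assumes N: "is_norm N"
  shows "bounded {x. N (x - x0) \<le> r}"
proof -
  obtain c where c: "0 < c" "\<And>x. c * norm x \<le> N x" by (rule is_norm_lower[OF N]) blast
  show ?thesis
  proof (rule boundedI)
    fix x assume "x \<in> {x. N (x - x0) \<le> r}"
    then have "c * norm (x - x0) \<le> r" using c(2)[of "x - x0"] by simp
    then have "norm (x - x0) \<le> r / c" using c(1) by (simp add: field_simps)
    then show "norm x \<le> r / c + norm x0" using norm_triangle_ineq2[of x x0] by linarith
  qed
qed

lemma nn_integral_wmeasure:
  assumes "f \<in> borel_measurable (lebesgue_on (halfspace k))"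
  shows "(\<integral>\<^sup>+x. f x \<partial>wmeasure k a) = (\<integral>\<^sup>+x. ennreal (indicator (halfspace k) x * weight k a x) * f x \<partial>lborel)"
proof -
  have w: "weight k a \<in> borel_measurable (lebesgue_on (halfspace k))"
    by (intro measurable_restrict_space1 measurable_completion) simp
  have "(\<integral>\<^sup>+x. f x \<partial>wmeasure k a) = (\<integral>\<^sup>+x. ennreal (weight k a x) * f x \<partial>lebesgue_on (halfspace k))"
    unfolding wmeasure_def by (rule nn_integral_density) (use assms w in auto)
  also have "\<dots> = (\<integral>\<^sup>+x. ennreal (weight k a x) * f x * indicator (halfspace k) x \<partial>lebesgue)"
    by (rule nn_integral_restrict_space) simp
  also have "\<dots> = (\<integral>\<^sup>+x. ennreal (weight k a x) * f x * indicator (halfspace k) x \<partial>lborel)"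
    by (rule nn_integral_completion)
  also have "\<dots> = (\<integral>\<^sup>+x. ennreal (indicator (halfspace k) x * weight k a x) * f x \<partial>lborel)"
    by (intro nn_integral_cong) (auto simp: indicator_def)
  finally show ?thesis .
qed

lemma nn_integral_wmeasure_borel:
  assumes "f \<in> borel_measurable borel"
  shows "(\<integral>\<^sup>+x. f x \<partial>wmeasure k a) = (\<integral>\<^sup>+x. f x \<partial>weighted_lborel k a)"
  by (subst nn_integral_weighted_lborel[OF assms], rule nn_integral_wmeasure)
    (use assms in \<open>auto intro!: measurable_restrict_space1 measurable_completion\<close>)

lemma AE_weighted_halfspace: "AE x in weighted_lborel k a. x \<in> halfspace k"
  unfolding weighted_lborel_def by (subst AE_density) (auto simp: indicator_def)

text \<open>Homogeneity of the weight: a dilation with centre on the boundary hyperplane scales \<open>\<omega> dx\<close> by the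
  power \<open>n\<^sub>a\<close> of the factor.\<close>

lemma nn_integral_weighted_dilation:
  fixes x0 :: "real ^ 'n::finite"
  assumes [measurable]: "f \<in> borel_measurable borel" and x0: "x0 $ k = 0" and r: "0 < r"
  shows "(\<integral>\<^sup>+x. f x \<partial>weighted_lborel k a)
     = ennreal (r powr wdim k a) * (\<integral>\<^sup>+x. f (x0 + r *\<^sub>R x) \<partial>weighted_lborel k a)"
proof -
  have [measurable]: "(\<lambda>x. x0 + r *\<^sub>R x) \<in> borel_measurable borel" by simp
  have scal: "(indicator (halfspace k) (x0 + r *\<^sub>R x) * weight k a (x0 + r *\<^sub>R x) :: real)
     = r powr a * (indicator (halfspace k) x * weight k a x)" for x
    using x0 r by (auto simp: indicator_def halfspace_def weight_def powr_mult zero_less_mult_iff)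
  have "(\<integral>\<^sup>+x. f x \<partial>weighted_lborel k a)
     = (\<integral>\<^sup>+x. ennreal (indicator (halfspace k) x * weight k a x) * f x
         \<partial>density (distr lborel borel (\<lambda>x. x0 + r *\<^sub>R x)) (\<lambda>_. \<bar>r\<bar>^DIM(real^'n)))"
    using lborel_affine[of r x0] r by (simp add: nn_integral_weighted_lborel)
  also have "\<dots> = (\<integral>\<^sup>+x. ennreal (\<bar>r\<bar>^DIM(real^'n)) * (ennreal (indicator (halfspace k) (x0 + r *\<^sub>R x) * weight k a (x0 + r *\<^sub>R x)) * f (x0 + r *\<^sub>R x)) \<partial>lborel)"
    by (subst nn_integral_density) (auto simp: nn_integral_distr)
  also have "\<dots> = (\<integral>\<^sup>+x. ennreal (r powr wdim k a) * (ennreal (indicator (halfspace k) x * weight k a x) * f (x0 + r *\<^sub>R x)) \<partial>lborel)"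
  proof (intro nn_integral_cong)
    fix x
    have "r powr wdim k a = \<bar>r\<bar>^DIM(real^'n) * r powr a"
      using r by (simp add: wdim_def powr_add powr_realpow)
    then show "ennreal (\<bar>r\<bar>^DIM(real^'n)) * (ennreal (indicator (halfspace k) (x0 + r *\<^sub>R x) * weight k a (x0 + r *\<^sub>R x)) * f (x0 + r *\<^sub>R x))
      = ennreal (r powr wdim k a) * (ennreal (indicator (halfspace k) x * weight k a x) * f (x0 + r *\<^sub>R x))"
      unfolding scal by (simp add: ennreal_mult mult.assoc)
  qed
  also have "\<dots> = ennreal (r powr wdim k a) * (\<integral>\<^sup>+x. f (x0 + r *\<^sub>R x) \<partial>weighted_lborel k a)"
    by (subst nn_integral_cmult) (auto simp: nn_integral_weighted_lborel)
  finally show ?thesis .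
qed

lemma halfball_mass_eq:
  fixes N :: "real ^ 'n::finite \<Rightarrow> real"
  assumes N: "is_norm N" and a: "0 \<le> a"
  shows "halfball_mass N k a = measure (weighted_lborel k a) {x \<in> halfspace k. N x \<le> 1}"
proof -
  have [measurable]: "N \<in> borel_measurable borel" using is_norm_measurable[OF N, of id borel] by (simp add: id_def)
  have [measurable]: "{x. N x \<le> 1} \<inter> halfspace k \<in> sets borel" by measurable
  have "halfball_mass N k a = (LINT x|lebesgue. indicator ({x. N x \<le> 1} \<inter> halfspace k) x * weight k a x)"
    by (simp add: halfball_mass_def set_lebesgue_integral_def)
  also have "\<dots> = (LINT x|lborel. indicator ({x. N x \<le> 1} \<inter> halfspace k) x * weight k a x)"
    by (rule integral_completion) measurable
  also have "\<dots> = enn2real (\<integral>\<^sup>+x. ennreal (indicator ({x. N x \<le> 1} \<inter> halfspace k) x * weight k a x) \<partial>lborel)"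
    by (rule integral_eq_nn_integral) auto
  also have "(\<integral>\<^sup>+x. ennreal (indicator ({x. N x \<le> 1} \<inter> halfspace k) x * weight k a x) \<partial>lborel)
     = emeasure (weighted_lborel k a) ({x. N x \<le> 1} \<inter> halfspace k)"
    by (subst emeasure_weighted_lborel) (auto intro!: nn_integral_cong simp: indicator_def)
  also have "{x. N x \<le> 1} \<inter> halfspace k = {x \<in> halfspace k. N x \<le> 1}" by auto
  finally show ?thesis by (simp add: measure_def)
qed

lemma emeasure_weighted_norm_ball:
  fixes N :: "real ^ 'n::finite \<Rightarrow> real"
  assumes N: "is_norm N" and a: "0 \<le> a" and x0: "x0 $ k = 0" and r: "0 < r"
  shows "emeasure (weighted_lborel k a) {x \<in> halfspace k. N (x - x0) \<le> r}
    = ennreal (halfball_mass N k a * r powr wdim k a)"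
proof -
  have [measurable]: "N \<in> borel_measurable borel" using is_norm_measurable[OF N, of id borel] by (simp add: id_def)
  have b: "bounded {x \<in> halfspace k. N x \<le> 1}"
    by (rule bounded_subset[OF bounded_is_norm_ball[OF N, of 0 1]]) auto
  have "emeasure (weighted_lborel k a) {x \<in> halfspace k. N (x - x0) \<le> r}
     = (\<integral>\<^sup>+x. indicator {x \<in> halfspace k. N (x - x0) \<le> r} x \<partial>weighted_lborel k a)"
    by (subst nn_integral_indicator) (auto, measurable)
  also have "\<dots> = ennreal (r powr wdim k a) * (\<integral>\<^sup>+x. indicator {x \<in> halfspace k. N (x - x0) \<le> r} (x0 + r *\<^sub>R x) \<partial>weighted_lborel k a)"
    by (rule nn_integral_weighted_dilation[OF _ x0 r]) measurable
  also have "(\<lambda>x. indicator {x \<in> halfspace k. N (x - x0) \<le> r} (x0 + r *\<^sub>R x) :: ennreal) = indicator {x \<in> halfspace k. N x \<le> 1}"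
    using x0 r by (auto simp: indicator_def halfspace_def is_normD[OF N] zero_less_mult_iff fun_eq_iff)
  also have "(\<integral>\<^sup>+x. indicator {x \<in> halfspace k. N x \<le> 1} x \<partial>weighted_lborel k a) = emeasure (weighted_lborel k a) {x \<in> halfspace k. N x \<le> 1}"
    by (rule nn_integral_indicator) measurable
  also have "\<dots> = ennreal (halfball_mass N k a)"
    unfolding halfball_mass_eq[OF N a] by (rule finite_measure_weighted[OF b a])
  finally show ?thesis by (simp add: ennreal_mult[symmetric] measure_nonneg halfball_mass_eq[OF N a] mult.commute)
qed

lemma halfball_mass_pos:
  fixes N :: "real ^ 'n::finite \<Rightarrow> real"
  assumes N: "is_norm N" and a: "0 \<le> a"
  shows "0 < halfball_mass N k a"
proof -
  have [measurable]: "N \<in> borel_measurable borel" using is_norm_measurable[OF N, of id borel] by (simp add: id_def)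
  have op: "open {x. N x < 1}" by (intro open_Collect_less is_norm_continuous[OF N] continuous_intros)
  have b: "bounded {x. N x \<le> 1}" using bounded_is_norm_ball[OF N, of 0 1] by simp
  define z where "z = (1 / (2 * N (axis k 1))) *\<^sub>R (axis k 1 :: real ^ 'n)"
  have "axis k (1::real) \<noteq> 0" by (simp add: axis_eq_0_iff)
  then have "N (axis k 1) > 0" using is_normD(1,2)[OF N, of "axis k 1"] by linarith
  then have "z \<in> {x. N x < 1} \<inter> halfspace k" by (simp add: z_def is_normD[OF N] halfspace_def)
  then have "0 < measure (weighted_lborel k a) ({x. N x < 1} \<inter> halfspace k)"
    by (intro measure_weighted_open_pos[OF _ _ _ _ a])
      (use op b in \<open>auto intro!: open_Int intro: bounded_subset\<close>)
  also have "\<dots> \<le> measure (weighted_lborel k a) {x \<in> halfspace k. N x \<le> 1}"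
    by (rule measure_weighted_mono[OF _ _ _ a]) (use b in \<open>auto intro: bounded_subset\<close>, measurable)
  finally show ?thesis by (simp add: halfball_mass_eq[OF N a])
qed

text \<open>The mass of a half-ball is a continuous function of its radius, so the sphere carries no mass.\<close>

lemma measure_weighted_open_norm_ball:
  fixes N :: "real ^ 'n::finite \<Rightarrow> real"
  assumes N: "is_norm N" and a: "0 \<le> a" and x0: "x0 $ k = 0" and r: "0 < r"
  shows "measure (weighted_lborel k a) {x \<in> halfspace k. N (x - x0) < r} = halfball_mass N k a * r powr wdim k a"
    and "emeasure (weighted_lborel k a) {x. N (x - x0) = r} = 0"
proof -
  let ?m = "measure (weighted_lborel k a)"
  have [measurable]: "N \<in> borel_measurable borel" using is_norm_measurable[OF N, of id borel] by (simp add: id_def)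
  have m0: "0 \<le> halfball_mass N k a" using halfball_mass_pos[OF N a] less_imp_le by blast
  have cb: "?m {x \<in> halfspace k. N (x - x0) \<le> s} = halfball_mass N k a * s powr wdim k a" if "0 < s" for s
    using emeasure_weighted_norm_ball[OF N a x0 that] m0 by (simp add: measure_def)
  have bd: "bounded {x \<in> halfspace k. N (x - x0) \<le> s}" for s
    by (rule bounded_subset[OF bounded_is_norm_ball[OF N, of x0 s]]) auto
  have up: "?m {x \<in> halfspace k. N (x - x0) < r} \<le> halfball_mass N k a * r powr wdim k a"
    unfolding cb[OF r, symmetric]
    by (rule measure_weighted_mono[OF _ _ bd a]) auto
  have "((\<lambda>s. halfball_mass N k a * s powr wdim k a) \<longlongrightarrow> halfball_mass N k a * r powr wdim k a) (at_left r)"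
    using r by (intro tendsto_intros) auto
  moreover have "eventually (\<lambda>s. halfball_mass N k a * s powr wdim k a \<le> ?m {x \<in> halfspace k. N (x - x0) < r}) (at_left r)"
    using eventually_at_left_real[OF r]
  proof (rule eventually_mono)
    fix s assume s: "s \<in> {0<..<r}"
    have "?m {x \<in> halfspace k. N (x - x0) \<le> s} \<le> ?m {x \<in> halfspace k. N (x - x0) < r}"
    proof (rule measure_weighted_mono[OF _ _ _ a])
      show "bounded {x \<in> halfspace k. N (x - x0) < r}" by (rule bounded_subset[OF bd[of r]]) auto
    qed (use s in auto)
    then show "halfball_mass N k a * s powr wdim k a \<le> ?m {x \<in> halfspace k. N (x - x0) < r}" using s cb by simp
  qed
  ultimately have "halfball_mass N k a * r powr wdim k a \<le> ?m {x \<in> halfspace k. N (x - x0) < r}"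
    by (intro tendsto_upperbound) auto
  with up show eq: "?m {x \<in> halfspace k. N (x - x0) < r} = halfball_mass N k a * r powr wdim k a" by simp
  have "?m {x \<in> halfspace k. N (x - x0) \<le> r} = ?m {x \<in> halfspace k. N (x - x0) < r} + ?m {x \<in> halfspace k. N (x - x0) = r}"
    by (subst measure_weighted_Un[symmetric, OF _ _ _ _ _ a])
      (auto intro!: arg_cong[where f="?m"] intro: bounded_subset[OF bd[of r]])
  then have "?m {x \<in> halfspace k. N (x - x0) = r} = 0" using eq cb[OF r] by simp
  moreover have "bounded {x \<in> halfspace k. N (x - x0) = r}" by (rule bounded_subset[OF bd[of r]]) auto
  ultimately have "emeasure (weighted_lborel k a) {x \<in> halfspace k. N (x - x0) = r} = 0"
    using finite_measure_weighted[of _ a k] a by simp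
  moreover have "emeasure (weighted_lborel k a) {x. N (x - x0) = r} = emeasure (weighted_lborel k a) {x \<in> halfspace k. N (x - x0) = r}"
    using AE_weighted_halfspace[of k a] by (intro emeasure_eq_AE) (auto elim: eventually_mono)
  ultimately show "emeasure (weighted_lborel k a) {x. N (x - x0) = r} = 0" by simp
qed

section \<open>Superlevel sets and \<open>L\<^sup>p\<close> norms\<close>

lemma sigma_finite_weighted_lborel: "sigma_finite_measure (weighted_lborel k a)"
  unfolding weighted_lborel_def
  by (subst sigma_finite_measure.sigma_finite_iff_density_finite[OF lborel.sigma_finite_measure_axioms]) auto

text \<open>Fubini's theorem for the region between \<open>0\<close> and the graph of \<open>F\<close>.\<close>

lemma layer_cake:
  fixes F :: "'a \<Rightarrow> real" and g :: "'a \<Rightarrow> ennreal"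
  assumes M: "sigma_finite_measure M" and [measurable]: "F \<in> borel_measurable M" "g \<in> borel_measurable M"
    and nonneg: "\<And>x. 0 \<le> F x"
  shows "(\<integral>\<^sup>+x. ennreal (F x) * g x \<partial>M)
     = (\<integral>\<^sup>+t. indicator {0<..} t * (\<integral>\<^sup>+x. indicator {x. t < F x} x * g x \<partial>M) \<partial>lborel)"
    and "(\<lambda>t. \<integral>\<^sup>+x. indicator {x. t < F x} x * g x \<partial>M) \<in> borel_measurable lborel"
proof -
  interpret M: sigma_finite_measure M by fact
  interpret P: pair_sigma_finite M lborel ..
  have [measurable]: "(\<lambda>(x, t). indicator {0<..<F x} t * g x) \<in> borel_measurable (M \<Otimes>\<^sub>M lborel)"
    by (simp add: indicator_def[abs_def] split_beta' greaterThanLessThan_iff) 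
  have "(\<integral>\<^sup>+x. ennreal (F x) * g x \<partial>M) = (\<integral>\<^sup>+x. (\<integral>\<^sup>+t. indicator {0<..<F x} t * g x \<partial>lborel) \<partial>M)"
    by (intro nn_integral_cong) (subst nn_integral_multc, auto simp: nonneg)
  also have "\<dots> = (\<integral>\<^sup>+t. (\<integral>\<^sup>+x. indicator {0<..<F x} t * g x \<partial>M) \<partial>lborel)"
    by (rule P.Fubini'[symmetric]) simp
  also have "\<dots> = (\<integral>\<^sup>+t. indicator {0<..} t * (\<integral>\<^sup>+x. indicator {x. t < F x} x * g x \<partial>M) \<partial>lborel)"
    by (intro nn_integral_cong) (auto simp: indicator_def intro!: nn_integral_cong)
  finally show "(\<integral>\<^sup>+x. ennreal (F x) * g x \<partial>M)
     = (\<integral>\<^sup>+t. indicator {0<..} t * (\<integral>\<^sup>+x. indicator {x. t < F x} x * g x \<partial>M) \<partial>lborel)" .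
  have [measurable]: "(\<lambda>(t, x). indicator {x. t < F x} x * g x) \<in> borel_measurable (lborel \<Otimes>\<^sub>M M)"
    by (simp add: indicator_def[abs_def] split_beta')
  show "(\<lambda>t. \<integral>\<^sup>+x. indicator {x. t < F x} x * g x \<partial>M) \<in> borel_measurable lborel"
    by measurable
qed

text \<open>Hoelder's inequality for \<open>1\<^sub>A\<close> and \<open>F\<^sup>p\<^sup>-\<^sup>1\<close>, from Young's inequality.\<close>

lemma holder_on_set:
  fixes F :: "'a \<Rightarrow> real" and p J :: real
  assumes p: "1 < p" and F [measurable]: "F \<in> borel_measurable M" and nn: "\<And>x. 0 \<le> F x"
    and J: "(\<integral>\<^sup>+x. ennreal (F x powr p) \<partial>M) = ennreal J" "0 < J"
    and A [measurable]: "A \<in> sets M" and fin: "emeasure M A < \<infinity>"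
  shows "(\<integral>\<^sup>+x. indicator A x * ennreal (F x powr (p - 1)) \<partial>M) \<le> ennreal (measure M A powr (1 / p) * J powr (1 - 1 / p))"
proof (cases "measure M A = 0")
  case True
  then have "emeasure M A = 0" using fin by (simp add: emeasure_eq_ennreal_measure)
  then have "AE x in M. x \<notin> A" by (intro AE_not_in) (auto simp: null_sets_def)
  then have "(\<integral>\<^sup>+x. indicator A x * ennreal (F x powr (p - 1)) \<partial>M) = (\<integral>\<^sup>+x. 0 \<partial>M)"
    by (intro nn_integral_cong_AE) (auto elim!: eventually_mono)
  then show ?thesis by simp
next
  case False
  define m where "m = measure M A"
  have m: "0 < m" using False by (simp add: m_def zero_less_measure_iff)
  define q where "q = p / (p - 1)"
  have q: "1 < q" "1 / q + 1 / p = 1" using p by (auto simp: q_def field_simps)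
  \<comment> \<open>With this scaling both terms of Young's inequality integrate to multiples of \<open>m\<^sup>1\<^sup>/\<^sup>p J\<^sup>1\<^sup>-\<^sup>1\<^sup>/\<^sup>p\<close>.\<close>
  define s where "s = (J / m) powr (1 / p)"
  have s: "0 < s" using J m by (simp add: s_def)
  have young: "F x powr (p - 1) \<le> F x powr p / (q * s) + s powr (p - 1) / p" for x
  proof -
    have "F x powr (p - 1) * s \<le> (F x powr (p - 1)) powr q / q + s powr p / p"
      using Youngs_inequality[of q p "F x powr (p-1)" s] q p s by simp
    also have "(F x powr (p - 1)) powr q = F x powr p" using p by (simp add: powr_powr q_def)
    finally have "F x powr (p - 1) \<le> (F x powr p / q + s powr p / p) / s" using s by (simp add: field_simps)
    also have "\<dots> = F x powr p / (q * s) + s powr (p - 1) / p"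
      using s by (simp add: add_divide_distrib powr_diff mult.commute)
    finally show ?thesis .
  qed
  have "(\<integral>\<^sup>+x. indicator A x * ennreal (F x powr (p - 1)) \<partial>M)
     \<le> (\<integral>\<^sup>+x. ennreal (1 / (q * s)) * ennreal (F x powr p) + ennreal (s powr (p - 1) / p) * indicator A x \<partial>M)"
  proof (rule nn_integral_mono)
    fix x
    have "ennreal (F x powr (p - 1)) \<le> ennreal (1 / (q * s)) * ennreal (F x powr p) + ennreal (s powr (p - 1) / p)"
      using young[of x] q p s by (simp add: ennreal_mult'[symmetric] ennreal_plus[symmetric] del: ennreal_plus)
    then show "indicator A x * ennreal (F x powr (p - 1))
      \<le> ennreal (1 / (q * s)) * ennreal (F x powr p) + ennreal (s powr (p - 1) / p) * indicator A x"
      by (auto simp: indicator_def)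
  qed
  also have "\<dots> = ennreal (1 / (q * s)) * ennreal J + ennreal (s powr (p - 1) / p) * ennreal m"
    using fin by (subst nn_integral_add) (auto simp: nn_integral_cmult nn_integral_cmult_indicator J(1) m_def emeasure_eq_ennreal_measure)
  also have "\<dots> = ennreal (J / (q * s) + s powr (p - 1) / p * m)"
    using J m q p s by (simp add: ennreal_mult'[symmetric] ennreal_plus[symmetric] del: ennreal_plus)
  also have "J / (q * s) + s powr (p - 1) / p * m = m powr (1 / p) * J powr (1 - 1 / p)"
  proof -
    have 1: "J / s = m powr (1 / p) * J powr (1 - 1 / p)"
      using J m by (simp add: s_def powr_divide powr_diff)
    have "s powr (p - 1) = s powr p / s" using s by (simp add: powr_diff)
    also have "s powr p = J / m" using p J m by (simp add: s_def powr_powr)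
    finally have 2: "s powr (p - 1) * m = J / s" using m by simp
    have "J / (q * s) = (1 / q) * (J / s)" "s powr (p - 1) / p * m = (1 / p) * (s powr (p - 1) * m)" by simp_all
    then have "J / (q * s) + s powr (p - 1) / p * m = (1 / q) * (J / s) + (1 / p) * (s powr (p - 1) * m)" by (simp only:)
    also have "\<dots> = (1 / q + 1 / p) * (J / s)" unfolding 2 by (rule distrib_right[symmetric])
    also have "\<dots> = J / s" unfolding q(2) by simp
    finally show ?thesis using 1 by (simp only:)
  qed
  finally show ?thesis by (simp add: m_def)
qed

text \<open>Minkowski's inequality for the decomposition of \<open>F\<close> into the indicators of its superlevel sets: the
  \<open>L\<^sup>p\<close> norm of an indicator is the \<open>1 / p\<close>-th power of the measure.\<close>

lemma Lp_norm_le_level_sets: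
  fixes F :: "'a \<Rightarrow> real" and p J :: real
  assumes M: "sigma_finite_measure M" and p: "1 < p" and F [measurable]: "F \<in> borel_measurable M" and nn: "\<And>x. 0 \<le> F x"
    and J: "(\<integral>\<^sup>+x. ennreal (F x powr p) \<partial>M) = ennreal J" "0 \<le> J"
    and fin: "\<And>t. 0 < t \<Longrightarrow> emeasure M {x \<in> space M. t < F x} < \<infinity>"
  shows "ennreal (J powr (1 / p)) \<le> (\<integral>\<^sup>+t. indicator {0<..} t * ennreal (measure M {x \<in> space M. t < F x} powr (1 / p)) \<partial>lborel)"
proof (cases "J = 0")
  case False
  then have J0: "0 < J" using J by simp
  let ?m = "\<lambda>t. measure M {x \<in> space M. t < F x}"
  have em: "(\<integral>\<^sup>+x. indicator {x. t < F x} x * 1 \<partial>M) = emeasure M {x \<in> space M. t < F x}" for t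
  proof -
    have "(\<integral>\<^sup>+x. indicator {x. t < F x} x * 1 \<partial>M) = (\<integral>\<^sup>+x. indicator {x \<in> space M. t < F x} x \<partial>M)"
      by (intro nn_integral_cong) (auto simp: indicator_def)
    also have "\<dots> = emeasure M {x \<in> space M. t < F x}" by (rule nn_integral_indicator) measurable
    finally show ?thesis .
  qed
  have [measurable]: "?m \<in> borel_measurable lborel"
    using layer_cake(2)[OF M F, of "\<lambda>_. 1"] nn unfolding em measure_def by measurable
  have "ennreal J = (\<integral>\<^sup>+x. ennreal (F x) * ennreal (F x powr (p - 1)) \<partial>M)"
    unfolding J(1)[symmetric]
  proof (intro nn_integral_cong)
    fix x show "ennreal (F x powr p) = ennreal (F x) * ennreal (F x powr (p - 1))"
      using nn[of x] by (cases "F x = 0") (auto simp: ennreal_mult[symmetric] powr_diff)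
  qed
  also have "\<dots> = (\<integral>\<^sup>+t. indicator {0<..} t * (\<integral>\<^sup>+x. indicator {x. t < F x} x * ennreal (F x powr (p - 1)) \<partial>M) \<partial>lborel)"
    by (rule layer_cake(1)[OF M F _ nn]) measurable
  also have "\<dots> \<le> (\<integral>\<^sup>+t. indicator {0<..} t * ennreal (?m t powr (1 / p)) * ennreal (J powr (1 - 1 / p)) \<partial>lborel)"
  proof (rule nn_integral_mono)
    fix t :: real
    show "indicator {0<..} t * (\<integral>\<^sup>+x. indicator {x. t < F x} x * ennreal (F x powr (p - 1)) \<partial>M)
       \<le> indicator {0<..} t * ennreal (?m t powr (1 / p)) * ennreal (J powr (1 - 1 / p))"
    proof (cases "0 < t")
      case True
      have "(\<integral>\<^sup>+x. indicator {x. t < F x} x * ennreal (F x powr (p - 1)) \<partial>M)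
         = (\<integral>\<^sup>+x. indicator {x \<in> space M. t < F x} x * ennreal (F x powr (p - 1)) \<partial>M)"
        by (intro nn_integral_cong) (auto simp: indicator_def)
      also have "\<dots> \<le> ennreal (?m t powr (1 / p) * J powr (1 - 1 / p))"
        by (rule holder_on_set[OF p F nn J(1) J0 _ fin[OF True]]) measurable
      finally show ?thesis using True by (simp add: ennreal_mult)
    qed simp
  qed
  also have "\<dots> = (\<integral>\<^sup>+t. indicator {0<..} t * ennreal (?m t powr (1 / p)) \<partial>lborel) * ennreal (J powr (1 - 1 / p))"
    by (rule nn_integral_multc) measurable
  finally have le: "ennreal J \<le> (\<integral>\<^sup>+t. indicator {0<..} t * ennreal (?m t powr (1 / p)) \<partial>lborel) * ennreal (J powr (1 - 1 / p))" .
  have "ennreal J = ennreal (J powr (1 / p)) * ennreal (J powr (1 - 1 / p))"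
    using J0 by (simp add: ennreal_mult[symmetric] powr_add[symmetric])
  with le have "ennreal (J powr (1 - 1 / p)) * ennreal (J powr (1 / p))
     \<le> ennreal (J powr (1 - 1 / p)) * (\<integral>\<^sup>+t. indicator {0<..} t * ennreal (?m t powr (1 / p)) \<partial>lborel)"
    by (simp add: mult.commute)
  then show ?thesis using J0 by (subst (asm) ennreal_mult_le_mult_iff) auto
qed simp

section \<open>The Sobolev inequality for functions with an upper slope\<close>

lemma bernoulli_powr:
  fixes x D :: real
  assumes "1 \<le> D" "0 \<le> x"
  shows "1 + D * x \<le> (1 + x) powr D"
proof -
  have D: "0 < D" using assms by simp
  have "(1 + D * x) powr (1 / D) * 1 powr (1 - 1 / D) \<le> (1 / D) * (1 + D * x) + (1 - 1 / D) * 1"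
    by (rule Youngs_inequality_0) (use assms in \<open>auto simp: add_pos_nonneg\<close>)
  also have "\<dots> = 1 + x" using D by (simp add: field_simps)
  finally have "(1 + D * x) powr (1 / D) \<le> 1 + x" by simp
  then have "((1 + D * x) powr (1 / D)) powr D \<le> (1 + x) powr D"
    using D by (intro powr_mono2) auto
  moreover have "1 + D * x > 0" using D assms by (simp add: add_pos_nonneg)
  ultimately show ?thesis using D by (simp add: powr_powr)
qed

text \<open>The isoperimetric inequality in the form of a lower bound for the gain in mass when a set is
  enlarged by the half-ball of radius \<open>h\<close>. It is the Brunn--Minkowski inequality together with
  Bernoulli's inequality, which linearises the \<open>n\<^sub>a\<close>-th power with the right sign.\<close>

lemma weighted_enlargement:
  fixes N :: "real ^ 'n::finite \<Rightarrow> real"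
  assumes N: "is_norm N" and a: "0 \<le> a" and D: "1 < wdim k a"
    and A: "open A" "bounded A" "A \<subseteq> halfspace k" and h: "0 < h"
  shows "measure (weighted_lborel k a) A
      + h * (wdim k a * halfball_mass N k a powr (1 / wdim k a) * measure (weighted_lborel k a) A powr (1 - 1 / wdim k a))
    \<le> measure (weighted_lborel k a) (setplus A {y \<in> halfspace k. N y < h})"
proof (cases "A = {}")
  case True
  then show ?thesis using D by simp
next
  case False
  let ?m = "measure (weighted_lborel k a)" and ?D = "wdim k a"
  let ?E = "{y \<in> halfspace k. N y < h}"
  have mA: "0 < ?m A" by (rule measure_weighted_open_pos[OF A False a])
  have mB: "0 < halfball_mass N k a" by (rule halfball_mass_pos[OF N a])
  have E: "open ?E" "bounded ?E"
  proof -
    have "?E = halfspace k \<inter> {y. N y < h}" by auto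
    moreover have "open {y. N y < h}" by (intro open_Collect_less is_norm_continuous[OF N] continuous_intros)
    ultimately show "open ?E" by auto
    show "bounded ?E" by (rule bounded_subset[OF bounded_is_norm_ball[OF N, of 0 h]]) auto
  qed
  have mE: "?m ?E = halfball_mass N k a * h powr ?D"
    using measure_weighted_open_norm_ball(1)[OF N a, of 0 k h] h by simp
  then have "0 < ?m ?E" using mB h by simp
  then have "?E \<noteq> {}" by (metis less_irrefl measure_empty)
  then have "?m A powr (1 / ?D) + ?m ?E powr (1 / ?D) \<le> ?m (setplus A ?E) powr (1 / ?D)"
    by (intro brunn_minkowski_weighted[OF A False E _ _ a]) auto
  also have "?m ?E powr (1 / ?D) = h * halfball_mass N k a powr (1 / ?D)"
    using mB h D by (simp add: mE powr_mult powr_powr)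
  finally have le: "?m A powr (1 / ?D) + h * halfball_mass N k a powr (1 / ?D) \<le> ?m (setplus A ?E) powr (1 / ?D)" .
  define x where "x = h * halfball_mass N k a powr (1 / ?D) / ?m A powr (1 / ?D)"
  have "?m A + h * (?D * halfball_mass N k a powr (1 / ?D) * ?m A powr (1 - 1 / ?D)) = ?m A * (1 + ?D * x)"
    using mA by (simp add: x_def powr_diff field_simps)
  also have "\<dots> \<le> ?m A * (1 + x) powr ?D"
    using mA h D by (intro mult_left_mono bernoulli_powr) (auto simp: x_def)
  also have "\<dots> = (?m A powr (1 / ?D)) powr ?D * (1 + x) powr ?D" using mA D by (simp add: powr_powr)
  also have "\<dots> = (?m A powr (1 / ?D) * (1 + x)) powr ?D" by (simp add: powr_mult)
  also have "?m A powr (1 / ?D) * (1 + x) = ?m A powr (1 / ?D) + h * halfball_mass N k a powr (1 / ?D)"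
    using mA by (simp add: x_def field_simps)
  also have "\<dots> powr ?D \<le> (?m (setplus A ?E) powr (1 / ?D)) powr ?D"
    using le D h by (intro powr_mono2) (auto intro!: add_nonneg_nonneg)
  also have "\<dots> = ?m (setplus A ?E)" using D by (simp add: powr_powr)
  finally show ?thesis .
qed

text \<open>The Sobolev inequality for a Lipschitz function \<open>F\<close> of bounded support, where any function \<open>G\<close> that
  dominates the upward slope of \<open>F\<close> plays the part of \<open>\<parallel>\<nabla>F\<parallel>\<^sub>*\<close>. Let \<open>F\<^sub>h x\<close> be the
  supremum of \<open>F\<close> over \<open>x - (half-ball of radius h)\<close>. Its superlevel sets are the enlarged superlevel
  sets of \<open>F\<close>, so \<open>weighted_enlargement\<close> and the layer cake formula bound the integral of
  \<open>(F\<^sub>h - F) / h\<close> from below by a multiple of the integral over \<open>t\<close> of \<open>|{F > t}|\<^sup>1\<^sup>/\<^sup>p\<close>, hence of the \<open>L\<^sup>p\<close> norm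
  of \<open>F\<close>. From above, the upper limit of these quotients as \<open>h\<close> tends to 0 is at most \<open>G\<close>.\<close>

theorem sobolev_upper_slope:
  fixes N :: "real ^ 'n::finite \<Rightarrow> real" and F G :: "real ^ 'n \<Rightarrow> real" and L R c :: real
  assumes N: "is_norm N" and a: "0 \<le> a" and D: "1 < wdim k a"
    and nonneg: "\<And>x. 0 \<le> F x" and supp: "\<And>x. x \<notin> halfspace k \<or> R < norm x \<Longrightarrow> F x = 0" and R: "0 \<le> R"
    and lip: "\<And>x y. x \<in> halfspace k \<Longrightarrow> y \<in> halfspace k \<Longrightarrow> \<bar>F x - F y\<bar> \<le> L * norm (x - y)" and L: "0 \<le> L"
    and G [measurable]: "G \<in> borel_measurable borel" and Gnn: "\<And>x. 0 \<le> G x"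
    and slope: "\<And>x e. x \<in> halfspace k \<Longrightarrow> 0 < e \<Longrightarrow> \<exists>d>0. \<forall>z\<in>halfspace k. norm (z - x) < d \<longrightarrow> F z \<le> F x + (G x + e) * N (z - x)"
    and bound: "(\<integral>\<^sup>+x. ennreal (G x) \<partial>weighted_lborel k a) \<le> ennreal c" and c: "0 \<le> c"
    and p: "p = wdim k a / (wdim k a - 1)" and S: "S = 1 / wdim k a * halfball_mass N k a powr (- 1 / wdim k a)"
  shows "(\<integral>\<^sup>+x. ennreal (F x powr p) \<partial>weighted_lborel k a) \<le> ennreal ((S * c) powr p)"
proof -
  let ?W = "weighted_lborel k a" and ?D = "wdim k a" and ?H = "halfspace k"
  let ?m = "measure ?W"
  define \<beta> where "\<beta> = ?D * halfball_mass N k a powr (1 / ?D)"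
  have mB: "0 < halfball_mass N k a" by (rule halfball_mass_pos[OF N a])
  have \<beta>: "0 < \<beta>" using D mB by (simp add: \<beta>_def)
  have p1: "1 < p" and ip: "1 / p = 1 - 1 / ?D" using D by (auto simp: p field_simps)
  have S\<beta>: "S = 1 / \<beta>" using mB by (simp add: S \<beta>_def powr_minus divide_simps)
  obtain n0 where n0: "0 < n0" "\<And>x. n0 * norm x \<le> N x" by (rule is_norm_lower[OF N]) blast
  have opH: "open ?H" by simp
  have contF: "continuous_on ?H F"
    using lip L by (intro lipschitz_on_continuous_on[of L] lipschitz_onI) (auto simp: dist_norm)
  have Lev: "open {x. t < F x}" if "0 \<le> t" for t
  proof -
    have "{x. t < F x} = ?H \<inter> F -` {t<..}" using that supp by force
    then show ?thesis using continuous_open_preimage[OF contF opH, of "{t<..}"] by simp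
  qed
  have F [measurable]: "F \<in> borel_measurable borel"
  proof (rule borel_measurable_iff_greater[THEN iffD2], rule allI)
    fix t :: real
    have "{w. t < F w} = UNIV" if "t < 0" using nonneg that by (auto intro: less_le_trans)
    then show "{w \<in> space borel. t < F w} \<in> sets borel" using Lev[of t] by (cases "t < 0") auto
  qed
  have LevH: "{x. t < F x} \<subseteq> ?H" "{x. t < F x} \<subseteq> cball 0 R" if "0 \<le> t" for t
    using that supp by (force, force simp: not_less[symmetric])
  have Levb: "bounded {x. t < F x}" if "0 \<le> t" for t
    using LevH(2)[OF that] bounded_cball bounded_subset by blast
  have Levf: "emeasure ?W {x. t < F x} < \<infinity>" if "0 < t" for t
    using emeasure_weighted_bounded_finite[OF Levb a] that by simp
  have Fmax: "F x \<le> L * (2 * R + 2)" for x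
  proof (cases "x \<in> ?H \<and> norm x \<le> R")
    case True
    have yH: "(R + 1) *\<^sub>R axis k 1 \<in> ?H" using R by (simp add: halfspace_def)
    have ny: "norm ((R + 1) *\<^sub>R axis k 1 :: real ^ 'n) = R + 1" using R by (simp add: norm_axis_1)
    have "F ((R + 1) *\<^sub>R axis k 1) = 0" using ny by (intro supp) simp
    then have "F x \<le> L * norm (x - (R + 1) *\<^sub>R axis k 1)" using lip[OF _ yH, of x] True by auto
    also have "\<dots> \<le> L * (2 * R + 2)"
      using norm_triangle_ineq4[of x "(R + 1) *\<^sub>R axis k 1"] True ny R L by (intro mult_left_mono) auto
    finally show ?thesis .
  next
    case False
    then have "F x = 0" using supp by (meson not_le)
    then show ?thesis using L R by simp
  qed
  have ballf: "emeasure ?W (cball 0 r) < \<infinity>" for r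
    by (rule emeasure_weighted_bounded_finite[OF bounded_cball a])
  define M0 where "M0 = L * (2 * R + 2)"
  have Fle: "F x \<le> M0 * indicator (cball 0 R) x" for x
    using Fmax[of x] supp[of x] by (auto simp: indicator_def M0_def not_le)
  have M0: "0 \<le> M0" using L R by (simp add: M0_def)
  have intF: "(\<integral>\<^sup>+x. ennreal (F x) \<partial>?W) < \<infinity>"
  proof -
    have "(\<integral>\<^sup>+x. ennreal (F x) \<partial>?W) \<le> (\<integral>\<^sup>+x. ennreal M0 * indicator (cball 0 R) x \<partial>?W)"
    proof (rule nn_integral_mono)
      fix x show "ennreal (F x) \<le> ennreal M0 * indicator (cball 0 R) x"
        using Fle[of x] nonneg[of x] by (auto simp: indicator_def intro!: ennreal_leI split: if_splits)
    qed
    also have "\<dots> < \<infinity>" using ballf by (subst nn_integral_cmult_indicator) (auto simp: ennreal_mult_less_top)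
    finally show ?thesis .
  qed
  have intFp: "(\<integral>\<^sup>+x. ennreal (F x powr p) \<partial>?W) < \<infinity>"
  proof -
    have "(\<integral>\<^sup>+x. ennreal (F x powr p) \<partial>?W) \<le> (\<integral>\<^sup>+x. ennreal (M0 powr p) * indicator (cball 0 R) x \<partial>?W)"
    proof (rule nn_integral_mono)
      fix x
      show "ennreal (F x powr p) \<le> ennreal (M0 powr p) * indicator (cball 0 R) x"
        using Fle[of x] nonneg[of x] p1 powr_mono2[of p "F x" M0]
        by (auto simp: indicator_def split: if_splits intro!: ennreal_leI)
    qed
    also have "\<dots> < \<infinity>" using ballf by (subst nn_integral_cmult_indicator) (auto simp: ennreal_mult_less_top)
    finally show ?thesis .
  qed
  define I where "I = (\<integral>\<^sup>+t. indicator {0<..} t * ennreal (?m {x. t < F x} powr (1 / p)) \<partial>lborel)"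

  \<comment> \<open>The set \<open>Z h x\<close> is the part inside the half-space of \<open>x\<close> minus the open half-ball of radius \<open>h\<close>;
      the Lipschitz bound relates values of \<open>F\<close> inside the half-space only.\<close>
  define Z where "Z h x = {z \<in> ?H. x - z \<in> ?H \<and> N (x - z) < h}" for h x
  define Fh where "Fh h x = (if x \<in> ?H then SUP z\<in>Z h x. F z else 0)" for h x
  have bdd: "bdd_above (F ` Z h x)" for h x using Fmax by (auto intro!: bdd_aboveI2)
  have Zne: "Z h x \<noteq> {}" if "x \<in> ?H" "0 < h" for h x
  proof -
    define s where "s = min (x $ k / 2) (h / (2 * N (axis k 1)))"
    have "axis k (1::real) \<noteq> 0" by (simp add: axis_eq_0_iff)
    then have Na: "N (axis k 1) > 0" using is_normD(1,2)[OF N, of "axis k 1"] by linarith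
    have xk: "0 < x $ k" using that by (simp add: halfspace_def)
    have s: "0 < s" "s < x $ k" using xk that Na by (auto simp: s_def min_less_iff_disj)
    have "s * N (axis k 1) \<le> h / (2 * N (axis k 1)) * N (axis k 1)"
      using Na by (intro mult_right_mono) (auto simp: s_def)
    also have "\<dots> < h" using Na that by simp
    finally have "x - s *\<^sub>R axis k 1 \<in> Z h x"
      using s by (simp add: Z_def halfspace_def is_normD[OF N])
    then show ?thesis by blast
  qed
  have Fh_gt: "t < Fh h x \<longleftrightarrow> (\<exists>z\<in>Z h x. t < F z)" if "x \<in> ?H" "0 < h" for t h x
    using less_cSUP_iff[OF Zne[OF that] bdd] that by (simp add: Fh_def)
  have Fh_le: "Fh h x \<le> u" if "x \<in> ?H" "0 < h" "\<And>z. z \<in> Z h x \<Longrightarrow> F z \<le> u" for h x u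
    using Fh_gt[OF that(1,2), of u] that(3) by (meson not_le)
  have Fh_nn: "0 \<le> Fh h x" if h0: "0 < h" for h x
  proof (cases "x \<in> ?H")
    case True
    obtain z where "z \<in> Z h x" using Zne[OF True h0] by blast
    then have "F z \<le> Fh h x" using True bdd by (auto simp: Fh_def intro: cSUP_upper)
    then show ?thesis using nonneg[of z] by linarith
  qed (simp add: Fh_def)
  have Fh_level: "{x. t < Fh h x} = setplus {x. t < F x} {y \<in> ?H. N y < h}" if t: "0 \<le> t" and h: "0 < h" for t h
  proof (intro equalityI subsetI)
    fix x assume x: "x \<in> {x. t < Fh h x}"
    then have xH: "x \<in> ?H" using t by (auto simp: Fh_def split: if_splits)
    then obtain z where z: "z \<in> Z h x" "t < F z" using Fh_gt[OF xH h] x by blast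
    have "x = z + (x - z)" by simp
    then show "x \<in> setplus {x. t < F x} {y \<in> ?H. N y < h}"
      using z unfolding setplus_def Z_def by blast
  next
    fix x assume "x \<in> setplus {x. t < F x} {y \<in> ?H. N y < h}"
    then obtain z y where zy: "t < F z" "y \<in> ?H" "N y < h" "x = z + y" unfolding setplus_def by blast
    have zH: "z \<in> ?H" using LevH(1)[OF t] zy(1) by blast
    have xH: "x \<in> ?H" using zH zy by (simp add: halfspace_def)
    have "z \<in> Z h x" using zy zH by (simp add: Z_def)
    then show "x \<in> {x. t < Fh h x}" using Fh_gt[OF xH h] zy(1) by blast
  qed
  have Fh_meas [measurable]: "Fh h \<in> borel_measurable borel" if h: "0 < h" for h
  proof (rule borel_measurable_iff_greater[THEN iffD2], rule allI)
    fix t :: real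
    have "{w. t < Fh h w} = UNIV" if "t < 0" using Fh_nn[OF h] that by (auto intro: less_le_trans)
    moreover have "open {w. t < Fh h w}" if "\<not> t < 0"
      unfolding Fh_level[OF leI[OF that] h] using that by (intro open_setplus Lev) simp
    ultimately show "{w \<in> space borel. t < Fh h w} \<in> sets borel" by (cases "t < 0") auto
  qed
  have em1: "(\<integral>\<^sup>+x. indicator {x. t < f x} x * 1 \<partial>?W) = emeasure ?W {x. t < f x}"
    if [measurable]: "f \<in> borel_measurable borel" for f :: "real ^ 'n \<Rightarrow> real" and t
    using nn_integral_indicator[of "{x. t < f x}" ?W] by simp
  have lc: "(\<integral>\<^sup>+x. ennreal (f x) \<partial>?W) = (\<integral>\<^sup>+t. indicator {0<..} t * emeasure ?W {x. t < f x} \<partial>lborel)"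
    "(\<lambda>t. emeasure ?W {x. t < f x}) \<in> borel_measurable lborel"
    if f: "f \<in> borel_measurable borel" "\<And>x. 0 \<le> f x" for f :: "real ^ 'n \<Rightarrow> real"
    using layer_cake[OF sigma_finite_weighted_lborel, of f k a "\<lambda>_. 1"] f em1[OF f(1)] by simp_all
  have mm [measurable]: "(\<lambda>t. ?m {x. t < F x}) \<in> borel_measurable lborel"
    unfolding measure_def using lc(2)[OF F nonneg] by measurable

  have enlarge: "(\<integral>\<^sup>+x. ennreal (F x) \<partial>?W) + ennreal (h * \<beta>) * I \<le> (\<integral>\<^sup>+x. ennreal (Fh h x) \<partial>?W)" if h: "0 < h" for h
  proof -
    have [measurable]: "(\<lambda>t. emeasure ?W {x. t < F x}) \<in> borel_measurable lborel" by (rule lc(2)[OF F nonneg])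
    have "(\<integral>\<^sup>+x. ennreal (F x) \<partial>?W) + ennreal (h * \<beta>) * I
      = (\<integral>\<^sup>+t. indicator {0<..} t * emeasure ?W {x. t < F x}
           + ennreal (h * \<beta>) * (indicator {0<..} t * ennreal (?m {x. t < F x} powr (1 / p))) \<partial>lborel)"
      unfolding I_def lc(1)[OF F nonneg]
      by (subst nn_integral_cmult[symmetric], measurable, subst nn_integral_add[symmetric], measurable)
    also have "\<dots> \<le> (\<integral>\<^sup>+t. indicator {0<..} t * emeasure ?W {x. t < Fh h x} \<partial>lborel)"
    proof (rule nn_integral_mono)
      fix t :: real
      show "indicator {0<..} t * emeasure ?W {x. t < F x}
           + ennreal (h * \<beta>) * (indicator {0<..} t * ennreal (?m {x. t < F x} powr (1 / p)))
         \<le> indicator {0<..} t * emeasure ?W {x. t < Fh h x}"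
      proof (cases "0 < t")
        case True
        then have t: "0 \<le> t" by simp
        have bb: "bounded {x. t < Fh h x}" unfolding Fh_level[OF t h]
          by (intro bounded_setplus Levb t) (rule bounded_subset[OF bounded_is_norm_ball[OF N, of 0 h]], auto)
        have "?m {x. t < F x} + h * (\<beta> * ?m {x. t < F x} powr (1 / p)) \<le> ?m {x. t < Fh h x}"
          unfolding Fh_level[OF t h] ip \<beta>_def
          by (rule weighted_enlargement[OF N a D Lev[OF t] Levb[OF t] LevH(1)[OF t] h])
        then have "ennreal (?m {x. t < F x} + h * \<beta> * ?m {x. t < F x} powr (1 / p)) \<le> emeasure ?W {x. t < Fh h x}"
          unfolding finite_measure_weighted[OF bb a] by (intro ennreal_leI) (simp add: mult.assoc)
        then show ?thesis using True h \<beta>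
          by (simp add: finite_measure_weighted[OF Levb[OF t] a] ennreal_plus ennreal_mult)
      qed simp
    qed
    also have "\<dots> = (\<integral>\<^sup>+x. ennreal (Fh h x) \<partial>?W)" by (rule lc(1)[OF Fh_meas[OF h] Fh_nn[OF h], symmetric])
    finally show ?thesis .
  qed

  \<comment> \<open>The positive part of the quotient for \<open>h = 1 / (j + 1)\<close>, as the reverse Fatou lemma is applied to
      functions with values in \<open>[0, \<infinity>]\<close>.\<close>
  define q where "q j x = max 0 ((Fh (1 / real (Suc j)) x - F x) * real (Suc j))" for j x
  have qm [measurable]: "q j \<in> borel_measurable borel" for j
    unfolding q_def using Fh_meas[of "1 / real (Suc j)"] by measurable
  have le_q: "ennreal \<beta> * I \<le> (\<integral>\<^sup>+x. ennreal (q j x) \<partial>?W)" for j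
  proof -
    define h where "h = 1 / real (Suc j)"
    have h: "0 < h" by (simp add: h_def)
    have "(\<integral>\<^sup>+x. ennreal (F x) \<partial>?W) + ennreal h * (ennreal \<beta> * I) \<le> (\<integral>\<^sup>+x. ennreal (Fh h x) \<partial>?W)"
      using enlarge[OF h] h \<beta> by (simp add: ennreal_mult mult.assoc)
    also have "\<dots> \<le> (\<integral>\<^sup>+x. ennreal (F x) + ennreal h * ennreal (q j x) \<partial>?W)"
    proof (rule nn_integral_mono)
      fix x
      have "Fh h x - F x \<le> h * q j x"
      proof -
        have "(Fh h x - F x) = h * ((Fh h x - F x) * real (Suc j))" by (simp add: h_def)
        also have "\<dots> \<le> h * q j x" using h by (intro mult_left_mono) (auto simp: q_def h_def)
        finally show ?thesis .
      qed
      then have "ennreal (Fh h x) \<le> ennreal (F x + h * q j x)" by (intro ennreal_leI) simp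
      also have "\<dots> = ennreal (F x) + ennreal h * ennreal (q j x)"
        using h nonneg[of x] by (subst ennreal_plus) (auto simp: q_def ennreal_mult)
      finally show "ennreal (Fh h x) \<le> ennreal (F x) + ennreal h * ennreal (q j x)" .
    qed
    also have "\<dots> = (\<integral>\<^sup>+x. ennreal (F x) \<partial>?W) + ennreal h * (\<integral>\<^sup>+x. ennreal (q j x) \<partial>?W)"
      by (subst nn_integral_add) (auto simp: nn_integral_cmult)
    finally have "ennreal h * (ennreal \<beta> * I) \<le> ennreal h * (\<integral>\<^sup>+x. ennreal (q j x) \<partial>?W)"
      using intF by (subst (asm) ennreal_add_left_cancel_le) auto
    then show ?thesis using h by (subst (asm) ennreal_mult_le_mult_iff) auto
  qed
  have near: "norm (z - x) \<le> h / n0" if "z \<in> Z h x" for z x h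
  proof -
    have "n0 * norm (z - x) \<le> N (z - x)" by (rule n0(2))
    also have "N (z - x) = N (x - z)" by (rule is_normD(6)[OF N])
    also have "\<dots> \<le> h" using that by (simp add: Z_def)
    finally show ?thesis using n0(1) by (simp add: field_simps)
  qed
  have Zh: "z \<in> ?H" "N (z - x) < h" if "z \<in> Z h x" for z x h
    using that is_normD(6)[OF N, of z x] by (auto simp: Z_def)
  have q_bound: "q j x \<le> L / n0 * indicator (cball 0 (R + 1 / n0)) x" for j x
  proof (cases "x \<in> ?H")
    case False
    then show ?thesis using supp[of x] L n0 by (simp add: q_def Fh_def)
  next
    case True
    define h where "h = 1 / real (Suc j)"
    have h: "0 < h" "h \<le> 1" by (auto simp: h_def)
    show ?thesis
    proof (cases "norm x \<le> R + 1 / n0")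
      case inside: True
      have "Fh h x \<le> F x + L * (h / n0)"
      proof (rule Fh_le[OF True h(1)])
        fix z assume z: "z \<in> Z h x"
        have "F z - F x \<le> L * norm (z - x)" using lip[OF Zh(1)[OF z] True] by simp
        also have "\<dots> \<le> L * (h / n0)" by (rule mult_left_mono[OF near[OF z] L])
        finally show "F z \<le> F x + L * (h / n0)" by simp
      qed
      then have "(Fh h x - F x) * real (Suc j) \<le> L * (h / n0) * real (Suc j)" by (intro mult_right_mono) auto
      also have "\<dots> = L / n0" by (simp add: h_def)
      finally show ?thesis using inside L n0 by (simp add: q_def h_def)
    next
      case outside: False
      have "Fh h x \<le> 0"
      proof (rule Fh_le[OF True h(1)])
        fix z assume z: "z \<in> Z h x"
        have "norm (z - x) \<le> 1 / n0" using near[OF z] h n0 by (meson divide_right_mono less_imp_le order_trans)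
        then have "R < norm z" using outside norm_triangle_ineq3[of z x] by linarith
        then show "F z \<le> 0" using supp by simp
      qed
      then have "q j x \<le> 0" using nonneg[of x] by (auto simp: q_def h_def mult_le_0_iff)
      also have "0 \<le> L / n0 * indicator (cball 0 (R + 1 / n0)) x" using L n0(1) by simp
      finally show ?thesis .
    qed
  qed
  have q_lim: "limsup (\<lambda>j. ennreal (q j x)) \<le> ennreal (G x)" if x: "x \<in> ?H" for x
  proof (rule ennreal_le_epsilon)
    fix e :: real assume e: "0 < e"
    obtain d where d: "0 < d" "\<And>z. z \<in> ?H \<Longrightarrow> norm (z - x) < d \<Longrightarrow> F z \<le> F x + (G x + e) * N (z - x)"
      using slope[OF x e] by blast
    have "eventually (\<lambda>j. 1 / real (Suc j) < d * n0) sequentially"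
    proof -
      have "(\<lambda>j. 1 / real (Suc j)) \<longlonglongrightarrow> 0" using LIMSEQ_inverse_real_of_nat by (simp add: inverse_eq_divide)
      then show ?thesis using d(1) n0(1) by (intro order_tendstoD(2)) auto
    qed
    then have ev: "eventually (\<lambda>j. ennreal (q j x) \<le> ennreal (G x) + ennreal e) sequentially"
    proof (rule eventually_mono)
      fix j assume j: "1 / real (Suc j) < d * n0"
      define h where "h = 1 / real (Suc j)"
      have h: "0 < h" "h / n0 < d" using j n0(1) pos_divide_less_eq[of n0 h d] by (auto simp: h_def)
      have "Fh h x \<le> F x + (G x + e) * h"
      proof (rule Fh_le[OF x h(1)])
        fix z assume z: "z \<in> Z h x"
        have "norm (z - x) < d" using near[OF z] h by linarith
        then have "F z \<le> F x + (G x + e) * N (z - x)" using d(2) Zh(1)[OF z] by blast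
        also have "(G x + e) * N (z - x) \<le> (G x + e) * h"
          using Gnn[of x] e Zh(2)[OF z] by (intro mult_left_mono) auto
        finally show "F z \<le> F x + (G x + e) * h" by simp
      qed
      then have "(Fh h x - F x) * real (Suc j) \<le> (G x + e) * h * real (Suc j)" by (intro mult_right_mono) auto
      also have "\<dots> = G x + e" by (simp add: h_def)
      finally have "q j x \<le> G x + e" using Gnn[of x] e by (simp add: q_def h_def)
      then show "ennreal (q j x) \<le> ennreal (G x) + ennreal e"
        using Gnn[of x] e ennreal_leI[of "q j x" "G x + e"] by (simp add: ennreal_plus)
    qed
    show "limsup (\<lambda>j. ennreal (q j x)) \<le> ennreal (G x) + ennreal e"
      by (rule Limsup_bounded[OF ev])
  qed
  have [measurable]: "cball (0::real^'n) r \<in> sets borel" for r by (simp add: borel_closed)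
  have "ennreal \<beta> * I \<le> limsup (\<lambda>j. \<integral>\<^sup>+x. ennreal (q j x) \<partial>?W)"
    using le_q by (intro le_Limsup) auto
  also have "\<dots> \<le> (\<integral>\<^sup>+x. limsup (\<lambda>j. ennreal (q j x)) \<partial>?W)"
  proof (rule nn_integral_limsup[where w="\<lambda>x. ennreal (L / n0) * indicator (cball 0 (R + 1 / n0)) x"])
    show "(\<integral>\<^sup>+x. ennreal (L / n0) * indicator (cball 0 (R + 1 / n0)) x \<partial>?W) < \<infinity>"
      using ballf by (subst nn_integral_cmult_indicator) (auto simp: ennreal_mult_less_top)
    show "AE x in ?W. ennreal (q j x) \<le> ennreal (L / n0) * indicator (cball 0 (R + 1 / n0)) x" for j
    proof (rule AE_I2)
      fix x show "ennreal (q j x) \<le> ennreal (L / n0) * indicator (cball 0 (R + 1 / n0)) x"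
        using q_bound[of j x] by (auto simp: indicator_def ennreal_neg split: if_splits intro!: ennreal_leI)
    qed
  qed measurable
  also have "\<dots> \<le> (\<integral>\<^sup>+x. ennreal (G x) \<partial>?W)"
    using AE_weighted_halfspace[of k a] by (intro nn_integral_mono_AE) (auto elim!: eventually_mono intro: q_lim)
  also have "\<dots> \<le> ennreal c" by (rule bound)
  finally have bI: "ennreal \<beta> * I \<le> ennreal c" .
  obtain J where J: "(\<integral>\<^sup>+x. ennreal (F x powr p) \<partial>?W) = ennreal J" "0 \<le> J"
    using intFp by (cases "\<integral>\<^sup>+x. ennreal (F x powr p) \<partial>?W") auto
  have "ennreal (J powr (1 / p)) \<le> I"
    using Lp_norm_le_level_sets[where F=F, OF sigma_finite_weighted_lborel p1 _ nonneg J] Levf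
    by (simp add: I_def)
  then have "ennreal \<beta> * ennreal (J powr (1 / p)) \<le> ennreal c"
    by (rule order_trans[OF mult_left_mono bI]) simp
  then have "\<beta> * J powr (1 / p) \<le> c" using \<beta> c by (simp add: ennreal_mult[symmetric])
  then have "J powr (1 / p) \<le> S * c" using \<beta> by (simp add: S\<beta> field_simps)
  then have "(J powr (1 / p)) powr p \<le> (S * c) powr p" using p1 by (intro powr_mono2) auto
  then have "J \<le> (S * c) powr p" using p1 J by (simp add: powr_powr)
  then show ?thesis unfolding J by (rule ennreal_leI)
qed

section \<open>The dual norm\<close>

lemma dual_norm_bdd:
  fixes N :: "real ^ 'n::finite \<Rightarrow> real"
  assumes N: "is_norm N"
  shows "bdd_above ((\<lambda>y. x \<bullet> y) ` {y. N y \<le> 1})"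
proof -
  obtain B where B: "\<And>y. y \<in> {y. N (y - 0) \<le> 1} \<Longrightarrow> norm y \<le> B"
    using bounded_is_norm_ball[OF N, of 0 1] unfolding bounded_iff by blast
  show ?thesis
  proof (rule bdd_aboveI2)
    fix y assume "y \<in> {y. N y \<le> 1}"
    then have "norm y \<le> B" using B[of y] by simp
    then show "x \<bullet> y \<le> norm x * B"
      using norm_cauchy_schwarz[of x y] by (meson mult_left_mono norm_ge_zero order_trans)
  qed
qed

lemma dual_norm_upper:
  fixes N :: "real ^ 'n::finite \<Rightarrow> real"
  assumes "is_norm N" "N y \<le> 1"
  shows "x \<bullet> y \<le> dual_norm N x"
  unfolding dual_norm_def using assms by (intro cSUP_upper dual_norm_bdd) auto

lemma dual_norm_least:
  fixes N :: "real ^ 'n::finite \<Rightarrow> real"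
  assumes N: "is_norm N" and "\<And>y. N y \<le> 1 \<Longrightarrow> x \<bullet> y \<le> c"
  shows "dual_norm N x \<le> c"
proof -
  have "N 0 \<le> 1" using is_normD(2)[OF N, of 0] by simp
  then show ?thesis unfolding dual_norm_def using assms(2) by (intro cSUP_least) auto
qed

lemma inner_le_dual_norm:
  fixes N :: "real ^ 'n::finite \<Rightarrow> real"
  assumes N: "is_norm N"
  shows "x \<bullet> y \<le> dual_norm N x * N y"
proof (cases "y = 0")
  case True then show ?thesis using is_normD(2)[OF N, of 0] by simp
next
  case False
  then have y: "N y > 0" using is_normD(1,2)[OF N, of y] by linarith
  have "N ((1 / N y) *\<^sub>R y) \<le> 1" using y by (simp add: is_normD(3)[OF N])
  from dual_norm_upper[OF N this, of x] show ?thesis using y by (simp add: field_simps)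
qed

lemma is_norm_dual_norm:
  fixes N :: "real ^ 'n::finite \<Rightarrow> real"
  assumes N: "is_norm N"
  shows "is_norm (dual_norm N)"
proof -
  have N0: "N 0 = 0" using is_normD(2)[OF N, of 0] by simp
  have nn: "0 \<le> dual_norm N x" for x using dual_norm_upper[OF N, of 0 x] N0 by simp
  have zero: "dual_norm N x = 0 \<longleftrightarrow> x = 0" for x
  proof
    assume "dual_norm N x = 0"
    then have "x \<bullet> x \<le> 0" using inner_le_dual_norm[OF N, of x x] by simp
    then show "x = 0" by (metis inner_eq_zero_iff inner_ge_zero order_antisym)
  next
    assume "x = 0"
    then have "dual_norm N x \<le> 0" by (intro dual_norm_least[OF N]) simp
    with nn[of x] show "dual_norm N x = 0" by simp
  qed
  have add: "dual_norm N (x + y) \<le> dual_norm N x + dual_norm N y" for x y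
    by (rule dual_norm_least[OF N]) (simp add: inner_add_left add_mono dual_norm_upper[OF N])
  have le: "dual_norm N (c *\<^sub>R x) \<le> \<bar>c\<bar> * dual_norm N x" for c x
  proof (rule dual_norm_least[OF N])
    fix y assume y: "N y \<le> 1"
    have "N (sgn c *\<^sub>R y) \<le> 1"
      using y is_normD(1)[OF N, of y] by (simp add: is_normD(3)[OF N] abs_sgn_eq)
    then have "\<bar>c\<bar> * (x \<bullet> (sgn c *\<^sub>R y)) \<le> \<bar>c\<bar> * dual_norm N x"
      by (intro mult_left_mono dual_norm_upper[OF N]) auto
    moreover have "\<bar>c\<bar> * (x \<bullet> (sgn c *\<^sub>R y)) = (c *\<^sub>R x) \<bullet> y"
    proof -
      have "\<bar>c\<bar> * (x \<bullet> (sgn c *\<^sub>R y)) = (\<bar>c\<bar> * sgn c) * (x \<bullet> y)" by simp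
      then show ?thesis unfolding abs_mult_sgn by simp
    qed
    ultimately show "(c *\<^sub>R x) \<bullet> y \<le> \<bar>c\<bar> * dual_norm N x" by linarith
  qed
  have scale: "dual_norm N (c *\<^sub>R x) = \<bar>c\<bar> * dual_norm N x" for c x
  proof (cases "c = 0")
    case True then show ?thesis using zero[of 0] by simp
  next
    case False
    have "dual_norm N x \<le> \<bar>1 / c\<bar> * dual_norm N (c *\<^sub>R x)"
      using le[of "1 / c" "c *\<^sub>R x"] False by simp
    then show ?thesis using le[of c x] False by (simp add: field_simps)
  qed
  show ?thesis unfolding is_norm_def using nn zero add scale by blast
qed

text \<open>Separation of \<open>z\<close> from the unit ball by a hyperplane: the norm is recovered from its dual norm.\<close>

lemma dual_norm_supporting:
  fixes N :: "real ^ 'n::finite \<Rightarrow> real"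
  assumes N: "is_norm N" and z: "1 < N z"
  obtains y where "dual_norm N y \<le> 1" "1 < y \<bullet> z"
proof -
  let ?B = "{x. N x \<le> 1}"
  have cv: "convex ?B"
  proof (rule convexI)
    fix x y u v assume h: "x \<in> ?B" "y \<in> ?B" "0 \<le> u" "0 \<le> v" "u + v = (1::real)"
    have "N (u *\<^sub>R x + v *\<^sub>R y) \<le> u * N x + v * N y"
      using is_normD(4)[OF N, of "u *\<^sub>R x" "v *\<^sub>R y"] h by (simp add: is_normD(3)[OF N])
    also have "\<dots> \<le> u * 1 + v * 1" using h by (intro add_mono mult_left_mono) auto
    finally show "u *\<^sub>R x + v *\<^sub>R y \<in> ?B" using h by simp
  qed
  have cl: "closed ?B" by (intro closed_Collect_le is_norm_continuous[OF N] continuous_intros)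
  have "z \<notin> ?B" using z by simp
  then obtain w b where w: "w \<bullet> z < b" "\<And>x. x \<in> ?B \<Longrightarrow> b < w \<bullet> x"
    using separating_hyperplane_closed_point[OF cv cl] by metis
  have b: "b < 0" using w(2)[of 0] is_normD(2)[OF N, of 0] by simp
  define y where "y = (1 / b) *\<^sub>R w"
  have "dual_norm N y \<le> 1"
  proof (rule dual_norm_least[OF N])
    fix x assume "N x \<le> 1"
    then have "b < w \<bullet> x" using w(2) by simp
    then show "y \<bullet> x \<le> 1" using b by (simp add: y_def field_simps)
  qed
  moreover have "1 < y \<bullet> z" using w(1) b by (simp add: y_def field_simps)
  ultimately show ?thesis by (rule that)
qed

text \<open>Finitely many functionals of dual norm at most 1 determine the norm up to the factor \<open>1 - e\<close>, because
  the unit sphere is compact.\<close>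

lemma finite_dual_net:
  fixes N :: "real ^ 'n::finite \<Rightarrow> real"
  assumes N: "is_norm N" and e: "0 < e" "e < 1"
  obtains Y where "finite Y" "Y \<noteq> {}" "\<And>y. y \<in> Y \<Longrightarrow> dual_norm N y \<le> 1" "\<And>x. \<exists>y\<in>Y. (1 - e) * N x \<le> y \<bullet> x"
proof -
  let ?Sph = "{x. N x = 1}"
  let ?D = "{y. dual_norm N y \<le> 1}"
  have cl: "closed ?Sph" by (intro closed_Collect_eq is_norm_continuous[OF N] continuous_intros)
  have "bounded ?Sph" by (rule bounded_subset[OF bounded_is_norm_ball[OF N, of 0 1]]) auto
  with cl have cp: "compact ?Sph" by (simp add: compact_eq_bounded_closed)
  have op: "open {x. 1 - e < y \<bullet> x}" for y :: "real ^ 'n" by (intro open_Collect_less continuous_intros)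
  have cov: "?Sph \<subseteq> (\<Union>y\<in>?D. {x. 1 - e < y \<bullet> x})"
  proof
    fix x assume x: "x \<in> ?Sph"
    have "1 < N ((1 / (1 - e)) *\<^sub>R x)" using x e by (simp add: is_normD(3)[OF N])
    then obtain y where y: "dual_norm N y \<le> 1" "1 < y \<bullet> ((1 / (1 - e)) *\<^sub>R x)" by (rule dual_norm_supporting[OF N])
    then show "x \<in> (\<Union>y\<in>?D. {x. 1 - e < y \<bullet> x})" using e by (auto simp: field_simps)
  qed
  obtain Y where Y: "Y \<subseteq> ?D" "finite Y" "?Sph \<subseteq> (\<Union>y\<in>Y. {x. 1 - e < y \<bullet> x})"
    by (rule compactE_image[OF cp op cov])
  have d0: "dual_norm N 0 \<le> 1" using is_normD(2)[OF is_norm_dual_norm[OF N], of 0] by simp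
  show ?thesis
  proof (rule that[of "insert 0 Y"])
    show "dual_norm N y \<le> 1" if "y \<in> insert 0 Y" for y using that Y d0 by auto
    show "\<exists>y\<in>insert 0 Y. (1 - e) * N x \<le> y \<bullet> x" for x
    proof (cases "x = 0")
      case True then show ?thesis using is_normD(2)[OF N, of 0] by auto
    next
      case False
      then have x: "N x > 0" using is_normD(1,2)[OF N, of x] by linarith
      then have "(1 / N x) *\<^sub>R x \<in> ?Sph" by (simp add: is_normD(3)[OF N])
      then obtain y where y: "y \<in> Y" "1 - e < y \<bullet> ((1 / N x) *\<^sub>R x)" using Y(3) by blast
      then have "(1 - e) * N x \<le> y \<bullet> x" using x by (simp add: field_simps)
      then show ?thesis using y(1) by blast
    qed
  qed (use Y in auto)
qed

section \<open>Calculus of \<open>C\<^sup>m\<close> functions\<close>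

lemma Cm_on_subset: "Cm_on m B f \<Longrightarrow> A \<subseteq> B \<Longrightarrow> Cm_on m A f"
proof (induction m arbitrary: f)
  case 0 then show ?case by (auto intro: continuous_on_subset)
next
  case (Suc m)
  then show ?case by (auto intro: has_derivative_subset) (meson has_derivative_subset subset_iff)
qed

lemma Cm_on_SucD: "Cm_on (Suc m) A f \<Longrightarrow> Cm_on m A f"
proof (induction m arbitrary: f)
  case 0
  then show ?case
    by (auto simp: continuous_on_eq_continuous_within intro: has_derivative_continuous)
next
  case (Suc m)
  obtain G where G: "\<forall>x\<in>A. (f has_derivative (\<lambda>h. G x \<bullet> h)) (at x within A)" "\<forall>i. Cm_on (Suc m) A (\<lambda>x. G x $ i)"
    using Suc.prems Cm_on.simps(2)[of "Suc m"] by blast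
  have "\<forall>i. Cm_on m A (\<lambda>x. G x $ i)" using G(2) Suc.IH by blast
  then show ?case unfolding Cm_on.simps(2)[of m] using G(1) by blast
qed

lemma Cm_on_const [intro, simp]: "Cm_on m A (\<lambda>x. c)"
proof (induction m arbitrary: c)
  case (Suc m)
  show ?case by (auto intro!: exI[of _ "\<lambda>_. 0"] Suc)
qed simp

lemma Cm_on_linear [intro]: "Cm_on m A (\<lambda>x. c \<bullet> x)"
proof (cases m)
  case (Suc l)
  show ?thesis unfolding Suc by (auto intro!: exI[of _ "\<lambda>_. c"] derivative_eq_intros)
qed (auto intro!: continuous_intros)

lemma Cm_on_add: "Cm_on m A f \<Longrightarrow> Cm_on m A g \<Longrightarrow> Cm_on m A (\<lambda>x. f x + g x)"
proof (induction m arbitrary: f g)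
  case (Suc m)
  obtain F where F: "\<forall>x\<in>A. (f has_derivative (\<lambda>h. F x \<bullet> h)) (at x within A)" "\<forall>i. Cm_on m A (\<lambda>x. F x $ i)"
    using Suc.prems by auto
  obtain G where G: "\<forall>x\<in>A. (g has_derivative (\<lambda>h. G x \<bullet> h)) (at x within A)" "\<forall>i. Cm_on m A (\<lambda>x. G x $ i)"
    using Suc.prems by auto
  show ?case using F G
    by (auto intro!: exI[of _ "\<lambda>x. F x + G x"] Suc.IH derivative_eq_intros simp: inner_add_left)
qed (auto intro: continuous_intros)

lemma Cm_on_sum: "(\<And>i. i \<in> I \<Longrightarrow> Cm_on m A (f i)) \<Longrightarrow> Cm_on m A (\<lambda>x. \<Sum>i\<in>I. f i x)"
  by (induction I rule: infinite_finite_induct) (auto intro: Cm_on_add)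

lemma Cm_on_mult: "Cm_on m A f \<Longrightarrow> Cm_on m A g \<Longrightarrow> Cm_on m A (\<lambda>x. f x * g x)"
proof (induction m arbitrary: f g)
  case (Suc m)
  obtain F where F: "\<forall>x\<in>A. (f has_derivative (\<lambda>h. F x \<bullet> h)) (at x within A)" "\<forall>i. Cm_on m A (\<lambda>x. F x $ i)"
    using Suc.prems by auto
  obtain G where G: "\<forall>x\<in>A. (g has_derivative (\<lambda>h. G x \<bullet> h)) (at x within A)" "\<forall>i. Cm_on m A (\<lambda>x. G x $ i)"
    using Suc.prems by auto
  have fg: "Cm_on m A f" "Cm_on m A g" using Suc.prems Cm_on_SucD by blast+
  have "\<forall>x\<in>A. ((\<lambda>x. f x * g x) has_derivative (\<lambda>h. (f x *\<^sub>R G x + g x *\<^sub>R F x) \<bullet> h)) (at x within A)"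
    using F(1) G(1) by (auto intro!: derivative_eq_intros simp: inner_add_left algebra_simps)
  moreover have "\<forall>i. Cm_on m A (\<lambda>x. (f x *\<^sub>R G x + g x *\<^sub>R F x) $ i)"
    using F(2) G(2) fg by (auto intro!: Cm_on_add Suc.IH)
  ultimately show ?case by auto
qed (auto intro: continuous_intros)

lemma Cm_on_shift: "Cm_on m UNIV f \<Longrightarrow> Cm_on m UNIV (\<lambda>x. f (x - x0))"
proof (induction m arbitrary: f)
  case 0
  then show ?case by (auto intro!: continuous_on_compose2[of UNIV f] continuous_intros)
next
  case (Suc m)
  obtain F where F: "\<forall>x. (f has_derivative (\<lambda>h. F x \<bullet> h)) (at x)" "\<forall>i. Cm_on m UNIV (\<lambda>x. F x $ i)"
    using Suc.prems by auto
  have "((\<lambda>x. f (x - x0)) has_derivative (\<lambda>h. F (x - x0) \<bullet> h)) (at x)" for x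
  proof -
    have "((\<lambda>x. x - x0) has_derivative (\<lambda>h. h)) (at x)" by (auto intro!: derivative_eq_intros)
    from has_derivative_compose[OF this F(1)[rule_format]] show ?thesis .
  qed
  then show ?case using F(2) Suc.IH by (auto intro!: exI[of _ "\<lambda>x. F (x - x0)"])
qed

text \<open>Smoothness of functions of one real variable, for compositions with functions on \<open>\<real>\<^sup>n\<close>.\<close>

primrec Cm_real :: "nat \<Rightarrow> real set \<Rightarrow> (real \<Rightarrow> real) \<Rightarrow> bool" where
  "Cm_real 0 I \<phi> \<longleftrightarrow> continuous_on I \<phi>"
| "Cm_real (Suc m) I \<phi> \<longleftrightarrow> (\<exists>\<phi>'. (\<forall>s\<in>I. (\<phi> has_real_derivative \<phi>' s) (at s)) \<and> Cm_real m I \<phi>')"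

text \<open>A family closed under differentiation consists of smooth functions; this avoids explicit formulas
  for higher derivatives.\<close>

lemma Cm_real_family:
  assumes "\<phi> \<in> X" "\<And>\<psi>. \<psi> \<in> X \<Longrightarrow> \<exists>\<psi>'\<in>X. \<forall>s\<in>I. (\<psi> has_real_derivative \<psi>' s) (at s)"
  shows "Cm_real m I \<phi>"
  using assms(1)
proof (induction m arbitrary: \<phi>)
  case 0
  then obtain \<psi>' where "\<forall>s\<in>I. (\<phi> has_real_derivative \<psi>' s) (at s)" using assms(2) by blast
  then have "\<phi> differentiable_on I" by (meson differentiable_at_imp_differentiable_on real_differentiable_def)
  then show ?case by (simp add: differentiable_imp_continuous_on)
next
  case (Suc m)
  obtain \<psi>' where "\<psi>' \<in> X" "\<forall>s\<in>I. (\<phi> has_real_derivative \<psi>' s) (at s)" using Suc.prems assms(2) by blast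
  then show ?case using Suc.IH by auto
qed

lemma Cm_real_SucD: "Cm_real (Suc m) I \<phi> \<Longrightarrow> Cm_real m I \<phi>"
proof (induction m arbitrary: \<phi>)
  case 0
  then obtain \<psi> where "\<forall>s\<in>I. (\<phi> has_real_derivative \<psi> s) (at s)" by auto
  then have "\<phi> differentiable_on I" by (meson differentiable_at_imp_differentiable_on real_differentiable_def)
  then show ?case by (simp add: differentiable_imp_continuous_on)
next
  case (Suc m)
  obtain \<psi> where \<psi>: "\<forall>s\<in>I. (\<phi> has_real_derivative \<psi> s) (at s)" "Cm_real (Suc m) I \<psi>"
    using Suc.prems Cm_real.simps(2)[of "Suc m"] by blast
  have "Cm_real m I \<psi>" by (rule Suc.IH[OF \<psi>(2)])
  then show ?case unfolding Cm_real.simps(2)[of m] using \<psi>(1) by blast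
qed

lemma Cm_real_mult: "Cm_real m I \<phi> \<Longrightarrow> Cm_real m I \<psi> \<Longrightarrow> Cm_real m I (\<lambda>s. \<phi> s * \<psi> s)"
  and Cm_real_add: "Cm_real m I \<phi> \<Longrightarrow> Cm_real m I \<psi> \<Longrightarrow> Cm_real m I (\<lambda>s. \<phi> s + \<psi> s)"
proof -
  show add: "Cm_real m I \<phi> \<Longrightarrow> Cm_real m I \<psi> \<Longrightarrow> Cm_real m I (\<lambda>s. \<phi> s + \<psi> s)" for m \<phi> \<psi>
  proof (induction m arbitrary: \<phi> \<psi>)
    case (Suc m)
    obtain f g where "\<forall>s\<in>I. (\<phi> has_real_derivative f s) (at s)" "\<forall>s\<in>I. (\<psi> has_real_derivative g s) (at s)"
      "Cm_real m I f" "Cm_real m I g" using Suc.prems by auto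
    then show ?case by (auto intro!: exI[of _ "\<lambda>s. f s + g s"] Suc.IH derivative_eq_intros)
  qed (auto intro: continuous_intros)
  show "Cm_real m I \<phi> \<Longrightarrow> Cm_real m I \<psi> \<Longrightarrow> Cm_real m I (\<lambda>s. \<phi> s * \<psi> s)"
  proof (induction m arbitrary: \<phi> \<psi>)
    case (Suc m)
    obtain f g where fg: "\<forall>s\<in>I. (\<phi> has_real_derivative f s) (at s)" "\<forall>s\<in>I. (\<psi> has_real_derivative g s) (at s)"
      "Cm_real m I f" "Cm_real m I g" using Suc.prems by auto
    have "\<forall>s\<in>I. ((\<lambda>s. \<phi> s * \<psi> s) has_real_derivative (f s * \<psi> s + \<phi> s * g s)) (at s)"
      using fg by (auto intro!: derivative_eq_intros)
    moreover have "Cm_real m I (\<lambda>s. f s * \<psi> s + \<phi> s * g s)"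
      using fg Suc.prems Cm_real_SucD by (auto intro!: add Suc.IH simp del: Cm_real.simps)
    ultimately show ?case by auto
  qed (auto intro: continuous_intros)
qed

lemma Cm_real_const: "Cm_real m I (\<lambda>s. c)"
  by (rule Cm_real_family[where X="range (\<lambda>c s. c)"]) (auto intro!: derivative_eq_intros)

lemma Cm_real_affine: "Cm_real m UNIV \<phi> \<Longrightarrow> Cm_real m UNIV (\<lambda>s. \<phi> (c * s + d))"
proof (induction m arbitrary: \<phi>)
  case 0
  then show ?case by (auto intro!: continuous_on_compose2[of UNIV \<phi>] continuous_intros)
next
  case (Suc m)
  obtain f where f: "\<forall>s. (\<phi> has_real_derivative f s) (at s)" "Cm_real m UNIV f" using Suc.prems by auto
  have "((\<lambda>s. \<phi> (c * s + d)) has_real_derivative f (c * s + d) * c) (at s)" for s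
    by (rule DERIV_chain2[OF f(1)[rule_format]]) (auto intro!: derivative_eq_intros)
  then show ?case using Cm_real_mult[OF Suc.IH[OF f(2)] Cm_real_const[of m UNIV c]]
    by (auto intro!: exI[of _ "\<lambda>s. f (c * s + d) * c"])
qed

lemma Cm_on_compose:
  "Cm_real m I \<phi> \<Longrightarrow> Cm_on m A f \<Longrightarrow> f ` A \<subseteq> I \<Longrightarrow> Cm_on m A (\<lambda>x. \<phi> (f x))"
proof (induction m arbitrary: \<phi> f)
  case 0
  then show ?case by (auto intro: continuous_on_compose2)
next
  case (Suc m)
  obtain \<psi> where \<psi>: "\<forall>s\<in>I. (\<phi> has_real_derivative \<psi> s) (at s)" "Cm_real m I \<psi>" using Suc.prems by auto
  obtain F where F: "\<forall>x\<in>A. (f has_derivative (\<lambda>h. F x \<bullet> h)) (at x within A)" "\<forall>i. Cm_on m A (\<lambda>x. F x $ i)"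
    using Suc.prems by auto
  have "((\<lambda>x. \<phi> (f x)) has_derivative (\<lambda>h. (\<psi> (f x) *\<^sub>R F x) \<bullet> h)) (at x within A)" if "x \<in> A" for x
  proof -
    have "(\<phi> has_derivative (\<lambda>h. \<psi> (f x) * h)) (at (f x))"
      using \<psi>(1) that Suc.prems(3) by (auto simp: has_field_derivative_def)
    then show ?thesis using has_derivative_compose[of f "\<lambda>h. F x \<bullet> h" x A \<phi> "\<lambda>h. \<psi> (f x) * h"] F(1) that by simp
  qed
  moreover have "\<forall>i. Cm_on m A (\<lambda>x. (\<psi> (f x) *\<^sub>R F x) $ i)"
    using Suc.IH[OF \<psi>(2) Cm_on_SucD[OF Suc.prems(2)] Suc.prems(3)] F(2) by (auto intro: Cm_on_mult)
  ultimately show ?case unfolding Cm_on.simps by (intro exI[of _ "\<lambda>x. \<psi> (f x) *\<^sub>R F x"]) blast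
qed

lemma Cm_real_exp: "Cm_real m UNIV exp"
  by (rule Cm_real_family[where X="{exp}"]) (auto intro!: derivative_eq_intros)

lemma Cm_real_ln: "Cm_real m {0<..} ln"
proof (cases m)
  case 0 then show ?thesis by (auto intro!: continuous_intros)
next
  case (Suc l)
  have "Cm_real l {0<..} (\<lambda>s. 1 * inverse s ^ 1)"
  proof (rule Cm_real_family[where X="{\<lambda>s. c * inverse s ^ j | c j. True}"])
    fix \<psi> :: "real \<Rightarrow> real" assume "\<psi> \<in> {\<lambda>s. c * inverse s ^ j | c j. True}"
    then obtain c j where \<psi>: "\<psi> = (\<lambda>s::real. c * inverse s ^ j)" by blast
    have "(\<psi> has_real_derivative (- (c * real j)) * inverse s ^ (j + 1)) (at s)" if "s \<in> {0<..}" for s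
    proof -
      have "(\<psi> has_real_derivative c * (real j * (- (inverse s * 1 * inverse s)) * inverse s ^ (j - Suc 0))) (at s)"
        unfolding \<psi> using that by (auto intro!: derivative_eq_intros)
      moreover have "c * (real j * (- (inverse s * 1 * inverse s)) * inverse s ^ (j - Suc 0)) = (- (c * real j)) * inverse s ^ (j + 1)"
        by (cases j) (simp_all add: mult_ac)
      ultimately show ?thesis by (simp only:)
    qed
    then show "\<exists>\<psi>'\<in>{\<lambda>s. c * inverse s ^ j | c j. True}. \<forall>s\<in>{0<..}. (\<psi> has_real_derivative \<psi>' s) (at s)"
      by (intro bexI[of _ "\<lambda>s. (- (c * real j)) * inverse s ^ (j + 1)"]) blast+
  qed blast
  then show ?thesis unfolding Suc
    by (auto intro!: exI[of _ "\<lambda>s. 1 * inverse s ^ 1"] derivative_eq_intros simp: inverse_eq_divide)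
qed

text \<open>Cauchy's function, smooth on the line and flat at \<open>0\<close>.\<close>

definition flat_exp :: "real \<Rightarrow> real" where
  "flat_exp s = (if 0 < s then exp (- (1 / s)) else 0)"

lemma tendsto_poly_exp: "((\<lambda>y::real. poly P y * exp (- y)) \<longlongrightarrow> 0) at_top"
proof -
  have "((\<lambda>y::real. y ^ i * exp (- y)) \<longlongrightarrow> 0) at_top" for i
    using tendsto_power_div_exp_0[of i] by (simp add: exp_minus divide_inverse)
  then have "((\<lambda>y::real. (\<Sum>i\<le>degree P. coeff P i * (y ^ i * exp (- y)))) \<longlongrightarrow> (\<Sum>i\<le>degree P. coeff P i * 0)) at_top"
    by (intro tendsto_intros)
  then show ?thesis by (simp add: poly_altdef sum_distrib_right mult.assoc)
qed

text \<open>The family of all \<open>P(1/s) exp(-1/s)\<close>, extended by zero to \<open>s \<le> 0\<close>, with polynomials \<open>P\<close> is closed under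
  differentiation.\<close>

lemma Cm_real_flat_exp: "Cm_real m UNIV flat_exp"
proof (rule Cm_real_family[where X="range (\<lambda>P s. if 0 < s then poly P (1 / s) * exp (- (1 / s)) else 0)"])
  show "flat_exp \<in> range (\<lambda>P s. if 0 < s then poly P (1 / s) * exp (- (1 / s)) else 0)"
    by (rule range_eqI[of _ _ 1]) (auto simp: flat_exp_def fun_eq_iff)
  fix \<psi> assume "\<psi> \<in> range (\<lambda>P s::real. if 0 < s then poly P (1 / s) * exp (- (1 / s)) else 0)"
  then obtain P where \<psi>: "\<psi> = (\<lambda>s. if 0 < s then poly P (1 / s) * exp (- (1 / s)) else 0)" by blast
  define Q where "Q = monom 1 2 * (P - pderiv P)"
  have "(\<psi> has_real_derivative (if 0 < s then poly Q (1 / s) * exp (- (1 / s)) else 0)) (at s)" for s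
  proof -
    consider "0 < s" | "s < 0" | "s = 0" by linarith
    then show ?thesis
    proof cases
      case 1
      have "((\<lambda>s. poly P (1 / s) * exp (- (1 / s))) has_real_derivative
           (poly (pderiv P) (1 / s) * (- (1 / s\<^sup>2))) * exp (- (1 / s)) + poly P (1 / s) * (exp (- (1 / s)) * (1 / s\<^sup>2))) (at s)"
        using 1 by (auto intro!: derivative_eq_intros DERIV_chain2[OF poly_DERIV] simp: power2_eq_square)
      also have "(poly (pderiv P) (1 / s) * (- (1 / s\<^sup>2))) * exp (- (1 / s)) + poly P (1 / s) * (exp (- (1 / s)) * (1 / s\<^sup>2))
         = poly Q (1 / s) * exp (- (1 / s))"
        by (simp add: Q_def poly_monom power_divide algebra_simps)
      finally have "((\<lambda>s. poly P (1 / s) * exp (- (1 / s))) has_real_derivative poly Q (1 / s) * exp (- (1 / s))) (at s)" .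
      then have "(\<psi> has_real_derivative poly Q (1 / s) * exp (- (1 / s))) (at s)"
        by (rule has_field_derivative_transform_within_open[of _ _ _ "{0<..}"]) (use 1 in \<open>auto simp: \<psi>\<close>)
      then show ?thesis using 1 by simp
    next
      case 2
      have "((\<lambda>s. 0) has_real_derivative 0) (at s)" by simp
      then have "(\<psi> has_real_derivative 0) (at s)"
        by (rule has_field_derivative_transform_within_open[of _ _ _ "{..<0}"]) (use 2 in \<open>auto simp: \<psi>\<close>)
      then show ?thesis using 2 by simp
    next
      case 3
      have "((\<lambda>h. \<psi> h / h) \<longlongrightarrow> 0) (at 0)"
      proof (rule filterlim_split_at)
        show "((\<lambda>h. \<psi> h / h) \<longlongrightarrow> 0) (at_left 0)"
          by (rule tendsto_eventually) (auto simp: \<psi> eventually_at_filter)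
        have "((\<lambda>h. poly (pCons 0 P) (inverse h) * exp (- inverse h)) \<longlongrightarrow> 0) (at_right (0::real))"
          by (rule filterlim_compose[OF tendsto_poly_exp filterlim_inverse_at_top_right])
        then show "((\<lambda>h. \<psi> h / h) \<longlongrightarrow> 0) (at_right 0)"
          by (rule Lim_transform_eventually) (auto simp: \<psi> eventually_at_filter inverse_eq_divide)
      qed
      then show ?thesis using 3 by (simp add: has_field_derivative_iff \<psi>)
    qed
  qed
  then show "\<exists>\<psi>'\<in>range (\<lambda>P s. if 0 < s then poly P (1 / s) * exp (- (1 / s)) else 0).
     \<forall>s\<in>UNIV. (\<psi> has_real_derivative \<psi>' s) (at s)"
    by (intro bexI[of _ "\<lambda>s. if 0 < s then poly Q (1 / s) * exp (- (1 / s)) else 0"] ballI) auto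
qed

lemma flat_exp_bounds: "0 \<le> flat_exp s" "flat_exp s \<le> 1" "flat_exp s = 0 \<longleftrightarrow> s \<le> 0" "0 < flat_exp s \<longleftrightarrow> 0 < s"
  by (auto simp: flat_exp_def)

section \<open>Smooth approximation of half-balls\<close>

text \<open>A descending step over an interval of length \<open>w\<close> whose slope exceeds the unavoidable \<open>1 / w\<close> by a
  factor \<open>1 + e\<close> at most. It is the normalised integral of a plateau function \<open>\<kappa>\<close> that is close to 1 on
  most of the interval.\<close>

lemma smooth_step:
  fixes r w e :: real
  assumes w: "0 < w" and e: "0 < e"
  obtains \<phi> \<phi>' where "\<And>m. Cm_real m UNIV \<phi>" "\<And>s. (\<phi> has_real_derivative \<phi>' s) (at s)"
    "\<And>s. s \<le> r \<Longrightarrow> \<phi> s = 1" "\<And>s. r + w \<le> s \<Longrightarrow> \<phi> s = 0" "\<And>s. 0 \<le> \<phi> s" "\<And>s. \<phi> s \<le> 1"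
    "\<And>s. \<bar>\<phi>' s\<bar> \<le> (1 + e) / w * indicator {r..r + w} s" "\<And>m. Cm_real m UNIV \<phi>'"
proof -
  \<comment> \<open>The margins of relative length \<open>\<delta>\<close> on both sides and the deficit \<open>\<delta>\<close> of the plateau cost at most
      \<open>3 \<delta>\<close>, and \<open>1 - 3 \<delta> = 1 / (1 + e)\<close>; the steepness \<open>J\<close> gives \<open>exp (- \<delta> / 2)\<close> for each factor of \<open>\<kappa>\<close>.\<close>
  define \<delta> where "\<delta> = e / (3 * (1 + e))"
  have \<delta>: "0 < \<delta>" "3 * \<delta> < 1" "1 - 3 * \<delta> = 1 / (1 + e)" using e by (auto simp: \<delta>_def field_simps)
  define \<eta> where "\<eta> = w * \<delta>"
  have \<eta>: "0 < \<eta>" using w \<delta> by (simp add: \<eta>_def)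
  define J where "J = 2 / (\<eta> * \<delta>)"
  have J: "0 < J" using \<eta> \<delta> by (simp add: J_def)
  define \<kappa> where "\<kappa> s = flat_exp (J * s + - (J * r)) * flat_exp (- J * s + J * (r + w))" for s
  have \<kappa>C: "Cm_real m UNIV \<kappa>" for m
    unfolding \<kappa>_def by (intro Cm_real_mult Cm_real_affine Cm_real_flat_exp)
  have \<kappa>01: "0 \<le> \<kappa> s" "\<kappa> s \<le> 1" for s
    using flat_exp_bounds(1,2) by (auto simp: \<kappa>_def intro!: mult_le_one)
  have \<kappa>0: "\<kappa> s = 0" if "s \<le> r \<or> r + w \<le> s" for s
  proof -
    have "J * s + - (J * r) \<le> 0 \<or> - J * s + J * (r + w) \<le> 0"
    proof -
      have "J * (s - r) \<le> 0 \<or> J * (r + w - s) \<le> 0" using that J by (auto simp: mult_le_0_iff)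
      then show ?thesis by (simp add: algebra_simps)
    qed
    then show ?thesis using flat_exp_bounds(3) by (auto simp: \<kappa>_def)
  qed
  have \<kappa>_lower: "1 - \<delta> \<le> \<kappa> s" if s: "r + \<eta> \<le> s" "s \<le> r + w - \<eta>" for s
  proof -
    have fl: "exp (- (\<delta> / 2)) \<le> flat_exp u" if "J * \<eta> \<le> u" for u
    proof -
      have "J * \<eta> > 0" using J \<eta> by simp
      then have "1 / u \<le> 1 / (J * \<eta>)" and u: "0 < u" using that by (auto intro: frac_le)
      moreover have "1 / (J * \<eta>) = \<delta> / 2" using \<eta> \<delta> by (simp add: J_def)
      ultimately show ?thesis by (simp add: flat_exp_def)
    qed
    have "J * \<eta> \<le> J * s + - (J * r)" using mult_left_mono[of "r + \<eta>" s J] s J by (simp add: algebra_simps)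
    moreover have "J * \<eta> \<le> - J * s + J * (r + w)"
      using mult_left_mono[of s "r + w - \<eta>" J] s J by (simp add: algebra_simps)
    ultimately have "exp (- (\<delta> / 2)) * exp (- (\<delta> / 2)) \<le> \<kappa> s"
      unfolding \<kappa>_def by (intro mult_mono fl) (auto simp: flat_exp_bounds)
    then have "exp (- \<delta>) \<le> \<kappa> s" by (simp add: exp_add[symmetric])
    then show ?thesis using exp_ge_add_one_self[of "- \<delta>"] by linarith
  qed
  have cont: "continuous_on A \<kappa>" for A
    using \<kappa>C[of 0] by (auto intro: continuous_on_subset)
  have int: "\<kappa> integrable_on {u..v}" for u v by (rule integrable_continuous_interval[OF cont])
  define P where "P s = integral {r - 1..s} \<kappa>" for s
  define c where "c = P (r + w)"
  have P_split: "P s = P u + integral {u..s} \<kappa>" if "r - 1 \<le> u" "u \<le> s" for s u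
    unfolding P_def using that by (intro Henstock_Kurzweil_Integration.integral_combine[symmetric] int) auto
  have zero_int: "integral {u..s} \<kappa> = 0" if "\<And>x. x \<in> {u..s} \<Longrightarrow> \<kappa> x = 0" for u s
  proof -
    have "integral {u..s} \<kappa> = integral {u..s} (\<lambda>_. 0 :: real)"
      by (rule integral_cong) (use that in blast)
    then show ?thesis by simp
  qed
  have Pl: "P s = 0" if "s \<le> r" for s
    unfolding P_def by (rule zero_int) (use that \<kappa>0 in auto)
  have Pr: "P s = c" if "r + w \<le> s" for s
    using P_split[of "r + w" s] zero_int[of "r + w" s] that w \<kappa>0 by (simp add: c_def)
  have Pmono: "P u \<le> P s" if "u \<le> s" for u s
  proof (cases "r - 1 \<le> u")
    case True
    then show ?thesis using P_split[OF True that] integral_nonneg[OF int, of u s] \<kappa>01 by simp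
  next
    case False
    then show ?thesis using Pl[of u] integral_nonneg[OF int, of "r - 1" s] \<kappa>01 by (simp add: P_def)
  qed
  have c_lower: "w / (1 + e) \<le> c"
  proof -
    have w2: "2 * \<eta> < w" using w \<delta> by (simp add: \<eta>_def)
    have "w / (1 + e) = w * (1 - 3 * \<delta>)" using \<delta> by simp
    also have "\<dots> \<le> w * ((1 - 2 * \<delta>) * (1 - \<delta>))" using w \<delta> by (intro mult_left_mono) (auto simp: algebra_simps)
    also have "\<dots> = integral {r + \<eta>..r + w - \<eta>} (\<lambda>_. 1 - \<delta>)" using w2 by (simp add: \<eta>_def algebra_simps)
    also have "\<dots> \<le> integral {r + \<eta>..r + w - \<eta>} \<kappa>"
      by (intro integral_le int integrable_const_ivl) (use \<kappa>_lower in auto)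
    also have "\<dots> = P (r + w - \<eta>) - P (r + \<eta>)" using P_split[of "r + \<eta>" "r + w - \<eta>"] w2 \<eta> by simp
    also have "\<dots> \<le> c" using Pmono[of "r + w - \<eta>" "r + w"] Pmono[of r "r + \<eta>"] Pl[of r] \<eta> by (simp add: c_def)
    finally show ?thesis .
  qed
  have c: "0 < c" by (rule less_le_trans[OF _ c_lower]) (use w e in simp)
  have Pd: "(P has_real_derivative \<kappa> s) (at s)" for s
  proof -
    consider "s < r" | "r + w < s" | "r - 1 < s" "s < r + w + 1" using w by linarith
    then show ?thesis
    proof cases
      case 1
      have "((\<lambda>_. 0) has_real_derivative 0) (at s)" by simp
      then have "(P has_real_derivative 0) (at s)"
        by (rule has_field_derivative_transform_within_open[of _ _ _ "{..<r}"]) (use 1 Pl in auto)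
      then show ?thesis using 1 \<kappa>0 by simp
    next
      case 2
      have "((\<lambda>_. c) has_real_derivative 0) (at s)" by simp
      then have "(P has_real_derivative 0) (at s)"
        by (rule has_field_derivative_transform_within_open[of _ _ _ "{r + w<..}"]) (use 2 Pr in auto)
      then show ?thesis using 2 \<kappa>0 by simp
    next
      case 3
      have "(P has_real_derivative \<kappa> s) (at s within {r - 1..r + w + 1})"
        unfolding P_def by (rule integral_has_real_derivative[OF cont]) (use 3 in auto)
      moreover have "at s within {r - 1..r + w + 1} = at s" using 3 by (intro at_within_interior) simp
      ultimately show ?thesis by simp
    qed
  qed
  define \<phi> where "\<phi> s = 1 + (- (1 / c)) * P s" for s
  define \<phi>' where "\<phi>' s = (- (1 / c)) * \<kappa> s" for s
  have d: "(\<phi> has_real_derivative \<phi>' s) (at s)" for s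
    unfolding \<phi>_def \<phi>'_def using c by (auto intro!: derivative_eq_intros Pd)
  have C': "Cm_real m UNIV \<phi>'" for m unfolding \<phi>'_def by (intro Cm_real_mult Cm_real_const \<kappa>C)
  have C: "Cm_real m UNIV \<phi>" for m
    by (rule Cm_real_SucD) (use d C' in auto)
  have P0: "0 \<le> P s" for s using Pmono[of "min s r" s] Pl[of "min s r"] by simp
  have Pc: "P s \<le> c" for s using Pmono[of s "max s (r + w)"] Pr[of "max s (r + w)"] by simp
  show ?thesis
  proof (rule that[OF C d _ _ _ _ _ C'])
    show "\<phi> s = 1" if "s \<le> r" for s using Pl[OF that] by (simp add: \<phi>_def)
    show "\<phi> s = 0" if "r + w \<le> s" for s using Pr[OF that] c by (simp add: \<phi>_def)
    show "0 \<le> \<phi> s" "\<phi> s \<le> 1" for s using P0[of s] Pc[of s] c by (auto simp: \<phi>_def)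
    show "\<bar>\<phi>' s\<bar> \<le> (1 + e) / w * indicator {r..r + w} s" for s
    proof (cases "s \<in> {r..r + w}")
      case True
      have "\<bar>\<phi>' s\<bar> = \<kappa> s / c" using \<kappa>01[of s] c by (simp add: \<phi>'_def abs_mult)
      also have "\<dots> \<le> 1 / c" using \<kappa>01[of s] c by (simp add: divide_right_mono)
      also have "\<dots> \<le> 1 / (w / (1 + e))" using c_lower w e c by (intro frac_le) auto
      finally show ?thesis using True by simp
    next
      case False
      then have "\<kappa> s = 0" using \<kappa>0[of s] by auto
      then show ?thesis using w e by (simp add: \<phi>'_def)
    qed
  qed
qed

lemma gradient_eqI:
  assumes "(f has_derivative (\<lambda>h. G \<bullet> h)) (at x)"
  shows "gradient f x = G"
  using frechet_derivative_at[OF assms, symmetric]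
  by (simp add: gradient_def vec_eq_iff inner_axis)

text \<open>A log-sum-exp regularisation of the norm: the function \<open>ln (\<Sum>y exp (t (y \<bullet> x))) / t\<close> over a finite net of
  functionals \<open>y\<close> exceeds their maximum by at most \<open>ln |Y| / t\<close>. Its gradient is a convex combination of
  the \<open>y\<close>, so its dual norm stays at most 1.\<close>

lemma smooth_norm_approx:
  fixes N :: "real ^ 'n::finite \<Rightarrow> real"
  assumes N: "is_norm N" and e: "0 < e" "e < 1"
  obtains M G where "\<And>m. Cm_on m UNIV M" "\<And>x. (M has_derivative (\<lambda>h. G x \<bullet> h)) (at x)"
    "\<And>x. dual_norm N (G x) \<le> 1" "\<And>x. (1 - e) * N x \<le> M x" "\<And>x. M x \<le> N x + e"
proof -
  obtain Y where Y: "finite Y" "Y \<noteq> {}" "\<And>y. y \<in> Y \<Longrightarrow> dual_norm N y \<le> 1"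
    "\<And>x. \<exists>y\<in>Y. (1 - e) * N x \<le> y \<bullet> x"
    using finite_dual_net[OF N e] by metis
  define t where "t = ln (real (card Y)) / e + 1"
  have cY: "1 \<le> real (card Y)" using Y by (simp add: Suc_leI card_gt_0_iff)
  have t: "0 < t" "ln (real (card Y)) / t \<le> e"
  proof -
    have "0 \<le> ln (real (card Y)) / e" using cY e by simp
    then show "0 < t" by (simp add: t_def)
    then show "ln (real (card Y)) / t \<le> e" using e by (simp add: t_def divide_le_eq algebra_simps)
  qed
  define Z where "Z x = (\<Sum>y\<in>Y. exp ((t *\<^sub>R y) \<bullet> x))" for x
  have Z: "0 < Z x" for x unfolding Z_def by (intro sum_pos) (use Y in auto)
  define M where "M x = (1 / t) * ln (Z x)" for x
  define G where "G x = (\<Sum>y\<in>Y. (exp ((t *\<^sub>R y) \<bullet> x) / Z x) *\<^sub>R y)" for x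
  have ZC: "Cm_on m UNIV Z" for m
    unfolding Z_def by (intro Cm_on_sum Cm_on_compose[OF Cm_real_exp] Cm_on_linear) auto
  have MC: "Cm_on m UNIV M" for m
    unfolding M_def by (intro Cm_on_mult Cm_on_const Cm_on_compose[OF Cm_real_ln ZC]) (use Z in auto)
  have Zd: "(Z has_derivative (\<lambda>h. \<Sum>y\<in>Y. exp ((t *\<^sub>R y) \<bullet> x) * ((t *\<^sub>R y) \<bullet> h))) (at x)" for x
    unfolding Z_def by (auto intro!: derivative_eq_intros simp: mult.commute)
  have Md: "(M has_derivative (\<lambda>h. G x \<bullet> h)) (at x)" for x
  proof -
    have "(M has_derivative (\<lambda>h. (1 / t) * ((\<Sum>y\<in>Y. exp ((t *\<^sub>R y) \<bullet> x) * ((t *\<^sub>R y) \<bullet> h)) * inverse (Z x)))) (at x)"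
      unfolding M_def using Z[of x] t(1)
      by (auto intro!: derivative_eq_intros Zd)
    moreover have "(1 / t) * ((\<Sum>y\<in>Y. exp ((t *\<^sub>R y) \<bullet> x) * ((t *\<^sub>R y) \<bullet> h)) * inverse (Z x)) = G x \<bullet> h" for h
    proof -
      have "(1 / t) * ((\<Sum>y\<in>Y. exp ((t *\<^sub>R y) \<bullet> x) * ((t *\<^sub>R y) \<bullet> h)) * inverse (Z x))
          = (\<Sum>y\<in>Y. (1 / t) * ((exp ((t *\<^sub>R y) \<bullet> x) * ((t *\<^sub>R y) \<bullet> h)) * inverse (Z x)))"
        by (simp only: sum_distrib_left sum_distrib_right)
      also have "\<dots> = (\<Sum>y\<in>Y. (exp ((t *\<^sub>R y) \<bullet> x) / Z x) * (y \<bullet> h))"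
        using t(1) by (intro sum.cong refl) (simp add: divide_inverse mult_ac)
      finally show ?thesis by (simp add: G_def inner_sum_left)
    qed
    ultimately show ?thesis by simp
  qed
  have Gd: "dual_norm N (G x) \<le> 1" for x
  proof (rule dual_norm_least[OF N])
    fix v assume v: "N v \<le> 1"
    have "G x \<bullet> v = (\<Sum>y\<in>Y. (exp ((t *\<^sub>R y) \<bullet> x) / Z x) * (y \<bullet> v))" by (simp add: G_def inner_sum_left)
    also have "\<dots> \<le> (\<Sum>y\<in>Y. (exp ((t *\<^sub>R y) \<bullet> x) / Z x) * 1)"
    proof (intro sum_mono mult_left_mono)
      fix y assume "y \<in> Y"
      then show "y \<bullet> v \<le> 1" using dual_norm_upper[OF N v, of y] Y(3) by force
    qed (use Z[of x] in auto)
    also have "\<dots> = (\<Sum>y\<in>Y. exp ((t *\<^sub>R y) \<bullet> x)) / Z x" by (simp only: sum_divide_distrib mult_1_right)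
    also have "\<dots> = 1" using Z[of x] by (simp only: Z_def[symmetric]) simp
    finally show "G x \<bullet> v \<le> 1" .
  qed
  have lower: "(1 - e) * N x \<le> M x" for x
  proof -
    obtain y where y: "y \<in> Y" "(1 - e) * N x \<le> y \<bullet> x" using Y(4) by blast
    have "exp ((t *\<^sub>R y) \<bullet> x) \<le> Z x" unfolding Z_def by (rule member_le_sum[OF y(1)]) (use Y in auto)
    then have "t * (y \<bullet> x) \<le> ln (Z x)" using Z[of x] by (simp add: ln_ge_iff)
    then have "y \<bullet> x \<le> M x" using t(1) by (simp add: M_def field_simps)
    then show ?thesis using y(2) by linarith
  qed
  have upper: "M x \<le> N x + e" for x
  proof -
    have "Z x \<le> (\<Sum>y\<in>Y. exp (t * N x))"
      unfolding Z_def
    proof (intro sum_mono)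
      fix y assume "y \<in> Y"
      then have "y \<bullet> x \<le> 1 * N x"
        using order_trans[OF inner_le_dual_norm[OF N, of y x] mult_right_mono[OF Y(3) is_normD(1)[OF N]]] by blast
      then show "exp ((t *\<^sub>R y) \<bullet> x) \<le> exp (t * N x)" using t by simp
    qed
    then have "ln (Z x) \<le> ln (real (card Y) * exp (t * N x))" using Z[of x] cY by simp
    also have "\<dots> = ln (real (card Y)) + t * N x" using cY by (simp add: ln_mult)
    finally have "M x \<le> ln (real (card Y)) / t + N x" using t(1) by (simp add: M_def field_simps)
    then show ?thesis using t(2) by linarith
  qed
  show ?thesis by (rule that[OF MC Md Gd lower upper])
qed

text \<open>Smooth functions that approximate the indicator of a ball centred on the boundary hyperplane, with
  gradient norm close to the weighted perimeter \<open>D m r\<^sup>D\<^sup>-\<^sup>1\<close>, \<open>D = n\<^sub>a\<close>, of the half-ball, that is, to the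
  derivative of its mass \<open>m r\<^sup>D\<close> with respect to the radius. They serve twice: to show that the constant
  is sharp, and to bound the variation of the extremal functions.\<close>

theorem smooth_halfball_approx:
  fixes N :: "real ^ 'n::finite \<Rightarrow> real"
  assumes N: "is_norm N" and a: "0 \<le> a" and D: "1 < wdim k a" and x0: "x0 $ k = 0" and r: "0 < r" and e: "0 < e" "e < r"
  obtains f g where "\<And>m. Cm_on m UNIV f" "\<And>x. (f has_derivative (\<lambda>h. g x \<bullet> h)) (at x)"
    "\<And>x. 0 \<le> f x" "\<And>x. f x \<le> 1" "\<And>x. N (x - x0) \<le> r - e \<Longrightarrow> f x = 1" "\<And>x. r + e \<le> N (x - x0) \<Longrightarrow> f x = 0"
    "(\<integral>\<^sup>+x. ennreal (dual_norm N (g x)) \<partial>weighted_lborel k a)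
      \<le> ennreal (wdim k a * halfball_mass N k a * r powr (wdim k a - 1) + e)" "\<And>i. continuous_on UNIV (\<lambda>x. g x $ i)"
proof -
  let ?W = "weighted_lborel k a" and ?D = "wdim k a" and ?m = "halfball_mass N k a"
  have m: "0 < ?m" by (rule halfball_mass_pos[OF N a])
  have [measurable]: "N \<in> borel_measurable borel" using is_norm_measurable[OF N, of id borel] by (simp add: id_def)
  \<comment> \<open>First the width \<open>\<delta>\<close> of the step is chosen such that the mass of the shell between \<open>r\<close> and \<open>r + \<delta>\<close>
      divided by \<open>\<delta>\<close> is close to \<open>T\<close>, then the accuracy \<open>\<epsilon>\<close> of the smooth norm in terms of \<open>\<delta>\<close>.\<close>
  define T where "T = ?D * ?m * r powr (?D - 1)"
  have lim1: "((\<lambda>\<delta>. (1 + \<delta>) * ?m * (((r + \<delta>) powr ?D - r powr ?D) / \<delta>)) \<longlongrightarrow> (1 + 0) * ?m * (?D * r powr (?D - 1))) (at_right 0)"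
  proof -
    have "((\<lambda>x. x powr ?D) has_real_derivative ?D * r powr (?D - 1)) (at r)"
      using r by (auto intro!: derivative_eq_intros)
    then have "((\<lambda>\<delta>. ((r + \<delta>) powr ?D - r powr ?D) / \<delta>) \<longlongrightarrow> ?D * r powr (?D - 1)) (at 0)"
      by (simp add: DERIV_def)
    then have "((\<lambda>\<delta>. ((r + \<delta>) powr ?D - r powr ?D) / \<delta>) \<longlongrightarrow> ?D * r powr (?D - 1)) (at_right 0)"
      by (rule tendsto_mono[rotated]) (simp add: at_le)
    then show ?thesis by (intro tendsto_intros)
  qed
  have "eventually (\<lambda>\<delta>. (1 + \<delta>) * ?m * (((r + \<delta>) powr ?D - r powr ?D) / \<delta>) < T + e / 2) (at_right 0)"
    using lim1 e by (intro order_tendstoD(2)) (auto simp: T_def mult_ac)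
  moreover have "eventually (\<lambda>\<delta>. \<delta> \<in> {0<..<e / 2}) (at_right 0)" using e by (intro eventually_at_right_real) simp
  ultimately have "eventually (\<lambda>\<delta>. (1 + \<delta>) * ?m * (((r + \<delta>) powr ?D - r powr ?D) / \<delta>) < T + e / 2 \<and> \<delta> \<in> {0<..<e / 2}) (at_right (0::real))"
    by (rule eventually_conj)
  then obtain \<delta> where \<delta>: "0 < \<delta>" "\<delta> < e / 2" "(1 + \<delta>) * ?m * (((r + \<delta>) powr ?D - r powr ?D) / \<delta>) < T + e / 2"
    using eventually_happens'[OF trivial_limit_at_right_real] by force
  have lim2: "((\<lambda>\<epsilon>. (1 + \<delta>) / \<delta> * (?m * (((r + \<delta>) / (1 - \<epsilon>)) powr ?D - (r - \<epsilon>) powr ?D)))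
     \<longlongrightarrow> (1 + \<delta>) / \<delta> * (?m * (((r + \<delta>) / (1 - 0)) powr ?D - (r - 0) powr ?D))) (at_right 0)"
    using r \<delta> by (intro tendsto_intros) auto
  have eq2: "(1 + \<delta>) / \<delta> * (?m * (((r + \<delta>) / (1 - 0)) powr ?D - (r - 0) powr ?D)) = (1 + \<delta>) * ?m * (((r + \<delta>) powr ?D - r powr ?D) / \<delta>)"
    by simp
  have "((\<lambda>\<epsilon>. (r + \<delta>) / (1 - \<epsilon>)) \<longlongrightarrow> (r + \<delta>) / (1 - 0)) (at_right 0)" by (intro tendsto_intros) auto
  then have ev3: "eventually (\<lambda>\<epsilon>. (r + \<delta>) / (1 - \<epsilon>) < r + e) (at_right 0)"
    using \<delta> e by (intro order_tendstoD(2)) auto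
  have ev1: "eventually (\<lambda>\<epsilon>. (1 + \<delta>) / \<delta> * (?m * (((r + \<delta>) / (1 - \<epsilon>)) powr ?D - (r - \<epsilon>) powr ?D)) < T + e / 2) (at_right 0)"
    using lim2 \<delta>(3) unfolding eq2 by (intro order_tendstoD(2)) auto
  have ev2: "eventually (\<lambda>\<epsilon>. \<epsilon> \<in> {0<..<min 1 e}) (at_right (0::real))" using e by (intro eventually_at_right_real) simp
  obtain \<epsilon> where \<epsilon>: "0 < \<epsilon>" "\<epsilon> < 1" "\<epsilon> < e" "(r + \<delta>) / (1 - \<epsilon>) < r + e"
    "(1 + \<delta>) / \<delta> * (?m * (((r + \<delta>) / (1 - \<epsilon>)) powr ?D - (r - \<epsilon>) powr ?D)) < T + e / 2"
    using eventually_happens'[OF trivial_limit_at_right_real eventually_conj[OF ev1 eventually_conj[OF ev2 ev3]]] by force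
  obtain M G where M: "\<And>m. Cm_on m UNIV M" "\<And>x. (M has_derivative (\<lambda>h. G x \<bullet> h)) (at x)"
    "\<And>x. dual_norm N (G x) \<le> 1" "\<And>x. (1 - \<epsilon>) * N x \<le> M x" "\<And>x. M x \<le> N x + \<epsilon>"
    using smooth_norm_approx[OF N \<epsilon>(1,2)] by metis
  obtain \<phi> \<phi>' where \<phi>: "\<And>m. Cm_real m UNIV \<phi>" "\<And>s. (\<phi> has_real_derivative \<phi>' s) (at s)"
    "\<And>s. s \<le> r \<Longrightarrow> \<phi> s = 1" "\<And>s. r + \<delta> \<le> s \<Longrightarrow> \<phi> s = 0" "\<And>s. 0 \<le> \<phi> s" "\<And>s. \<phi> s \<le> 1"
    "\<And>s. \<bar>\<phi>' s\<bar> \<le> (1 + \<delta>) / \<delta> * indicator {r..r + \<delta>} s" "\<And>m. Cm_real m UNIV \<phi>'"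
    using smooth_step[OF \<delta>(1) \<delta>(1), of r] by metis
  define f where "f x = \<phi> (M (x - x0))" for x
  define g where "g x = \<phi>' (M (x - x0)) *\<^sub>R G (x - x0)" for x
  have fC: "Cm_on m UNIV f" for m
    unfolding f_def by (rule Cm_on_compose[OF \<phi>(1) Cm_on_shift[OF M(1)]]) simp
  have fd: "(f has_derivative (\<lambda>h. g x \<bullet> h)) (at x)" for x
  proof -
    have 1: "((\<lambda>x. x - x0) has_derivative (\<lambda>h. h)) (at x)" by (auto intro!: derivative_eq_intros)
    have 2: "((\<lambda>x. M (x - x0)) has_derivative (\<lambda>h. G (x - x0) \<bullet> h)) (at x)"
      by (rule has_derivative_compose[OF 1 M(2)])
    have "(\<phi> has_derivative (\<lambda>h. \<phi>' (M (x - x0)) * h)) (at (M (x - x0)))"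
      using \<phi>(2) by (simp add: has_field_derivative_def)
    from has_derivative_compose[OF 2 this] show ?thesis by (simp add: f_def[abs_def] g_def)
  qed
  have gcont: "continuous_on UNIV (\<lambda>x. g x $ i)" for i
  proof -
    obtain g' where g': "\<And>x. (f has_derivative (\<lambda>h. g' x \<bullet> h)) (at x)" "\<And>i. Cm_on 0 UNIV (\<lambda>x. g' x $ i)"
      using fC[of "Suc 0"] by auto
    have "g' = g" using gradient_eqI[OF g'(1)] gradient_eqI[OF fd] by auto
    then show ?thesis using g'(2) by simp
  qed
  define R1 R2 where "R1 = r - \<epsilon>" and "R2 = (r + \<delta>) / (1 - \<epsilon>)"
  have R12: "0 < R1" "R1 < R2"
  proof -
    show "0 < R1" using \<epsilon> e by (simp add: R1_def)
    have "r + \<delta> \<le> R2" using \<epsilon> r \<delta> by (simp add: R2_def field_simps)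
    then show "R1 < R2" using \<epsilon> \<delta> by (simp add: R1_def)
  qed
  define A where "A = {x \<in> halfspace k. N (x - x0) \<le> R2} - {x \<in> halfspace k. N (x - x0) < R1}"
  have bR2: "bounded {x \<in> halfspace k. N (x - x0) \<le> R2}"
    by (rule bounded_subset[OF bounded_is_norm_ball[OF N, of x0 R2]]) auto
  have mA: "emeasure ?W A = ennreal (?m * (R2 powr ?D - R1 powr ?D))"
  proof -
    have bA: "bounded A" and bR1: "bounded {x \<in> halfspace k. N (x - x0) < R1}"
      by (rule bounded_subset[OF bR2], use R12 in \<open>force simp: A_def\<close>)+
    have "measure ?W {x \<in> halfspace k. N (x - x0) \<le> R2} = measure ?W (A \<union> {x \<in> halfspace k. N (x - x0) < R1})"
      using R12 by (intro arg_cong[where f="measure ?W"]) (auto simp: A_def)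
    also have "\<dots> = measure ?W A + measure ?W {x \<in> halfspace k. N (x - x0) < R1}"
      by (rule measure_weighted_Un[OF _ _ _ bA bR1 a]) (auto simp: A_def)
    finally have "measure ?W A = ?m * R2 powr ?D - ?m * R1 powr ?D"
      using emeasure_weighted_norm_ball[OF N a x0, of R2] measure_weighted_open_norm_ball(1)[OF N a x0 R12(1)] R12 m
      by (simp add: measure_def)
    then show ?thesis using finite_measure_weighted[OF bA a, of k] by (simp add: right_diff_distrib)
  qed
  have gle: "dual_norm N (g x) \<le> (1 + \<delta>) / \<delta> * indicator A x" if xH: "x \<in> halfspace k" for x
  proof -
    let ?u = "M (x - x0)"
    have "dual_norm N (g x) = \<bar>\<phi>' ?u\<bar> * dual_norm N (G (x - x0))"
      using is_normD(3)[OF is_norm_dual_norm[OF N]] by (simp add: g_def)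
    also have "\<dots> \<le> \<bar>\<phi>' ?u\<bar> * 1" by (intro mult_left_mono M) auto
    also have "\<dots> \<le> (1 + \<delta>) / \<delta> * indicator {r..r + \<delta>} ?u" using \<phi>(7) by simp
    also have "\<dots> \<le> (1 + \<delta>) / \<delta> * indicator A x"
    proof (cases "?u \<in> {r..r + \<delta>}")
      case True
      have "r \<le> N (x - x0) + \<epsilon>" "(1 - \<epsilon>) * N (x - x0) \<le> r + \<delta>"
        using True M(4)[of "x - x0"] M(5)[of "x - x0"] by auto
      then have "N (x - x0) \<le> R2" "R1 \<le> N (x - x0)" using \<epsilon>(2) by (auto simp: R1_def R2_def field_simps)
      then have "x \<in> A" using xH by (auto simp: A_def)
      then show ?thesis using \<delta>(1) by (simp add: indicator_def)
    next
      case False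
      then have "(1 + \<delta>) / \<delta> * indicator {r..r + \<delta>} ?u = 0" by simp
      then show ?thesis using \<delta>(1) by simp
    qed
    finally show ?thesis .
  qed
  have [measurable]: "A \<in> sets borel" unfolding A_def by measurable
  have "(\<integral>\<^sup>+x. ennreal (dual_norm N (g x)) \<partial>?W) \<le> (\<integral>\<^sup>+x. ennreal ((1 + \<delta>) / \<delta>) * indicator A x \<partial>?W)"
    using AE_weighted_halfspace[of k a]
  proof (intro nn_integral_mono_AE, elim eventually_mono)
    fix x assume "x \<in> halfspace k"
    then show "ennreal (dual_norm N (g x)) \<le> ennreal ((1 + \<delta>) / \<delta>) * indicator A x"
      using gle[of x] ennreal_leI[OF gle[of x]] by (auto simp: indicator_def split: if_splits)
  qed
  also have "\<dots> = ennreal ((1 + \<delta>) / \<delta>) * ennreal (?m * (R2 powr ?D - R1 powr ?D))"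
    by (subst nn_integral_cmult_indicator) (auto simp: mA)
  also have "\<dots> = ennreal ((1 + \<delta>) / \<delta> * (?m * (R2 powr ?D - R1 powr ?D)))"
    by (rule ennreal_mult'[symmetric]) (use \<delta>(1) in simp)
  also have "\<dots> \<le> ennreal (T + e)" using \<epsilon>(5) e by (intro ennreal_leI) (auto simp: R1_def R2_def)
  finally have bnd: "(\<integral>\<^sup>+x. ennreal (dual_norm N (g x)) \<partial>?W) \<le> ennreal (T + e)" .
  show ?thesis
  proof (rule that[OF fC fd _ _ _ _ _ gcont])
    show "0 \<le> f x" "f x \<le> 1" for x using \<phi>(5,6) by (auto simp: f_def)
    show "f x = 1" if "N (x - x0) \<le> r - e" for x
      unfolding f_def using M(5)[of "x - x0"] that \<epsilon>(3) by (intro \<phi>(3)) linarith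
    show "f x = 0" if "r + e \<le> N (x - x0)" for x
    proof -
      have "r + \<delta> \<le> (1 - \<epsilon>) * (r + e)" using \<epsilon>(2,4) by (simp add: field_simps)
      also have "\<dots> \<le> (1 - \<epsilon>) * N (x - x0)" using that \<epsilon> by (intro mult_left_mono) auto
      also have "\<dots> \<le> M (x - x0)" by (rule M(4))
      finally show ?thesis unfolding f_def by (rule \<phi>(4))
    qed
    show "(\<integral>\<^sup>+x. ennreal (dual_norm N (g x)) \<partial>?W) \<le> ennreal (?D * ?m * r powr (?D - 1) + e)"
      using bnd by (simp add: T_def)
  qed
qed

section \<open>Smooth functions: inequality and sharpness\<close>

lemma space_wmeasure [simp]: "space (wmeasure k a) = halfspace k"
  by (simp add: wmeasure_def space_restrict_space)

lemma nn_integral_wmeasure_eq: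
  fixes f g :: "real ^ 'n::finite \<Rightarrow> ennreal"
  assumes "g \<in> borel_measurable borel" "\<And>x. x \<in> halfspace k \<Longrightarrow> f x = g x"
  shows "(\<integral>\<^sup>+x. f x \<partial>wmeasure k a) = (\<integral>\<^sup>+x. g x \<partial>weighted_lborel k a)"
  by (subst nn_integral_wmeasure_borel[OF assms(1), symmetric], rule nn_integral_cong) (simp add: assms(2))

lemma ennreal_powr_le:
  assumes "X \<le> ennreal (b powr p)" "0 \<le> b" "0 < p"
  shows "ennreal_powr X (1 / p) \<le> ennreal b"
proof -
  have X: "X \<noteq> \<infinity>" using assms(1) by (auto simp: top_unique)
  have "enn2real X \<le> b powr p" using assms(1) by (intro enn2real_leI) auto
  then have "enn2real X powr (1 / p) \<le> (b powr p) powr (1 / p)" using assms by (intro powr_mono2) auto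
  then show ?thesis using X assms by (auto simp: ennreal_powr_def powr_powr intro!: ennreal_leI)
qed

lemma ennreal_powr_ge:
  assumes "ennreal y \<le> X" "0 \<le> y" "0 < q"
  shows "ennreal (y powr q) \<le> ennreal_powr X q"
proof (cases "X = \<infinity>")
  case False
  then have "y \<le> enn2real X" using assms
    by (metis enn2real_ennreal enn2real_mono infinity_ennreal_def top.not_eq_extremum)
  then show ?thesis using False assms by (auto simp: ennreal_powr_def intro!: ennreal_leI powr_mono2)
qed (simp add: ennreal_powr_def)

text \<open>The dual norm of the gradient controls increments measured with \<open>N\<close>, by \<open>G \<bullet> v \<le> \<parallel>G\<parallel>\<^sub>* N v\<close>.\<close>

lemma upper_slope_of_derivative:
  fixes N :: "real ^ 'n::finite \<Rightarrow> real"
  assumes N: "is_norm N" and f: "(f has_derivative (\<lambda>h. G \<bullet> h)) (at x)" and e: "0 < e"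
  shows "\<exists>d>0. \<forall>z. norm (z - x) < d \<longrightarrow> \<bar>f z - f x\<bar> \<le> (dual_norm N G + e) * N (z - x)"
proof -
  obtain n0 where n0: "0 < n0" "\<And>x. n0 * norm x \<le> N x" by (rule is_norm_lower[OF N]) blast
  have "0 < e * n0" using e n0 by simp
  then obtain d where d: "0 < d" "\<And>z. norm (z - x) < d \<Longrightarrow> norm (f z - f x - G \<bullet> (z - x)) \<le> e * n0 * norm (z - x)"
    using f unfolding has_derivative_at_alt by blast
  have "\<bar>f z - f x\<bar> \<le> (dual_norm N G + e) * N (z - x)" if "norm (z - x) < d" for z
  proof -
    have "\<bar>f z - f x\<bar> \<le> \<bar>G \<bullet> (z - x)\<bar> + e * (n0 * norm (z - x))"
      using d(2)[OF that] by (simp add: mult.assoc)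
    also have "\<bar>G \<bullet> (z - x)\<bar> \<le> dual_norm N G * N (z - x)"
      using inner_le_dual_norm[OF N, of G "z - x"] inner_le_dual_norm[OF N, of G "- (z - x)"] is_normD(5)[OF N, of "z - x"]
      unfolding inner_minus_right by (simp only: abs_le_iff)
    also have "e * (n0 * norm (z - x)) \<le> e * N (z - x)" using n0(2) e by (intro mult_left_mono) auto
    finally show ?thesis by (simp add: distrib_right)
  qed
  with d(1) show ?thesis by blast
qed

lemma continuous_on_vecI:
  fixes G :: "'a::topological_space \<Rightarrow> real ^ 'n::finite"
  assumes "\<And>i. continuous_on A (\<lambda>x. G x $ i)"
  shows "continuous_on A G"
proof -
  have "continuous_on A (\<lambda>x. \<chi> i. G x $ i)" by (rule continuous_on_vec_lambda[OF assms])
  then show ?thesis by simp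
qed

text \<open>On the bounded part the mean value inequality applies, as the half-space is convex; far outside the
  support both values vanish, and the unit gap in between absorbs the bound of \<open>f\<close>.\<close>

lemma smooth_cs_lipschitz:
  fixes f :: "real ^ 'n::finite \<Rightarrow> real"
  assumes f: "Cm_on 1 (closed_halfspace k) f" and cp: "compact (closure {x \<in> closed_halfspace k. f x \<noteq> 0})"
  obtains G L R where "\<And>x. x \<in> closed_halfspace k \<Longrightarrow> (f has_derivative (\<lambda>h. G x \<bullet> h)) (at x within closed_halfspace k)"
    "continuous_on (closed_halfspace k) G" "0 \<le> R" "\<And>x. x \<in> closed_halfspace k \<Longrightarrow> R < norm x \<Longrightarrow> f x = 0"
    "0 \<le> L" "\<And>x y. x \<in> closed_halfspace k \<Longrightarrow> y \<in> closed_halfspace k \<Longrightarrow> \<bar>f x - f y\<bar> \<le> L * norm (x - y)"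
proof -
  let ?H = "closed_halfspace k"
  obtain G where G: "\<And>x. x \<in> ?H \<Longrightarrow> (f has_derivative (\<lambda>h. G x \<bullet> h)) (at x within ?H)"
    "\<And>i. continuous_on ?H (\<lambda>x. G x $ i)" using f by auto
  have Gc: "continuous_on ?H G" by (rule continuous_on_vecI[OF G(2)])
  have "bounded {x \<in> ?H. f x \<noteq> 0}" using compact_imp_bounded[OF cp] bounded_subset closure_subset by blast
  then obtain R where R: "0 < R" "\<And>x. x \<in> {x \<in> ?H. f x \<noteq> 0} \<Longrightarrow> norm x \<le> R" by (auto simp: bounded_pos)
  have fR: "f x = 0" if "x \<in> ?H" "R < norm x" for x using R(2)[of x] that by auto
  let ?B = "?H \<inter> cball 0 (R + 1)"
  have cB: "compact ?B" by (intro closed_Int_compact) auto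
  have "bounded (G ` ?B)" by (intro compact_imp_bounded compact_continuous_image cB continuous_on_subset[OF Gc]) auto
  then obtain L where L: "0 < L" "\<And>x. x \<in> ?B \<Longrightarrow> norm (G x) \<le> L" by (auto simp: bounded_pos)
  have fc: "continuous_on ?H f"
    using G(1) by (auto simp: continuous_on_eq_continuous_within intro: has_derivative_continuous)
  have "bounded (f ` ?B)" by (intro compact_imp_bounded compact_continuous_image cB continuous_on_subset[OF fc]) auto
  then obtain M where M: "0 < M" "\<And>x. x \<in> ?B \<Longrightarrow> \<bar>f x\<bar> \<le> M" by (auto simp: bounded_pos)
  have cv: "convex ?B"
    unfolding closed_halfspace_def
    by (intro convex_Int convex_cball) (auto simp: convex_def)
  have in_B: "\<bar>f x - f y\<bar> \<le> L * norm (x - y)" if "x \<in> ?B" "y \<in> ?B" for x y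
  proof -
    have "norm (f x - f y) \<le> L * norm (x - y)"
    proof (rule differentiable_bound[OF cv])
      show "(f has_derivative (\<lambda>h. G z \<bullet> h)) (at z within ?B)" if "z \<in> ?B" for z
        using G(1)[of z] that by (auto intro: has_derivative_subset)
      show "onorm (\<lambda>h. G z \<bullet> h) \<le> L" if "z \<in> ?B" for z
      proof (rule onorm_le)
        fix h show "norm (G z \<bullet> h) \<le> L * norm h"
          using Cauchy_Schwarz_ineq2[of "G z" h] mult_right_mono[OF L(2)[OF that], of "norm h"] by simp
      qed
    qed (use that in auto)
    then show ?thesis by simp
  qed
  have far: "\<bar>f x - f y\<bar> \<le> (L + M) * norm (x - y)" if x: "x \<in> ?H" "norm x \<le> R" and y: "y \<in> ?H" "R + 1 < norm y" for x y
  proof -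
    have "1 \<le> norm (x - y)" using x y norm_triangle_ineq3[of x y] by linarith
    then have "M * 1 \<le> (L + M) * norm (x - y)" using L M by (intro mult_mono) auto
    moreover have "\<bar>f x\<bar> \<le> M" using M(2)[of x] x by auto
    ultimately show ?thesis using fR[of y] y by simp
  qed
  have "\<bar>f x - f y\<bar> \<le> (L + M) * norm (x - y)" if x: "x \<in> ?H" and y: "y \<in> ?H" for x y
  proof -
    consider "norm x \<le> R + 1" "norm y \<le> R + 1" | "norm x \<le> R" "R + 1 < norm y" | "norm y \<le> R" "R + 1 < norm x"
      | "R < norm x" "R < norm y" by linarith
    then show ?thesis
    proof cases
      case 1
      then have "\<bar>f x - f y\<bar> \<le> L * norm (x - y)" using in_B x y by simp
      also have "\<dots> \<le> (L + M) * norm (x - y)" using M by (intro mult_right_mono) auto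
      finally show ?thesis .
    next
      case 2 then show ?thesis using far x y by blast
    next
      case 3
      then have "\<bar>f y - f x\<bar> \<le> (L + M) * norm (y - x)" using far x y by blast
      then show ?thesis by (simp add: norm_minus_commute abs_minus_commute)
    next
      case 4 then show ?thesis using fR x y L M by simp
    qed
  qed
  moreover have "0 \<le> L + M" using L M by simp
  ultimately show ?thesis using that[OF G(1) Gc less_imp_le[OF R(1)] fR] by blast
qed

definition sobolev_const :: "(real ^ 'n \<Rightarrow> real) \<Rightarrow> 'n::finite \<Rightarrow> real \<Rightarrow> real" where
  "sobolev_const N k a = 1 / wdim k a * halfball_mass N k a powr (- 1 / wdim k a)"

lemma sobolev_const_pos:
  fixes N :: "real ^ 'n::finite \<Rightarrow> real"
  assumes "is_norm N" "0 \<le> a" "1 < wdim k a" shows "0 < sobolev_const N k a"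
  using halfball_mass_pos[OF assms(1,2), of k] assms(3) by (simp add: sobolev_const_def)

lemma halfspace_subset_closed: "halfspace k \<subseteq> closed_halfspace k"
  by (auto simp: halfspace_def closed_halfspace_def)

lemma at_within_closed_halfspace: "x \<in> halfspace k \<Longrightarrow> at x within closed_halfspace k = at x"
  using interior_maximal[OF halfspace_subset_closed open_halfspace] by (intro at_within_interior) blast

text \<open>The function \<open>|f|\<close>, cut off outside the half-space, satisfies the hypotheses of
  \<open>sobolev_upper_slope\<close> with the slope \<open>\<parallel>\<nabla>f\<parallel>\<^sub>*\<close>. It need not vanish on the boundary hyperplane, and
  indeed only points of the open half-space are compared there.\<close>

theorem sobolev_smooth:
  fixes N :: "real ^ 'n::finite \<Rightarrow> real"
  assumes N: "is_norm N" and a: "0 \<le> a" and D: "1 < wdim k a"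
  shows "is_sobolev_const N k a (ennreal (sobolev_const N k a))"
  unfolding is_sobolev_const_def
proof (intro allI impI)
  fix f assume f: "smooth_cs_closed_halfspace k f"
  let ?W = "weighted_lborel k a" and ?H = "halfspace k" and ?p = "wdim k a / (wdim k a - 1)"
  let ?S = "sobolev_const N k a"
  have S: "0 < ?S" by (rule sobolev_const_pos[OF N a D])
  have p: "0 < ?p" using D by simp
  have C1: "Cm_on 1 (closed_halfspace k) f" and cp: "compact (closure {x \<in> closed_halfspace k. f x \<noteq> 0})"
    using f by (auto simp: smooth_cs_closed_halfspace_def simp del: One_nat_def)
  obtain G L R where G: "\<And>x. x \<in> closed_halfspace k \<Longrightarrow> (f has_derivative (\<lambda>h. G x \<bullet> h)) (at x within closed_halfspace k)"
    "continuous_on (closed_halfspace k) G" and R: "0 \<le> R" "\<And>x. x \<in> closed_halfspace k \<Longrightarrow> R < norm x \<Longrightarrow> f x = 0"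
    and L: "0 \<le> L" "\<And>x y. x \<in> closed_halfspace k \<Longrightarrow> y \<in> closed_halfspace k \<Longrightarrow> \<bar>f x - f y\<bar> \<le> L * norm (x - y)"
    by (rule smooth_cs_lipschitz[OF C1 cp]) blast
  have Gd: "(f has_derivative (\<lambda>h. G x \<bullet> h)) (at x)" if "x \<in> ?H" for x
    using G(1)[of x] that halfspace_subset_closed at_within_closed_halfspace[OF that] by auto
  have grad: "gradient f x = G x" if "x \<in> ?H" for x by (rule gradient_eqI[OF Gd[OF that]])
  define F where "F x = indicator ?H x * \<bar>f x\<bar>" for x
  define q where "q x = indicator ?H x * dual_norm N (G x)" for x
  note dn = is_norm_dual_norm[OF N]
  have qm [measurable]: "q \<in> borel_measurable borel"
  proof -
    have "continuous_on ?H (\<lambda>x. dual_norm N (G x))"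
      by (rule continuous_on_compose2[OF is_norm_continuous[OF dn, of UNIV] continuous_on_subset[OF G(2) halfspace_subset_closed]]) simp
    from borel_measurable_continuous_on_indicator[OF _ this] show ?thesis by (simp add: q_def[abs_def])
  qed
  have Fm [measurable]: "F \<in> borel_measurable borel"
  proof -
    have "continuous_on ?H f"
      using Gd by (auto simp: continuous_on_eq_continuous_at intro: has_derivative_continuous)
    then have "continuous_on ?H (\<lambda>x. \<bar>f x\<bar>)" by (intro continuous_intros)
    from borel_measurable_continuous_on_indicator[OF _ this] show ?thesis by (simp add: F_def[abs_def])
  qed
  have gn: "weighted_grad_norm N k a f = (\<integral>\<^sup>+x. ennreal (q x) \<partial>?W)"
    unfolding weighted_grad_norm_def by (rule nn_integral_wmeasure_eq, measurable) (auto simp: q_def grad)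
  have Lp: "weighted_Lp_norm ?p k a f = ennreal_powr (\<integral>\<^sup>+x. ennreal (F x powr ?p) \<partial>?W) (1 / ?p)"
    unfolding weighted_Lp_norm_def
    by (rule arg_cong2[where f=ennreal_powr], rule nn_integral_wmeasure_eq, measurable) (auto simp: F_def)
  show "weighted_Lp_norm ?p k a f \<le> ennreal ?S * weighted_grad_norm N k a f"
  proof (cases "weighted_grad_norm N k a f")
    case top
    then show ?thesis using S by (simp add: ennreal_mult_eq_top_iff ennreal_mult_top)
  next
    case (real c)
    have "(\<integral>\<^sup>+x. ennreal (F x powr ?p) \<partial>?W) \<le> ennreal ((?S * c) powr ?p)"
    proof (rule sobolev_upper_slope[OF N a D, where F=F and G=q and R=R and L=L])
      show "0 \<le> F x" "0 \<le> q x" for x using is_normD(1)[OF dn] by (auto simp: F_def q_def)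
      show "x \<notin> ?H \<or> R < norm x \<Longrightarrow> F x = 0" for x
        using R(2)[of x] halfspace_subset_closed[of k] by (auto simp: F_def indicator_def)
      show "\<bar>F x - F y\<bar> \<le> L * norm (x - y)" if "x \<in> ?H" "y \<in> ?H" for x y
      proof -
        have "\<bar>f x - f y\<bar> \<le> L * norm (x - y)" using that halfspace_subset_closed[of k] by (intro L(2)) auto
        moreover have "\<bar>\<bar>f x\<bar> - \<bar>f y\<bar>\<bar> \<le> \<bar>f x - f y\<bar>" by (rule abs_triangle_ineq3)
        ultimately show ?thesis using that by (simp add: F_def)
      qed
      show "\<exists>d>0. \<forall>z\<in>?H. norm (z - x) < d \<longrightarrow> F z \<le> F x + (q x + e) * N (z - x)" if x: "x \<in> ?H" and e: "0 < e" for x e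
      proof -
        obtain d where d: "0 < d" "\<And>z. norm (z - x) < d \<Longrightarrow> \<bar>f z - f x\<bar> \<le> (dual_norm N (G x) + e) * N (z - x)"
          using upper_slope_of_derivative[OF N Gd[OF x] e] by blast
        have "F z \<le> F x + (q x + e) * N (z - x)" if "z \<in> ?H" "norm (z - x) < d" for z
          using d(2)[OF that(2)] that x by (simp add: F_def q_def)
        with d(1) show ?thesis by blast
      qed
    qed (use R L real gn in \<open>auto simp: sobolev_const_def\<close>)
    then have "weighted_Lp_norm ?p k a f \<le> ennreal (?S * c)"
      unfolding Lp by (rule ennreal_powr_le) (use S real p in auto)
    then show ?thesis using real S by (simp add: ennreal_mult)
  qed
qed

lemma weighted_Lp_norm_ball_lower:
  fixes N :: "real ^ 'n::finite \<Rightarrow> real"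
  assumes N: "is_norm N" and a: "0 \<le> a" and p: "0 < p" and r: "0 < r" 
    and f: "f \<in> borel_measurable borel" "\<And>x. N x \<le> r \<Longrightarrow> f x = 1"
  shows "ennreal ((halfball_mass N k a * r powr wdim k a) powr (1 / p)) \<le> weighted_Lp_norm p k a f"
proof -
  have [measurable]: "N \<in> borel_measurable borel" "f \<in> borel_measurable borel"
    using is_norm_measurable[OF N, of id borel] f by (simp_all add: id_def)
  have m: "0 < halfball_mass N k a" by (rule halfball_mass_pos[OF N a])
  have "ennreal (halfball_mass N k a * r powr wdim k a) = emeasure (weighted_lborel k a) {x \<in> halfspace k. N (x - 0) \<le> r}"
    by (rule emeasure_weighted_norm_ball[OF N a _ r, symmetric]) simp
  also have "\<dots> = (\<integral>\<^sup>+x. indicator {x \<in> halfspace k. N (x - 0) \<le> r} x \<partial>weighted_lborel k a)"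
    by (subst nn_integral_indicator) (auto, measurable)
  also have "\<dots> \<le> (\<integral>\<^sup>+x. ennreal (\<bar>f x\<bar> powr p) \<partial>weighted_lborel k a)"
    by (intro nn_integral_mono) (auto simp: indicator_def f(2))
  also have "\<dots> = (\<integral>\<^sup>+x. ennreal (\<bar>f x\<bar> powr p) \<partial>wmeasure k a)"
    by (rule nn_integral_wmeasure_eq[symmetric]) auto
  finally show ?thesis unfolding weighted_Lp_norm_def
    by (rule ennreal_powr_ge) (use m p in auto)
qed

text \<open>Testing with smooth approximations of the indicator of the unit half-ball gives
  \<open>m\<^sup>1\<^sup>/\<^sup>p \<le> C n\<^sub>a m\<close> in the limit, where \<open>m\<close> is the mass of the half-ball.\<close>

theorem sobolev_sharp:
  fixes N :: "real ^ 'n::finite \<Rightarrow> real"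
  assumes N: "is_norm N" and a: "0 \<le> a" and D: "1 < wdim k a" and C: "is_sobolev_const N k a C"
  shows "ennreal (sobolev_const N k a) \<le> C"
proof (cases C)
  case top then show ?thesis by simp
next
  case (real c)
  let ?D = "wdim k a" and ?m = "halfball_mass N k a" and ?p = "wdim k a / (wdim k a - 1)"
  have p: "0 < ?p" using D by simp
  have m: "0 < ?m" by (rule halfball_mass_pos[OF N a])
  have ineq: "(?m * (1 - e) powr ?D) powr (1 / ?p) \<le> c * (?D * ?m + e)" if e: "0 < e" "e < 1" for e
  proof -
    obtain f g where f: "\<And>m. Cm_on m UNIV f" "\<And>x. (f has_derivative (\<lambda>h. g x \<bullet> h)) (at x)"
      "\<And>x. N (x - 0) \<le> 1 - e \<Longrightarrow> f x = 1" "\<And>x. 1 + e \<le> N (x - 0) \<Longrightarrow> f x = 0"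
      "(\<integral>\<^sup>+x. ennreal (dual_norm N (g x)) \<partial>weighted_lborel k a) \<le> ennreal (?D * ?m * 1 powr (?D - 1) + e)"
      "\<And>i. continuous_on UNIV (\<lambda>x. g x $ i)"
      by (rule smooth_halfball_approx[OF N a D, of 0 1 e]) (use e in auto)
    have fc: "continuous_on UNIV f" using f(1)[of 0] by simp
    have fm: "f \<in> borel_measurable borel" by (rule borel_measurable_continuous_onI[OF fc])
    have gm: "(\<lambda>x. dual_norm N (g x)) \<in> borel_measurable borel"
      by (rule borel_measurable_continuous_onI,
          rule continuous_on_compose2[OF is_norm_continuous[OF is_norm_dual_norm[OF N], of UNIV] continuous_on_vecI[OF f(6)]]) simp
    have "smooth_cs_closed_halfspace k f"
      unfolding smooth_cs_closed_halfspace_def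
    proof (intro conjI allI)
      show "Cm_on m (closed_halfspace k) f" for m by (rule Cm_on_subset[OF f(1)]) simp
      have "{x \<in> closed_halfspace k. f x \<noteq> 0} \<subseteq> {x. N (x - 0) \<le> 1 + e}"
        using f(4) by force
      then have "bounded {x \<in> closed_halfspace k. f x \<noteq> 0}"
        by (rule bounded_subset[OF bounded_is_norm_ball[OF N]])
      then show "compact (closure {x \<in> closed_halfspace k. f x \<noteq> 0})" by simp
    qed
    then have "weighted_Lp_norm ?p k a f \<le> C * weighted_grad_norm N k a f" using C by (simp add: is_sobolev_const_def)
    also have "weighted_grad_norm N k a f = (\<integral>\<^sup>+x. ennreal (dual_norm N (g x)) \<partial>weighted_lborel k a)"
      unfolding weighted_grad_norm_def
      by (rule nn_integral_wmeasure_eq) (use gm gradient_eqI[OF f(2)] in auto)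
    also have "C * \<dots> \<le> C * ennreal (?D * ?m + e)" using f(5) by (intro mult_left_mono) auto
    finally have "weighted_Lp_norm ?p k a f \<le> ennreal (c * (?D * ?m + e))"
      using real m D e by (simp add: ennreal_mult)
    with weighted_Lp_norm_ball_lower[OF N a p _ fm, of "1 - e" k] f(3) e
    have "ennreal ((?m * (1 - e) powr ?D) powr (1 / ?p)) \<le> ennreal (c * (?D * ?m + e))"
      by (auto intro: order_trans)
    then show ?thesis using real m D e by (subst (asm) ennreal_le_iff) auto
  qed
  have l1: "((\<lambda>e. (?m * (1 - e) powr ?D) powr (1 / ?p)) \<longlongrightarrow> (?m * (1 - 0) powr ?D) powr (1 / ?p)) (at_right 0)"
    using m by (intro tendsto_intros) auto
  have l2: "((\<lambda>e. c * (?D * ?m + e)) \<longlongrightarrow> c * (?D * ?m + 0)) (at_right 0)" by (intro tendsto_intros)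
  have "eventually (\<lambda>e. (?m * (1 - e) powr ?D) powr (1 / ?p) \<le> c * (?D * ?m + e)) (at_right 0)"
    using eventually_at_right_real[of 0 "1::real", OF zero_less_one] by (rule eventually_mono) (rule ineq, simp_all only: greaterThanLessThan_iff)
  from tendsto_le[OF trivial_limit_at_right_real l2 l1 this]
  have "?m powr (1 / ?p) \<le> c * ?D * ?m" by (simp add: mult.assoc)
  moreover have "1 / ?p = 1 - 1 / ?D" using D by (simp add: field_simps)
  ultimately have "?m * ?m powr (- 1 / ?D) \<le> ?m * (c * ?D)" using m by (simp add: powr_diff powr_minus divide_inverse mult_ac)
  then have "?m powr (- 1 / ?D) \<le> c * ?D" using m by simp
  then have "sobolev_const N k a \<le> c" using D by (simp add: sobolev_const_def field_simps)
  then show ?thesis using real by (simp add: ennreal_leI)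
qed

section \<open>Duality\<close>

lemma Cm_on_diff: "Cm_on m A f \<Longrightarrow> Cm_on m A g \<Longrightarrow> Cm_on m A (\<lambda>x. f x - g x)"
  using Cm_on_add[of m A f "\<lambda>x. (-1) * g x"] Cm_on_mult[of m A "\<lambda>_. -1" g] by simp

lemma Cm_on_prod: "(\<And>i. i \<in> I \<Longrightarrow> Cm_on m A (f i)) \<Longrightarrow> Cm_on m A (\<lambda>x. \<Prod>i\<in>I. f i x)"
  by (induction I rule: infinite_finite_induct) (auto intro: Cm_on_mult)

lemma Cm_on_component: "Cm_on m A (\<lambda>x. x $ i)"
  using Cm_on_linear[of m A "axis i 1"] by (simp add: inner_axis')

lemma smooth_ball_bump:
  fixes c :: "real ^ 'n::finite"
  shows "Cm_on m UNIV (\<lambda>x. flat_exp (r\<^sup>2 - (x - c) \<bullet> (x - c)))" (is ?th1)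
    and "0 < r \<Longrightarrow> 0 < flat_exp (r\<^sup>2 - (x - c) \<bullet> (x - c)) \<longleftrightarrow> x \<in> ball c r" (is "_ \<Longrightarrow> ?th2")
proof -
  have "Cm_on m UNIV (\<lambda>x. r\<^sup>2 - (x - c) \<bullet> (x - c))"
    unfolding inner_vec_def vector_minus_component inner_real_def
    by (intro Cm_on_diff Cm_on_const Cm_on_sum Cm_on_mult Cm_on_component)
  then show ?th1 by (rule Cm_on_compose[OF Cm_real_flat_exp]) simp
  assume r: "0 < r"
  have "(x - c) \<bullet> (x - c) = (norm (x - c))\<^sup>2" by (simp add: power2_norm_eq_inner)
  moreover have "(norm (x - c))\<^sup>2 < r\<^sup>2 \<longleftrightarrow> norm (x - c) < r"
    using r power_mono_iff[of r "norm (x - c)" 2] by (simp add: not_le[symmetric])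
  ultimately have "0 < r\<^sup>2 - (x - c) \<bullet> (x - c) \<longleftrightarrow> norm (x - c) < r" by simp
  then show ?th2 by (simp add: flat_exp_bounds(4) dist_norm norm_minus_commute)
qed

text \<open>Density of smooth functions in \<open>L\<^sup>1\<close> of a finite measure, with values kept in \<open>[0, 1]\<close>. Regularity of
  the measure gives a compact \<open>C \<subseteq> B\<close> and an open \<open>Q \<supseteq> C\<close> of almost the same measure; a finite union \<open>V\<close>
  of balls lies between them, and a sum \<open>s\<close> of bumps is positive exactly on \<open>V\<close>.\<close>

lemma smooth_indicator_approx:
  fixes M :: "(real ^ 'n::finite) measure"
  assumes sM: "sets M = sets borel" and fin: "emeasure M UNIV < \<infinity>"
    and B: "B \<in> sets borel" "B \<subseteq> U" and U: "open U" and e: "0 < e"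
  obtains b where "\<And>m. Cm_on m UNIV b" "\<And>x. 0 \<le> b x" "\<And>x. b x \<le> 1"
    "\<exists>K. compact K \<and> K \<subseteq> U \<and> (\<forall>x. x \<notin> K \<longrightarrow> b x = 0)"
    "(\<integral>\<^sup>+x. ennreal \<bar>b x - indicator B x\<bar> \<partial>M) < ennreal e"
proof -
  note [measurable_cong] = sM
  have sp: "space M = UNIV" using sets_eq_imp_space_eq[OF sM] by simp
  have finA: "emeasure M A < \<infinity>" for A
    by (rule le_less_trans[OF emeasure_space fin[folded sp]])
  have finS: "emeasure M (space M) \<noteq> \<infinity>" using finA[of "space M"] by simp
  have e4: "0 < e / 4" using e by simp
  obtain C where C: "C \<subseteq> B" "compact C" "emeasure M B < emeasure M C + ennreal (e / 4)"
  proof -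
    have "\<exists>K\<in>{K. K \<subseteq> B \<and> compact K}. emeasure M B < emeasure M K + ennreal (e / 4)"
      by (rule SUP_approx_ennreal[OF e4 _ inner_regular[OF sM finS B(1)]])
        (use finA[of B] in \<open>auto intro!: exI[of _ "{}"]\<close>)
    then show ?thesis using that by blast
  qed
  have Cb: "C \<in> sets borel" using C(2) by (simp add: borel_compact)
  obtain Q where Q: "C \<subseteq> Q" "open Q" "emeasure M Q < emeasure M C + ennreal (e / 4)"
  proof -
    have "\<exists>K\<in>{K. C \<subseteq> K \<and> open K}. emeasure M K < emeasure M C + ennreal (e / 4)"
      by (rule INF_approx_ennreal[OF e4 outer_regular[OF sM finS Cb]]) (use finA[of C] in auto)
    then show ?thesis using that by blast
  qed
  have QU: "open (Q \<inter> U)" "C \<subseteq> Q \<inter> U" using Q U C B by auto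
  have "\<forall>x\<in>C. \<exists>r>0. cball x r \<subseteq> Q \<inter> U" using QU open_contains_cball by blast
  then obtain r where r: "\<And>x. x \<in> C \<Longrightarrow> 0 < r x" "\<And>x. x \<in> C \<Longrightarrow> cball x (r x) \<subseteq> Q \<inter> U" by metis
  obtain T where T: "T \<subseteq> C" "finite T" "C \<subseteq> (\<Union>x\<in>T. ball x (r x))"
    by (rule compactE_image[OF C(2), of C "\<lambda>x. ball x (r x)"]) (use r(1) in auto)
  define s where "s y = (\<Sum>x\<in>T. flat_exp ((r x)\<^sup>2 - (y - x) \<bullet> (y - x)))" for y
  define V where "V = (\<Union>x\<in>T. ball x (r x))"
  define K where "K = (\<Union>x\<in>T. cball x (r x))"
  have K: "compact K" "K \<subseteq> Q \<inter> U" "V \<subseteq> K"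
    using T r by (auto simp: K_def V_def intro!: compact_UN) (force simp: less_imp_le)+
  have s0: "0 \<le> s y" for y unfolding s_def by (intro sum_nonneg flat_exp_bounds)
  have sV: "0 < s y \<longleftrightarrow> y \<in> V" for y
  proof -
    have "s y = 0 \<longleftrightarrow> (\<forall>x\<in>T. flat_exp ((r x)\<^sup>2 - (y - x) \<bullet> (y - x)) = 0)"
      unfolding s_def by (rule sum_nonneg_eq_0_iff[OF T(2)]) (rule flat_exp_bounds)
    also have "\<dots> \<longleftrightarrow> (\<forall>x\<in>T. y \<notin> ball x (r x))"
    proof (rule ball_cong[OF refl])
      fix x assume "x \<in> T"
      then have "0 < r x" using T r by blast
      from smooth_ball_bump(2)[OF this, of y x] flat_exp_bounds(1)[of "(r x)\<^sup>2 - (y - x) \<bullet> (y - x)"]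
      show "flat_exp ((r x)\<^sup>2 - (y - x) \<bullet> (y - x)) = 0 \<longleftrightarrow> y \<notin> ball x (r x)" by linarith
    qed
    finally show ?thesis using s0[of y] by (auto simp: V_def less_le)
  qed
  \<comment> \<open>These increase to the indicator of \<open>V\<close>.\<close>
  define b where "b j y = 1 - exp ((- real j) * s y)" for j y
  have sC: "Cm_on m UNIV s" for m unfolding s_def by (intro Cm_on_sum smooth_ball_bump(1))
  have bC: "Cm_on m UNIV (b j)" for m j
    unfolding b_def by (intro Cm_on_diff Cm_on_const Cm_on_compose[OF Cm_real_exp] Cm_on_mult sC) auto
  have b01: "0 \<le> b j y" "b j y \<le> 1" for j y using s0[of y] by (auto simp: b_def)
  have bV: "b j y = 0" if "y \<notin> V" for j y using sV[of y] s0[of y] that by (auto simp: b_def)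
  have [measurable]: "b j \<in> borel_measurable borel" for j
    using bC[of 0 j] by (auto intro: borel_measurable_continuous_onI)
  have [measurable]: "V \<in> sets borel" "B \<in> sets borel" "C \<in> sets borel" "Q \<in> sets borel"
    using B(1) Cb Q(2) by (auto simp: V_def intro!: borel_open open_UN)
  have blim: "(\<lambda>j. b j y) \<longlonglongrightarrow> indicator V y" for y
  proof (cases "y \<in> V")
    case True
    then have "0 < s y" using sV by blast
    then have "filterlim (\<lambda>j. real j * s y) at_top sequentially"
      by (intro filterlim_at_top_mult_tendsto_pos[OF tendsto_const] filterlim_real_sequentially)
    then have "(\<lambda>j. exp (- (real j * s y))) \<longlonglongrightarrow> 0"
      by (intro filterlim_compose[OF exp_at_bot] filterlim_compose[OF filterlim_uminus_at_bot_at_top])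
    then have "(\<lambda>j. 1 - exp (- (real j * s y))) \<longlonglongrightarrow> 1 - 0" by (intro tendsto_intros)
    then show ?thesis using True by (simp add: b_def)
  next
    case False then show ?thesis using bV[OF False] by simp
  qed
  have VB: "(\<integral>\<^sup>+x. ennreal \<bar>indicator V x - indicator B x\<bar> \<partial>M) \<le> ennreal (e / 2)"
  proof -
    have "(\<integral>\<^sup>+x. ennreal \<bar>indicator V x - indicator B x\<bar> \<partial>M) \<le> (\<integral>\<^sup>+x. indicator (Q - C) x + indicator (B - C) x \<partial>M)"
    proof (rule nn_integral_mono)
      have VQ: "V \<subseteq> Q" "C \<subseteq> V" using K T(3) by (auto simp: V_def)
      fix x show "ennreal \<bar>indicator V x - indicator B x\<bar> \<le> indicator (Q - C) x + indicator (B - C) x"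
        by (cases "x \<in> V"; cases "x \<in> B"; cases "x \<in> C") (use VQ C(1) in auto)
    qed
    also have "\<dots> = emeasure M (Q - C) + emeasure M (B - C)"
      by (subst nn_integral_add) (auto simp: sM)
    also have "emeasure M (Q - C) = emeasure M Q - emeasure M C"
      using finA[of C] Q by (intro emeasure_Diff) (auto simp: sM)
    also have "\<dots> \<le> ennreal (e / 4)" using Q(3) finA[of C]
      by (subst ennreal_minus_le_iff) (auto simp: less_imp_le add.commute)
    also have "emeasure M (B - C) = emeasure M B - emeasure M C"
      using finA[of C] C by (intro emeasure_Diff) (auto simp: sM)
    also have "\<dots> \<le> ennreal (e / 4)" using C(3) finA[of C]
      by (subst ennreal_minus_le_iff) (auto simp: less_imp_le add.commute)
    also have "ennreal (e / 4) + ennreal (e / 4) = ennreal (e / 2)" using e by (subst ennreal_plus[symmetric]) auto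
    finally show ?thesis by (simp add: add_mono)
  qed
  have lim: "(\<lambda>j. \<integral>\<^sup>+x. ennreal \<bar>b j x - indicator B x\<bar> \<partial>M) \<longlonglongrightarrow> (\<integral>\<^sup>+x. ennreal \<bar>indicator V x - indicator B x\<bar> \<partial>M)"
  proof (rule nn_integral_dominated_convergence[where w="\<lambda>_. 1"])
    show "(\<integral>\<^sup>+x. 1 \<partial>M) < \<infinity>" using finA[of "space M"] by simp
    show "AE x in M. (\<lambda>j. ennreal \<bar>b j x - indicator B x\<bar>) \<longlonglongrightarrow> ennreal \<bar>indicator V x - indicator B x\<bar>"
      by (intro AE_I2 tendsto_ennrealI tendsto_intros blim)
    show "AE x in M. ennreal \<bar>b j x - indicator B x\<bar> \<le> 1" for j
    proof (rule AE_I2)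
      fix x show "ennreal \<bar>b j x - indicator B x\<bar> \<le> 1"
        using b01[of j x] by (auto simp: indicator_def ennreal_le_1)
    qed
  qed measurable
  have "ennreal (e / 2) < ennreal e" using e by (intro ennreal_lessI) auto
  with VB have "(\<integral>\<^sup>+x. ennreal \<bar>indicator V x - indicator B x\<bar> \<partial>M) < ennreal e" by (rule le_less_trans)
  with lim have "eventually (\<lambda>j. (\<integral>\<^sup>+x. ennreal \<bar>b j x - indicator B x\<bar> \<partial>M) < ennreal e) sequentially"
    by (rule order_tendstoD(2))
  then obtain j where j: "(\<integral>\<^sup>+x. ennreal \<bar>b j x - indicator B x\<bar> \<partial>M) < ennreal e"
    by (auto simp: eventually_sequentially)
  have "compact K \<and> K \<subseteq> U \<and> (\<forall>x. x \<notin> K \<longrightarrow> b j x = 0)" using K bV[of _ j] by blast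
  then show ?thesis using that[of "b j"] bC b01 j by blast
qed

definition exhaust :: "'n::finite \<Rightarrow> nat \<Rightarrow> (real ^ 'n) set" where
  "exhaust k j = {x. 1 / (real j + 1) \<le> x $ k} \<inter> cball 0 (real j + 1)"

lemma exhaust_props:
  fixes k :: "'n::finite"
  shows "compact (exhaust k j)" "exhaust k j \<subseteq> halfspace k" "incseq (exhaust k)" "(\<Union>j. exhaust k j) = halfspace k"
    "exhaust k j \<subseteq> interior (exhaust k (Suc j))" "exhaust k j \<in> sets borel"
proof -
  have cl: "closed {x :: real ^ 'n. 1 / (real j + 1) \<le> x $ k}" for j
    by (intro closed_Collect_le continuous_intros)
  show cp: "compact (exhaust k j)" for j unfolding exhaust_def by (intro closed_Int_compact cl) simp
  then show "exhaust k j \<in> sets borel" by (simp add: borel_compact)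
  show sub: "exhaust k j \<subseteq> halfspace k" for j
    by (auto simp: exhaust_def halfspace_def intro: less_le_trans[rotated])
  show "incseq (exhaust k)"
  proof (rule incseq_SucI)
    fix j
    have "1 / (real (Suc j) + 1) \<le> 1 / (real j + 1)" by (intro divide_left_mono) auto
    then show "exhaust k j \<subseteq> exhaust k (Suc j)" unfolding exhaust_def by auto
  qed
  have "open ({x :: real ^ 'n. 1 / (real (Suc j) + 1) < x $ k} \<inter> ball 0 (real (Suc j) + 1))" (is "open ?O")
    by (intro open_Int open_Collect_less continuous_intros open_ball)
  moreover have "?O \<subseteq> exhaust k (Suc j)" by (auto simp: exhaust_def less_imp_le)
  moreover have "exhaust k j \<subseteq> ?O"
  proof -
    have "1 / (real (Suc j) + 1) < 1 / (real j + 1)" by (intro divide_strict_left_mono) auto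
    then show ?thesis unfolding exhaust_def by auto
  qed
  ultimately show "exhaust k j \<subseteq> interior (exhaust k (Suc j))" using interior_maximal by blast
  show "(\<Union>j. exhaust k j) = halfspace k"
  proof
    show "(\<Union>j. exhaust k j) \<subseteq> halfspace k" using sub by blast
    show "halfspace k \<subseteq> (\<Union>j. exhaust k j)"
    proof
      fix x assume x: "x \<in> halfspace k"
      obtain j where j: "max (1 / x $ k) (norm x) < real j" using reals_Archimedean2 by blast
      have xk: "0 < x $ k" using x by (simp add: halfspace_def)
      have "1 / (real j + 1) \<le> x $ k" using j xk by (simp add: field_simps)
      then have "x \<in> exhaust k j" using j by (simp add: exhaust_def)
      then show "x \<in> (\<Union>j. exhaust k j)" by blast
    qed
  qed
qed

text \<open>The net for the dual norm is a priori bounded in the bidual norm, which is the norm itself.\<close>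

lemma finite_net_for_dual_norm:
  fixes N :: "real ^ 'n::finite \<Rightarrow> real"
  assumes N: "is_norm N" and e: "0 < e" "e < 1"
  obtains Y where "finite Y" "\<And>y. y \<in> Y \<Longrightarrow> N y \<le> 1" "\<And>v. \<exists>y\<in>Y. (1 - e) * dual_norm N v \<le> y \<bullet> v"
proof -
  have bidual: "N y \<le> 1" if "dual_norm (dual_norm N) y \<le> 1" for y
  proof (rule ccontr)
    assume "\<not> N y \<le> 1"
    then obtain w where w: "dual_norm N w \<le> 1" "1 < w \<bullet> y"
      using dual_norm_supporting[OF N, of y] by (auto simp: not_le)
    have "y \<bullet> w \<le> dual_norm (dual_norm N) y" by (rule dual_norm_upper[OF is_norm_dual_norm[OF N] w(1)])
    then show False using w(2) that by (simp add: inner_commute)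
  qed
  obtain Y where Y: "finite Y" "Y \<noteq> {}" "\<And>y. y \<in> Y \<Longrightarrow> dual_norm (dual_norm N) y \<le> 1"
     "\<And>x. \<exists>y\<in>Y. (1 - e) * dual_norm N x \<le> y \<bullet> x"
    by (rule finite_dual_net[OF is_norm_dual_norm[OF N] e]) blast
  show ?thesis by (rule that[OF Y(1) bidual[OF Y(3)] Y(4)])
qed

text \<open>Turns functions with values in \<open>[0, 1]\<close> into weights of total at most 1. On the indicators of
  disjoint sets it is the identity, so approximate indicators give weights that are nearly these.\<close>

definition peel :: "(nat \<Rightarrow> real) \<Rightarrow> nat \<Rightarrow> real" where
  "peel c i = c i * (\<Prod>l<i. 1 - c l)"

lemma sum_peel: "(\<Sum>i<m. peel c i) = 1 - (\<Prod>l<m. 1 - c l)"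
  by (induction m) (simp_all add: peel_def algebra_simps)

lemma peel_diff:
  fixes c d :: "nat \<Rightarrow> real"
  assumes "\<And>l. 0 \<le> c l" "\<And>l. c l \<le> 1" "\<And>l. 0 \<le> d l" "\<And>l. d l \<le> 1" and "i < m"
  shows "\<bar>peel c i - peel d i\<bar> \<le> (\<Sum>l<m. \<bar>c l - d l\<bar>)"
proof -
  have eq: "peel c i = (\<Prod>l\<le>i. if l = i then c l else 1 - c l)" for c
  proof -
    have "(\<Prod>l\<le>i. if l = i then c l else 1 - c l) = (\<Prod>l<i. if l = i then c l else 1 - c l) * c i"
      by (simp add: lessThan_Suc_atMost[symmetric])
    also have "(\<Prod>l<i. if l = i then c l else 1 - c l) = (\<Prod>l<i. 1 - c l)" by (intro prod.cong) auto
    finally show ?thesis by (simp add: peel_def mult.commute)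
  qed
  have "norm (peel c i - peel d i) \<le> (\<Sum>l\<le>i. norm ((if l = i then c l else 1 - c l) - (if l = i then d l else 1 - d l)))"
    unfolding eq by (rule norm_prod_diff) (use assms in auto)
  also have "\<dots> = (\<Sum>l\<le>i. \<bar>c l - d l\<bar>)" by (intro sum.cong) auto
  also have "\<dots> \<le> (\<Sum>l<m. \<bar>c l - d l\<bar>)" by (intro sum_mono2) (use assms in auto)
  finally show ?thesis by simp
qed

definition smooth_field :: "'n::finite \<Rightarrow> (real ^ 'n \<Rightarrow> real ^ 'n) \<Rightarrow> bool" where
  "smooth_field k g \<longleftrightarrow> (\<forall>i m. Cm_on m UNIV (\<lambda>x. g x $ i)) \<and>
     (\<exists>K. compact K \<and> K \<subseteq> halfspace k \<and> (\<forall>x. x \<notin> K \<longrightarrow> g x = 0))"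

text \<open>Duality: the integral of \<open>\<parallel>h\<parallel>\<^sub>*\<close> is controlled by the integrals of \<open>g \<bullet> h\<close> over smooth compactly
  supported fields \<open>g\<close> with \<open>N g \<le> 1\<close>. Up to a factor \<open>1 - e\<close>, the best \<open>g\<close> takes finitely many values \<open>y\<^sub>i\<close>,
  each on a measurable set \<open>A\<^sub>i\<close>; smooth approximate indicators of these sets, made into weights by
  \<open>peel\<close>, give a smooth convex combination of the \<open>y\<^sub>i\<close>.\<close>

theorem dual_norm_integral_le:
  fixes N :: "real ^ 'n::finite \<Rightarrow> real" and h :: "real ^ 'n \<Rightarrow> real ^ 'n" and M :: "(real ^ 'n) measure"
  assumes N: "is_norm N" and sM: "sets M = sets borel"
    and fin: "\<And>K. compact K \<Longrightarrow> K \<subseteq> halfspace k \<Longrightarrow> emeasure M K < \<infinity>"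
    and AEH: "AE x in M. x \<in> halfspace k"
    and h: "h \<in> borel_measurable borel" and h1: "\<And>x. norm (h x) \<le> 1"
    and hyp: "\<And>g. smooth_field k g \<Longrightarrow> (\<And>x. N (g x) \<le> 1) \<Longrightarrow> (LINT x|M. g x \<bullet> h x) \<le> c"
  shows "(\<integral>\<^sup>+x. ennreal (dual_norm N (h x)) \<partial>M) \<le> ennreal c"
proof -
  note [measurable_cong] = sM
  note [measurable] = h
  note dn = is_norm_dual_norm[OF N]
  have [measurable]: "exhaust k j \<in> sets borel" for j by (rule exhaust_props)
  have sp: "space M = UNIV" using sets_eq_imp_space_eq[OF sM] by simp
  have dnm [measurable]: "(\<lambda>x. dual_norm N (h x)) \<in> borel_measurable borel"
    by (rule is_norm_measurable[OF dn h])
  obtain C0 where C0: "0 < C0" "\<And>x. dual_norm N x \<le> C0 * norm x" by (rule is_norm_upper[OF dn]) blast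
  have dh: "dual_norm N (h x) \<le> C0" for x
    using C0(2)[of "h x"] mult_left_mono[OF h1[of x] less_imp_le[OF C0(1)]] by linarith
  have dh0: "0 \<le> dual_norm N (h x)" for x by (rule is_normD(1)[OF dn])
  have N0: "N 0 = 0" using is_normD(2)[OF N, of 0] by simp
  have step: "(\<integral>\<^sup>+x. ennreal (dual_norm N (h x)) * indicator (exhaust k j) x \<partial>M) \<le> ennreal c" for j
  proof -
    define I where "I = (LINT x|M. dual_norm N (h x) * indicator (exhaust k j) x)"
    have fj: "emeasure M (exhaust k j) < \<infinity>" "emeasure M (exhaust k (Suc j)) < \<infinity>"
      by (intro fin exhaust_props)+
    have indi: "integrable M (\<lambda>x. r * indicator (exhaust k j) x :: real)" "integrable M (\<lambda>x. r * indicator (exhaust k (Suc j)) x :: real)" for r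
      using fj by (auto intro!: integrable_mult_right integrable_real_indicator simp: sM simp del: indicator_simps)
    have integ: "integrable M (\<lambda>x. dual_norm N (h x) * indicator (exhaust k j) x)"
    proof (rule Bochner_Integration.integrable_bound[OF indi(1)[of C0]])
      show "AE x in M. norm (dual_norm N (h x) * indicator (exhaust k j) x) \<le> norm (C0 * indicator (exhaust k j) x)"
        using dh dh0 C0(1) by (auto simp: indicator_def)
    qed measurable
    have "(1 - e) * I \<le> c + e" if e: "0 < e" "e < 1" for e
    proof -
      obtain Y where Y: "finite Y" "\<And>y. y \<in> Y \<Longrightarrow> N y \<le> 1" "\<And>v. \<exists>y\<in>Y. (1 - e) * dual_norm N v \<le> y \<bullet> v"
        by (rule finite_net_for_dual_norm[OF N e]) blast
      obtain ys where ys: "set ys = Y" using finite_list[OF Y(1)] by blast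
      define m where "m = length ys"
      define y where "y i = (if i < m then ys ! i else 0)" for i
      have yN: "N (y i) \<le> 1" for i using Y(2) ys N0 by (auto simp: y_def m_def)
      obtain Cy where Cy: "0 < Cy" "\<And>i. i < m \<Longrightarrow> norm (y i) \<le> Cy"
      proof -
        have "bounded (y ` {..<m})" by (intro finite_imp_bounded) simp
        then show ?thesis using that unfolding bounded_pos by blast
      qed
      \<comment> \<open>On \<open>P i\<close> the value \<open>y i\<close> is nearly optimal; \<open>A i\<close> are the points where it is the first such value.\<close>
      define P where "P i = {x \<in> exhaust k j. (1 - e) * dual_norm N (h x) \<le> y i \<bullet> h x}" for i
      define A where "A i = P i - (\<Union>l<i. P l)" for i
      have Am: "A i \<in> sets borel" for i unfolding A_def P_def by measurable
      have Asub: "A i \<subseteq> interior (exhaust k (Suc j))" for i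
        using exhaust_props(5)[where k=k and j=j] by (auto simp: A_def P_def)
      define Mj where "Mj = density M (indicator (exhaust k (Suc j)))"
      have sMj: "sets Mj = sets borel" by (simp add: Mj_def sM)
      have finMj: "emeasure Mj UNIV < \<infinity>"
        unfolding Mj_def using fj(2) by (subst emeasure_density) (auto simp: sM)
      \<comment> \<open>The \<open>m\<close> errors of size \<open>e'\<close> enter with the factor \<open>Cy * m\<close>; the summand 1 avoids division by zero.\<close>
      define e' where "e' = e / (Cy * real m * real m + 1)"
      have e': "0 < e'" using e Cy by (simp add: e'_def add_nonneg_pos)
      define good where "good i b \<longleftrightarrow> (\<forall>m. Cm_on m UNIV b) \<and> (\<forall>x. 0 \<le> b x) \<and> (\<forall>x. b x \<le> 1) \<and>
         (\<exists>K. compact K \<and> K \<subseteq> interior (exhaust k (Suc j)) \<and> (\<forall>x. x \<notin> K \<longrightarrow> b x = 0)) \<and>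
         (\<integral>\<^sup>+x. ennreal \<bar>b x - indicator (A i) x\<bar> \<partial>Mj) < ennreal e'" for i b
      have "\<exists>b. good i b" for i
        unfolding good_def
        by (rule smooth_indicator_approx[OF sMj finMj Am Asub open_interior e']) blast
      then have "\<exists>b. \<forall>i. good i (b i)" by (intro choice allI)
      then obtain b where good: "\<And>i. good i (b i)" by blast
      have b: "\<And>i m. Cm_on m UNIV (b i)" "\<And>i x. 0 \<le> b i x" "\<And>i x. b i x \<le> 1"
        "\<And>i. \<exists>K. compact K \<and> K \<subseteq> interior (exhaust k (Suc j)) \<and> (\<forall>x. x \<notin> K \<longrightarrow> b i x = 0)"
        "\<And>i. (\<integral>\<^sup>+x. ennreal \<bar>b i x - indicator (A i) x\<bar> \<partial>Mj) < ennreal e'"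
        using good unfolding good_def by blast+
      have bz: "b i x = 0" if "x \<notin> interior (exhaust k (Suc j))" for i x using b(4)[of i] that by blast
      have bm [measurable]: "b i \<in> borel_measurable borel" for i
        using b(1)[of 0 i] by (auto intro: borel_measurable_continuous_onI)
      define w where "w i x = peel (\<lambda>l. b l x) i" for i x
      define g where "g x = (\<Sum>i<m. w i x *\<^sub>R y i)" for x
      have w0: "0 \<le> w i x" for i x unfolding w_def peel_def by (intro mult_nonneg_nonneg prod_nonneg) (use b in auto)
      have w1: "(\<Sum>i<m. w i x) \<le> 1" for x
        unfolding w_def sum_peel using prod_nonneg[of "{..<m}" "\<lambda>l. 1 - b l x"] b(3) by simp
      have gN: "N (g x) \<le> 1" for x
      proof -
        have "N (\<Sum>i\<in>J. w i x *\<^sub>R y i) \<le> (\<Sum>i\<in>J. w i x)" if "finite J" for J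
          using that
        proof (induction J)
          case (insert i J)
          have "N (w i x *\<^sub>R y i + (\<Sum>i\<in>J. w i x *\<^sub>R y i)) \<le> N (w i x *\<^sub>R y i) + N (\<Sum>i\<in>J. w i x *\<^sub>R y i)"
            by (rule is_normD(4)[OF N])
          also have "N (w i x *\<^sub>R y i) \<le> w i x"
            using mult_left_mono[OF yN[of i] w0[of i x]] w0[of i x] by (simp add: is_normD(3)[OF N])
          finally show ?case using insert by simp
        qed (simp add: N0)
        from this[of "{..<m}"] w1[of x] show ?thesis by (simp add: g_def)
      qed
      have gz: "g x = 0" if "x \<notin> exhaust k (Suc j)" for x
      proof -
        have "b i x = 0" for i using bz that interior_subset by blast
        then show ?thesis by (simp add: g_def w_def peel_def)
      qed
      have gC: "Cm_on m' UNIV (\<lambda>x. g x $ i)" for m' i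
        unfolding g_def w_def peel_def sum_component vector_scaleR_component real_scaleR_def
        by (intro Cm_on_sum Cm_on_mult Cm_on_prod Cm_on_diff Cm_on_const b)
      have sf: "smooth_field k g"
        unfolding smooth_field_def using gC gz exhaust_props(1,2)[where k=k and j="Suc j"] by blast
      have gm [measurable]: "g \<in> borel_measurable borel"
        by (rule borel_measurable_continuous_onI, rule continuous_on_vecI) (use gC[of 0] in simp)
      define E where "E x = (\<Sum>l<m. \<bar>b l x - indicator (A l) x\<bar>)" for x
      have pw: "(1 - e) * (dual_norm N (h x) * indicator (exhaust k j) x) \<le> g x \<bullet> h x + Cy * real m * E x" for x
      proof -
        define d where "d l = (indicator (A l) x :: real)" for l
        have disj: "peel d i = d i" for i
        proof (cases "x \<in> A i")
          case True
          then have "d l = 0" if "l < i" for l using that by (auto simp: d_def A_def)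
          then show ?thesis by (simp add: peel_def)
        qed (simp add: peel_def d_def)
        have yh: "\<bar>y i \<bullet> h x\<bar> \<le> Cy" if "i < m" for i
          using Cauchy_Schwarz_ineq2[of "y i" "h x"] mult_mono[OF Cy(2)[OF that] h1[of x]] Cy(1) by simp
        have "(\<Sum>i<m. d i * (y i \<bullet> h x)) - g x \<bullet> h x = (\<Sum>i<m. (d i - w i x) * (y i \<bullet> h x))"
          by (simp add: g_def inner_sum_left sum_subtractf left_diff_distrib)
        also have "\<dots> \<le> (\<Sum>i<m. E x * Cy)"
        proof (rule sum_mono)
          fix i assume i: "i \<in> {..<m}"
          have "\<bar>w i x - peel d i\<bar> \<le> E x"
            unfolding w_def E_def d_def[symmetric] by (rule peel_diff) (use b i in \<open>auto simp: d_def\<close>)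
          then have "\<bar>(d i - w i x) * (y i \<bullet> h x)\<bar> \<le> E x * Cy"
            unfolding abs_mult disj using yh[of i] i by (intro mult_mono) (auto simp: abs_minus_commute)
          then show "(d i - w i x) * (y i \<bullet> h x) \<le> E x * Cy" by linarith
        qed
        finally have 1: "(\<Sum>i<m. d i * (y i \<bullet> h x)) \<le> g x \<bullet> h x + Cy * real m * E x" by (simp add: mult_ac)
        have "(1 - e) * (dual_norm N (h x) * indicator (exhaust k j) x) \<le> (\<Sum>i<m. d i * (y i \<bullet> h x))"
        proof (cases "x \<in> exhaust k j")
          case True
          obtain v where "v \<in> Y" "(1 - e) * dual_norm N (h x) \<le> v \<bullet> h x" using Y(3) by blast
          then obtain i0 where i0: "i0 < m" "x \<in> P i0"
            using ys True by (auto simp: in_set_conv_nth m_def P_def y_def)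
          define i where "i = (LEAST i. x \<in> P i)"
          have iP: "x \<in> P i" unfolding i_def using i0(2) by (rule LeastI)
          have il: "x \<notin> P l" if "l < i" for l using not_less_Least[OF that[unfolded i_def]] .
          have "i \<le> i0" unfolding i_def using i0(2) by (rule Least_le)
          then have im: "i < m" using i0 by simp
          have iA: "x \<in> A i" using iP il by (auto simp: A_def)
          have "x \<notin> A l" if "l \<noteq> i" for l
          proof (cases "l < i")
            case True then show ?thesis using il by (auto simp: A_def)
          next
            case False then show ?thesis using iP that by (auto simp: A_def)
          qed
          then have "(\<Sum>l<m. d l * (y l \<bullet> h x)) = (\<Sum>l<m. if l = i then y i \<bullet> h x else 0)"
            using iA by (intro sum.cong) (auto simp: d_def)
          also have "\<dots> = y i \<bullet> h x" using im by simp
          finally show ?thesis using iP True by (simp add: P_def)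
        next
          case False
          then have "x \<notin> A l" for l by (auto simp: A_def P_def)
          then show ?thesis using False by (simp add: d_def)
        qed
        with 1 show ?thesis by linarith
      qed
      have Ej: "integrable M (\<lambda>x. E x * indicator (exhaust k (Suc j)) x)" "(LINT x|M. E x * indicator (exhaust k (Suc j)) x) \<le> real m * e'"
      proof -
        note [measurable_cong] = sMj
        note [measurable] = Am
        have E0: "0 \<le> E x" for x unfolding E_def by (intro sum_nonneg) auto
        have [measurable]: "E \<in> borel_measurable borel" unfolding E_def using Am by measurable
        have "(\<integral>\<^sup>+x. ennreal (E x * indicator (exhaust k (Suc j)) x) \<partial>M) = (\<integral>\<^sup>+x. ennreal (E x) \<partial>Mj)"
          unfolding Mj_def by (subst nn_integral_density) (auto simp: indicator_def intro!: nn_integral_cong)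
        also have "\<dots> = (\<Sum>l<m. \<integral>\<^sup>+x. ennreal \<bar>b l x - indicator (A l) x\<bar> \<partial>Mj)"
          unfolding E_def by (subst sum_ennreal[symmetric], simp, subst nn_integral_sum, measurable)
        also have "\<dots> \<le> (\<Sum>l<m. ennreal e')" using b(5) by (intro sum_mono less_imp_le)
        also have "\<dots> = ennreal (real m * e')" using e' by (simp add: ennreal_mult ennreal_of_nat_eq_real_of_nat)
        finally have le: "(\<integral>\<^sup>+x. ennreal (E x * indicator (exhaust k (Suc j)) x) \<partial>M) \<le> ennreal (real m * e')" .
        then show "integrable M (\<lambda>x. E x * indicator (exhaust k (Suc j)) x)"
          by (intro integrableI_nonneg) (auto simp: E0 sM intro: le_less_trans)
        show "(LINT x|M. E x * indicator (exhaust k (Suc j)) x) \<le> real m * e'"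
          using le e' E0 by (subst integral_eq_nn_integral) (auto simp: sM intro!: enn2real_leI)
      qed
      have gi: "integrable M (\<lambda>x. g x \<bullet> h x)"
      proof -
        obtain Cn where Cn: "0 < Cn" "\<And>x. Cn * norm x \<le> N x" by (rule is_norm_lower[OF N]) blast
        have "norm (g x \<bullet> h x) \<le> norm (1 / Cn * indicator (exhaust k (Suc j)) x)" for x
        proof (cases "x \<in> exhaust k (Suc j)")
          case True
          have "norm (g x) \<le> 1 / Cn" using Cn(2)[of "g x"] gN[of x] Cn(1) by (simp add: field_simps)
          then have "\<bar>g x \<bullet> h x\<bar> \<le> 1 / Cn * 1"
            using Cauchy_Schwarz_ineq2[of "g x" "h x"] mult_mono[OF _ h1[of x], of "norm (g x)" "1 / Cn"] Cn(1) by fastforce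
          then show ?thesis using True Cn(1) by simp
        qed (simp add: gz)
        then show ?thesis
          by (intro Bochner_Integration.integrable_bound[OF indi(2)[of "1 / Cn"]] AE_I2) measurable
      qed
      have "(1 - e) * I = (LINT x|M. (1 - e) * (dual_norm N (h x) * indicator (exhaust k j) x))" by (simp add: I_def)
      also have "\<dots> \<le> (LINT x|M. g x \<bullet> h x + Cy * real m * (E x * indicator (exhaust k (Suc j)) x))"
      proof (rule integral_mono)
        fix x
        show "(1 - e) * (dual_norm N (h x) * indicator (exhaust k j) x) \<le> g x \<bullet> h x + Cy * real m * (E x * indicator (exhaust k (Suc j)) x)"
        proof (cases "x \<in> exhaust k (Suc j)")
          case True then show ?thesis using pw[of x] by simp
        next
          case False
          then have "x \<notin> exhaust k j" using exhaust_props(3)[of k] by (auto simp: incseq_Suc_iff)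
          then show ?thesis using False gz[OF False] by simp
        qed
      qed (use integ gi Ej in auto)
      also have "\<dots> = (LINT x|M. g x \<bullet> h x) + Cy * real m * (LINT x|M. E x * indicator (exhaust k (Suc j)) x)"
        using gi Ej by simp
      also have "\<dots> \<le> c + Cy * real m * (real m * e')"
        using hyp[OF sf gN] Ej(2) Cy(1) by (intro add_mono mult_left_mono) auto
      also have "Cy * real m * (real m * e') \<le> e"
      proof -
        have "Cy * real m * (real m * e') = e * (Cy * real m * real m / (Cy * real m * real m + 1))" by (simp add: e'_def)
        also have "\<dots> \<le> e * 1" using e Cy by (intro mult_left_mono) (auto simp: divide_le_eq_1 add_nonneg_pos)
        finally show ?thesis by simp
      qed
      finally show ?thesis by simp
    qed
    then have ev: "eventually (\<lambda>e. (1 - e) * I \<le> c + e) (at_right 0)"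
      using eventually_at_right_real[of 0 "1::real", OF zero_less_one] by (rule eventually_mono[rotated]) auto
    have "I \<le> c"
    proof (rule tendsto_le[OF trivial_limit_at_right_real _ _ ev])
      show "((\<lambda>e. c + e) \<longlongrightarrow> c) (at_right 0)" by (auto intro!: tendsto_eq_intros)
      show "((\<lambda>e. (1 - e) * I) \<longlongrightarrow> I) (at_right 0)" by (auto intro!: tendsto_eq_intros)
    qed
    have "(\<integral>\<^sup>+x. ennreal (dual_norm N (h x)) * indicator (exhaust k j) x \<partial>M)
       = (\<integral>\<^sup>+x. ennreal (dual_norm N (h x) * indicator (exhaust k j) x) \<partial>M)"
      by (intro nn_integral_cong) (auto simp: indicator_def)
    also have "\<dots> = ennreal I" unfolding I_def by (rule nn_integral_eq_integral[OF integ]) (auto simp: dh0)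
    also have "\<dots> \<le> ennreal c" using \<open>I \<le> c\<close> by (rule ennreal_leI)
    finally show ?thesis .
  qed
  have "(\<integral>\<^sup>+x. ennreal (dual_norm N (h x)) \<partial>M) = (\<integral>\<^sup>+x. (SUP j. ennreal (dual_norm N (h x)) * indicator (exhaust k j) x) \<partial>M)"
    using AEH
  proof (intro nn_integral_cong_AE, elim eventually_mono)
    fix x assume "x \<in> halfspace k"
    then obtain j where "x \<in> exhaust k j" using exhaust_props(4)[of k] by blast
    then have "ennreal (dual_norm N (h x)) \<le> (SUP j. ennreal (dual_norm N (h x)) * indicator (exhaust k j) x)"
      by (intro SUP_upper2[of j]) auto
    moreover have "(SUP j. ennreal (dual_norm N (h x)) * indicator (exhaust k j) x) \<le> ennreal (dual_norm N (h x))"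
      by (intro SUP_least) (auto simp: indicator_def)
    ultimately show "ennreal (dual_norm N (h x)) = (SUP j. ennreal (dual_norm N (h x)) * indicator (exhaust k j) x)"
      by (rule antisym)
  qed
  also have "\<dots> = (SUP j. \<integral>\<^sup>+x. ennreal (dual_norm N (h x)) * indicator (exhaust k j) x \<partial>M)"
  proof (rule nn_integral_monotone_convergence_SUP)
    show "incseq (\<lambda>j x. ennreal (dual_norm N (h x)) * indicator (exhaust k j) x)"
      using exhaust_props(3)[of k] by (auto simp: incseq_def le_fun_def indicator_def)
  qed measurable
  also have "\<dots> \<le> ennreal c" by (intro SUP_least step)
  finally show ?thesis .
qed

section \<open>Functions of bounded weighted variation\<close>

text \<open>The gradient is a parameter, as the integration by parts formulas below refer to its components.\<close>

definition C1_supported :: "(real ^ 'n::finite) set \<Rightarrow> (real ^ 'n \<Rightarrow> real) \<Rightarrow> (real ^ 'n \<Rightarrow> real ^ 'n) \<Rightarrow> bool" where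
  "C1_supported K \<eta> G \<longleftrightarrow> compact K \<and> (\<forall>x. (\<eta> has_derivative (\<lambda>h. G x \<bullet> h)) (at x)) \<and> continuous_on UNIV G
     \<and> (\<forall>x. x \<notin> K \<longrightarrow> \<eta> x = 0)"

text \<open>The function vanishes on the complement of \<open>K\<close>, which is open.\<close>

lemma gradient_zero_outside:
  assumes "C1_supported K \<eta> G" "x \<notin> K"
  shows "G x = 0"
proof -
  have cl: "closed K" and d: "(\<eta> has_derivative (\<lambda>h. G x \<bullet> h)) (at x)" and z: "\<And>y. y \<notin> K \<Longrightarrow> \<eta> y = 0"
    using assms by (auto simp: C1_supported_def compact_imp_closed)
  have "((\<lambda>_. 0::real) has_derivative (\<lambda>h. 0)) (at x)" by simp
  then have "(\<eta> has_derivative (\<lambda>h. 0)) (at x)"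
    by (rule has_derivative_transform_within_open[of _ _ _ _ "- K"]) (use cl assms(2) z in auto)
  from has_derivative_unique[OF d this] have "G x \<bullet> G x = 0" by meson
  then show ?thesis by simp
qed

lemma C1_supported_shift:
  assumes "C1_supported K \<eta> G"
  shows "C1_supported ((\<lambda>y. y + x0) ` K) (\<lambda>y. \<eta> (y - x0)) (\<lambda>y. G (y - x0))"
  unfolding C1_supported_def
proof (intro conjI allI impI)
  have cp: "compact K" and d: "\<And>x. (\<eta> has_derivative (\<lambda>h. G x \<bullet> h)) (at x)" and c: "continuous_on UNIV G"
    and z: "\<And>x. x \<notin> K \<Longrightarrow> \<eta> x = 0" using assms by (auto simp: C1_supported_def)
  show "compact ((\<lambda>y. y + x0) ` K)" by (intro compact_continuous_image cp continuous_intros)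
  show "((\<lambda>y. \<eta> (y - x0)) has_derivative (\<lambda>h. G (x - x0) \<bullet> h)) (at x)" for x
  proof -
    have "((\<lambda>x. x - x0) has_derivative (\<lambda>h. h)) (at x)" by (auto intro!: derivative_eq_intros)
    from has_derivative_compose[OF this d] show ?thesis .
  qed
  show "continuous_on UNIV (\<lambda>y. G (y - x0))" by (rule continuous_on_compose2[OF c]) (auto intro: continuous_intros)
  show "\<eta> (x - x0) = 0" if "x \<notin> (\<lambda>y. y + x0) ` K" for x
    using that by (intro z) (metis diff_add_cancel image_eqI)
qed

lemma C1_supported_bounds:
  assumes \<eta>: "C1_supported K \<eta> G"
  obtains L where "0 < L" "\<And>x. norm (G x) \<le> L" "\<And>x. \<bar>\<eta> x\<bar> \<le> L" "\<And>x y. \<bar>\<eta> x - \<eta> y\<bar> \<le> L * norm (x - y)"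
proof -
  have cp: "compact K" and d: "\<And>x. (\<eta> has_derivative (\<lambda>h. G x \<bullet> h)) (at x)" and c: "continuous_on UNIV G"
    and z: "\<And>x. x \<notin> K \<Longrightarrow> \<eta> x = 0" using \<eta> by (auto simp: C1_supported_def)
  have ce: "continuous_on UNIV \<eta>" using d by (auto simp: continuous_on_eq_continuous_at intro: has_derivative_continuous)
  have "bounded (G ` K)" by (intro compact_imp_bounded compact_continuous_image cp continuous_on_subset[OF c]) auto
  then obtain L1 where L1: "0 < L1" "\<And>x. x \<in> K \<Longrightarrow> norm (G x) \<le> L1" by (auto simp: bounded_pos)
  have "bounded (\<eta> ` K)" by (intro compact_imp_bounded compact_continuous_image cp continuous_on_subset[OF ce]) auto
  then obtain L2 where L2: "0 < L2" "\<And>x. x \<in> K \<Longrightarrow> \<bar>\<eta> x\<bar> \<le> L2" by (auto simp: bounded_pos)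
  have G: "norm (G x) \<le> L1 + L2" for x
    using L1(1) L1(2)[of x] L2(1) gradient_zero_outside[OF \<eta>, of x] by (cases "x \<in> K") auto
  have e: "\<bar>\<eta> x\<bar> \<le> L1 + L2" for x
    using L1(1) L2(1) L2(2)[of x] z[of x] by (cases "x \<in> K") auto
  have "norm (\<eta> x - \<eta> y) \<le> (L1 + L2) * norm (x - y)" for x y
  proof (rule differentiable_bound[of UNIV])
    show "onorm (\<lambda>h. G x \<bullet> h) \<le> L1 + L2" for x
    proof (rule onorm_le)
      fix h show "norm (G x \<bullet> h) \<le> (L1 + L2) * norm h"
        using Cauchy_Schwarz_ineq2[of "G x" h] mult_right_mono[OF G[of x], of "norm h"] by simp
    qed
  qed (use d in auto)
  then show ?thesis using that[of "L1 + L2"] G e L1 L2 by simp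
qed

text \<open>Uniform continuity of the gradient makes the first order expansion uniform in the base point, as
  is needed for differentiation under an integral.\<close>

lemma C1_supported_uniform:
  fixes \<eta> :: "real ^ 'n::finite \<Rightarrow> real"
  assumes \<eta>: "C1_supported K \<eta> G" and e: "0 < e"
  obtains d where "0 < d" "\<And>w h. norm h < d \<Longrightarrow> \<bar>\<eta> (w + h) - \<eta> w - G w \<bullet> h\<bar> \<le> e * norm h"
proof -
  have cp: "compact K" and dv: "\<And>x. (\<eta> has_derivative (\<lambda>h. G x \<bullet> h)) (at x)" and c: "continuous_on UNIV G"
    and z: "\<And>x. x \<notin> K \<Longrightarrow> \<eta> x = 0" using \<eta> by (auto simp: C1_supported_def)
  define K1 where "K1 = (\<Union>x\<in>K. \<Union>y\<in>cball 0 1. {x + y})"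
  have cp1: "compact K1" unfolding K1_def by (intro compact_sums' cp) simp
  have "uniformly_continuous_on K1 G" by (rule compact_uniformly_continuous[OF continuous_on_subset[OF c] cp1]) simp
  then obtain d where d: "0 < d" "\<And>x y. x \<in> K1 \<Longrightarrow> y \<in> K1 \<Longrightarrow> dist y x < d \<Longrightarrow> dist (G y) (G x) < e"
    using e unfolding uniformly_continuous_on_def by metis
  have uc: "norm (G y - G x) \<le> e" if "norm (y - x) < min d 1" for x y
  proof -
    have near: "b \<in> K1" if "a \<in> K" "norm (b - a) \<le> 1" for a b
    proof -
      have "b = a + (b - a)" "b - a \<in> cball 0 1" using that by auto
      then show ?thesis using that unfolding K1_def by blast
    qed
    consider "x \<in> K" | "y \<in> K" | "x \<notin> K" "y \<notin> K" by blast
    then show ?thesis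
    proof cases
      case 1
      then show ?thesis using d(2)[of x y] near[of x x] near[of x y] that by (simp add: dist_norm less_imp_le)
    next
      case 2
      then show ?thesis using d(2)[of x y] near[of y y] near[of y x] that
        by (simp add: dist_norm less_imp_le norm_minus_commute)
    next
      case 3
      then show ?thesis using gradient_zero_outside[OF \<eta>] e by simp
    qed
  qed
  have "\<bar>\<eta> (w + h) - \<eta> w - G w \<bullet> h\<bar> \<le> e * norm h" if h: "norm h < min d 1" for w h
  proof -
    have "norm (\<eta> (w + h) - \<eta> w - G w \<bullet> ((w + h) - w)) \<le> norm ((w + h) - w) * e"
    proof (rule differentiable_bound_linearization[where S="ball w (min d 1)" and f'="\<lambda>x h. G x \<bullet> h" and ?x0.0=w])
      show "w + t *\<^sub>R (w + h - w) \<in> ball w (min d 1)" if "t \<in> {0..1}" for t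
        using that h mult_left_le_one_le[of "norm h" t] by (auto simp: dist_norm intro: le_less_trans)
      show "(\<eta> has_derivative (\<lambda>h. G x \<bullet> h)) (at x within ball w (min d 1))" for x
        by (rule has_derivative_at_withinI[OF dv])
      show "onorm ((\<lambda>h. G x \<bullet> h) - (\<lambda>h. G w \<bullet> h)) \<le> e" if "x \<in> ball w (min d 1)" for x
      proof (rule onorm_le)
        fix v :: "real ^ 'n"
        have "norm (G x - G w) \<le> e" using that by (intro uc) (simp add: dist_norm norm_minus_commute)
        then have "norm (G x - G w) * norm v \<le> e * norm v" by (rule mult_right_mono) simp
        then show "norm (((\<lambda>h. G x \<bullet> h) - (\<lambda>h. G w \<bullet> h)) v) \<le> e * norm v"
          using Cauchy_Schwarz_ineq2[of "G x - G w" v] by (simp add: inner_diff_left)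
      qed
      show "w \<in> ball w (min d 1)" using d by simp
    qed
    then show ?thesis by (simp add: mult.commute)
  qed
  then show ?thesis using that[of "min d 1"] d by simp
qed

text \<open>A function together with its derivative \<open>\<nu> \<mu>\<close> on the half-space, normalised: everything is Borel on the
  whole space, \<open>f\<close> vanishes outside the half-space, and \<open>|\<nu>| \<le> 1\<close> everywhere. Integration by parts is
  required for single components only.\<close>

locale bv_data =
  fixes N :: "real ^ 'n::finite \<Rightarrow> real" and k :: 'n and a :: real
    and f :: "real ^ 'n \<Rightarrow> real" and \<mu> :: "(real ^ 'n) measure" and \<nu> :: "real ^ 'n \<Rightarrow> real ^ 'n"
  assumes N: "is_norm N" and a: "0 \<le> a"
    and f_meas [measurable]: "f \<in> borel_measurable borel"
    and f_outside: "\<And>x. x \<notin> halfspace k \<Longrightarrow> f x = 0"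
    and f_loc: "\<And>K. compact K \<Longrightarrow> K \<subseteq> halfspace k \<Longrightarrow> integrable lborel (\<lambda>x. indicator K x * f x)"
    and sets_mu [measurable_cong]: "sets \<mu> = sets borel"
    and mu_fin: "\<And>K. compact K \<Longrightarrow> K \<subseteq> halfspace k \<Longrightarrow> emeasure \<mu> K < \<infinity>"
    and mu_AE: "AE x in \<mu>. x \<in> halfspace k"
    and nu_meas [measurable]: "\<nu> \<in> borel_measurable borel" and nu_le: "\<And>x. norm (\<nu> x) \<le> 1"
    and ibp: "\<And>K \<eta> G i. C1_supported K \<eta> G \<Longrightarrow> K \<subseteq> halfspace k \<Longrightarrow>
       (LINT x|lborel. f x * G x $ i) = - (LINT x|\<mu>. \<eta> x * \<nu> x $ i)"
begin

lemma integrable_f_mult: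
  assumes K: "compact K" "K \<subseteq> halfspace k" and c: "continuous_on UNIV c" "\<And>x. x \<notin> K \<Longrightarrow> c x = 0"
  shows "integrable lborel (\<lambda>x. f x * c x :: real)"
proof -
  have [measurable]: "c \<in> borel_measurable borel" by (rule borel_measurable_continuous_onI[OF c(1)])
  have "bounded (c ` K)" by (intro compact_imp_bounded compact_continuous_image K continuous_on_subset[OF c(1)]) auto
  then obtain B where B: "0 < B" "\<And>x. x \<in> K \<Longrightarrow> \<bar>c x\<bar> \<le> B" by (auto simp: bounded_pos)
  show ?thesis
  proof (rule Bochner_Integration.integrable_bound[OF integrable_mult_right[OF f_loc[OF K], of B]])
    show "AE x in lborel. norm (f x * c x) \<le> norm (B * (indicator K x * f x))"
    proof (rule AE_I2)
      fix x show "norm (f x * c x) \<le> norm (B * (indicator K x * f x))"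
        using B(1) mult_right_mono[OF B(2)[of x], of "\<bar>f x\<bar>"] c(2)[of x]
        by (cases "x \<in> K") (auto simp: abs_mult mult.commute)
    qed
  qed measurable
qed

lemma integrable_mu_mult:
  assumes K: "compact K" "K \<subseteq> halfspace k" and c: "continuous_on UNIV c" "\<And>x. x \<notin> K \<Longrightarrow> c x = 0"
    and h: "h \<in> borel_measurable borel" "\<And>x. \<bar>h x\<bar> \<le> C"
  shows "integrable \<mu> (\<lambda>x. c x * h x :: real)"
proof -
  have [measurable]: "c \<in> borel_measurable borel" by (rule borel_measurable_continuous_onI[OF c(1)])
  have [measurable]: "h \<in> borel_measurable borel" "K \<in> sets borel" using h K by (auto intro: borel_compact)
  have "bounded (c ` K)" by (intro compact_imp_bounded compact_continuous_image K continuous_on_subset[OF c(1)]) auto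
  then obtain B where B: "0 < B" "\<And>x. x \<in> K \<Longrightarrow> \<bar>c x\<bar> \<le> B" by (auto simp: bounded_pos)
  have "integrable \<mu> (\<lambda>x. B * C * indicator K x :: real)"
    using mu_fin[OF K] by (intro integrable_mult_right integrable_real_indicator) auto
  then show ?thesis
  proof (rule Bochner_Integration.integrable_bound)
    show "AE x in \<mu>. norm (c x * h x) \<le> norm (B * C * indicator K x)"
    proof (rule AE_I2)
      fix x
      have C: "0 \<le> C" using h(2)[of x] by linarith
      show "norm (c x * h x) \<le> norm (B * C * indicator K x)"
      proof (cases "x \<in> K")
        case True
        have "\<bar>c x\<bar> * \<bar>h x\<bar> \<le> B * C" using B h(2)[of x] True by (intro mult_mono) auto
        then show ?thesis using True C B(1) by (simp add: abs_mult)
      qed (simp add: c(2))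
    qed
  qed measurable
qed

lemma nu_component_meas [measurable]: "(\<lambda>y. \<nu> y $ i) \<in> borel_measurable borel"
proof -
  have "(\<lambda>y. \<nu> y \<bullet> axis i 1) \<in> borel_measurable borel" by measurable
  then show ?thesis by (simp add: inner_axis)
qed

lemma nu_component: "\<bar>\<nu> y $ i\<bar> \<le> 1"
  by (rule order_trans[OF component_le_norm_cart nu_le])

definition conv :: "(real ^ 'n \<Rightarrow> real) \<Rightarrow> real ^ 'n \<Rightarrow> real" where
  "conv \<eta> x = (LINT y|lborel. f y * \<eta> (y - x))"

definition conv_grad :: "(real ^ 'n \<Rightarrow> real) \<Rightarrow> real ^ 'n \<Rightarrow> real ^ 'n" where
  "conv_grad \<eta> x = (\<chi> i. LINT y|\<mu>. \<eta> (y - x) * \<nu> y $ i)"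

lemma conv_grad_inner:
  assumes \<eta>: "C1_supported K \<eta> G" and K: "(\<lambda>y. y + x) ` K \<subseteq> halfspace k"
  shows "conv_grad \<eta> x \<bullet> v = (LINT y|\<mu>. \<eta> (y - x) * (\<nu> y \<bullet> v))"
proof -
  note s = C1_supported_shift[OF \<eta>, of x]
  have cp: "compact ((\<lambda>y. y + x) ` K)" and z: "\<And>y. y \<notin> (\<lambda>y. y + x) ` K \<Longrightarrow> \<eta> (y - x) = 0"
    and c: "continuous_on UNIV (\<lambda>y. \<eta> (y - x))"
    using s unfolding C1_supported_def continuous_on_eq_continuous_at[OF open_UNIV] by (auto intro: has_derivative_continuous)
  have i: "integrable \<mu> (\<lambda>y. \<eta> (y - x) * \<nu> y $ i)" for i
    by (rule integrable_mu_mult[OF cp K c z _ nu_component]) measurable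
  have "conv_grad \<eta> x \<bullet> v = (\<Sum>i\<in>UNIV. (LINT y|\<mu>. \<eta> (y - x) * \<nu> y $ i) * v $ i)"
    by (simp add: inner_vec_def conv_grad_def)
  also have "\<dots> = (LINT y|\<mu>. (\<Sum>i\<in>UNIV. \<eta> (y - x) * \<nu> y $ i * v $ i))"
    using i by (subst Bochner_Integration.integral_sum) auto
  also have "\<dots> = (LINT y|\<mu>. \<eta> (y - x) * (\<nu> y \<bullet> v))"
    by (simp add: inner_vec_def sum_distrib_left mult.assoc)
  finally show ?thesis .
qed

text \<open>Differentiation under the integral puts the derivative on the kernel; integration by parts then
  moves it to \<open>f\<close>, where it becomes \<open>\<nu> \<mu>\<close>. The shifted support has to stay inside the half-space.\<close>

lemma conv_has_derivative:
  assumes \<eta>: "C1_supported K \<eta> G" and K: "(\<lambda>y. y + x) ` K \<subseteq> halfspace k"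
  shows "(conv \<eta> has_derivative (\<lambda>h. conv_grad \<eta> x \<bullet> h)) (at x)"
  unfolding has_derivative_at_alt
proof (intro conjI allI impI)
  show "bounded_linear (\<lambda>h. conv_grad \<eta> x \<bullet> h)" by (rule bounded_linear_inner_right)
  fix e :: real assume e: "0 < e"
  let ?K0 = "(\<lambda>y. y + x) ` K"
  note s = C1_supported_shift[OF \<eta>, of x]
  have cp: "compact ?K0" and z: "\<And>y. y \<notin> ?K0 \<Longrightarrow> \<eta> (y - x) = 0" and cG: "continuous_on UNIV (\<lambda>y. G (y - x))"
    using s by (auto simp: C1_supported_def)
  have c\<eta>: "continuous_on UNIV (\<lambda>y. \<eta> (y - x))" for x
    using C1_supported_shift[OF \<eta>, of x] unfolding C1_supported_def continuous_on_eq_continuous_at[OF open_UNIV]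
    by (auto intro: has_derivative_continuous)
  obtain \<delta> where \<delta>: "0 < \<delta>" "(\<Union>x\<in>?K0. cball x \<delta>) \<subseteq> halfspace k"
    using compact_subset_open_imp_cball_epsilon_subset[OF cp open_halfspace K] by blast
  define K1 where "K1 = (\<Union>y\<in>?K0. \<Union>w\<in>cball 0 \<delta>. {y + w})"
  have K1c: "compact K1" unfolding K1_def by (intro compact_sums' cp) simp
  have K1_eq: "y \<in> K1" if "u \<in> ?K0" "norm (y - u) \<le> \<delta>" for y u
  proof -
    have "y = u + (y - u)" "y - u \<in> cball 0 \<delta>" using that by auto
    then show ?thesis using that(1) unfolding K1_def by blast
  qed
  have K1H: "K1 \<subseteq> halfspace k"
  proof
    fix y assume "y \<in> K1"
    then obtain u w where "u \<in> ?K0" "w \<in> cball 0 \<delta>" "y = u + w" unfolding K1_def by blast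
    then have "y \<in> cball u \<delta>" by (simp add: dist_norm)
    then show "y \<in> halfspace k" using \<delta>(2) \<open>u \<in> ?K0\<close> by blast
  qed
  define F1 where "F1 = (LINT y|lborel. \<bar>indicator K1 y * f y\<bar>)"
  have F1i: "integrable lborel (\<lambda>y. \<bar>indicator K1 y * f y\<bar>)" using f_loc[OF K1c K1H] by (rule integrable_abs)
  have F1: "0 \<le> F1" unfolding F1_def by (rule integral_nonneg_AE) simp
  define e' where "e' = e / (F1 + 1)"
  have e': "0 < e'" "e' * F1 \<le> e" using e F1 by (auto simp: e'_def divide_le_eq mult_left_mono algebra_simps)
  obtain d where d: "0 < d" "\<And>w h. norm h < d \<Longrightarrow> \<bar>\<eta> (w + h) - \<eta> w - G w \<bullet> h\<bar> \<le> e' * norm h"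
    by (rule C1_supported_uniform[OF \<eta> e'(1)]) blast
  have gradi: "conv_grad \<eta> x $ i = - (LINT y|lborel. f y * G (y - x) $ i)" for i
    using ibp[OF s K, of i] by (simp add: conv_grad_def)
  have Gz: "G (y - x) = 0" if "y \<notin> ?K0" for y by (rule gradient_zero_outside[OF s that])
  have iG: "integrable lborel (\<lambda>y. f y * G (y - x) $ i)" for i
    by (rule integrable_f_mult[OF cp K]) (use cG Gz in \<open>auto intro!: continuous_intros\<close>)
  have iGh: "integrable lborel (\<lambda>y. f y * (G (y - x) \<bullet> h))" for h
    by (rule integrable_f_mult[OF cp K]) (use cG Gz in \<open>auto intro!: continuous_intros\<close>)
  have grad: "conv_grad \<eta> x \<bullet> h = - (LINT y|lborel. f y * (G (y - x) \<bullet> h))" for h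
  proof -
    have "conv_grad \<eta> x \<bullet> h = - (\<Sum>i\<in>UNIV. (LINT y|lborel. f y * G (y - x) $ i) * h $ i)"
      by (simp add: inner_vec_def gradi sum_negf)
    also have "(\<Sum>i\<in>UNIV. (LINT y|lborel. f y * G (y - x) $ i) * h $ i) = (LINT y|lborel. (\<Sum>i\<in>UNIV. f y * G (y - x) $ i * h $ i))"
      using iG by (subst Bochner_Integration.integral_sum) auto
    also have "\<dots> = (LINT y|lborel. f y * (G (y - x) \<bullet> h))"
      by (simp add: inner_vec_def sum_distrib_left mult.assoc)
    finally show ?thesis .
  qed
  show "\<exists>d>0. \<forall>x'. norm (x' - x) < d \<longrightarrow> norm (conv \<eta> x' - conv \<eta> x - conv_grad \<eta> x \<bullet> (x' - x)) \<le> e * norm (x' - x)"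
  proof (intro exI[of _ "min d \<delta>"] conjI allI impI)
    show "0 < min d \<delta>" using d \<delta> by simp
    fix x' assume x': "norm (x' - x) < min d \<delta>"
    define h where "h = x' - x"
    have z': "\<eta> (y - x') = 0" if "y \<notin> K1" for y
    proof -
      have "y - h \<notin> ?K0"
      proof
        assume "y - h \<in> ?K0"
        then have "y \<in> K1" using x' by (intro K1_eq[of "y - h"]) (auto simp: h_def)
        then show False using that by simp
      qed
      then have "\<eta> ((y - h) - x) = 0" by (rule z)
      then show ?thesis by (simp add: h_def)
    qed
    have z0: "y \<notin> ?K0" if "y \<notin> K1" for y using K1_eq[of y y] that \<delta>(1) by auto
    have i1: "integrable lborel (\<lambda>y. f y * \<eta> (y - x'))" by (rule integrable_f_mult[OF K1c K1H c\<eta> z'])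
    have i2: "integrable lborel (\<lambda>y. f y * \<eta> (y - x))" by (rule integrable_f_mult[OF cp K c\<eta> z])
    have "conv \<eta> x' - conv \<eta> x - conv_grad \<eta> x \<bullet> h
       = (LINT y|lborel. f y * \<eta> (y - x') - f y * \<eta> (y - x) + f y * (G (y - x) \<bullet> h))"
      unfolding conv_def grad using i1 i2 iGh by simp
    also have "norm \<dots> \<le> (LINT y|lborel. e' * norm h * \<bar>indicator K1 y * f y\<bar>)"
    proof (rule Bochner_Integration.integral_norm_bound_integral)
      show "integrable lborel (\<lambda>y. f y * \<eta> (y - x') - f y * \<eta> (y - x) + f y * (G (y - x) \<bullet> h))"
        using i1 i2 iGh by simp
      show "integrable lborel (\<lambda>y. e' * norm h * \<bar>indicator K1 y * f y\<bar>)" using F1i by simp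
      fix y
      show "norm (f y * \<eta> (y - x') - f y * \<eta> (y - x) + f y * (G (y - x) \<bullet> h)) \<le> e' * norm h * \<bar>indicator K1 y * f y\<bar>"
      proof (cases "y \<in> K1")
        case True
        have "norm (- h) < d" using x' by (simp add: h_def norm_minus_commute)
        from d(2)[OF this, of "y - x"]
        have "\<bar>\<eta> (y - x') - \<eta> (y - x) + G (y - x) \<bullet> h\<bar> \<le> e' * norm h"
          by (simp add: h_def algebra_simps norm_minus_commute)
        then have "\<bar>f y\<bar> * \<bar>\<eta> (y - x') - \<eta> (y - x) + G (y - x) \<bullet> h\<bar> \<le> \<bar>f y\<bar> * (e' * norm h)"
          by (rule mult_left_mono) simp
        then show ?thesis using True by (simp add: abs_mult[symmetric] algebra_simps)
      next
        case False
        then show ?thesis using z'[OF False] z[OF z0[OF False]] Gz[OF z0[OF False]] by simp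
      qed
    qed
    also have "\<dots> = (e' * F1) * norm h" by (simp add: F1_def)
    also have "\<dots> \<le> e * norm h" by (rule mult_right_mono[OF e'(2)]) simp
    finally show "norm (conv \<eta> x' - conv \<eta> x - conv_grad \<eta> x \<bullet> (x' - x)) \<le> e * norm (x' - x)" by (simp add: h_def)
  qed
qed

end

locale bv_function = bv_data N k a f \<mu> \<nu>
  for N :: "real ^ 'n::finite \<Rightarrow> real" and k :: 'n and a :: real and f \<mu> \<nu> +
  fixes V :: real
  assumes V0: "0 \<le> V" and V: "(\<integral>\<^sup>+x. ennreal (weight k a x * dual_norm N (\<nu> x)) \<partial>\<mu>) \<le> ennreal V"
begin

lemma weight_mono: "x \<in> halfspace k \<Longrightarrow> x $ k \<le> y $ k \<Longrightarrow> weight k a x \<le> weight k a y"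
  using a by (auto simp: weight_def halfspace_def intro: powr_mono2)

lemma halfspace_add: "x \<in> halfspace k \<Longrightarrow> 0 \<le> z $ k \<Longrightarrow> x + z \<in> halfspace k"
  by (simp add: halfspace_def)

lemma variation_integral_le:
  assumes h: "h \<in> borel_measurable borel" "\<And>y. y \<in> halfspace k \<Longrightarrow> \<bar>h y\<bar> \<le> weight k a y * dual_norm N (\<nu> y) * c" and c: "0 \<le> c"
  shows "\<bar>LINT y|\<mu>. h y\<bar> \<le> c * V"
proof -
  have [measurable]: "h \<in> borel_measurable borel" by (rule h)
  have [measurable]: "(\<lambda>y. dual_norm N (\<nu> y)) \<in> borel_measurable borel"
    by (rule is_norm_measurable[OF is_norm_dual_norm[OF N] nu_meas])
  have "ennreal \<bar>LINT y|\<mu>. h y\<bar> \<le> (\<integral>\<^sup>+y. ennreal \<bar>h y\<bar> \<partial>\<mu>)"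
    using integral_norm_bound_ennreal[of \<mu> h] integrable_iff_bounded
    by (cases "integrable \<mu> h") (auto simp: not_integrable_integral_eq)
  also have "\<dots> \<le> (\<integral>\<^sup>+y. ennreal c * ennreal (weight k a y * dual_norm N (\<nu> y)) \<partial>\<mu>)"
    using mu_AE
  proof (intro nn_integral_mono_AE, elim eventually_mono)
    fix y assume "y \<in> halfspace k"
    from h(2)[OF this] show "ennreal \<bar>h y\<bar> \<le> ennreal c * ennreal (weight k a y * dual_norm N (\<nu> y))"
      using c by (subst ennreal_mult'[symmetric]) (auto intro!: ennreal_leI simp: mult_ac)
  qed
  also have "\<dots> = ennreal c * (\<integral>\<^sup>+y. ennreal (weight k a y * dual_norm N (\<nu> y)) \<partial>\<mu>)"
    by (rule nn_integral_cmult) measurable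
  also have "\<dots> \<le> ennreal c * ennreal V" by (rule mult_left_mono[OF V]) simp
  finally show ?thesis using c V0 by (simp add: ennreal_mult'[symmetric])
qed

end

lemma is_norm_norm: "is_norm (norm :: 'a::real_normed_vector \<Rightarrow> real)"
  by (simp add: is_norm_def norm_triangle_ineq)

lemma integral_lborel_shift:
  fixes z :: "real ^ 'n::finite" and g :: "real ^ 'n \<Rightarrow> real"
  assumes [measurable]: "g \<in> borel_measurable borel"
  shows "(LINT x|lborel. g (x + z)) = (LINT x|lborel. g x)"
    and "integrable lborel (\<lambda>x. g (x + z)) = integrable lborel g"
proof -
  have "(LINT x|lborel. g x) = (LINT x|distr lborel borel ((+) z). g x)"
    by (simp add: lborel_distr_plus)
  also have "\<dots> = (LINT x|lborel. g (z + x))" by (rule integral_distr) auto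
  finally show "(LINT x|lborel. g (x + z)) = (LINT x|lborel. g x)" by (simp add: add.commute)
  have "integrable lborel g = integrable (distr lborel borel ((+) z)) g"
    by (simp add: lborel_distr_plus)
  also have "\<dots> = integrable lborel (\<lambda>x. g (z + x))" by (rule integrable_distr_eq) auto
  finally show "integrable lborel (\<lambda>x. g (x + z)) = integrable lborel g" by (simp add: add.commute)
qed

text \<open>The weight is smooth on the open half-space only, so the product is glued from there and from the
  complement of the support.\<close>

lemma C1_supported_weight:
  fixes \<psi> :: "real ^ 'n::finite \<Rightarrow> real"
  assumes C: "Cm_on 1 UNIV \<psi>" and K: "compact K" "K \<subseteq> halfspace k" and z: "\<And>x. x \<notin> K \<Longrightarrow> \<psi> x = 0"
  obtains G where "C1_supported K (\<lambda>x. indicator (halfspace k) x * weight k a x * \<psi> x) G"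
proof -
  let ?H = "halfspace k"
  obtain P where P: "\<And>x. (\<psi> has_derivative (\<lambda>h. P x \<bullet> h)) (at x)" "\<And>i. continuous_on UNIV (\<lambda>x. P x $ i)"
    using C by auto
  have Pc: "continuous_on UNIV P" by (rule continuous_on_vecI[OF P(2)])
  have Pz: "P x = 0" if "x \<notin> K" for x
    by (rule gradient_zero_outside[of K \<psi> P]) (use K P(1) Pc z that in \<open>auto simp: C1_supported_def\<close>)
  define \<eta> where "\<eta> x = indicator ?H x * weight k a x * \<psi> x" for x
  define G where "G x = (if x \<in> ?H then (\<psi> x * (a * x $ k powr (a - 1))) *\<^sub>R axis k 1 + weight k a x *\<^sub>R P x else 0)" for x
  have Gz: "G x = 0" if "x \<notin> K" for x using that z Pz by (simp add: G_def)
  have dH: "(\<eta> has_derivative (\<lambda>h. G x \<bullet> h)) (at x)" if x: "x \<in> ?H" for x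
  proof -
    have xk: "0 < x $ k" using x by (simp add: halfspace_def)
    have 1: "((\<lambda>x. x $ k) has_derivative (\<lambda>h. h $ k)) (at x)"
      by (rule bounded_linear_imp_has_derivative[OF bounded_linear_vec_nth])
    have "((\<lambda>t. t powr a) has_derivative (\<lambda>h. a * x $ k powr (a - 1) * h)) (at (x $ k))"
      using has_real_derivative_powr[OF xk, of a] by (simp add: has_field_derivative_def)
    from has_derivative_compose[OF 1 this]
    have 2: "(weight k a has_derivative (\<lambda>h. a * x $ k powr (a - 1) * h $ k)) (at x)" by (simp add: weight_def[abs_def])
    have "((\<lambda>x. weight k a x * \<psi> x) has_derivative (\<lambda>h. G x \<bullet> h)) (at x)"
    proof (rule has_derivative_eq_rhs[OF has_derivative_mult[OF 2 P(1)]])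
      show "(\<lambda>h. weight k a x * (P x \<bullet> h) + a * x $ k powr (a - 1) * h $ k * \<psi> x) = (\<lambda>h. G x \<bullet> h)"
        using x by (simp add: G_def inner_add_left inner_axis' fun_eq_iff)
    qed
    then show ?thesis
      by (rule has_derivative_transform_within_open[of _ _ _ _ ?H]) (use x in \<open>auto simp: \<eta>_def\<close>)
  qed
  have cl: "open (- K)" using K(1) by (simp add: compact_imp_closed open_Compl)
  have d: "(\<eta> has_derivative (\<lambda>h. G x \<bullet> h)) (at x)" for x
  proof (cases "x \<in> ?H")
    case False
    then have xK: "x \<in> - K" using K by blast
    have "((\<lambda>_. 0::real) has_derivative (\<lambda>h. 0)) (at x)" by simp
    then have "(\<eta> has_derivative (\<lambda>h. 0)) (at x)"
      by (rule has_derivative_transform_within_open[OF _ cl xK]) (simp add: \<eta>_def z)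
    then show ?thesis using Gz[of x] xK by simp
  qed (rule dH)
  have "continuous_on ?H G"
  proof -
    have c\<psi>: "continuous_on UNIV \<psi>" using P(1) by (auto simp: continuous_on_eq_continuous_at intro: has_derivative_continuous)
    have "continuous_on ?H (\<lambda>x. (\<psi> x * (a * x $ k powr (a - 1))) *\<^sub>R axis k (1::real) + weight k a x *\<^sub>R P x)"
      unfolding weight_def
      by (intro continuous_intros continuous_on_subset[OF c\<psi>] continuous_on_subset[OF Pc]) (auto simp: halfspace_def)
    then show ?thesis by (rule continuous_on_eq) (simp add: G_def)
  qed
  moreover have "continuous_on (- K) G"
    by (rule continuous_on_eq[OF continuous_on_const[of _ 0]]) (simp add: Gz)
  ultimately have "continuous_on (?H \<union> - K) G" by (intro continuous_on_open_Un cl) auto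
  moreover have "?H \<union> - K = UNIV" using K by blast
  ultimately have "continuous_on UNIV G" by simp
  then have "C1_supported K \<eta> G" using d K(1) z by (auto simp: C1_supported_def \<eta>_def)
  then show ?thesis using that by (simp add: \<eta>_def[abs_def])
qed

context bv_function
begin

text \<open>Translations into the half-space move \<open>f\<close> in the weighted \<open>L\<^sup>1\<close> norm by at most \<open>N z\<close> times the variation.
  By duality it suffices to integrate the difference against functions \<open>\<eta>\<close> with \<open>|\<eta>| \<le> \<omega>\<close>, and
  this integral is the increment of \<open>\<phi> s = \<integral> f(y) \<eta>(y - s z) dy\<close> from \<open>s = 0\<close> to \<open>s = 1\<close>. In its derivative
  \<open>|\<eta>(y - s z)| \<le> \<omega>(y - s z) \<le> \<omega>(y)\<close>: here it is used that the weight increases in the direction \<open>z\<close>.\<close>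

lemma translation_estimate:
  assumes z: "z \<in> halfspace k"
  shows "(\<integral>\<^sup>+x. ennreal \<bar>f (x + z) - f x\<bar> \<partial>weighted_lborel k a) \<le> ennreal (N z * V)"
proof -
  let ?H = "halfspace k"
  have zk: "0 < z $ k" using z by (simp add: halfspace_def)
  define \<Delta> where "\<Delta> x = f (x + z) - f x" for x
  have [measurable]: "\<Delta> \<in> borel_measurable borel" unfolding \<Delta>_def by measurable
  define dens where "dens x = indicator ?H x * weight k a x * \<bar>\<Delta> x\<bar>" for x
  have [measurable]: "dens \<in> borel_measurable borel" unfolding dens_def by measurable
  have dens0: "0 \<le> dens x" for x by (simp add: dens_def)
  define M where "M = density lborel (\<lambda>x. ennreal (dens x))"
  \<comment> \<open>The scalar duality is read off from the vector one: \<open>h\<close> is \<open>sgn \<Delta>\<close> times a fixed unit vector.\<close>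
  define h where "h x = sgn (\<Delta> x) *\<^sub>R (axis k 1 :: real ^ 'n)" for x
  have [measurable]: "h \<in> borel_measurable borel" unfolding h_def by measurable
  have sM: "sets M = sets borel" by (simp add: M_def)
  have \<Delta>_loc: "integrable lborel (\<lambda>x. indicator K x * \<bar>\<Delta> x\<bar>)" if K: "compact K" "K \<subseteq> ?H" for K
  proof -
    have K': "compact ((\<lambda>x. x + z) ` K)" "(\<lambda>x. x + z) ` K \<subseteq> ?H"
    proof -
      show "compact ((\<lambda>x. x + z) ` K)" by (intro compact_continuous_image continuous_intros K(1))
      have "x + z \<in> ?H" if "x \<in> K" for x using K(2) that zk by (intro halfspace_add) auto
      then show "(\<lambda>x. x + z) ` K \<subseteq> ?H" by blast
    qed
    have [measurable]: "K \<in> sets borel" "(\<lambda>x. x + z) ` K \<in> sets borel" using K K' by (auto intro: borel_compact)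
    have "integrable lborel (\<lambda>x. indicator ((\<lambda>x. x + z) ` K) (x + z) * f (x + z))"
      using f_loc[OF K'] by (subst integral_lborel_shift(2)[of "\<lambda>x. indicator ((\<lambda>x. x + z) ` K) x * f x"]) auto
    moreover have "indicator ((\<lambda>x. x + z) ` K) (x + z) = (indicator K x :: real)" for x
      by (auto simp: indicator_def)
    ultimately have "integrable lborel (\<lambda>x. indicator K x * f (x + z))" by simp
    then have "integrable lborel (\<lambda>x. \<bar>indicator K x * f (x + z) - indicator K x * f x\<bar>)"
      using f_loc[OF K] by (intro integrable_abs Bochner_Integration.integrable_diff)
    then show ?thesis by (simp add: \<Delta>_def right_diff_distrib[symmetric] abs_mult)
  qed
  have main: "(\<integral>\<^sup>+x. ennreal (dual_norm norm (h x)) \<partial>M) \<le> ennreal (N z * V)"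
  proof (rule dual_norm_integral_le[OF is_norm_norm sM])
    show "emeasure M K < \<infinity>" if K: "compact K" "K \<subseteq> ?H" for K
    proof -
      have [measurable]: "K \<in> sets borel" using K by (auto intro: borel_compact)
      obtain r where r: "0 < r" "\<And>x. x \<in> K \<Longrightarrow> norm x \<le> r" using compact_imp_bounded[OF K(1)] by (auto simp: bounded_pos)
      have le: "dens x * indicator K x \<le> r powr a * (indicator K x * \<bar>\<Delta> x\<bar>)" for x
      proof (cases "x \<in> K")
        case True
        have "0 < x $ k" "x $ k \<le> r"
          using True K r(2)[OF True] component_le_norm_cart[of x k] by (auto simp: halfspace_def)
        then have "weight k a x \<le> r powr a" using a by (auto simp: weight_def intro: powr_mono2)
        then have "weight k a x * \<bar>\<Delta> x\<bar> \<le> r powr a * \<bar>\<Delta> x\<bar>" by (rule mult_right_mono) simp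
        moreover have "x \<in> ?H" using True K(2) by blast
        ultimately show ?thesis using True by (simp add: dens_def)
      qed simp
      have "emeasure M K = (\<integral>\<^sup>+x. ennreal (dens x) * indicator K x \<partial>lborel)"
        unfolding M_def by (rule emeasure_density) auto
      also have "\<dots> \<le> (\<integral>\<^sup>+x. ennreal (r powr a * (indicator K x * \<bar>\<Delta> x\<bar>)) \<partial>lborel)"
      proof (rule nn_integral_mono)
        fix x show "ennreal (dens x) * indicator K x \<le> ennreal (r powr a * (indicator K x * \<bar>\<Delta> x\<bar>))"
          using ennreal_leI[OF le[of x]] by (cases "x \<in> K") auto
      qed
      also have "\<dots> < \<infinity>"
        using integrableD(2)[OF integrable_mult_right[OF \<Delta>_loc[OF K], of "r powr a"]]
        by (simp add: less_top abs_mult)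
      finally show ?thesis .
    qed
    show "AE x in M. x \<in> ?H" unfolding M_def by (subst AE_density) (auto simp: dens_def indicator_def)
    show "norm (h x) \<le> 1" for x by (simp add: h_def norm_axis_1 abs_sgn_eq)
    fix g :: "real ^ 'n \<Rightarrow> real ^ 'n" assume g: "smooth_field k g" and g1: "\<And>x. norm (g x) \<le> 1"
    obtain K where K: "compact K" "K \<subseteq> ?H" "\<And>x. x \<notin> K \<Longrightarrow> g x = 0" using g by (auto simp: smooth_field_def)
    have gC: "Cm_on 1 UNIV (\<lambda>x. g x $ k)" using g by (simp add: smooth_field_def del: One_nat_def)
    define \<eta> where "\<eta> x = indicator ?H x * weight k a x * g x $ k" for x
    obtain G where \<eta>: "C1_supported K \<eta> G"
      by (rule C1_supported_weight[OF gC K(1,2), of a]) (use K(3) \<eta>_def[abs_def] in auto)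
    have c\<eta>: "continuous_on UNIV \<eta>" and \<eta>z: "\<And>x. x \<notin> K \<Longrightarrow> \<eta> x = 0"
      using \<eta> unfolding C1_supported_def continuous_on_eq_continuous_at[OF open_UNIV] by (auto intro: has_derivative_continuous)
    have [measurable]: "\<eta> \<in> borel_measurable borel" by (rule borel_measurable_continuous_onI[OF c\<eta>])
    have \<eta>le: "\<bar>\<eta> x\<bar> \<le> indicator ?H x * weight k a x" for x
    proof -
      have "\<bar>g x $ k\<bar> \<le> 1" using component_le_norm_cart[of "g x" k] g1[of x] by linarith
      then show ?thesis by (simp add: \<eta>_def abs_mult indicator_def mult_left_le)
    qed
    have gm: "g \<in> borel_measurable borel"
    proof (rule borel_measurable_continuous_onI, rule continuous_on_vecI)
      fix i
      have "Cm_on 0 UNIV (\<lambda>x. g x $ i)" using g unfolding smooth_field_def by blast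
      then show "continuous_on UNIV (\<lambda>x. g x $ i)" by simp
    qed
    have Ks: "(\<lambda>y. y + s *\<^sub>R z) ` K \<subseteq> ?H" if "0 \<le> s" for s
    proof -
      have "y + s *\<^sub>R z \<in> ?H" if "y \<in> K" for y using K(2) that zk \<open>0 \<le> s\<close> by (intro halfspace_add) auto
      then show ?thesis by blast
    qed
    define \<phi> where "\<phi> s = conv \<eta> (s *\<^sub>R z)" for s
    have d\<phi>: "(\<phi> has_real_derivative (LINT y|\<mu>. \<eta> (y - s *\<^sub>R z) * (\<nu> y \<bullet> z))) (at s)" if s: "0 \<le> s" for s
    proof -
      have 1: "((\<lambda>s. s *\<^sub>R z) has_derivative (\<lambda>t. t *\<^sub>R z)) (at s)" by (auto intro!: derivative_eq_intros)
      have "(\<phi> has_derivative (\<lambda>t. conv_grad \<eta> (s *\<^sub>R z) \<bullet> (t *\<^sub>R z))) (at s)"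
        unfolding \<phi>_def by (rule has_derivative_compose[OF 1 conv_has_derivative[OF \<eta> Ks[OF s]]])
      moreover have "conv_grad \<eta> (s *\<^sub>R z) \<bullet> (t *\<^sub>R z) = (LINT y|\<mu>. \<eta> (y - s *\<^sub>R z) * (\<nu> y \<bullet> z)) * t" for t
        using conv_grad_inner[OF \<eta> Ks[OF s], of z] by simp
      ultimately have "(\<phi> has_derivative (\<lambda>t. (LINT y|\<mu>. \<eta> (y - s *\<^sub>R z) * (\<nu> y \<bullet> z)) * t)) (at s)" by (simp only:)
      then show ?thesis by (simp only: has_field_derivative_def)
    qed
    have bound: "\<bar>LINT y|\<mu>. \<eta> (y - s *\<^sub>R z) * (\<nu> y \<bullet> z)\<bar> \<le> N z * V" if s: "0 \<le> s" for s
    proof (rule variation_integral_le)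
      fix y assume y: "y \<in> ?H"
      have "\<bar>\<eta> (y - s *\<^sub>R z)\<bar> \<le> weight k a y"
      proof (cases "y - s *\<^sub>R z \<in> ?H")
        case True
        have "\<bar>\<eta> (y - s *\<^sub>R z)\<bar> \<le> weight k a (y - s *\<^sub>R z)" using \<eta>le[of "y - s *\<^sub>R z"] True by simp
        also have "\<dots> \<le> weight k a y" by (rule weight_mono[OF True]) (use s zk in simp)
        finally show ?thesis .
      next
        case False then show ?thesis using \<eta>le[of "y - s *\<^sub>R z"] by simp
      qed
      moreover have "\<bar>\<nu> y \<bullet> z\<bar> \<le> dual_norm N (\<nu> y) * N z"
        using inner_le_dual_norm[OF N, of "\<nu> y" z] inner_le_dual_norm[OF N, of "\<nu> y" "- z"]
        by (simp add: abs_le_iff is_normD(5)[OF N])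
      ultimately show "\<bar>\<eta> (y - s *\<^sub>R z) * (\<nu> y \<bullet> z)\<bar> \<le> weight k a y * dual_norm N (\<nu> y) * N z"
        unfolding abs_mult mult.assoc by (intro mult_mono) auto
    qed (use is_normD(1)[OF N] in auto)
    have mvt: "\<phi> 1 - \<phi> 0 \<le> N z * V"
    proof -
      have "\<exists>s>0. s < 1 \<and> \<phi> 1 - \<phi> 0 = (1 - 0) * (LINT y|\<mu>. \<eta> (y - s *\<^sub>R z) * (\<nu> y \<bullet> z))"
        by (rule MVT2) (use d\<phi> in auto)
      then obtain s where "0 < s" "\<phi> 1 - \<phi> 0 = (LINT y|\<mu>. \<eta> (y - s *\<^sub>R z) * (\<nu> y \<bullet> z))" by auto
      then show ?thesis using bound[of s] by simp
    qed
    have i1: "integrable lborel (\<lambda>y. f y * \<eta> (y - z))"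
      by (rule integrable_f_mult[of "(\<lambda>y. y + z) ` K"])
        (use C1_supported_shift[OF \<eta>, of z] Ks[of 1] in \<open>auto simp: C1_supported_def continuous_on_eq_continuous_at intro: has_derivative_continuous\<close>)
    have i0: "integrable lborel (\<lambda>y. f y * \<eta> y)" by (rule integrable_f_mult[OF K(1,2) c\<eta> \<eta>z])
    have i1': "integrable lborel (\<lambda>x. f (x + z) * \<eta> x)"
      using i1 by (subst (asm) integral_lborel_shift(2)[symmetric, of _ z]) auto
    have "(LINT x|M. g x \<bullet> h x) = (LINT x|lborel. dens x *\<^sub>R (g x \<bullet> h x))"
      unfolding M_def using gm dens0 by (intro integral_density) auto
    also have "\<dots> = (LINT x|lborel. f (x + z) * \<eta> x - f x * \<eta> x)"
    proof (rule Bochner_Integration.integral_cong[OF refl])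
      fix x
      have "dens x *\<^sub>R (g x \<bullet> h x) = (indicator ?H x * weight k a x * g x $ k) * (\<bar>\<Delta> x\<bar> * sgn (\<Delta> x))"
        by (simp add: dens_def h_def inner_axis)
      also have "\<bar>\<Delta> x\<bar> * sgn (\<Delta> x) = \<Delta> x" by (rule abs_mult_sgn)
      finally show "dens x *\<^sub>R (g x \<bullet> h x) = f (x + z) * \<eta> x - f x * \<eta> x"
        by (simp add: \<eta>_def \<Delta>_def algebra_simps)
    qed
    also have "\<dots> = (LINT x|lborel. f (x + z) * \<eta> x) - (LINT x|lborel. f x * \<eta> x)" using i0 i1' by simp
    also have "(LINT x|lborel. f (x + z) * \<eta> x) = (LINT y|lborel. f y * \<eta> (y - z))"
      by (subst integral_lborel_shift(1)[symmetric, of _ z]) auto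
    finally have "(LINT x|M. g x \<bullet> h x) = \<phi> 1 - \<phi> 0" by (simp add: \<phi>_def conv_def)
    then show "(LINT x|M. g x \<bullet> h x) \<le> N z * V" using mvt by simp
  qed measurable
  have "(\<integral>\<^sup>+x. ennreal \<bar>\<Delta> x\<bar> \<partial>weighted_lborel k a) = (\<integral>\<^sup>+x. ennreal (dens x) \<partial>lborel)"
    by (subst nn_integral_weighted_lborel) (auto intro!: nn_integral_cong simp: dens_def ennreal_mult'')
  also have "\<dots> \<le> (\<integral>\<^sup>+x. ennreal (dens x) * ennreal (dual_norm norm (h x)) \<partial>lborel)"
  proof (rule nn_integral_mono)
    fix x
    show "ennreal (dens x) \<le> ennreal (dens x) * ennreal (dual_norm norm (h x))"
    proof (cases "\<Delta> x = 0")
      case False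
      have "norm (h x) \<le> 1" by (simp add: h_def norm_axis_1 abs_sgn_eq)
      then have "h x \<bullet> h x \<le> dual_norm norm (h x)" by (rule dual_norm_upper[OF is_norm_norm])
      moreover have "h x \<bullet> h x = 1" using False by (simp add: h_def inner_axis sgn_if)
      ultimately have "1 \<le> dual_norm norm (h x)" by simp
      then have "ennreal (dens x) * 1 \<le> ennreal (dens x) * ennreal (dual_norm norm (h x))"
        by (intro mult_left_mono) auto
      then show ?thesis by simp
    qed (simp add: dens_def)
  qed
  also have "\<dots> = (\<integral>\<^sup>+x. ennreal (dual_norm norm (h x)) \<partial>M)"
    unfolding M_def
    by (rule nn_integral_density[symmetric]) (auto intro: measurable_compose[OF is_norm_measurable[OF is_norm_dual_norm[OF is_norm_norm]]] is_norm_measurable[OF is_norm_dual_norm[OF is_norm_norm]])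
  finally show ?thesis using main by (simp add: \<Delta>_def)
qed

end

section \<open>Mollification\<close>

text \<open>Fatou's lemma in the form in which \<open>L\<^sup>p\<close> bounds pass to limits.\<close>

lemma fatou_powr:
  fixes F :: "'a \<Rightarrow> real" and Fi :: "nat \<Rightarrow> 'a \<Rightarrow> real"
  assumes meas [measurable]: "\<And>i. Fi i \<in> borel_measurable M" "F \<in> borel_measurable M"
    and nn: "\<And>i x. 0 \<le> Fi i x" and lim: "AE x in M. (\<lambda>i. Fi i x) \<longlonglongrightarrow> F x" and p: "0 < p"
    and bnd: "\<And>i. (\<integral>\<^sup>+x. ennreal (Fi i x powr p) \<partial>M) \<le> ennreal (c i)" and c: "c \<longlonglongrightarrow> c'"
  shows "(\<integral>\<^sup>+x. ennreal (F x powr p) \<partial>M) \<le> ennreal c'"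
proof -
  have "(\<integral>\<^sup>+x. ennreal (F x powr p) \<partial>M) = (\<integral>\<^sup>+x. liminf (\<lambda>i. ennreal (Fi i x powr p)) \<partial>M)"
    using lim
  proof (intro nn_integral_cong_AE, elim eventually_mono)
    fix x assume l: "(\<lambda>i. Fi i x) \<longlonglongrightarrow> F x"
    have "(\<lambda>i. Fi i x powr p) \<longlonglongrightarrow> F x powr p"
      by (rule tendsto_powr'[OF l tendsto_const]) (use nn p in \<open>auto intro: always_eventually\<close>)
    then have "(\<lambda>i. ennreal (Fi i x powr p)) \<longlonglongrightarrow> ennreal (F x powr p)" by (rule tendsto_ennrealI)
    then show "ennreal (F x powr p) = liminf (\<lambda>i. ennreal (Fi i x powr p))"
      by (rule lim_imp_Liminf[symmetric, rotated]) simp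
  qed
  also have "\<dots> \<le> liminf (\<lambda>i. \<integral>\<^sup>+x. ennreal (Fi i x powr p) \<partial>M)"
    by (rule nn_integral_liminf) measurable
  also have "\<dots> \<le> liminf (\<lambda>i. ennreal (c i))" by (intro Liminf_mono always_eventually allI bnd)
  also have "\<dots> = ennreal c'" by (rule lim_imp_Liminf[OF _ tendsto_ennrealI[OF c]]) simp
  finally show ?thesis .
qed

lemma nn_integral_lborel_reflect:
  fixes y :: "real ^ 'n::finite"
  assumes [measurable]: "g \<in> borel_measurable borel"
  shows "(\<integral>\<^sup>+x. g (y - x) \<partial>lborel) = (\<integral>\<^sup>+x. g x \<partial>lborel)"
proof -
  have "lborel = density (distr lborel borel (\<lambda>x. y + (-1) *\<^sub>R x)) (\<lambda>_. ennreal (\<bar>-1\<bar>^DIM(real^'n)))"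
    by (rule lborel_affine) simp
  then have eq: "lborel = distr lborel borel (\<lambda>x. y - x)" by (simp add: density_1)
  have "(\<integral>\<^sup>+x. g x \<partial>lborel) = (\<integral>\<^sup>+x. g x \<partial>distr lborel borel (\<lambda>x. y - x))" using eq by simp
  also have "\<dots> = (\<integral>\<^sup>+x. g (y - x) \<partial>lborel)" by (rule nn_integral_distr) auto
  finally show ?thesis by simp
qed

text \<open>The support lies strictly above the boundary hyperplane, so that convolution with this kernel uses
  only values of \<open>f\<close> inside the half-space, even at points close to its boundary.\<close>

lemma mollifier_exists:
  fixes k :: "'n::finite"
  assumes r: "0 < r"
  obtains \<rho> G where "C1_supported (cball ((2 * r) *\<^sub>R axis k 1) r) \<rho> G" "\<And>x. 0 \<le> \<rho> x"
    "(\<integral>\<^sup>+x. ennreal (\<rho> x) \<partial>lborel) = 1"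
proof -
  define c where "c = (2 * r) *\<^sub>R (axis k 1 :: real ^ 'n)"
  define g where "g x = flat_exp (r\<^sup>2 - (x - c) \<bullet> (x - c))" for x
  have gC: "Cm_on m UNIV g" for m unfolding g_def by (rule smooth_ball_bump(1))
  have g0: "0 \<le> g x" for x unfolding g_def by (rule flat_exp_bounds)
  have gpos: "0 < g x \<longleftrightarrow> x \<in> ball c r" for x unfolding g_def by (rule smooth_ball_bump(2)[OF r])
  have gz: "g x = 0" if "x \<notin> cball c r" for x using gpos[of x] g0[of x] that by force
  have gc: "continuous_on UNIV g" using gC[of 0] by simp
  have [measurable]: "g \<in> borel_measurable borel" by (rule borel_measurable_continuous_onI[OF gc])
  have "integrable lborel (\<lambda>x. indicator (cball c r) x *\<^sub>R g x)"
    by (rule borel_integrable_compact) (use gc in \<open>auto intro: continuous_on_subset\<close>)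
  also have "(\<lambda>x. indicator (cball c r) x *\<^sub>R g x) = g" using gz by (auto simp: indicator_def fun_eq_iff)
  finally have gi: "integrable lborel g" .
  define I where "I = (LINT x|lborel. g x)"
  have I: "(\<integral>\<^sup>+x. ennreal (g x) \<partial>lborel) = ennreal I"
    unfolding I_def by (rule nn_integral_eq_integral[OF gi]) (simp add: g0)
  have "I \<noteq> 0"
  proof
    assume "I = 0"
    then have "(\<integral>\<^sup>+x. ennreal (g x) \<partial>lborel) = 0" using I by simp
    then have "AE x in lborel. ennreal (g x) = 0" by (subst (asm) nn_integral_0_iff_AE) auto
    then have "AE x in lborel. x \<notin> ball c r" by (rule eventually_mono) (use gpos g0 in \<open>auto simp: ennreal_eq_0_iff not_le[symmetric]\<close>)
    then have "ball c r \<in> null_sets lborel" by (subst AE_iff_null_sets) auto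
    then have "negligible (ball c r)" by (auto simp: negligible_iff_null_sets null_sets_completionI)
    then show False using open_not_negligible[OF open_ball, of c r] r by simp
  qed
  then have I0: "0 < I" using g0 unfolding I_def by (simp add: less_le integral_nonneg_AE)
  define \<rho> where "\<rho> x = (1 / I) * g x" for x
  have \<rho>C: "Cm_on 1 UNIV \<rho>" unfolding \<rho>_def by (rule Cm_on_mult[OF Cm_on_const gC])
  obtain G where G: "\<And>x. (\<rho> has_derivative (\<lambda>h. G x \<bullet> h)) (at x)" "\<And>i. continuous_on UNIV (\<lambda>x. G x $ i)"
    using \<rho>C by auto
  show ?thesis
  proof (rule that[of \<rho> G])
    show "C1_supported (cball ((2 * r) *\<^sub>R axis k 1) r) \<rho> G"
      using G(1) continuous_on_vecI[OF G(2)] gz unfolding C1_supported_def c_def[symmetric] by (simp add: \<rho>_def)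
    show "0 \<le> \<rho> x" for x using I0 g0 by (simp add: \<rho>_def)
    have "(\<integral>\<^sup>+x. ennreal (\<rho> x) \<partial>lborel) = ennreal (1 / I) * ennreal I"
    proof -
      have "ennreal (\<rho> x) = ennreal (1 / I) * ennreal (g x)" for x
        unfolding \<rho>_def by (rule ennreal_mult) (use I0 g0 in auto)
      then show ?thesis unfolding I[symmetric] by (simp only: nn_integral_cmult[symmetric] measurable_lborel1 measurable_compose[OF _ measurable_ennreal])
          (rule nn_integral_cmult, measurable)
    qed
    also have "\<dots> = 1" using I0 by (simp add: ennreal_mult'[symmetric] del: divide_const_simps)
    finally show "(\<integral>\<^sup>+x. ennreal (\<rho> x) \<partial>lborel) = 1" .
  qed
qed

lemma mollifier_support:
  fixes k :: "'n::finite"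
  assumes z: "z \<in> cball ((2 * r) *\<^sub>R axis k 1 :: real ^ 'n) r" and r: "0 < r"
  shows "r \<le> z $ k" "norm z \<le> 3 * r" "z \<in> halfspace k"
proof -
  let ?c = "(2 * r) *\<^sub>R axis k 1 :: real ^ 'n"
  have d: "norm (z - ?c) \<le> r" using z by (simp add: dist_norm norm_minus_commute)
  have "\<bar>(z - ?c) $ k\<bar> \<le> r" by (rule order_trans[OF component_le_norm_cart d])
  then show 1: "r \<le> z $ k" by simp
  have "norm ?c = 2 * r" using r by (simp add: norm_axis_1)
  then show "norm z \<le> 3 * r" using norm_triangle_ineq2[of z ?c] d by linarith
  show "z \<in> halfspace k" using 1 r by (simp add: halfspace_def)
qed

context bv_function
begin

lemma sigma_finite_mu: "sigma_finite_measure \<mu>"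
proof
  have sp: "space \<mu> = UNIV" using sets_eq_imp_space_eq[OF sets_mu] by simp
  let ?A = "insert (- halfspace k) (range (exhaust k))"
  show "\<exists>A. countable A \<and> A \<subseteq> sets \<mu> \<and> \<Union>A = space \<mu> \<and> (\<forall>a\<in>A. emeasure \<mu> a \<noteq> \<infinity>)"
  proof (intro exI[of _ ?A] conjI ballI)
    show "countable ?A" by simp
    show "?A \<subseteq> sets \<mu>" using exhaust_props(6)[where k=k] by (auto simp: sets_mu)
    show "\<Union>?A = space \<mu>" using exhaust_props(4)[where k=k] sp by auto
    fix A assume A: "A \<in> ?A"
    have "emeasure \<mu> (- halfspace k) = 0"
      using mu_AE by (subst (asm) AE_iff_measurable[OF _ refl]) (auto simp: sets_mu sp Compl_eq)
    moreover have "emeasure \<mu> (exhaust k j) \<noteq> \<infinity>" for j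
      using mu_fin[OF exhaust_props(1)[where k=k and j=j] exhaust_props(2)[where k=k and j=j]] by simp
    ultimately show "emeasure \<mu> A \<noteq> \<infinity>" using A by auto
  qed
qed

context
  fixes r :: real and \<rho> :: "real ^ 'n \<Rightarrow> real" and G :: "real ^ 'n \<Rightarrow> real ^ 'n" and K :: "(real ^ 'n) set"
  assumes r: "0 < r" and K_def: "K = cball ((2 * r) *\<^sub>R axis k 1) r"
    and \<rho>: "C1_supported K \<rho> G" and \<rho>0: "\<And>x. 0 \<le> \<rho> x" and \<rho>1: "(\<integral>\<^sup>+x. ennreal (\<rho> x) \<partial>lborel) = 1"
begin

lemma K_in: "z \<in> K \<Longrightarrow> r \<le> z $ k" "z \<in> K \<Longrightarrow> norm z \<le> 3 * r" "z \<in> K \<Longrightarrow> z \<in> halfspace k"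
  unfolding K_def using mollifier_support[of z r k] r by auto

lemma shift_K: "x \<in> halfspace k \<Longrightarrow> (\<lambda>y. y + x) ` K \<subseteq> halfspace k"
  using K_in(1) r by (force simp: halfspace_def)

lemma rho_outside: "x \<notin> K \<Longrightarrow> \<rho> x = 0"
  using \<rho> by (simp add: C1_supported_def)

lemma rho_cont: "continuous_on UNIV \<rho>"
  using \<rho> unfolding C1_supported_def continuous_on_eq_continuous_at[OF open_UNIV] by (auto intro: has_derivative_continuous)

lemma rho_cont_shift: "continuous_on A (\<lambda>y. \<rho> (y - x))"
  by (rule continuous_on_compose2[OF rho_cont]) (auto intro: continuous_intros)

lemma rho_meas [measurable]: "\<rho> \<in> borel_measurable borel"
  by (rule borel_measurable_continuous_onI[OF rho_cont])

text \<open>The mollified measure \<open>\<parallel>\<nu>\<parallel>\<^sub>* \<mu>\<close>, as a function.\<close>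

definition slope :: "real ^ 'n \<Rightarrow> real" where
  "slope x = indicator (halfspace k) x * (LINT y|\<mu>. \<rho> (y - x) * dual_norm N (\<nu> y))"

lemma dual_nu_meas [measurable]: "(\<lambda>y. dual_norm N (\<nu> y)) \<in> borel_measurable borel"
  by (rule is_norm_measurable[OF is_norm_dual_norm[OF N] nu_meas])

lemma dual_nu_nonneg: "0 \<le> dual_norm N (\<nu> y)"
  by (rule is_normD(1)[OF is_norm_dual_norm[OF N]])

lemma dual_nu_bound: "\<exists>C. \<forall>y. \<bar>dual_norm N (\<nu> y)\<bar> \<le> C"
proof -
  obtain C where C: "0 < C" "\<And>x. dual_norm N x \<le> C * norm x" by (rule is_norm_upper[OF is_norm_dual_norm[OF N]]) blast
  have "\<bar>dual_norm N (\<nu> y)\<bar> \<le> C" for y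
    using C(2)[of "\<nu> y"] mult_left_mono[OF nu_le[of y] less_imp_le[OF C(1)]] dual_nu_nonneg[of y] by simp
  then show ?thesis by blast
qed

lemma slope_integrable:
  assumes x: "x \<in> halfspace k"
  shows "integrable \<mu> (\<lambda>y. \<rho> (y - x) * dual_norm N (\<nu> y))"
    and "integrable \<mu> (\<lambda>y. \<rho> (y - x) * (\<nu> y \<bullet> v))"
proof -
  have cp: "compact ((\<lambda>y. y + x) ` K)" and z: "\<And>y. y \<notin> (\<lambda>y. y + x) ` K \<Longrightarrow> \<rho> (y - x) = 0"
    using C1_supported_shift[OF \<rho>, of x] by (auto simp: C1_supported_def)
  obtain C where C: "\<And>y. \<bar>dual_norm N (\<nu> y)\<bar> \<le> C" using dual_nu_bound by blast
  show "integrable \<mu> (\<lambda>y. \<rho> (y - x) * dual_norm N (\<nu> y))"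
    by (rule integrable_mu_mult[OF cp shift_K[OF x] rho_cont_shift z dual_nu_meas C])
  have b: "\<bar>\<nu> y \<bullet> v\<bar> \<le> norm v" for y
    using Cauchy_Schwarz_ineq2[of "\<nu> y" v] mult_right_mono[OF nu_le[of y], of "norm v"] by simp
  show "integrable \<mu> (\<lambda>y. \<rho> (y - x) * (\<nu> y \<bullet> v))"
    by (rule integrable_mu_mult[OF cp shift_K[OF x] rho_cont_shift z _ b]) measurable
qed

lemma slope_nonneg: "0 \<le> slope x"
  unfolding slope_def by (intro mult_nonneg_nonneg integral_nonneg_AE) (auto simp: \<rho>0 dual_nu_nonneg)

lemma slope_meas [measurable]: "slope \<in> borel_measurable borel"
proof -
  interpret mu: sigma_finite_measure \<mu> by (rule sigma_finite_mu)
  have "(\<lambda>x. LINT y|\<mu>. \<rho> (y - x) * dual_norm N (\<nu> y)) \<in> borel_measurable borel" by measurable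
  then show ?thesis unfolding slope_def by measurable
qed

lemma conv_grad_le_slope:
  assumes x: "x \<in> halfspace k"
  shows "dual_norm N (conv_grad \<rho> x) \<le> slope x"
proof (rule dual_norm_least[OF N])
  fix v assume v: "N v \<le> 1"
  have "conv_grad \<rho> x \<bullet> v = (LINT y|\<mu>. \<rho> (y - x) * (\<nu> y \<bullet> v))" by (rule conv_grad_inner[OF \<rho> shift_K[OF x]])
  also have "\<dots> \<le> (LINT y|\<mu>. \<rho> (y - x) * dual_norm N (\<nu> y))"
    by (intro integral_mono slope_integrable[OF x] mult_left_mono dual_norm_upper[OF N v] \<rho>0)
  also have "\<dots> = slope x" using x by (simp add: slope_def)
  finally show "conv_grad \<rho> x \<bullet> v \<le> slope x" .
qed

text \<open>Mollifying from above does not increase the weighted variation: the mass at \<open>y\<close> is spread to points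
  \<open>x\<close> with \<open>x\<^sub>k \<le> y\<^sub>k\<close>, where the weight is not larger than at \<open>y\<close>.\<close>

lemma slope_integral: "(\<integral>\<^sup>+x. ennreal (slope x) \<partial>weighted_lborel k a) \<le> ennreal V"
proof -
  let ?W = "weighted_lborel k a"
  interpret mu: sigma_finite_measure \<mu> by (rule sigma_finite_mu)
  interpret W: sigma_finite_measure ?W by (rule sigma_finite_weighted_lborel)
  interpret P: pair_sigma_finite ?W \<mu> ..
  have [measurable]: "(\<lambda>(x, y). ennreal (\<rho> (y - x) * dual_norm N (\<nu> y))) \<in> borel_measurable (?W \<Otimes>\<^sub>M \<mu>)"
    by measurable
  have "(\<integral>\<^sup>+x. ennreal (slope x) \<partial>?W) = (\<integral>\<^sup>+x. (\<integral>\<^sup>+y. ennreal (\<rho> (y - x) * dual_norm N (\<nu> y)) \<partial>\<mu>) \<partial>?W)"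
    using AE_weighted_halfspace[of k a]
  proof (intro nn_integral_cong_AE, elim eventually_mono)
    fix x assume x: "x \<in> halfspace k"
    show "ennreal (slope x) = (\<integral>\<^sup>+y. ennreal (\<rho> (y - x) * dual_norm N (\<nu> y)) \<partial>\<mu>)"
      using x by (subst nn_integral_eq_integral[OF slope_integrable(1)[OF x]]) (auto simp: slope_def \<rho>0 dual_nu_nonneg)
  qed
  also have "\<dots> = (\<integral>\<^sup>+y. (\<integral>\<^sup>+x. ennreal (\<rho> (y - x) * dual_norm N (\<nu> y)) \<partial>?W) \<partial>\<mu>)"
    by (rule P.Fubini'[symmetric]) simp
  also have "\<dots> \<le> (\<integral>\<^sup>+y. ennreal (weight k a y * dual_norm N (\<nu> y)) \<partial>\<mu>)"
    using mu_AE
  proof (intro nn_integral_mono_AE, elim eventually_mono)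
    fix y assume y: "y \<in> halfspace k"
    have "(\<integral>\<^sup>+x. ennreal (\<rho> (y - x) * dual_norm N (\<nu> y)) \<partial>?W)
       = (\<integral>\<^sup>+x. ennreal (indicator (halfspace k) x * weight k a x) * ennreal (\<rho> (y - x) * dual_norm N (\<nu> y)) \<partial>lborel)"
      by (rule nn_integral_weighted_lborel) measurable
    also have "\<dots> \<le> (\<integral>\<^sup>+x. ennreal (weight k a y * dual_norm N (\<nu> y)) * ennreal (\<rho> (y - x)) \<partial>lborel)"
    proof (rule nn_integral_mono)
      fix x
      have "indicator (halfspace k) x * weight k a x * (\<rho> (y - x) * dual_norm N (\<nu> y)) \<le> weight k a y * dual_norm N (\<nu> y) * \<rho> (y - x)"
      proof (cases "y - x \<in> K \<and> x \<in> halfspace k")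
        case True
        then have "weight k a x \<le> weight k a y" using K_in(1)[of "y - x"] r by (intro weight_mono) auto
        then have "weight k a x * (\<rho> (y - x) * dual_norm N (\<nu> y)) \<le> weight k a y * (\<rho> (y - x) * dual_norm N (\<nu> y))"
          by (rule mult_right_mono) (simp add: \<rho>0 dual_nu_nonneg)
        then show ?thesis using True by (simp add: mult_ac)
      next
        case False
        then have "indicator (halfspace k) x * weight k a x * (\<rho> (y - x) * dual_norm N (\<nu> y)) = 0"
          using rho_outside[of "y - x"] by auto
        also have "0 \<le> weight k a y * dual_norm N (\<nu> y) * \<rho> (y - x)" by (simp add: \<rho>0 dual_nu_nonneg)
        finally show ?thesis .
      qed
      then show "ennreal (indicator (halfspace k) x * weight k a x) * ennreal (\<rho> (y - x) * dual_norm N (\<nu> y))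
         \<le> ennreal (weight k a y * dual_norm N (\<nu> y)) * ennreal (\<rho> (y - x))"
        by (subst (1 2) ennreal_mult[symmetric]) (auto intro!: ennreal_leI simp: \<rho>0 dual_nu_nonneg)
    qed
    also have "\<dots> = ennreal (weight k a y * dual_norm N (\<nu> y)) * (\<integral>\<^sup>+x. ennreal (\<rho> (y - x)) \<partial>lborel)"
      by (rule nn_integral_cmult) measurable
    also have "(\<integral>\<^sup>+x. ennreal (\<rho> (y - x)) \<partial>lborel) = 1"
      using nn_integral_lborel_reflect[of "\<lambda>x. ennreal (\<rho> x)" y] \<rho>1 by simp
    finally show "(\<integral>\<^sup>+x. ennreal (\<rho> (y - x) * dual_norm N (\<nu> y)) \<partial>?W) \<le> ennreal (weight k a y * dual_norm N (\<nu> y))" by simp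
  qed
  also have "\<dots> \<le> ennreal V" by (rule V)
  finally show ?thesis .
qed

lemma conv_integrable:
  assumes x: "x \<in> halfspace k"
  shows "integrable lborel (\<lambda>y. f y * \<rho> (y - x))"
proof -
  have cp: "compact ((\<lambda>y. y + x) ` K)" and z: "\<And>y. y \<notin> (\<lambda>y. y + x) ` K \<Longrightarrow> \<rho> (y - x) = 0"
    using C1_supported_shift[OF \<rho>, of x] by (auto simp: C1_supported_def)
  show ?thesis by (rule integrable_f_mult[OF cp shift_K[OF x] rho_cont_shift z])
qed

lemma conv_lipschitz:
  "\<exists>L\<ge>0. \<forall>x\<in>halfspace k. \<forall>x'\<in>halfspace k. norm x \<le> R \<longrightarrow> norm x' \<le> R \<longrightarrow> \<bar>conv \<rho> x - conv \<rho> x'\<bar> \<le> L * norm (x - x')"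
proof -
  obtain L where L: "0 < L" "\<And>x y. \<bar>\<rho> x - \<rho> y\<bar> \<le> L * norm (x - y)" by (rule C1_supported_bounds[OF \<rho>]) blast
  define B where "B = {y :: real ^ 'n. r \<le> y $ k} \<inter> cball 0 (R + 3 * r)"
  have B: "compact B" "B \<subseteq> halfspace k"
    using r unfolding B_def by (auto simp: halfspace_def intro!: closed_Int_compact closed_Collect_le continuous_intros)
  define F where "F = (LINT y|lborel. \<bar>indicator B y * f y\<bar>)"
  have Fi: "integrable lborel (\<lambda>y. \<bar>indicator B y * f y\<bar>)" using f_loc[OF B] by (rule integrable_abs)
  have F: "0 \<le> F" unfolding F_def by (rule integral_nonneg_AE) simp
  have zero: "\<rho> (y - x) = 0" if "y \<notin> B" "x \<in> halfspace k" "norm x \<le> R" for x y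
  proof (rule rho_outside, rule notI)
    assume "y - x \<in> K"
    from K_in(1)[OF this] K_in(2)[OF this] have "r \<le> (y - x) $ k" "norm (y - x) \<le> 3 * r" .
    then have "y \<in> B" using that norm_triangle_ineq2[of y x] by (auto simp: B_def halfspace_def)
    then show False using that by simp
  qed
  have "\<bar>conv \<rho> x - conv \<rho> x'\<bar> \<le> (L * F) * norm (x - x')"
    if x: "x \<in> halfspace k" "norm x \<le> R" and x': "x' \<in> halfspace k" "norm x' \<le> R" for x x'
  proof -
    have "conv \<rho> x - conv \<rho> x' = (LINT y|lborel. f y * \<rho> (y - x) - f y * \<rho> (y - x'))"
      unfolding conv_def using conv_integrable x x' by simp
    also have "norm \<dots> \<le> (LINT y|lborel. L * norm (x - x') * \<bar>indicator B y * f y\<bar>)"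
    proof (rule Bochner_Integration.integral_norm_bound_integral)
      fix y
      show "norm (f y * \<rho> (y - x) - f y * \<rho> (y - x')) \<le> L * norm (x - x') * \<bar>indicator B y * f y\<bar>"
      proof (cases "y \<in> B")
        case True
        have "\<bar>\<rho> (y - x) - \<rho> (y - x')\<bar> \<le> L * norm (x - x')" using L(2)[of "y - x" "y - x'"] by (simp add: norm_minus_commute)
        then have "\<bar>f y\<bar> * \<bar>\<rho> (y - x) - \<rho> (y - x')\<bar> \<le> \<bar>f y\<bar> * (L * norm (x - x'))" by (rule mult_left_mono) simp
        then show ?thesis using True by (simp add: abs_mult[symmetric] algebra_simps)
      next
        case False then show ?thesis using zero x x' by simp
      qed
    qed (use conv_integrable x x' Fi in auto)
    also have "\<dots> = (L * F) * norm (x - x')" by (simp add: F_def)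
    finally show ?thesis by simp
  qed
  then show ?thesis using L F by (intro exI[of _ "L * F"]) auto
qed

text \<open>The difference is an average of translation differences over \<open>z \<in> K\<close>, and \<open>N z \<le> 3 C r\<close> there.\<close>

lemma conv_approx:
  assumes C: "0 \<le> C" "\<And>x. N x \<le> C * norm x"
  shows "(\<integral>\<^sup>+x. ennreal \<bar>indicator (halfspace k) x * conv \<rho> x - f x\<bar> \<partial>weighted_lborel k a) \<le> ennreal (C * (3 * r) * V)"
proof -
  let ?W = "weighted_lborel k a"
  interpret W: sigma_finite_measure ?W by (rule sigma_finite_weighted_lborel)
  interpret P: pair_sigma_finite ?W "lborel :: (real ^ 'n) measure" ..
  have [measurable]: "(\<lambda>(x, z). ennreal (\<rho> z * \<bar>f (x + z) - f x\<bar>)) \<in> borel_measurable (?W \<Otimes>\<^sub>M lborel)"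
    by measurable
  have \<rho>i: "integrable lborel \<rho>" and \<rho>I: "(LINT z|lborel. \<rho> z) = 1"
    using \<rho>1 \<rho>0 by (auto intro: integrableI_nonneg simp: integral_eq_nn_integral)
  have "(\<integral>\<^sup>+x. ennreal \<bar>indicator (halfspace k) x * conv \<rho> x - f x\<bar> \<partial>?W)
     \<le> (\<integral>\<^sup>+x. (\<integral>\<^sup>+z. ennreal (\<rho> z * \<bar>f (x + z) - f x\<bar>) \<partial>lborel) \<partial>?W)"
    using AE_weighted_halfspace[of k a]
  proof (intro nn_integral_mono_AE, elim eventually_mono)
    fix x assume x: "x \<in> halfspace k"
    have i: "integrable lborel (\<lambda>z. f (z + x) * \<rho> z)"
      using conv_integrable[OF x] integral_lborel_shift(2)[of "\<lambda>y. f y * \<rho> (y - x)" x] by simp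
    have "conv \<rho> x = (LINT z|lborel. f (z + x) * \<rho> z)"
      unfolding conv_def using integral_lborel_shift(1)[of "\<lambda>y. f y * \<rho> (y - x)" x] by simp
    then have "conv \<rho> x - f x = (LINT z|lborel. f (z + x) * \<rho> z - f x * \<rho> z)"
      using i \<rho>i \<rho>I by simp
    also have "ennreal (norm \<dots>) \<le> (\<integral>\<^sup>+z. ennreal (norm (f (z + x) * \<rho> z - f x * \<rho> z)) \<partial>lborel)"
      by (rule integral_norm_bound_ennreal) (use i \<rho>i in simp)
    also have "\<dots> = (\<integral>\<^sup>+z. ennreal (\<rho> z * \<bar>f (x + z) - f x\<bar>) \<partial>lborel)"
    proof (intro nn_integral_cong arg_cong[where f=ennreal])
      fix z
      have "f (z + x) * \<rho> z - f x * \<rho> z = \<rho> z * (f (x + z) - f x)" by (simp add: algebra_simps)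
      then show "norm (f (z + x) * \<rho> z - f x * \<rho> z) = \<rho> z * \<bar>f (x + z) - f x\<bar>" by (simp add: abs_mult \<rho>0)
    qed
    finally show "ennreal \<bar>indicator (halfspace k) x * conv \<rho> x - f x\<bar> \<le> (\<integral>\<^sup>+z. ennreal (\<rho> z * \<bar>f (x + z) - f x\<bar>) \<partial>lborel)"
      using x by simp
  qed
  also have "\<dots> = (\<integral>\<^sup>+z. (\<integral>\<^sup>+x. ennreal (\<rho> z * \<bar>f (x + z) - f x\<bar>) \<partial>?W) \<partial>lborel)"
    by (rule P.Fubini'[symmetric]) simp
  also have "\<dots> \<le> (\<integral>\<^sup>+z. ennreal (C * (3 * r) * V) * ennreal (\<rho> z) \<partial>lborel)"
  proof (rule nn_integral_mono)
    fix z :: "real ^ 'n"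
    show "(\<integral>\<^sup>+x. ennreal (\<rho> z * \<bar>f (x + z) - f x\<bar>) \<partial>?W) \<le> ennreal (C * (3 * r) * V) * ennreal (\<rho> z)"
    proof (cases "z \<in> K")
      case True
      have "(\<integral>\<^sup>+x. ennreal (\<rho> z * \<bar>f (x + z) - f x\<bar>) \<partial>?W) = ennreal (\<rho> z) * (\<integral>\<^sup>+x. ennreal \<bar>f (x + z) - f x\<bar> \<partial>?W)"
        by (subst nn_integral_cmult[symmetric]) (auto simp: ennreal_mult' \<rho>0)
      also have "\<dots> \<le> ennreal (\<rho> z) * ennreal (N z * V)"
        by (intro mult_left_mono translation_estimate K_in(3)[OF True]) simp
      also have "\<dots> \<le> ennreal (\<rho> z) * ennreal (C * (3 * r) * V)"
      proof (intro mult_left_mono ennreal_leI mult_right_mono V0)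
        show "N z \<le> C * (3 * r)" using C(2)[of z] mult_left_mono[OF K_in(2)[OF True] C(1)] by linarith
      qed simp
      finally show ?thesis by (simp add: mult.commute)
    qed (simp add: rho_outside)
  qed
  also have "\<dots> = ennreal (C * (3 * r) * V)" by (subst nn_integral_cmult) (auto simp: \<rho>1)
  finally show ?thesis .
qed

text \<open>The mollified function \<open>u\<close> is locally Lipschitz with upper slope \<open>slope\<close>. To reach the bounded Lipschitz
  functions of bounded support of \<open>sobolev_upper_slope\<close>, \<open>|u|\<close> is truncated to \<open>w = min (max (|u| - 1/j) 0) j\<close> with a large integer \<open>j\<close>
  and multiplied by a slowly decaying cut-off \<open>\<kappa>\<close>. The truncation does not increase the slope; the cut-off
  costs a multiple of \<open>w / m\<close>, \<open>m\<close> being its radius, and the integral of this tends to 0 because \<open>w\<close> is integrable: this is where the finite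
  measure of the superlevel sets of \<open>f\<close> enters.\<close>

lemma sobolev_mollified:
  assumes D: "1 < wdim k a" and p: "p = wdim k a / (wdim k a - 1)"
    and lev: "\<And>t. 0 < t \<Longrightarrow> emeasure (weighted_lborel k a) {x \<in> halfspace k. t < \<bar>f x\<bar>} < \<infinity>"
  shows "(\<integral>\<^sup>+x. ennreal (\<bar>indicator (halfspace k) x * conv \<rho> x\<bar> powr p) \<partial>weighted_lborel k a)
      \<le> ennreal ((sobolev_const N k a * V) powr p)"
    and "(\<lambda>x. indicator (halfspace k) x * conv \<rho> x) \<in> borel_measurable borel"
proof -
  let ?W = "weighted_lborel k a" and ?H = "halfspace k" and ?S = "sobolev_const N k a"
  have S: "0 < ?S" by (rule sobolev_const_pos[OF N a D])
  have p0: "0 < p" using D p by simp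
  obtain n0 where n0: "0 < n0" "\<And>x. n0 * norm x \<le> N x" by (rule is_norm_lower[OF N]) blast
  obtain C where C: "0 < C" "\<And>x. N x \<le> C * norm x" by (rule is_norm_upper[OF N]) blast
  define u where "u x = indicator ?H x * conv \<rho> x" for x
  have cd: "(conv \<rho> has_derivative (\<lambda>h. conv_grad \<rho> x \<bullet> h)) (at x)" if "x \<in> ?H" for x
    by (rule conv_has_derivative[OF \<rho> shift_K[OF that]])
  show um [measurable]: "u \<in> borel_measurable borel" unfolding u_def
  proof -
    have "continuous_on ?H (conv \<rho>)" using cd by (auto simp: continuous_on_eq_continuous_at intro: has_derivative_continuous)
    from borel_measurable_continuous_on_indicator[OF _ this]
    show "(\<lambda>x. indicator ?H x * conv \<rho> x) \<in> borel_measurable borel" by simp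
  qed
  \<comment> \<open>Where \<open>|u| > t\<close>, either \<open>|f| > t / 2\<close> or \<open>|u - f| \<ge> t / 2\<close>, and \<open>u - f\<close> is integrable.\<close>
  have ulev: "emeasure ?W {x. t < \<bar>u x\<bar>} < \<infinity>" if t: "0 < t" for t
  proof -
    have [measurable]: "{x \<in> ?H. t / 2 < \<bar>f x\<bar>} \<in> sets borel" by measurable
    have "emeasure ?W {x. t < \<bar>u x\<bar>} \<le> emeasure ?W ({x \<in> ?H. t / 2 < \<bar>f x\<bar>} \<union> {x. 1 \<le> ennreal (2 / t) * ennreal \<bar>u x - f x\<bar>})"
    proof (rule emeasure_mono)
      show "{x. t < \<bar>u x\<bar>} \<subseteq> {x \<in> ?H. t / 2 < \<bar>f x\<bar>} \<union> {x. 1 \<le> ennreal (2 / t) * ennreal \<bar>u x - f x\<bar>}"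
      proof
        fix x assume "x \<in> {x. t < \<bar>u x\<bar>}"
        then have ux: "t < \<bar>u x\<bar>" by simp
        then have xH: "x \<in> ?H" using t by (cases "x \<in> ?H") (auto simp: u_def)
        show "x \<in> {x \<in> ?H. t / 2 < \<bar>f x\<bar>} \<union> {x. 1 \<le> ennreal (2 / t) * ennreal \<bar>u x - f x\<bar>}"
        proof (cases "t / 2 < \<bar>f x\<bar>")
          case False
          then have "t / 2 \<le> \<bar>u x - f x\<bar>" using ux by linarith
          then have "1 \<le> 2 / t * \<bar>u x - f x\<bar>" using t by (simp add: field_simps)
          then have "ennreal 1 \<le> ennreal (2 / t * \<bar>u x - f x\<bar>)" by (rule ennreal_leI)
          also have "\<dots> = ennreal (2 / t) * ennreal \<bar>u x - f x\<bar>" by (rule ennreal_mult) (use t in auto)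
          finally have "1 \<le> ennreal (2 / t) * ennreal \<bar>u x - f x\<bar>" by simp
          then show ?thesis by blast
        qed (use xH in simp)
      qed
    qed measurable
    also have "\<dots> \<le> emeasure ?W {x \<in> ?H. t / 2 < \<bar>f x\<bar>} + emeasure ?W {x. 1 \<le> ennreal (2 / t) * ennreal \<bar>u x - f x\<bar>}"
      by (rule emeasure_subadditive) (simp_all, measurable)
    also have "emeasure ?W {x. 1 \<le> ennreal (2 / t) * ennreal \<bar>u x - f x\<bar>} \<le> ennreal (2 / t) * (\<integral>\<^sup>+x. ennreal \<bar>u x - f x\<bar> * indicator UNIV x \<partial>?W)"
      using nn_integral_Markov_inequality[of "\<lambda>x. ennreal \<bar>u x - f x\<bar>" UNIV ?W "ennreal (2 / t)"] by simp
    also have "\<dots> \<le> ennreal (2 / t) * ennreal (C * (3 * r) * V)"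
      using conv_approx[OF less_imp_le[OF C(1)] C(2)] by (intro mult_left_mono) (simp_all add: u_def)
    also have "emeasure ?W {x \<in> ?H. t / 2 < \<bar>f x\<bar>} + ennreal (2 / t) * ennreal (C * (3 * r) * V) < \<infinity>"
      using lev[of "t / 2"] t by (simp add: ennreal_mult_less_top)
    finally show ?thesis by (simp add: add_left_mono)
  qed
  define w where "w j x = min (max (\<bar>u x\<bar> - 1 / real (Suc j)) 0) (real (Suc j))" for j x
  have wm [measurable]: "w j \<in> borel_measurable borel" for j unfolding w_def by measurable
  have w0: "0 \<le> w j x" and wT: "w j x \<le> real (Suc j)" for j x by (auto simp: w_def)
  have w_lip: "\<bar>w j x - w j y\<bar> \<le> \<bar>u x - u y\<bar>" for j x y unfolding w_def by linarith
  have wH: "w j x = 0" if "x \<notin> ?H" for j x using that by (simp add: w_def u_def)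
  \<comment> \<open>Equal to 1 up to radius \<open>m + 1\<close>, to 0 from twice this radius on, with slope \<open>1 / (m + 1)\<close>.\<close>
  define \<kappa> where "\<kappa> m x = max 0 (min 1 (2 - norm x / real (Suc m)))" for m and x :: "real ^ 'n"
  have chi01: "0 \<le> \<kappa> m x" "\<kappa> m x \<le> 1" for m x by (auto simp: \<kappa>_def)
  have chi_lip: "\<bar>\<kappa> m x - \<kappa> m y\<bar> \<le> norm (x - y) / real (Suc m)" for m x y
  proof -
    have "\<bar>\<kappa> m x - \<kappa> m y\<bar> \<le> \<bar>norm x / real (Suc m) - norm y / real (Suc m)\<bar>" unfolding \<kappa>_def by linarith
    also have "\<dots> = \<bar>norm x - norm y\<bar> / real (Suc m)" by (simp add: diff_divide_distrib[symmetric])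
    also have "\<dots> \<le> norm (x - y) / real (Suc m)" by (intro divide_right_mono norm_triangle_ineq3) simp
    finally show ?thesis .
  qed
  have chi_out: "\<kappa> m x = 0" if "2 * real (Suc m) < norm x" for m x
    using that by (simp add: \<kappa>_def field_simps)
  have chim [measurable]: "\<kappa> m \<in> borel_measurable borel" for m unfolding \<kappa>_def by measurable
  have wint: "(\<integral>\<^sup>+x. ennreal (w j x) \<partial>?W) < \<infinity>" for j
  proof -
    have "(\<integral>\<^sup>+x. ennreal (w j x) \<partial>?W) \<le> (\<integral>\<^sup>+x. ennreal (real (Suc j)) * indicator {x. 1 / real (Suc j) < \<bar>u x\<bar>} x \<partial>?W)"
    proof (rule nn_integral_mono)
      fix x show "ennreal (w j x) \<le> ennreal (real (Suc j)) * indicator {x. 1 / real (Suc j) < \<bar>u x\<bar>} x"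
      proof (cases "1 / real (Suc j) < \<bar>u x\<bar>")
        case True then show ?thesis using ennreal_leI[OF wT[of j x]] by simp
      next
        case False then show ?thesis by (simp add: w_def max_def)
      qed
    qed
    also have "\<dots> = ennreal (real (Suc j)) * emeasure ?W {x. 1 / real (Suc j) < \<bar>u x\<bar>}"
      by (rule nn_integral_cmult_indicator) simp
    also have "\<dots> < \<infinity>" using ulev[of "1 / real (Suc j)"] by (simp add: ennreal_mult_less_top)
    finally show ?thesis .
  qed
  have cut: "(\<integral>\<^sup>+x. ennreal (w j x powr p) \<partial>?W) \<le> ennreal ((?S * V) powr p)" for j
  proof -
    obtain B where B: "(\<integral>\<^sup>+x. ennreal (w j x) \<partial>?W) = ennreal B" "0 \<le> B"
      using wint[of j] by (cases "\<integral>\<^sup>+x. ennreal (w j x) \<partial>?W") auto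
    have each: "(\<integral>\<^sup>+x. ennreal ((w j x * \<kappa> m x) powr p) \<partial>?W) \<le> ennreal ((?S * (V + B / (n0 * real (Suc m)))) powr p)" for m
    proof -
      let ?F = "\<lambda>x. w j x * \<kappa> m x"
      let ?G = "\<lambda>x. slope x + w j x / (n0 * real (Suc m))"
      let ?R = "2 * real (Suc m)"
      obtain L where L: "0 \<le> L" "\<And>x x'. x \<in> ?H \<Longrightarrow> x' \<in> ?H \<Longrightarrow> norm x \<le> ?R \<Longrightarrow> norm x' \<le> ?R \<Longrightarrow> \<bar>conv \<rho> x - conv \<rho> x'\<bar> \<le> L * norm (x - x')"
        using conv_lipschitz[of ?R] by blast
      define L' where "L' = L + real (Suc j) / real (Suc m)"
      have prod_le: "\<bar>?F x - ?F y\<bar> \<le> \<bar>u x - u y\<bar> + w j x * \<bar>\<kappa> m x - \<kappa> m y\<bar>" for x y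
      proof -
        have "?F x - ?F y = \<kappa> m y * (w j x - w j y) + w j x * (\<kappa> m x - \<kappa> m y)" by (simp add: algebra_simps)
        also have "\<bar>\<dots>\<bar> \<le> \<bar>\<kappa> m y * (w j x - w j y)\<bar> + \<bar>w j x * (\<kappa> m x - \<kappa> m y)\<bar>" by (rule abs_triangle_ineq)
        also have "\<bar>\<kappa> m y * (w j x - w j y)\<bar> \<le> 1 * \<bar>u x - u y\<bar>"
          unfolding abs_mult using chi01[of m y] w_lip[of j x y] by (intro mult_mono) auto
        finally show ?thesis using w0[of j x] by (simp add: abs_mult)
      qed
      have mixed: "w j x * \<bar>\<kappa> m x - \<kappa> m y\<bar> \<le> real (Suc j) / real (Suc m) * norm (x - y)" for x y
        using mult_mono[OF wT[of j x] chi_lip[of m x y]] by simp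
      have lip: "\<bar>?F x - ?F y\<bar> \<le> L' * norm (x - y)" if x: "x \<in> ?H" and y: "y \<in> ?H" for x y
      proof -
        consider "norm x \<le> ?R" "norm y \<le> ?R" | "?R < norm y" | "?R < norm x" by linarith
        then show ?thesis
        proof cases
          case 1
          have "\<bar>u x - u y\<bar> \<le> L * norm (x - y)" using L(2)[OF x y 1] x y by (simp add: u_def)
          then show ?thesis using prod_le[of x y] mixed[of x y] by (simp add: L'_def distrib_right)
        next
          case 2
          then have "\<bar>?F x - ?F y\<bar> = w j x * \<bar>\<kappa> m x - \<kappa> m y\<bar>" using chi_out[OF 2] w0[of j x] chi01[of m x] by (simp add: abs_mult)
          also have "\<dots> \<le> L' * norm (x - y)" using mixed[of x y] mult_nonneg_nonneg[OF L(1) norm_ge_zero[of "x - y"]] by (simp add: L'_def distrib_right)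
          finally show ?thesis .
        next
          case 3
          then have "\<bar>?F x - ?F y\<bar> = w j y * \<bar>\<kappa> m y - \<kappa> m x\<bar>" using chi_out[OF 3] w0[of j y] chi01[of m y] by (simp add: abs_mult)
          also have "\<dots> \<le> L' * norm (x - y)" using mixed[of y x] mult_nonneg_nonneg[OF L(1) norm_ge_zero[of "x - y"]]
            by (simp add: L'_def distrib_right norm_minus_commute)
          finally show ?thesis .
        qed
      qed
      have slp: "\<exists>d>0. \<forall>z\<in>?H. norm (z - x) < d \<longrightarrow> ?F z \<le> ?F x + (?G x + e) * N (z - x)" if x: "x \<in> ?H" and e: "0 < e" for x e
      proof -
        obtain d where d: "0 < d" "\<And>z. norm (z - x) < d \<Longrightarrow> \<bar>conv \<rho> z - conv \<rho> x\<bar> \<le> (dual_norm N (conv_grad \<rho> x) + e) * N (z - x)"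
          using upper_slope_of_derivative[OF N cd[OF x] e] by blast
        have "?F z \<le> ?F x + (?G x + e) * N (z - x)" if z: "z \<in> ?H" "norm (z - x) < d" for z
        proof -
          have Nz: "0 \<le> N (z - x)" by (rule is_normD(1)[OF N])
          have "\<bar>u x - u z\<bar> \<le> (slope x + e) * N (z - x)"
            using d(2)[OF z(2)] mult_right_mono[OF conv_grad_le_slope[OF x] Nz] x z(1)
            by (simp add: u_def distrib_right abs_minus_commute)
          moreover have "w j x * \<bar>\<kappa> m x - \<kappa> m z\<bar> \<le> w j x / (n0 * real (Suc m)) * N (z - x)"
          proof -
            have "norm (x - z) \<le> N (z - x) / n0" using n0(2)[of "z - x"] n0(1) by (simp add: field_simps norm_minus_commute)
            then have "norm (x - z) / real (Suc m) \<le> N (z - x) / n0 / real (Suc m)" by (rule divide_right_mono) simp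
            then have "\<bar>\<kappa> m x - \<kappa> m z\<bar> \<le> N (z - x) / (n0 * real (Suc m))" using chi_lip[of m x z] by simp
            from mult_left_mono[OF this w0[of j x]] show ?thesis by simp
          qed
          ultimately show ?thesis using prod_le[of x z] by (simp add: distrib_right)
        qed
        with d(1) show ?thesis by blast
      qed
      have Gint: "(\<integral>\<^sup>+x. ennreal (?G x) \<partial>?W) \<le> ennreal (V + B / (n0 * real (Suc m)))"
      proof -
        have "(\<integral>\<^sup>+x. ennreal (?G x) \<partial>?W) = (\<integral>\<^sup>+x. ennreal (slope x) + ennreal (1 / (n0 * real (Suc m))) * ennreal (w j x) \<partial>?W)"
          using n0(1) slope_nonneg w0 by (intro nn_integral_cong) (simp add: ennreal_plus[symmetric] ennreal_mult'[symmetric] del: ennreal_plus)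
        also have "\<dots> = (\<integral>\<^sup>+x. ennreal (slope x) \<partial>?W) + ennreal (1 / (n0 * real (Suc m))) * ennreal B"
          by (subst nn_integral_add) (auto simp: nn_integral_cmult B(1)[symmetric])
        also have "\<dots> \<le> ennreal V + ennreal (1 / (n0 * real (Suc m))) * ennreal B"
          by (rule add_right_mono[OF slope_integral])
        also have "\<dots> = ennreal (V + B / (n0 * real (Suc m)))"
          using n0(1) V0 B(2) by (simp add: ennreal_plus[symmetric] ennreal_mult'[symmetric] del: ennreal_plus)
        finally show ?thesis .
      qed
      show ?thesis
      proof (rule sobolev_upper_slope[OF N a D, where F="?F" and G="?G" and R="?R" and L=L'])
        show "0 \<le> ?F x" for x using w0 chi01 by simp
        show "x \<notin> ?H \<or> ?R < norm x \<Longrightarrow> ?F x = 0" for x using wH chi_out by auto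
        show "0 \<le> ?G x" for x using slope_nonneg w0 n0(1) by simp
        show "\<bar>?F x - ?F y\<bar> \<le> L' * norm (x - y)" if "x \<in> ?H" "y \<in> ?H" for x y by (rule lip[OF that])
        show "\<exists>d>0. \<forall>z\<in>?H. norm (z - x) < d \<longrightarrow> ?F z \<le> ?F x + (?G x + e) * N (z - x)" if "x \<in> ?H" "0 < e" for x e
          by (rule slp[OF that])
      qed (use L(1) V0 B(2) n0(1) Gint p in \<open>auto simp: sobolev_const_def L'_def\<close>)
    qed
    show ?thesis
    proof (rule fatou_powr[where Fi="\<lambda>m x. w j x * \<kappa> m x" and c="\<lambda>m. (?S * (V + B / (n0 * real (Suc m)))) powr p"])
      show "AE x in ?W. (\<lambda>m. w j x * \<kappa> m x) \<longlonglongrightarrow> w j x"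
      proof (rule AE_I2)
        fix x :: "real ^ 'n"
        obtain m0 where m0: "norm x < real m0" using reals_Archimedean2 by blast
        have "eventually (\<lambda>m. w j x * \<kappa> m x = w j x) sequentially"
          unfolding eventually_sequentially
        proof (intro exI[of _ m0] allI impI)
          fix m assume "m0 \<le> m"
          then have "norm x \<le> real (Suc m)" using m0 by simp
          then have "norm x / real (Suc m) \<le> 1" by simp
          then show "w j x * \<kappa> m x = w j x" by (simp add: \<kappa>_def)
        qed
        then show "(\<lambda>m. w j x * \<kappa> m x) \<longlonglongrightarrow> w j x" by (rule tendsto_eventually)
      qed
      have "(\<lambda>m. B / n0 * inverse (real (Suc m))) \<longlonglongrightarrow> B / n0 * 0" by (intro tendsto_intros LIMSEQ_inverse_real_of_nat)
      then have "(\<lambda>m. B / (n0 * real (Suc m))) \<longlonglongrightarrow> 0" by (simp add: divide_inverse mult.assoc)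
      then have "(\<lambda>m. ?S * (V + B / (n0 * real (Suc m)))) \<longlonglongrightarrow> ?S * (V + 0)" by (intro tendsto_intros)
      then show "(\<lambda>m. (?S * (V + B / (n0 * real (Suc m)))) powr p) \<longlonglongrightarrow> (?S * V) powr p"
        using S V0 B(2) n0(1) p0 by (intro tendsto_powr'[OF _ tendsto_const]) (auto intro!: always_eventually)
    qed (use w0 chi01 p0 each in auto)
  qed
  have "(\<integral>\<^sup>+x. ennreal (\<bar>u x\<bar> powr p) \<partial>?W) \<le> ennreal ((?S * V) powr p)"
  proof (rule fatou_powr[where Fi=w and c="\<lambda>_. (?S * V) powr p"])
    show "AE x in ?W. (\<lambda>j. w j x) \<longlonglongrightarrow> \<bar>u x\<bar>"
    proof (rule AE_I2)
      fix x
      obtain j0 where j0: "\<bar>u x\<bar> < real j0" using reals_Archimedean2 by blast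
      have "(\<lambda>j. inverse (real (Suc j))) \<longlonglongrightarrow> 0" by (rule LIMSEQ_inverse_real_of_nat)
      then have "(\<lambda>j. max (\<bar>u x\<bar> - inverse (real (Suc j))) 0) \<longlonglongrightarrow> max (\<bar>u x\<bar> - 0) 0" by (intro tendsto_intros)
      moreover have "eventually (\<lambda>j. max (\<bar>u x\<bar> - inverse (real (Suc j))) 0 = w j x) sequentially"
        unfolding eventually_sequentially
      proof (intro exI[of _ j0] allI impI)
        fix j assume "j0 \<le> j"
        then have "\<bar>u x\<bar> \<le> real (Suc j)" using j0 by simp
        moreover have "0 \<le> inverse (real (Suc j))" by simp
        ultimately have "max (\<bar>u x\<bar> - inverse (real (Suc j))) 0 \<le> real (Suc j)" by linarith
        then show "max (\<bar>u x\<bar> - inverse (real (Suc j))) 0 = w j x" by (simp add: w_def inverse_eq_divide)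
      qed
      ultimately show "(\<lambda>j. w j x) \<longlonglongrightarrow> \<bar>u x\<bar>" by (auto intro: Lim_transform_eventually)
    qed
  qed (use w0 p0 cut in auto)
  then show "(\<integral>\<^sup>+x. ennreal (\<bar>indicator (halfspace k) x * conv \<rho> x\<bar> powr p) \<partial>?W) \<le> ennreal ((?S * V) powr p)"
    by (simp add: u_def)
qed

end

text \<open>Mollifiers of radius \<open>2\<^sup>-\<^sup>i\<close> approximate \<open>f\<close> in \<open>L\<^sup>1\<close> with summable errors, hence almost everywhere, and
  Fatou's lemma applies.\<close>

theorem sobolev_bv:
  assumes D: "1 < wdim k a" and p: "p = wdim k a / (wdim k a - 1)"
    and lev: "\<And>t. 0 < t \<Longrightarrow> emeasure (weighted_lborel k a) {x \<in> halfspace k. t < \<bar>f x\<bar>} < \<infinity>"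
  shows "(\<integral>\<^sup>+x. ennreal (\<bar>f x\<bar> powr p) \<partial>weighted_lborel k a) \<le> ennreal ((sobolev_const N k a * V) powr p)"
proof -
  let ?W = "weighted_lborel k a" and ?B = "ennreal ((sobolev_const N k a * V) powr p)"
  have p0: "0 < p" using D p by simp
  obtain C where C: "0 < C" "\<And>x. N x \<le> C * norm x" by (rule is_norm_upper[OF N]) blast
  define good where "good i u \<longleftrightarrow> u \<in> borel_measurable borel \<and> (\<integral>\<^sup>+x. ennreal (\<bar>u x\<bar> powr p) \<partial>?W) \<le> ?B
     \<and> (\<integral>\<^sup>+x. ennreal \<bar>u x - f x\<bar> \<partial>?W) \<le> ennreal (C * (3 * (1 / 2) ^ i) * V)" for i :: nat and u :: "real ^ 'n \<Rightarrow> real"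
  have "\<exists>u. good i u" for i
  proof -
    have r: "0 < (1 / 2 :: real) ^ i" by simp
    obtain \<rho> G where \<rho>: "C1_supported (cball ((2 * (1 / 2) ^ i) *\<^sub>R axis k 1) ((1 / 2) ^ i)) \<rho> G" "\<And>x. 0 \<le> \<rho> x"
      "(\<integral>\<^sup>+x. ennreal (\<rho> x) \<partial>lborel) = 1" by (rule mollifier_exists[OF r, of k]) blast
    have "good i (\<lambda>x. indicator (halfspace k) x * conv \<rho> x)"
      unfolding good_def
      using sobolev_mollified[OF r refl \<rho> D p lev] conv_approx[OF r refl \<rho> less_imp_le[OF C(1)] C(2)] by blast
    then show ?thesis by blast
  qed
  then have "\<exists>u. \<forall>i. good i (u i)" by (intro choice allI)
  then obtain u where good: "\<And>i. good i (u i)" by blast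
  have um [measurable]: "u i \<in> borel_measurable borel" for i using good by (simp add: good_def)
  have "(\<integral>\<^sup>+x. (\<Sum>i. ennreal \<bar>u i x - f x\<bar>) \<partial>?W) = (\<Sum>i. \<integral>\<^sup>+x. ennreal \<bar>u i x - f x\<bar> \<partial>?W)"
    by (rule nn_integral_suminf) measurable
  also have "\<dots> \<le> (\<Sum>i. ennreal (C * (3 * (1 / 2) ^ i) * V))"
    using good by (intro suminf_le) (auto simp: good_def)
  also have "\<dots> < \<infinity>"
  proof -
    have s: "summable (\<lambda>i. C * (3 * (1 / 2 :: real) ^ i) * V)"
      by (intro summable_mult summable_mult2 summable_geometric) simp
    show ?thesis using C(1) V0 by (subst suminf_ennreal2[OF _ s]) auto
  qed
  finally have "AE x in ?W. (\<Sum>i. ennreal \<bar>u i x - f x\<bar>) \<noteq> \<infinity>"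
    by (intro nn_integral_noteq_infinite) auto
  then have lim: "AE x in ?W. (\<lambda>i. \<bar>u i x\<bar>) \<longlonglongrightarrow> \<bar>f x\<bar>"
  proof (rule eventually_mono)
    fix x assume "(\<Sum>i. ennreal \<bar>u i x - f x\<bar>) \<noteq> \<infinity>"
    then have "summable (\<lambda>i. \<bar>u i x - f x\<bar>)" by (intro summable_suminf_not_top) auto
    then have "(\<lambda>i. \<bar>u i x - f x\<bar>) \<longlonglongrightarrow> 0" by (rule summable_LIMSEQ_zero)
    then have "(\<lambda>i. u i x) \<longlonglongrightarrow> f x" by (simp add: LIM_zero_iff tendsto_rabs_zero_iff)
    then show "(\<lambda>i. \<bar>u i x\<bar>) \<longlonglongrightarrow> \<bar>f x\<bar>" by (rule tendsto_rabs)
  qed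
  show ?thesis
    by (rule fatou_powr[OF _ _ _ lim p0 _ tendsto_const]) (use good in \<open>auto simp: good_def\<close>)
qed

end

section \<open>Normalisation of derivative measures\<close>

lemma AE_wmeasureI:
  assumes "AE x in lborel. x \<in> halfspace k \<longrightarrow> P x"
  shows "AE x in wmeasure k a. P x"
proof -
  have "AE x in lebesgue. x \<in> halfspace k \<longrightarrow> P x" using assms by (rule AE_completion)
  then have ae: "AE x in lebesgue_on (halfspace k). P x" by (subst AE_restrict_space_iff) auto
  have w: "(\<lambda>x. ennreal (weight k a x)) \<in> borel_measurable (lebesgue_on (halfspace k))"
    by (intro measurable_restrict_space1 measurable_completion) simp
  show ?thesis unfolding wmeasure_def by (subst AE_density[OF w]) (use ae in \<open>auto elim: eventually_mono\<close>)
qed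

lemma set_integral_lebesgue_eq:
  fixes f g :: "real ^ 'n::finite \<Rightarrow> real"
  assumes ae: "AE x in lborel. indicator A x * f x = g x" and g: "g \<in> borel_measurable borel"
    and fm: "(\<lambda>x. indicator A x * f x) \<in> borel_measurable lebesgue"
  shows "(LINT x:A|lebesgue. f x) = (LINT x|lborel. g x)"
proof -
  have "(LINT x:A|lebesgue. f x) = (LINT x|lebesgue. indicator A x * f x)" by (simp add: set_lebesgue_integral_def)
  also have "\<dots> = (LINT x|lebesgue. g x)"
    by (rule integral_cong_AE) (use fm g AE_completion[OF ae] in \<open>auto intro: measurable_completion\<close>)
  also have "\<dots> = (LINT x|lborel. g x)" by (rule integral_completion) (use g in simp)
  finally show ?thesis .
qed

lemma divergence_eq:
  fixes \<phi> :: "real ^ 'n::finite \<Rightarrow> real ^ 'n"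
  assumes d: "\<And>i. ((\<lambda>y. \<phi> y $ i) has_derivative (\<lambda>h. G i \<bullet> h)) (at x)"
  shows "divergence \<phi> x = (\<Sum>i\<in>UNIV. G i $ i)"
proof -
  have "(\<phi> has_derivative (\<lambda>h. \<chi> i. G i \<bullet> h)) (at x)"
  proof -
    have "((\<lambda>y. \<Sum>i\<in>UNIV. (\<phi> y $ i) *\<^sub>R axis i (1::real)) has_derivative (\<lambda>h. \<Sum>i\<in>UNIV. (G i \<bullet> h) *\<^sub>R axis i (1::real))) (at x)"
      by (intro has_derivative_sum has_derivative_scaleR_left d)
    moreover have "(\<Sum>i\<in>UNIV. (v i) *\<^sub>R axis i (1::real)) = (\<chi> i. v i)" for v :: "'n \<Rightarrow> real"
      by (simp add: vec_eq_iff axis_def if_distrib[where f="\<lambda>y. _ * y"] cong: if_cong)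
    ultimately show ?thesis by simp
  qed
  then have "frechet_derivative \<phi> (at x) = (\<lambda>h. \<chi> i. G i \<bullet> h)" by (rule frechet_derivative_at[symmetric])
  then show ?thesis
    by (simp add: divergence_def jacobian_def matrix_def trace_def inner_axis)
qed

lemma C1_supported_Cm: "C1_supported K \<eta> G \<Longrightarrow> Cm_on 1 A \<eta>"
proof -
  assume "C1_supported K \<eta> G"
  then have d: "\<And>x. (\<eta> has_derivative (\<lambda>h. G x \<bullet> h)) (at x)" and c: "continuous_on UNIV G" by (auto simp: C1_supported_def)
  have "\<forall>i. continuous_on A (\<lambda>x. G x $ i)" by (intro allI continuous_intros continuous_on_subset[OF c]) simp
  then show ?thesis using has_derivative_at_withinI[OF d] by auto
qed

text \<open>Normalisation of a derivative measure: \<open>f\<close> is replaced by a Borel function almost equal to it and set to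
  0 outside the half-space, \<open>\<mu>\<close> is extended by zero, and \<open>\<nu>\<close> is changed where \<open>|\<nu>| > 1\<close>, a null set.\<close>

lemma bv_data_of_derivative:
  fixes N :: "real ^ 'n::finite \<Rightarrow> real"
  assumes N: "is_norm N" and a: "0 \<le> a"
    and floc: "\<And>K. compact K \<Longrightarrow> K \<subseteq> halfspace k \<Longrightarrow> f absolutely_integrable_on K"
    and dm: "derivative_measure k f \<mu> \<nu>"
  obtains f' \<mu>' \<nu>' where "bv_data N k a f' \<mu>' \<nu>'" "AE x in lborel. indicator (halfspace k) x * f x = f' x"
    "(\<lambda>x. indicator (halfspace k) x * f x) \<in> borel_measurable lebesgue"
    "weighted_variation N k a \<mu> \<nu> = (\<integral>\<^sup>+x. ennreal (weight k a x * dual_norm N (\<nu>' x)) \<partial>\<mu>')"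
proof -
  let ?H = "halfspace k"
  have s\<mu>: "sets \<mu> = sets (restrict_space borel ?H)" and fin: "\<And>K. compact K \<Longrightarrow> K \<subseteq> ?H \<Longrightarrow> emeasure \<mu> K < \<infinity>"
    and \<nu>m: "\<nu> \<in> borel_measurable \<mu>" and \<nu>1: "AE x in \<mu>. norm (\<nu> x) = 1"
    and by_parts: "\<And>\<phi>. test_field k \<phi> \<Longrightarrow> (LINT x:?H|lebesgue. f x * divergence \<phi> x) = - (LINT x|\<mu>. \<phi> x \<bullet> \<nu> x)"
    using dm by (auto simp: derivative_measure_def)
  have sp: "space \<mu> = ?H" using sets_eq_imp_space_eq[OF s\<mu>] by (simp add: space_restrict_space)
  have fm: "(\<lambda>x. indicator ?H x * f x) \<in> borel_measurable lebesgue"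
  proof (rule borel_measurable_LIMSEQ_real)
    show "(\<lambda>x. indicator (exhaust k j) x * f x) \<in> borel_measurable lebesgue" for j
      using floc[OF exhaust_props(1)[where k=k and j=j] exhaust_props(2)[where k=k and j=j]]
      by (auto simp: set_integrable_def dest: borel_measurable_integrable)
    show "(\<lambda>j. indicator (exhaust k j) x * f x) \<longlonglongrightarrow> indicator ?H x * f x" for x
    proof (cases "x \<in> ?H")
      case True
      then obtain j0 where "x \<in> exhaust k j0" using exhaust_props(4)[where k=k] by blast
      then have "x \<in> exhaust k j" if "j0 \<le> j" for j using exhaust_props(3)[where k=k] that by (auto simp: incseq_def)
      then have "eventually (\<lambda>j. indicator (exhaust k j) x * f x = indicator ?H x * f x) sequentially"
        using True by (auto simp: eventually_sequentially intro!: exI[of _ j0])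
      then show ?thesis by (rule tendsto_eventually)
    next
      case False
      then have "x \<notin> exhaust k j" for j using exhaust_props(2)[where k=k] by blast
      then show ?thesis using False by simp
    qed
  qed
  obtain f0 where f0: "f0 \<in> borel_measurable lborel" "AE x in lborel. indicator ?H x * f x = f0 x"
    using completion_ex_borel_measurable_real[OF fm] by blast
  define f' where "f' x = indicator ?H x * f0 x" for x
  have f'm [measurable]: "f' \<in> borel_measurable borel" using f0(1) unfolding f'_def by measurable
  have ae: "AE x in lborel. indicator ?H x * f x = f' x"
    using f0(2) by (rule eventually_mono) (auto simp: f'_def indicator_def split: if_splits)
  define \<mu>' where "\<mu>' = distr \<mu> borel (\<lambda>x. x)"
  have idm: "(\<lambda>x. x) \<in> measurable \<mu> borel"
    unfolding measurable_cong_sets[OF s\<mu> refl] by (rule measurable_restrict_space1) simp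
  have s\<mu>': "sets \<mu>' = sets borel" by (simp add: \<mu>'_def)
  define \<nu>' where "\<nu>' x = (if norm (indicator ?H x *\<^sub>R \<nu> x) \<le> 1 then indicator ?H x *\<^sub>R \<nu> x else 0)" for x
  have \<nu>0: "(\<lambda>x. indicator ?H x *\<^sub>R \<nu> x) \<in> borel_measurable borel"
    using \<nu>m unfolding measurable_cong_sets[OF s\<mu> refl] by (subst (asm) borel_measurable_restrict_space_iff) auto
  have \<nu>'m [measurable]: "\<nu>' \<in> borel_measurable borel" unfolding \<nu>'_def using \<nu>0 by measurable
  have \<nu>'1: "norm (\<nu>' x) \<le> 1" for x by (simp add: \<nu>'_def)
  have \<nu>ae: "AE x in \<mu>. \<nu>' x = \<nu> x" using \<nu>1 AE_space by eventually_elim (auto simp: \<nu>'_def sp)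
  have H\<mu>: "AE x in \<mu>'. x \<in> ?H"
    unfolding \<mu>'_def by (subst AE_distr_iff[OF idm]) (auto simp: sp)
  have data: "bv_data N k a f' \<mu>' \<nu>'"
  proof
    show "f' x = 0" if "x \<notin> ?H" for x using that by (simp add: f'_def)
    show "integrable lborel (\<lambda>x. indicator K x * f' x)" if K: "compact K" "K \<subseteq> ?H" for K
    proof -
      have [measurable]: "K \<in> sets borel" using K by (auto intro: borel_compact)
      have "integrable lebesgue (\<lambda>x. indicator K x * f x)" using floc[OF K] by (simp add: set_integrable_def)
      moreover have "AE x in lebesgue. indicator K x * f x = indicator K x * f' x"
        by (rule AE_completion) (use ae K in \<open>auto elim!: eventually_mono simp: indicator_def split: if_splits\<close>)
      moreover have "(\<lambda>x. indicator K x * f' x) \<in> borel_measurable lebesgue" by (rule measurable_completion) measurable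
      ultimately have "integrable lebesgue (\<lambda>x. indicator K x * f' x)"
        using integrable_cong_AE[of "\<lambda>x. indicator K x * f x" lebesgue "\<lambda>x. indicator K x * f' x"]
        by (auto dest: borel_measurable_integrable)
      then show ?thesis by (subst (asm) integrable_completion) auto
    qed
    show "emeasure \<mu>' K < \<infinity>" if K: "compact K" "K \<subseteq> ?H" for K
    proof -
      have "emeasure \<mu>' K = emeasure \<mu> ((\<lambda>x. x) -` K \<inter> space \<mu>)"
        unfolding \<mu>'_def by (rule emeasure_distr[OF idm]) (use K in \<open>auto intro: borel_compact\<close>)
      also have "(\<lambda>x. x) -` K \<inter> space \<mu> = K" using K sp by auto
      finally show ?thesis using fin[OF K] by simp
    qed
    fix K \<eta> G i assume \<eta>: "C1_supported K \<eta> G" and K: "K \<subseteq> ?H"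
    have d: "\<And>x. (\<eta> has_derivative (\<lambda>h. G x \<bullet> h)) (at x)" and cp: "compact K" and z: "\<And>x. x \<notin> K \<Longrightarrow> \<eta> x = 0"
      and Gc: "continuous_on UNIV G"
      using \<eta> by (auto simp: C1_supported_def)
    define \<phi> where "\<phi> x = \<eta> x *\<^sub>R (axis i 1 :: real ^ 'n)" for x
    have tf: "test_field k \<phi>"
      unfolding test_field_def
    proof (intro conjI allI)
      fix j
      have "Cm_on 1 ?H (\<lambda>x. \<eta> x * axis i 1 $ j)" by (rule Cm_on_mult[OF C1_supported_Cm[OF \<eta>] Cm_on_const])
      then show "Cm_on 1 ?H (\<lambda>x. \<phi> x $ j)" by (simp add: \<phi>_def del: One_nat_def)
      show "\<exists>K. compact K \<and> K \<subseteq> ?H \<and> (\<forall>x\<in>?H - K. \<phi> x = 0)"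
        using cp K z by (auto intro!: exI[of _ K] simp: \<phi>_def)
    qed
    have div: "divergence \<phi> x = G x $ i" for x
    proof -
      have "divergence \<phi> x = (\<Sum>j\<in>UNIV. ((axis i 1 $ j) *\<^sub>R G x) $ j)"
        by (rule divergence_eq) (use d in \<open>auto intro!: derivative_eq_intros simp: \<phi>_def\<close>)
      also have "\<dots> = G x $ i" by (simp add: axis_def if_distrib[where f="\<lambda>y. y * _"] cong: if_cong)
      finally show ?thesis .
    qed
    have [measurable]: "(\<lambda>x. G x $ i) \<in> borel_measurable borel"
      by (intro borel_measurable_continuous_onI continuous_intros Gc)
    have [measurable]: "\<eta> \<in> borel_measurable borel"
      using d by (intro borel_measurable_continuous_onI) (auto simp: continuous_on_eq_continuous_at intro: has_derivative_continuous)
    have "(LINT x|lborel. f' x * G x $ i) = (LINT x:?H|lebesgue. f x * divergence \<phi> x)"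
    proof (rule set_integral_lebesgue_eq[symmetric])
      show "AE x in lborel. indicator ?H x * (f x * divergence \<phi> x) = f' x * G x $ i"
        using ae by (rule eventually_mono) (simp add: div mult.assoc[symmetric])
      have "(\<lambda>x. (indicator ?H x * f x) * G x $ i) \<in> borel_measurable lebesgue"
        by (rule borel_measurable_times[OF fm]) (rule measurable_completion, simp)
      then show "(\<lambda>x. indicator ?H x * (f x * divergence \<phi> x)) \<in> borel_measurable lebesgue"
        by (simp add: div mult.assoc)
    qed measurable
    also have "\<dots> = - (LINT x|\<mu>. \<phi> x \<bullet> \<nu> x)" by (rule by_parts[OF tf])
    also have "(LINT x|\<mu>. \<phi> x \<bullet> \<nu> x) = (LINT x|\<mu>. \<eta> x * \<nu>' x $ i)"
    proof (rule integral_cong_AE)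
      have "(\<lambda>x. \<phi> x \<bullet> \<nu> x) = (\<lambda>x. \<eta> x * (\<nu> x \<bullet> axis i 1))" by (simp add: \<phi>_def inner_commute)
      then show "(\<lambda>x. \<phi> x \<bullet> \<nu> x) \<in> borel_measurable \<mu>"
        using \<nu>m measurable_compose[OF idm \<open>\<eta> \<in> borel_measurable borel\<close>] by simp
      have "(\<lambda>x. \<eta> x * (\<nu>' x \<bullet> axis i 1)) \<in> borel_measurable borel" by measurable
      from measurable_compose[OF idm this] show "(\<lambda>x. \<eta> x * \<nu>' x $ i) \<in> borel_measurable \<mu>" by (simp add: inner_axis)
      show "AE x in \<mu>. \<phi> x \<bullet> \<nu> x = \<eta> x * \<nu>' x $ i"
        using \<nu>ae by (rule eventually_mono) (simp add: \<phi>_def inner_axis')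
    qed
    also have "(LINT x|\<mu>. \<eta> x * \<nu>' x $ i) = (LINT x|\<mu>'. \<eta> x * \<nu>' x $ i)"
    proof -
      have "(\<lambda>x. \<eta> x * (\<nu>' x \<bullet> axis i 1)) \<in> borel_measurable borel" by measurable
      then show ?thesis unfolding \<mu>'_def by (subst integral_distr[OF idm]) (auto simp: inner_axis)
    qed
    finally show "(LINT x|lborel. f' x * G x $ i) = - (LINT x|\<mu>'. \<eta> x * \<nu>' x $ i)" .
  qed (use N a f'm s\<mu>' H\<mu> \<nu>'m \<nu>'1 in auto)
  have dnm: "(\<lambda>x. dual_norm N (\<nu>' x)) \<in> borel_measurable borel"
    by (rule is_norm_measurable[OF is_norm_dual_norm[OF N] \<nu>'m])
  have "weighted_variation N k a \<mu> \<nu> = (\<integral>\<^sup>+x. ennreal (weight k a x * dual_norm N (\<nu>' x)) \<partial>\<mu>)"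
    unfolding weighted_variation_def using \<nu>ae by (intro nn_integral_cong_AE) (auto elim!: eventually_mono)
  also have "\<dots> = (\<integral>\<^sup>+x. ennreal (weight k a x * dual_norm N (\<nu>' x)) \<partial>\<mu>')"
    unfolding \<mu>'_def by (rule nn_integral_distr[OF idm, symmetric]) (use dnm in measurable)
  finally show ?thesis using that[OF data ae fm] by blast
qed

text \<open>If the variation is infinite there is nothing to prove; otherwise it is the number \<open>V\<close> of \<open>sobolev_bv\<close>.\<close>

theorem sobolev_weighted_BV:
  fixes N :: "real ^ 'n::finite \<Rightarrow> real"
  assumes N: "is_norm N" and a: "0 \<le> a" and D: "1 < wdim k a"
    and bv: "weighted_BV N k a f" and lev: "\<And>t. 0 < t \<Longrightarrow> emeasure (wmeasure k a) {x \<in> halfspace k. t < \<bar>f x\<bar>} < \<infinity>"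
    and dm: "derivative_measure k f \<mu> \<nu>"
  shows "weighted_Lp_norm (wdim k a / (wdim k a - 1)) k a f \<le> ennreal (sobolev_const N k a) * weighted_variation N k a \<mu> \<nu>"
proof -
  let ?H = "halfspace k" and ?p = "wdim k a / (wdim k a - 1)" and ?S = "sobolev_const N k a"
  have S: "0 < ?S" by (rule sobolev_const_pos[OF N a D])
  have p: "0 < ?p" using D by simp
  obtain f' \<mu>' \<nu>' where data: "bv_data N k a f' \<mu>' \<nu>'" and ae: "AE x in lborel. indicator ?H x * f x = f' x"
    and fm: "(\<lambda>x. indicator ?H x * f x) \<in> borel_measurable lebesgue"
    and V': "weighted_variation N k a \<mu> \<nu> = (\<integral>\<^sup>+x. ennreal (weight k a x * dual_norm N (\<nu>' x)) \<partial>\<mu>')"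
    by (rule bv_data_of_derivative[OF N a _ dm]) (use bv dm in \<open>auto simp: weighted_BV_def\<close>)
  interpret bv_data N k a f' \<mu>' \<nu>' by (rule data)
  have aew: "AE x in wmeasure k a. f x = f' x"
    by (rule AE_wmeasureI) (use ae in \<open>auto elim!: eventually_mono\<close>)
  have sw: "sets (wmeasure k a) = sets (lebesgue_on ?H)" by (simp add: wmeasure_def)
  have fmH: "f \<in> borel_measurable (wmeasure k a)"
    unfolding measurable_cong_sets[OF sw refl] using fm by (subst borel_measurable_restrict_space_iff) auto
  have fm': "f' \<in> borel_measurable (wmeasure k a)"
    unfolding measurable_cong_sets[OF sw refl] by (intro measurable_restrict_space1 measurable_completion) simp
  have lev': "emeasure (weighted_lborel k a) {x \<in> ?H. t < \<bar>f' x\<bar>} < \<infinity>" if t: "0 < t" for t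
  proof -
    have [measurable]: "{x \<in> ?H. t < \<bar>f' x\<bar>} \<in> sets borel" by measurable
    have "emeasure (weighted_lborel k a) {x \<in> ?H. t < \<bar>f' x\<bar>} = (\<integral>\<^sup>+x. indicator {x \<in> ?H. t < \<bar>f' x\<bar>} x \<partial>weighted_lborel k a)"
      by (rule nn_integral_indicator[symmetric]) simp
    also have "\<dots> = (\<integral>\<^sup>+x. indicator {x \<in> ?H. t < \<bar>f' x\<bar>} x \<partial>wmeasure k a)"
      by (rule nn_integral_wmeasure_borel[symmetric]) simp
    also have "\<dots> = (\<integral>\<^sup>+x. indicator {x \<in> ?H. t < \<bar>f x\<bar>} x \<partial>wmeasure k a)"
      using aew by (intro nn_integral_cong_AE) (auto elim!: eventually_mono simp: indicator_def)
    also have "\<dots> = emeasure (wmeasure k a) {x \<in> ?H. t < \<bar>f x\<bar>}"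
    proof (rule nn_integral_indicator)
      have "{x \<in> space (wmeasure k a). t < \<bar>f x\<bar>} \<in> sets (wmeasure k a)" using fmH by measurable
      then show "{x \<in> ?H. t < \<bar>f x\<bar>} \<in> sets (wmeasure k a)" by simp
    qed
    finally show ?thesis using lev[OF t] by simp
  qed
  have Lp: "weighted_Lp_norm ?p k a f = ennreal_powr (\<integral>\<^sup>+x. ennreal (\<bar>f' x\<bar> powr ?p) \<partial>weighted_lborel k a) (1 / ?p)"
  proof -
    have "(\<integral>\<^sup>+x. ennreal (\<bar>f x\<bar> powr ?p) \<partial>wmeasure k a) = (\<integral>\<^sup>+x. ennreal (\<bar>f' x\<bar> powr ?p) \<partial>wmeasure k a)"
      using aew by (intro nn_integral_cong_AE) (auto elim!: eventually_mono)
    also have "\<dots> = (\<integral>\<^sup>+x. ennreal (\<bar>f' x\<bar> powr ?p) \<partial>weighted_lborel k a)"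
      by (rule nn_integral_wmeasure_borel) measurable
    finally show ?thesis by (simp add: weighted_Lp_norm_def)
  qed
  show ?thesis
  proof (cases "weighted_variation N k a \<mu> \<nu>")
    case top
    then show ?thesis using S by (simp add: ennreal_mult_top)
  next
    case (real V)
    interpret bv_function N k a f' \<mu>' \<nu>' V
      by unfold_locales (use real V' in auto)
    have "weighted_Lp_norm ?p k a f \<le> ennreal (?S * V)"
      unfolding Lp by (rule ennreal_powr_le[OF sobolev_bv[OF D refl lev']]) (use S real p in auto)
    then show ?thesis using real S by (simp add: ennreal_mult)
  qed
qed

section \<open>The extremal functions\<close>

text \<open>By translation invariance the integrals of the difference quotients vanish.\<close>

lemma integral_derivative_zero:
  fixes \<eta> :: "real ^ 'n::finite \<Rightarrow> real"
  assumes \<eta>: "C1_supported K \<eta> G"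
  shows "(LINT x|lborel. G x $ i) = 0"
proof -
  have cp: "compact K" and d: "\<And>x. (\<eta> has_derivative (\<lambda>h. G x \<bullet> h)) (at x)" and c: "continuous_on UNIV G"
    and z: "\<And>x. x \<notin> K \<Longrightarrow> \<eta> x = 0" using \<eta> by (auto simp: C1_supported_def)
  have ce: "continuous_on UNIV \<eta>" using d by (auto simp: continuous_on_eq_continuous_at intro: has_derivative_continuous)
  have [measurable]: "\<eta> \<in> borel_measurable borel" by (rule borel_measurable_continuous_onI[OF ce])
  have [measurable]: "(\<lambda>x. G x $ i) \<in> borel_measurable borel" by (intro borel_measurable_continuous_onI continuous_intros c)
  obtain L where L: "0 < L" "\<And>x y. \<bar>\<eta> x - \<eta> y\<bar> \<le> L * norm (x - y)" by (rule C1_supported_bounds[OF \<eta>]) blast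
  obtain R where R: "\<And>x. x \<in> K \<Longrightarrow> norm x \<le> R" using compact_imp_bounded[OF cp] by (auto simp: bounded_iff)
  have "integrable lborel (\<lambda>x. indicator K x *\<^sub>R \<eta> x)" by (rule borel_integrable_compact[OF cp continuous_on_subset[OF ce]]) simp
  also have "(\<lambda>x. indicator K x *\<^sub>R \<eta> x) = \<eta>" using z by (auto simp: indicator_def fun_eq_iff)
  finally have ei: "integrable lborel \<eta>" .
  define v where "v j = (1 / real (Suc j)) *\<^sub>R (axis i 1 :: real ^ 'n)" for j
  have nv: "norm (v j) = 1 / real (Suc j)" for j by (simp add: v_def norm_axis_1)
  define q where "q j x = (\<eta> (x + v j) - \<eta> x) * real (Suc j)" for j x
  have zero: "(LINT x|lborel. q j x) = 0" for j
  proof -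
    have "integrable lborel (\<lambda>x. \<eta> (x + v j))" using ei by (subst integral_lborel_shift(2)) auto
    then have "(LINT x|lborel. \<eta> (x + v j) - \<eta> x) = (LINT x|lborel. \<eta> (x + v j)) - (LINT x|lborel. \<eta> x)"
      using ei by simp
    also have "\<dots> = 0" by (subst integral_lborel_shift(1)) auto
    finally show ?thesis unfolding q_def by simp
  qed
  have "(\<lambda>j. LINT x|lborel. q j x) \<longlonglongrightarrow> (LINT x|lborel. G x $ i)"
  proof (rule integral_dominated_convergence[where w="\<lambda>x :: real ^ 'n. L * indicator (cball 0 (R + 1)) x"])
    show "integrable lborel (\<lambda>x :: real ^ 'n. L * indicator (cball 0 (R + 1)) x :: real)"
    proof (intro integrable_mult_right integrable_real_indicator)
      show "emeasure lborel (cball (0::real^'n) (R + 1)) < \<infinity>"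
        by (rule emeasure_bounded_finite) simp
    qed (simp add: borel_closed)
    show "AE x in lborel. (\<lambda>j. q j x) \<longlonglongrightarrow> G x $ i"
    proof (rule AE_I2)
      fix x :: "real ^ 'n"
      have 1: "((\<lambda>t. x + t *\<^sub>R axis i 1) has_derivative (\<lambda>t. t *\<^sub>R axis i 1)) (at 0)" by (auto intro!: derivative_eq_intros)
      have "(\<eta> has_derivative (\<lambda>h. G x \<bullet> h)) (at (x + 0 *\<^sub>R axis i 1))" using d[of x] by simp
      from has_derivative_compose[OF 1 this]
      have "((\<lambda>t. \<eta> (x + t *\<^sub>R axis i 1)) has_real_derivative G x $ i) (at 0)"
        by (simp add: has_field_derivative_def inner_axis mult.commute[of _ "G x $ i"] fun_eq_iff)
      then have l: "((\<lambda>h. (\<eta> (x + h *\<^sub>R axis i 1) - \<eta> x) / h) \<longlongrightarrow> G x $ i) (at 0)" by (simp add: DERIV_def)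
      have "filterlim (\<lambda>j. inverse (real (Suc j))) (at 0) sequentially"
        using LIMSEQ_inverse_real_of_nat by (simp add: filterlim_at)
      from filterlim_compose[OF l this]
      show "(\<lambda>j. q j x) \<longlonglongrightarrow> G x $ i" by (simp add: q_def v_def divide_inverse)
    qed
    show "AE x in lborel. norm (q j x) \<le> L * indicator (cball 0 (R + 1)) x" for j
    proof (rule AE_I2)
      fix x
      show "norm (q j x) \<le> L * indicator (cball 0 (R + 1)) x"
      proof (cases "norm x \<le> R + 1")
        case True
        have "\<bar>\<eta> (x + v j) - \<eta> x\<bar> \<le> L * (1 / real (Suc j))" using L(2)[of "x + v j" x] nv by simp
        then have "\<bar>\<eta> (x + v j) - \<eta> x\<bar> * real (Suc j) \<le> L * (1 / real (Suc j)) * real (Suc j)" by (rule mult_right_mono) simp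
        then show ?thesis using True by (simp add: q_def abs_mult)
      next
        case False
        have "norm (v j) \<le> 1" using nv by simp
        then have "R < norm (x + v j)" "R < norm x" using False norm_triangle_ineq2[of x "- v j"] by auto
        then have "\<eta> (x + v j) = 0" "\<eta> x = 0" using R z by force+
        then show ?thesis using False by (simp add: q_def)
      qed
    qed
  qed (simp_all add: q_def[abs_def])
  then show ?thesis by (simp add: zero LIMSEQ_const_iff)
qed

text \<open>The weighted perimeter of the half-ball bounds the flux of every field \<open>\<Psi>\<close> with \<open>N \<Psi> \<le> \<omega>\<close>. The
  indicator is approximated by the functions \<open>u\<close> of
  \<open>smooth_halfball_approx\<close>: integration by parts turns the integral of \<open>u div \<Psi>\<close> into that of \<open>- \<nabla>u \<bullet> \<Psi>\<close>, which
  is at most the integral of \<open>\<omega> \<parallel>\<nabla>u\<parallel>\<^sub>*\<close>.\<close>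

lemma ball_divergence_bound:
  fixes N :: "real ^ 'n::finite \<Rightarrow> real" and \<Psi> :: "'n \<Rightarrow> real ^ 'n \<Rightarrow> real"
  assumes N: "is_norm N" and a: "0 \<le> a" and D: "1 < wdim k a" and x0: "x0 $ k = 0" and r: "0 < r"
    and \<Psi>: "\<And>i. C1_supported K (\<Psi> i) (G i)" and K: "K \<subseteq> halfspace k"
    and le: "\<And>x. x \<in> halfspace k \<Longrightarrow> N (\<chi> i. \<Psi> i x) \<le> weight k a x"
  shows "\<bar>LINT x|lborel. indicator {x \<in> halfspace k. N (x - x0) \<le> r} x * (\<Sum>i\<in>UNIV. G i x $ i)\<bar>
    \<le> wdim k a * halfball_mass N k a * r powr (wdim k a - 1)"
proof -
  let ?T = "wdim k a * halfball_mass N k a * r powr (wdim k a - 1)" and ?H = "halfspace k"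
  have [measurable]: "N \<in> borel_measurable borel" using is_norm_measurable[OF N, of id borel] by (simp add: id_def)
  have cp: "compact K" and \<Psi>d: "\<And>i x. (\<Psi> i has_derivative (\<lambda>h. G i x \<bullet> h)) (at x)"
    and Gc: "\<And>i. continuous_on UNIV (G i)" and \<Psi>z: "\<And>i x. x \<notin> K \<Longrightarrow> \<Psi> i x = 0"
    using \<Psi> by (auto simp: C1_supported_def)
  have Gz: "G i x = 0" if "x \<notin> K" for i x by (rule gradient_zero_outside[OF \<Psi> that])
  have \<Psi>c: "continuous_on UNIV (\<Psi> i)" for i
    using \<Psi>d by (auto simp: continuous_on_eq_continuous_at intro: has_derivative_continuous)
  define dv where "dv x = (\<Sum>i\<in>UNIV. G i x $ i)" for x
  have dvc: "continuous_on UNIV dv" unfolding dv_def by (intro continuous_intros Gc)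
  have [measurable]: "dv \<in> borel_measurable borel" by (rule borel_measurable_continuous_onI[OF dvc])
  have cint: "integrable lborel g" if "continuous_on UNIV g" "\<And>x. x \<notin> K \<Longrightarrow> g x = 0" for g :: "real ^ 'n \<Rightarrow> real"
  proof -
    have "integrable lborel (\<lambda>x. indicator K x *\<^sub>R g x)" by (rule borel_integrable_compact[OF cp continuous_on_subset[OF that(1)]]) simp
    also have "(\<lambda>x. indicator K x *\<^sub>R g x) = g" using that(2) by (auto simp: indicator_def fun_eq_iff)
    finally show ?thesis .
  qed
  have dvi: "integrable lborel dv" by (rule cint[OF dvc]) (simp add: dv_def Gz)
  define approx where "approx e u \<longleftrightarrow> continuous_on UNIV u \<and> (\<forall>x. \<bar>u x\<bar> \<le> 1) \<and> (\<forall>x. N (x - x0) \<le> r - e \<longrightarrow> u x = 1)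
     \<and> (\<forall>x. r + e \<le> N (x - x0) \<longrightarrow> u x = 0) \<and> \<bar>LINT x|lborel. u x * dv x\<bar> \<le> ?T + e" for e :: real and u :: "real ^ 'n \<Rightarrow> real"
  have ex: "\<exists>u. approx e u" if e: "0 < e" "e < r" for e
  proof -
    obtain u g where u: "\<And>m. Cm_on m UNIV u" "\<And>x. (u has_derivative (\<lambda>h. g x \<bullet> h)) (at x)"
      "\<And>x. 0 \<le> u x" "\<And>x. u x \<le> 1" "\<And>x. N (x - x0) \<le> r - e \<Longrightarrow> u x = 1" "\<And>x. r + e \<le> N (x - x0) \<Longrightarrow> u x = 0"
      "(\<integral>\<^sup>+x. ennreal (dual_norm N (g x)) \<partial>weighted_lborel k a) \<le> ennreal (?T + e)" "\<And>i. continuous_on UNIV (\<lambda>x. g x $ i)"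
      by (rule smooth_halfball_approx[OF N a D x0 r e]) blast
    have uc: "continuous_on UNIV u" using u(1)[of 0] by simp
    have gc: "continuous_on UNIV g" by (rule continuous_on_vecI[OF u(8)])
    have prod: "C1_supported K (\<lambda>x. u x * \<Psi> i x) (\<lambda>x. u x *\<^sub>R G i x + \<Psi> i x *\<^sub>R g x)" for i
      unfolding C1_supported_def
    proof (intro conjI allI impI)
      show "((\<lambda>x. u x * \<Psi> i x) has_derivative (\<lambda>h. (u x *\<^sub>R G i x + \<Psi> i x *\<^sub>R g x) \<bullet> h)) (at x)" for x
        by (rule has_derivative_eq_rhs[OF has_derivative_mult[OF u(2) \<Psi>d]]) (simp add: inner_add_left fun_eq_iff mult_ac)
    qed (use cp \<Psi>z in \<open>auto intro!: continuous_intros uc gc \<Psi>c Gc\<close>)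
    have i1: "integrable lborel (\<lambda>x. u x * G i x $ i)" for i
      by (rule cint) (auto intro!: continuous_intros uc Gc simp: Gz)
    have i2: "integrable lborel (\<lambda>x. \<Psi> i x * g x $ i)" for i
      by (rule cint) (auto intro!: continuous_intros gc \<Psi>c simp: \<Psi>z)
    have parts: "(LINT x|lborel. u x * G i x $ i) = - (LINT x|lborel. \<Psi> i x * g x $ i)" for i
      using integral_derivative_zero[OF prod, of i i] i1[of i] i2[of i] by simp
    define \<Psi>v where "\<Psi>v x = (\<chi> i. \<Psi> i x)" for x
    have "(LINT x|lborel. u x * dv x) = (\<Sum>i\<in>UNIV. LINT x|lborel. u x * G i x $ i)"
      unfolding dv_def sum_distrib_left using i1 by (subst Bochner_Integration.integral_sum) auto
    also have "\<dots> = - (\<Sum>i\<in>UNIV. LINT x|lborel. \<Psi> i x * g x $ i)" by (simp add: parts sum_negf)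
    also have "(\<Sum>i\<in>UNIV. LINT x|lborel. \<Psi> i x * g x $ i) = (LINT x|lborel. g x \<bullet> \<Psi>v x)"
      using i2 by (subst Bochner_Integration.integral_sum[symmetric]) (auto simp: inner_vec_def \<Psi>v_def mult.commute)
    finally have eq: "\<bar>LINT x|lborel. u x * dv x\<bar> = \<bar>LINT x|lborel. g x \<bullet> \<Psi>v x\<bar>" by simp
    have gi: "integrable lborel (\<lambda>x. g x \<bullet> \<Psi>v x)"
      by (rule cint) (auto intro!: continuous_intros gc \<Psi>c simp: \<Psi>v_def \<Psi>z inner_vec_def)
    have dgm [measurable]: "(\<lambda>x. dual_norm N (g x)) \<in> borel_measurable borel"
      by (rule is_norm_measurable[OF is_norm_dual_norm[OF N] borel_measurable_continuous_onI[OF gc]])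
    have "ennreal \<bar>LINT x|lborel. g x \<bullet> \<Psi>v x\<bar> \<le> (\<integral>\<^sup>+x. ennreal \<bar>g x \<bullet> \<Psi>v x\<bar> \<partial>lborel)"
      using integral_norm_bound_ennreal[OF gi] by simp
    also have "\<dots> \<le> (\<integral>\<^sup>+x. ennreal (indicator ?H x * weight k a x) * ennreal (dual_norm N (g x)) \<partial>lborel)"
    proof (rule nn_integral_mono)
      fix x
      have d0: "0 \<le> dual_norm N (g x)" by (rule is_normD(1)[OF is_norm_dual_norm[OF N]])
      have "\<bar>g x \<bullet> \<Psi>v x\<bar> \<le> indicator ?H x * weight k a x * dual_norm N (g x)"
      proof (cases "x \<in> ?H")
        case True
        have "\<bar>g x \<bullet> \<Psi>v x\<bar> \<le> dual_norm N (g x) * N (\<Psi>v x)"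
          using inner_le_dual_norm[OF N, of "g x" "\<Psi>v x"] inner_le_dual_norm[OF N, of "g x" "- \<Psi>v x"]
          by (simp add: abs_le_iff is_normD(5)[OF N])
        also have "\<dots> \<le> dual_norm N (g x) * weight k a x"
          by (rule mult_left_mono[OF le[OF True, folded \<Psi>v_def] d0])
        finally show ?thesis using True by (simp add: mult.commute)
      next
        case False
        then have "x \<notin> K" using K by blast
        then have "\<Psi>v x = 0" by (simp add: \<Psi>v_def \<Psi>z vec_eq_iff)
        then show ?thesis using d0 by simp
      qed
      then show "ennreal \<bar>g x \<bullet> \<Psi>v x\<bar> \<le> ennreal (indicator ?H x * weight k a x) * ennreal (dual_norm N (g x))"
        using d0 by (subst ennreal_mult[symmetric]) (auto intro!: ennreal_leI)
    qed
    also have "\<dots> = (\<integral>\<^sup>+x. ennreal (dual_norm N (g x)) \<partial>weighted_lborel k a)"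
      by (rule nn_integral_weighted_lborel[symmetric]) measurable
    also have "\<dots> \<le> ennreal (?T + e)" by (rule u(7))
    finally have "\<bar>LINT x|lborel. g x \<bullet> \<Psi>v x\<bar> \<le> ?T + e"
      using D halfball_mass_pos[OF N a, of k] e by (subst (asm) ennreal_le_iff) auto
    then have "approx e u" unfolding approx_def eq using u(3-6) uc by auto
    then show ?thesis by blast
  qed
  define e where "e j = r / (real j + 2)" for j :: nat
  have e: "0 < e j" "e j < r" for j using r by (auto simp: e_def field_simps intro: add_pos_nonneg)
  have elim: "e \<longlonglongrightarrow> 0"
  proof -
    have "(\<lambda>j. r * inverse (real (Suc (Suc j)))) \<longlonglongrightarrow> r * 0" by (intro tendsto_intros LIMSEQ_Suc[OF LIMSEQ_inverse_real_of_nat])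
    then show ?thesis by (simp add: e_def[abs_def] divide_inverse add.commute)
  qed
  have "\<exists>u. \<forall>j. approx (e j) (u j)" by (intro choice allI ex e)
  then obtain u where u: "\<And>j. approx (e j) (u j)" by blast
  have [measurable]: "u j \<in> borel_measurable borel" for j using u[of j] by (auto simp: approx_def intro: borel_measurable_continuous_onI)
  let ?E = "{x \<in> ?H. N (x - x0) \<le> r}"
  have Em [measurable]: "?E \<in> sets borel" by measurable
  have nullS: "AE x in lborel. x \<in> ?H \<longrightarrow> N (x - x0) \<noteq> r"
  proof -
    have [measurable]: "{x. N (x - x0) = r} \<in> sets borel" by measurable
    have "{x. N (x - x0) = r} \<in> null_sets (weighted_lborel k a)"
      using measure_weighted_open_norm_ball(2)[OF N a x0 r] by (auto simp: null_sets_def)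
    then have "AE x in weighted_lborel k a. N (x - x0) \<noteq> r" using AE_not_in by fastforce
    then have "AE x in lborel. 0 < ennreal (indicator ?H x * weight k a x) \<longrightarrow> N (x - x0) \<noteq> r"
      unfolding weighted_lborel_def by (subst (asm) AE_density) auto
    then show ?thesis by (rule eventually_mono) (auto simp: weight_def halfspace_def indicator_def ennreal_less_zero_iff)
  qed
  have "(\<lambda>j. LINT x|lborel. u j x * dv x) \<longlonglongrightarrow> (LINT x|lborel. indicator ?E x * dv x)"
  proof (rule integral_dominated_convergence[where w="\<lambda>x. \<bar>dv x\<bar>"])
    show "AE x in lborel. norm (u j x * dv x) \<le> \<bar>dv x\<bar>" for j
    proof (rule AE_I2)
      fix x show "norm (u j x * dv x) \<le> \<bar>dv x\<bar>"
        using u[of j] mult_right_mono[of "\<bar>u j x\<bar>" 1 "\<bar>dv x\<bar>"] by (simp add: approx_def abs_mult)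
    qed
    show "AE x in lborel. (\<lambda>j. u j x * dv x) \<longlonglongrightarrow> indicator ?E x * dv x"
      using nullS
    proof (rule eventually_mono)
      fix x assume ne: "x \<in> ?H \<longrightarrow> N (x - x0) \<noteq> r"
      show "(\<lambda>j. u j x * dv x) \<longlonglongrightarrow> indicator ?E x * dv x"
      proof (cases "x \<in> ?H")
        case False
        then have "x \<notin> K" using K by blast
        then have "dv x = 0" by (simp add: dv_def Gz)
        then show ?thesis by simp
      next
        case True
        have ev: "eventually (\<lambda>j. e j < \<bar>r - N (x - x0)\<bar>) sequentially"
          using elim by (rule order_tendstoD(2)) (use ne True in auto)
        have "eventually (\<lambda>j. u j x * dv x = indicator ?E x * dv x) sequentially"
          using ev
        proof (rule eventually_mono)
          fix j assume j: "e j < \<bar>r - N (x - x0)\<bar>"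
          show "u j x * dv x = indicator ?E x * dv x"
          proof (cases "N (x - x0) \<le> r")
            case inside: True
            then have "N (x - x0) \<le> r - e j" using j by linarith
            then have "u j x = 1" using u[of j] by (simp add: approx_def)
            then show ?thesis using inside True by simp
          next
            case outside: False
            then have "r + e j \<le> N (x - x0)" using j by linarith
            then have "u j x = 0" using u[of j] by (simp add: approx_def)
            then show ?thesis using outside by simp
          qed
        qed
        then show ?thesis by (rule tendsto_eventually)
      qed
    qed
  qed (use dvi in auto)
  then have "(\<lambda>j. \<bar>LINT x|lborel. u j x * dv x\<bar>) \<longlonglongrightarrow> \<bar>LINT x|lborel. indicator ?E x * dv x\<bar>" by (rule tendsto_rabs)
  moreover have "(\<lambda>j. ?T + e j) \<longlonglongrightarrow> ?T + 0" by (intro tendsto_intros elim)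
  moreover have "\<bar>LINT x|lborel. u j x * dv x\<bar> \<le> ?T + e j" for j using u[of j] by (simp add: approx_def)
  ultimately have "\<bar>LINT x|lborel. indicator ?E x * dv x\<bar> \<le> ?T + 0"
    by (intro LIMSEQ_le[of "\<lambda>j. \<bar>LINT x|lborel. u j x * dv x\<bar>" _ "\<lambda>j. ?T + e j"]) auto
  then show ?thesis by (simp add: dv_def)
qed

lemma Cm_on_extend_zero:
  fixes u :: "real ^ 'n::finite \<Rightarrow> real"
  assumes u: "Cm_on 1 (halfspace k) u" and K: "compact K" "K \<subseteq> halfspace k" and z: "\<And>x. x \<in> halfspace k \<Longrightarrow> x \<notin> K \<Longrightarrow> u x = 0"
  shows "Cm_on 1 UNIV (\<lambda>x. indicator (halfspace k) x * u x)"
proof -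
  let ?H = "halfspace k" and ?v = "\<lambda>x. indicator (halfspace k) x * u x"
  obtain G where G: "\<And>x. x \<in> ?H \<Longrightarrow> (u has_derivative (\<lambda>h. G x \<bullet> h)) (at x within ?H)"
    and Gc: "\<And>i. continuous_on ?H (\<lambda>x. G x $ i)" using u by auto
  have d: "(u has_derivative (\<lambda>h. G x \<bullet> h)) (at x)" if "x \<in> ?H" for x
    using G[OF that] at_within_open[OF that open_halfspace] by simp
  have dv: "(?v has_derivative (\<lambda>h. G x \<bullet> h)) (at x)" if "x \<in> ?H" for x
    by (rule has_derivative_transform_within_open[OF d[OF that] open_halfspace that]) simp
  have cl: "open (- K)" using K(1) by (simp add: compact_imp_closed open_Compl)
  have d0: "(?v has_derivative (\<lambda>h. 0)) (at x)" if "x \<in> - K" for x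
  proof -
    have "((\<lambda>_. 0::real) has_derivative (\<lambda>h. 0)) (at x)" by simp
    then show ?thesis
      by (rule has_derivative_transform_within_open[OF _ cl that]) (use z in \<open>auto simp: indicator_def\<close>)
  qed
  define G' where "G' x = (if x \<in> K then G x else 0)" for x
  have GG': "G' x = G x" if "x \<in> ?H" for x
  proof (cases "x \<in> K")
    case False
    from has_derivative_unique[OF dv[OF that] d0] False have "G x \<bullet> G x = 0" by (meson ComplI)
    then show ?thesis using False by (simp add: G'_def)
  qed (simp add: G'_def)
  have "(?v has_derivative (\<lambda>h. G' x \<bullet> h)) (at x)" for x
  proof (cases "x \<in> ?H")
    case True then show ?thesis using dv GG' by simp
  next
    case False
    then have "x \<in> - K" using K by blast
    then show ?thesis using d0 by (simp add: G'_def)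
  qed
  moreover have "continuous_on UNIV (\<lambda>x. G' x $ i)" for i
  proof -
    have "continuous_on ?H (\<lambda>x. G' x $ i)" by (rule continuous_on_eq[OF Gc]) (simp add: GG')
    moreover have "continuous_on (- K) (\<lambda>x. G' x $ i)"
      by (rule continuous_on_eq[OF continuous_on_const[of _ 0]]) (simp add: G'_def)
    ultimately have "continuous_on (?H \<union> - K) (\<lambda>x. G' x $ i)" by (intro continuous_on_open_Un cl open_halfspace)
    moreover have "?H \<union> - K = UNIV" using K by blast
    ultimately show ?thesis by simp
  qed
  ultimately show ?thesis by auto
qed

text \<open>After multiplication by the weight a test field extends to a \<open>C\<^sup>1\<close> field on the whole space, in the
  form required by \<open>ball_divergence_bound\<close>.\<close>

lemma test_field_weight:
  fixes g :: "real ^ 'n::finite \<Rightarrow> real ^ 'n"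
  assumes g: "test_field k g"
  obtains K G where "K \<subseteq> halfspace k" "\<And>i. C1_supported K (\<lambda>x. indicator (halfspace k) x * weight k a x * g x $ i) (G i)"
    "\<And>x. x \<in> halfspace k \<Longrightarrow> divergence (\<lambda>y. weight k a y *\<^sub>R g y) x = (\<Sum>i\<in>UNIV. G i x $ i)"
proof -
  let ?H = "halfspace k" and ?\<Psi> = "\<lambda>i x. indicator (halfspace k) x * weight k a x * g x $ i"
  obtain K where K: "compact K" "K \<subseteq> ?H" and z: "\<And>x. x \<in> ?H \<Longrightarrow> x \<notin> K \<Longrightarrow> g x = 0"
    using g by (auto simp: test_field_def)
  have "\<exists>G. C1_supported K (?\<Psi> i) G" for i
  proof -
    have "Cm_on 1 UNIV (\<lambda>x. indicator ?H x * g x $ i)"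
      by (rule Cm_on_extend_zero[OF _ K]) (use g z in \<open>auto simp: test_field_def simp del: One_nat_def\<close>)
    then obtain G where "C1_supported K (\<lambda>x. indicator ?H x * weight k a x * (indicator ?H x * g x $ i)) G"
      by (rule C1_supported_weight[OF _ K]) (use z in \<open>auto simp: indicator_def\<close>)
    also have "(\<lambda>x. indicator ?H x * weight k a x * (indicator ?H x * g x $ i)) = ?\<Psi> i"
      by (auto simp: indicator_def)
    finally show ?thesis by blast
  qed
  then obtain G where G: "\<And>i. C1_supported K (?\<Psi> i) (G i)" by metis
  have "divergence (\<lambda>y. weight k a y *\<^sub>R g y) x = (\<Sum>i\<in>UNIV. G i x $ i)" if x: "x \<in> ?H" for x
  proof (rule divergence_eq)
    fix i
    have "(?\<Psi> i has_derivative (\<lambda>h. G i x \<bullet> h)) (at x)" using G by (auto simp: C1_supported_def)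
    then show "((\<lambda>y. (weight k a y *\<^sub>R g y) $ i) has_derivative (\<lambda>h. G i x \<bullet> h)) (at x)"
      by (rule has_derivative_transform_within_open[OF _ open_halfspace x]) simp
  qed
  then show ?thesis using that[OF K(2) G] by blast
qed

context
  fixes N :: "real ^ 'n::finite \<Rightarrow> real" and k :: 'n and a :: real and x0 :: "real ^ 'n" and r c :: real
    and f :: "real ^ 'n \<Rightarrow> real"
  assumes N: "is_norm N" and a: "0 \<le> a" and D: "1 < wdim k a" and x0: "x0 $ k = 0" and r: "0 < r"
    and f: "f = (\<lambda>x. c * indicator {x \<in> halfspace k. N (x - x0) \<le> r} x)"
begin

lemma halfball_meas [measurable]: "{x \<in> halfspace k. N (x - x0) \<le> r} \<in> sets borel"
proof -
  have [measurable]: "N \<in> borel_measurable borel" using is_norm_measurable[OF N, of id borel] by (simp add: id_def)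
  show ?thesis by measurable
qed

lemma halfball_function_locally_integrable:
  assumes "compact K" shows "f absolutely_integrable_on K"
proof -
  let ?E = "{x \<in> halfspace k. N (x - x0) \<le> r}"
  have [measurable]: "K \<in> sets borel" using assms by (rule borel_compact)
  have "integrable lborel (\<lambda>x. c * indicator (K \<inter> ?E) x :: real)"
  proof (intro integrable_mult_right integrable_real_indicator)
    show "emeasure lborel (K \<inter> ?E) < \<infinity>"
      by (rule emeasure_bounded_finite) (use assms in \<open>auto intro: bounded_subset compact_imp_bounded\<close>)
  qed measurable
  moreover have "(\<lambda>x. indicator K x *\<^sub>R f x) = (\<lambda>x. c * indicator (K \<inter> ?E) x)" by (auto simp: f indicator_def)
  ultimately show ?thesis by (simp add: set_integrable_def integrable_completion)
qed

lemma halfball_function_test_le: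
  assumes g: "test_field k g" and g1: "\<And>x. x \<in> halfspace k \<Longrightarrow> N (g x) \<le> 1"
  shows "(LINT x:halfspace k|lebesgue. f x * divergence (\<lambda>y. weight k a y *\<^sub>R g y) x)
     \<le> \<bar>c\<bar> * (wdim k a * halfball_mass N k a * r powr (wdim k a - 1))"
proof -
  let ?H = "halfspace k" and ?E = "{x \<in> halfspace k. N (x - x0) \<le> r}"
  obtain K G where K: "K \<subseteq> ?H" and G: "\<And>i. C1_supported K (\<lambda>x. indicator ?H x * weight k a x * g x $ i) (G i)"
    and div: "\<And>x. x \<in> ?H \<Longrightarrow> divergence (\<lambda>y. weight k a y *\<^sub>R g y) x = (\<Sum>i\<in>UNIV. G i x $ i)"
    by (rule test_field_weight[OF g, of a]) blast
  let ?F = "\<lambda>x. c * (indicator ?E x * (\<Sum>i\<in>UNIV. G i x $ i))"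
  have [measurable]: "(\<lambda>x. \<Sum>i\<in>UNIV. G i x $ i) \<in> borel_measurable borel"
    using G by (intro borel_measurable_continuous_onI continuous_intros) (auto simp: C1_supported_def)
  have Fm: "?F \<in> borel_measurable borel" by measurable
  have eq: "(\<lambda>x. indicator ?H x * (f x * divergence (\<lambda>y. weight k a y *\<^sub>R g y) x)) = ?F"
    by (rule ext) (auto simp: f div indicator_def)
  have "(LINT x:?H|lebesgue. f x * divergence (\<lambda>y. weight k a y *\<^sub>R g y) x) = (LINT x|lborel. ?F x)"
    by (rule set_integral_lebesgue_eq) (use Fm in \<open>simp_all add: fun_cong[OF eq] eq measurable_completion\<close>)
  also have "\<dots> = c * (LINT x|lborel. indicator ?E x * (\<Sum>i\<in>UNIV. G i x $ i))" by simp
  also have "\<dots> \<le> \<bar>c\<bar> * \<bar>LINT x|lborel. indicator ?E x * (\<Sum>i\<in>UNIV. G i x $ i)\<bar>"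
    unfolding abs_mult[symmetric] by (rule abs_ge_self)
  also have "\<dots> \<le> \<bar>c\<bar> * (wdim k a * halfball_mass N k a * r powr (wdim k a - 1))"
  proof (rule mult_left_mono[OF ball_divergence_bound[OF N a D x0 r G K]])
    fix x assume x: "x \<in> ?H"
    have "(\<chi> i. indicator ?H x * weight k a x * g x $ i) = weight k a x *\<^sub>R g x" using x by (simp add: vec_eq_iff)
    then show "N (\<chi> i. indicator ?H x * weight k a x * g x $ i) \<le> weight k a x"
      using mult_left_mono[OF g1[OF x], of "weight k a x"] by (simp add: is_normD[OF N] weight_def)
  qed simp
  finally show ?thesis .
qed

lemma halfball_function_weighted_BV: "weighted_BV N k a f"
  unfolding weighted_BV_def
proof (intro conjI allI impI)
  show "f absolutely_integrable_on K" if "compact K \<and> K \<subseteq> halfspace k" for K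
    using that by (auto intro: halfball_function_locally_integrable)
  show "bdd_above {LINT x:halfspace k|lebesgue. f x * divergence (\<lambda>y. weight k a y *\<^sub>R g y) x
                | g. test_field k g \<and> (\<forall>x\<in>halfspace k. N (g x) \<le> 1)}"
    by (rule bdd_aboveI) (use halfball_function_test_le in blast)
qed

lemma halfball_function_level_sets:
  assumes t: "0 < t" shows "emeasure (wmeasure k a) {x \<in> halfspace k. t < \<bar>f x\<bar>} < \<infinity>"
proof -
  let ?H = "halfspace k" and ?E = "{x \<in> halfspace k. N (x - x0) \<le> r}"
  have EH: "?E \<in> sets (wmeasure k a)"
  proof -
    have "?E \<in> sets lebesgue" by (rule sets_completionI_sets) simp
    then have "?E \<in> sets (lebesgue_on ?H)" by (subst sets_restrict_space_iff) auto
    then show ?thesis by (simp add: wmeasure_def)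
  qed
  have "emeasure (wmeasure k a) {x \<in> ?H. t < \<bar>f x\<bar>} \<le> emeasure (wmeasure k a) ?E"
    by (rule emeasure_mono[OF _ EH]) (use t in \<open>auto simp: f indicator_def split: if_splits\<close>)
  also have "\<dots> = (\<integral>\<^sup>+x. indicator ?E x \<partial>wmeasure k a)" by (rule nn_integral_indicator[OF EH, symmetric])
  also have "\<dots> = (\<integral>\<^sup>+x. indicator ?E x \<partial>weighted_lborel k a)" by (rule nn_integral_wmeasure_borel) measurable
  also have "\<dots> = emeasure (weighted_lborel k a) ?E" by (rule nn_integral_indicator) simp
  also have "\<dots> < \<infinity>" by (simp add: emeasure_weighted_norm_ball[OF N a x0 r])
  finally show ?thesis .
qed

lemma halfball_function_Lp_norm:
  "weighted_Lp_norm (wdim k a / (wdim k a - 1)) k a f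
     = ennreal (sobolev_const N k a * (\<bar>c\<bar> * (wdim k a * halfball_mass N k a * r powr (wdim k a - 1))))"
proof -
  let ?E = "{x \<in> halfspace k. N (x - x0) \<le> r}" and ?D = "wdim k a" and ?m = "halfball_mass N k a"
  define p where "p = ?D / (?D - 1)"
  have p: "0 < p" using D by (simp add: p_def)
  have m: "0 < ?m" by (rule halfball_mass_pos[OF N a])
  have "(\<integral>\<^sup>+x. ennreal (\<bar>f x\<bar> powr p) \<partial>wmeasure k a) = (\<integral>\<^sup>+x. ennreal (\<bar>c\<bar> powr p) * indicator ?E x \<partial>wmeasure k a)"
    using p by (intro nn_integral_cong) (auto simp: f indicator_def)
  also have "\<dots> = (\<integral>\<^sup>+x. ennreal (\<bar>c\<bar> powr p) * indicator ?E x \<partial>weighted_lborel k a)"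
    by (rule nn_integral_wmeasure_borel) measurable
  also have "\<dots> = ennreal (\<bar>c\<bar> powr p) * emeasure (weighted_lborel k a) ?E" by (rule nn_integral_cmult_indicator) simp
  also have "\<dots> = ennreal (\<bar>c\<bar> powr p * (?m * r powr ?D))"
    unfolding emeasure_weighted_norm_ball[OF N a x0 r] using m by (simp add: ennreal_mult)
  finally have "weighted_Lp_norm p k a f = ennreal ((\<bar>c\<bar> powr p * (?m * r powr ?D)) powr (1 / p))"
    using m by (simp add: weighted_Lp_norm_def ennreal_powr_def)
  also have "(\<bar>c\<bar> powr p * (?m * r powr ?D)) powr (1 / p) = \<bar>c\<bar> * (?m powr (1 / p) * r powr (?D * (1 / p)))"
    using p m by (simp add: powr_mult powr_powr)
  also have "?D * (1 / p) = ?D - 1" using D by (simp add: p_def)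
  also have "?m powr (1 / p) = ?m powr (- 1 / ?D) * ?m"
  proof -
    have "1 / p = - 1 / ?D + 1" using D by (simp add: p_def field_simps)
    then show ?thesis using m by (simp only: powr_add) simp
  qed
  also have "\<bar>c\<bar> * (?m powr (- 1 / ?D) * ?m * r powr (?D - 1)) = sobolev_const N k a * (\<bar>c\<bar> * (?D * ?m * r powr (?D - 1)))"
    using D by (simp add: sobolev_const_def)
  finally show ?thesis by (simp add: p_def)
qed

text \<open>The measure \<open>\<mu>\<close> and the field \<open>\<nu>\<close> enter only through integration by parts, which reduces the
  integrals of \<open>\<omega> (g \<bullet> \<nu>)\<close> to fluxes out of the half-ball; duality then bounds the variation by the
  largest flux.\<close>

lemma halfball_function_variation_le:
  assumes dm: "derivative_measure k f \<mu> \<nu>"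
  shows "weighted_variation N k a \<mu> \<nu> \<le> ennreal (\<bar>c\<bar> * (wdim k a * halfball_mass N k a * r powr (wdim k a - 1)))"
proof -
  let ?H = "halfspace k" and ?E = "{x \<in> halfspace k. N (x - x0) \<le> r}"
  obtain f' \<mu>' \<nu>' where data: "bv_data N k a f' \<mu>' \<nu>'" and ae: "AE x in lborel. indicator ?H x * f x = f' x"
    and V': "weighted_variation N k a \<mu> \<nu> = (\<integral>\<^sup>+x. ennreal (weight k a x * dual_norm N (\<nu>' x)) \<partial>\<mu>')"
    by (rule bv_data_of_derivative[OF N a _ dm]) (use halfball_function_locally_integrable in auto)
  interpret bv_data N k a f' \<mu>' \<nu>' by (rule data)
  have f'E: "AE x in lborel. f' x = c * indicator ?E x"
    using ae by (rule eventually_mono) (auto simp: f indicator_def split: if_splits)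
  define M where "M = density \<mu>' (\<lambda>x. ennreal (indicator ?H x * weight k a x))"
  have dm [measurable]: "(\<lambda>x. dual_norm N (\<nu>' x)) \<in> borel_measurable borel"
    by (rule is_norm_measurable[OF is_norm_dual_norm[OF N] nu_meas])
  have dn: "0 \<le> dual_norm N (\<nu>' x)" for x by (rule is_normD(1)[OF is_norm_dual_norm[OF N]])
  have w0: "0 \<le> weight k a x" for x :: "real ^ 'n" by (simp add: weight_def)
  have "weighted_variation N k a \<mu> \<nu> = (\<integral>\<^sup>+x. ennreal (indicator ?H x * weight k a x) * ennreal (dual_norm N (\<nu>' x)) \<partial>\<mu>')"
    unfolding V' using mu_AE by (intro nn_integral_cong_AE) (auto elim!: eventually_mono simp: ennreal_mult dn w0)
  also have "\<dots> = (\<integral>\<^sup>+x. ennreal (dual_norm N (\<nu>' x)) \<partial>M)"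
    unfolding M_def by (rule nn_integral_density[symmetric]) measurable
  also have "\<dots> \<le> ennreal (\<bar>c\<bar> * (wdim k a * halfball_mass N k a * r powr (wdim k a - 1)))"
  proof (rule dual_norm_integral_le[OF N])
    show "sets M = sets borel" by (simp add: M_def sets_mu)
    show "AE x in M. x \<in> ?H" unfolding M_def using mu_AE by (subst AE_density) (auto elim!: eventually_mono)
    show "emeasure M K < \<infinity>" if K: "compact K" "K \<subseteq> ?H" for K
    proof -
      have [measurable]: "K \<in> sets borel" using K by (auto intro: borel_compact)
      have "continuous_on K (weight k a)"
        unfolding weight_def using K(2) by (intro continuous_intros) (auto simp: halfspace_def)
      then have "bounded (weight k a ` K)" using K(1) by (intro compact_imp_bounded compact_continuous_image)
      then obtain C where C: "0 < C" "\<And>x. x \<in> K \<Longrightarrow> weight k a x \<le> C" by (auto simp: bounded_pos w0)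
      have "emeasure M K = (\<integral>\<^sup>+x. ennreal (indicator ?H x * weight k a x) * indicator K x \<partial>\<mu>')"
        unfolding M_def by (rule emeasure_density) measurable
      also have "\<dots> \<le> (\<integral>\<^sup>+x. ennreal C * indicator K x \<partial>\<mu>')"
        by (rule nn_integral_mono) (use C in \<open>auto simp: indicator_def intro!: ennreal_leI\<close>)
      also have "\<dots> = ennreal C * emeasure \<mu>' K" by (rule nn_integral_cmult_indicator) measurable
      also have "\<dots> < \<infinity>" using mu_fin[OF K] by (simp add: ennreal_mult_less_top)
      finally show ?thesis .
    qed
    fix g assume g: "smooth_field k g" and g1: "\<And>x. N (g x) \<le> 1"
    obtain K where K: "compact K" "K \<subseteq> ?H" and z: "\<And>x. x \<notin> K \<Longrightarrow> g x = 0" using g by (auto simp: smooth_field_def)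
    let ?\<Psi> = "\<lambda>i x. indicator ?H x * weight k a x * g x $ i"
    have "\<exists>G. C1_supported K (?\<Psi> i) G" for i
    proof -
      have "Cm_on 1 UNIV (\<lambda>x. g x $ i)" using g unfolding smooth_field_def by blast
      from C1_supported_weight[OF this K, of a] show ?thesis using z by (metis zero_index)
    qed
    then obtain G where G: "\<And>i. C1_supported K (?\<Psi> i) (G i)" by metis
    have \<Psi>c: "continuous_on UNIV (?\<Psi> i)" for i
      using G[of i] unfolding C1_supported_def continuous_on_eq_continuous_at[OF open_UNIV]
      by (blast intro: has_derivative_continuous)
    have Gc: "continuous_on UNIV (G i)" for i using G[of i] by (simp add: C1_supported_def)
    have Gz: "G i x = 0" if "x \<notin> K" for i x by (rule gradient_zero_outside[OF G that])
    have [measurable]: "(\<lambda>x. g x $ i) \<in> borel_measurable borel" for i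
    proof -
      have "Cm_on 0 UNIV (\<lambda>x. g x $ i)" using g unfolding smooth_field_def by blast
      then show ?thesis by (simp add: borel_measurable_continuous_onI)
    qed
    have i1: "integrable \<mu>' (\<lambda>x. ?\<Psi> i x * \<nu>' x $ i)" for i
      by (rule integrable_mu_mult[OF K \<Psi>c _ nu_component_meas nu_component]) (simp add: z)
    have i2: "integrable lborel (\<lambda>x. f' x * G i x $ i)" for i
      by (rule integrable_f_mult[OF K]) (auto intro!: continuous_intros Gc simp: Gz)
    have inner: "g x \<bullet> \<nu>' x = (\<Sum>i\<in>UNIV. g x $ i * \<nu>' x $ i)" for x by (simp add: inner_vec_def)
    have "(LINT x|M. g x \<bullet> \<nu>' x) = (LINT x|\<mu>'. (indicator ?H x * weight k a x) *\<^sub>R (g x \<bullet> \<nu>' x))"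
      unfolding M_def by (rule integral_density) (auto simp: inner w0)
    also have "\<dots> = (LINT x|\<mu>'. (\<Sum>i\<in>UNIV. ?\<Psi> i x * \<nu>' x $ i))"
      by (simp add: inner sum_distrib_left mult.assoc)
    also have "\<dots> = (\<Sum>i\<in>UNIV. LINT x|\<mu>'. ?\<Psi> i x * \<nu>' x $ i)"
      by (rule Bochner_Integration.integral_sum) (rule i1)
    also have "\<dots> = (\<Sum>i\<in>UNIV. - (LINT x|lborel. f' x * G i x $ i))" using ibp[OF G K(2)] by simp
    also have "\<dots> = - (LINT x|lborel. (\<Sum>i\<in>UNIV. f' x * G i x $ i))"
      using i2 by (subst Bochner_Integration.integral_sum) (auto simp: sum_negf)
    also have "(LINT x|lborel. (\<Sum>i\<in>UNIV. f' x * G i x $ i)) = (LINT x|lborel. c * (indicator ?E x * (\<Sum>i\<in>UNIV. G i x $ i)))"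
    proof (rule integral_cong_AE)
      have [measurable]: "(\<lambda>x. G i x $ i) \<in> borel_measurable borel" for i
        by (intro borel_measurable_continuous_onI continuous_intros Gc)
      show "(\<lambda>x. \<Sum>i\<in>UNIV. f' x * G i x $ i) \<in> borel_measurable lborel" by measurable
      show "(\<lambda>x. c * (indicator ?E x * (\<Sum>i\<in>UNIV. G i x $ i))) \<in> borel_measurable lborel" by measurable
      show "AE x in lborel. (\<Sum>i\<in>UNIV. f' x * G i x $ i) = c * (indicator ?E x * (\<Sum>i\<in>UNIV. G i x $ i))"
        using f'E by (rule eventually_mono) (simp add: sum_distrib_left mult.assoc)
    qed
    also have "- \<dots> = - (c * (LINT x|lborel. indicator ?E x * (\<Sum>i\<in>UNIV. G i x $ i)))" by simp
    also have "\<dots> \<le> \<bar>c\<bar> * \<bar>LINT x|lborel. indicator ?E x * (\<Sum>i\<in>UNIV. G i x $ i)\<bar>"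
      unfolding abs_mult[symmetric] by (rule abs_ge_minus_self)
    also have "\<dots> \<le> \<bar>c\<bar> * (wdim k a * halfball_mass N k a * r powr (wdim k a - 1))"
    proof (rule mult_left_mono[OF ball_divergence_bound[OF N a D x0 r G K(2)]])
      fix x assume x: "x \<in> ?H"
      have "(\<chi> i. ?\<Psi> i x) = weight k a x *\<^sub>R g x" using x by (simp add: vec_eq_iff)
      then show "N (\<chi> i. ?\<Psi> i x) \<le> weight k a x"
        using mult_left_mono[OF g1[of x] w0[of x]] by (simp add: is_normD[OF N] w0)
    qed simp
    finally show "(LINT x|M. g x \<bullet> \<nu>' x) \<le> \<bar>c\<bar> * (wdim k a * halfball_mass N k a * r powr (wdim k a - 1))" .
  qed (use nu_le in auto)
  finally show ?thesis .
qed

text \<open>By the Sobolev inequality the variation is at least \<open>\<parallel>f\<parallel> / S\<close>, and the upper bound for the variation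
  is exactly this number.\<close>

lemma halfball_function_equality:
  assumes dm: "derivative_measure k f \<mu> \<nu>"
  shows "weighted_Lp_norm (wdim k a / (wdim k a - 1)) k a f = ennreal (sobolev_const N k a) * weighted_variation N k a \<mu> \<nu>"
proof (rule antisym)
  show "weighted_Lp_norm (wdim k a / (wdim k a - 1)) k a f \<le> ennreal (sobolev_const N k a) * weighted_variation N k a \<mu> \<nu>"
    by (rule sobolev_weighted_BV[OF N a D halfball_function_weighted_BV halfball_function_level_sets dm])
  have "0 \<le> sobolev_const N k a" using sobolev_const_pos[OF N a D] by simp
  moreover have "0 \<le> \<bar>c\<bar> * (wdim k a * halfball_mass N k a * r powr (wdim k a - 1))"
    using D halfball_mass_pos[OF N a, of k] by simp
  ultimately show "ennreal (sobolev_const N k a) * weighted_variation N k a \<mu> \<nu> \<le> weighted_Lp_norm (wdim k a / (wdim k a - 1)) k a f"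
    unfolding halfball_function_Lp_norm by (simp add: ennreal_mult mult_left_mono[OF halfball_function_variation_le[OF dm]])
qed

end

lemma extremal_dilate:
  fixes x0 :: "real ^ 'n::finite"
  assumes N: "is_norm N" and l: "0 < l" and x0: "x0 $ k = 0"
  shows "c * extremal N k a (l *\<^sub>R (x - x0))
    = c / halfball_mass N k a powr ((wdim k a - 1) / wdim k a) * indicator {x \<in> halfspace k. N (x - x0) \<le> 1 / l} x"
proof -
  have "l *\<^sub>R (x - x0) \<in> {x. N x \<le> 1} \<inter> halfspace k \<longleftrightarrow> x \<in> {x \<in> halfspace k. N (x - x0) \<le> 1 / l}"
    using l x0 by (auto simp: is_normD[OF N] halfspace_def zero_less_mult_iff pos_le_divide_eq[OF l] mult.commute[of l])
  then show ?thesis by (simp add: extremal_def indicator_def)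
qed

theorem proposition1p2:
  fixes N :: "real ^ 'n \<Rightarrow> real" and k :: "'n::finite" and a S :: real
  assumes "is_norm N" and "0 \<le> a" and "1 < wdim k a"
    and "S = 1 / wdim k a * halfball_mass N k a powr (- 1 / wdim k a)"
  shows "is_sobolev_const N k a (ennreal S)
    \<and> (\<forall>C. is_sobolev_const N k a C \<longrightarrow> ennreal S \<le> C)
    \<and> (\<forall>f \<mu> \<nu>. weighted_BV N k a f
          \<and> (\<forall>t>0. emeasure (wmeasure k a) {x \<in> halfspace k. t < \<bar>f x\<bar>} < \<infinity>)
          \<and> derivative_measure k f \<mu> \<nu>
        \<longrightarrow> weighted_Lp_norm (wdim k a / (wdim k a - 1)) k a f
              \<le> ennreal S * weighted_variation N k a \<mu> \<nu>)
    \<and> (\<forall>c l x0 f. 0 < l \<and> x0 $ k = 0 \<and> f = (\<lambda>x. c * extremal N k a (l *\<^sub>R (x - x0)))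
        \<longrightarrow> weighted_BV N k a f
          \<and> (\<forall>t>0. emeasure (wmeasure k a) {x \<in> halfspace k. t < \<bar>f x\<bar>} < \<infinity>)
          \<and> (\<forall>\<mu> \<nu>. derivative_measure k f \<mu> \<nu>
              \<longrightarrow> weighted_Lp_norm (wdim k a / (wdim k a - 1)) k a f
                    = ennreal S * weighted_variation N k a \<mu> \<nu>))"
proof -
  note assm = assms(1-3)
  have S: "S = sobolev_const N k a" using assms(4) by (simp add: sobolev_const_def)
  show ?thesis
    unfolding S
  proof (intro conjI allI impI; (elim conjE)?)
    show "is_sobolev_const N k a (ennreal (sobolev_const N k a))" by (rule sobolev_smooth[OF assm])
    show "ennreal (sobolev_const N k a) \<le> C" if "is_sobolev_const N k a C" for C
      by (rule sobolev_sharp[OF assm that])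
    show "weighted_Lp_norm (wdim k a / (wdim k a - 1)) k a f
              \<le> ennreal (sobolev_const N k a) * weighted_variation N k a \<mu> \<nu>"
      if "weighted_BV N k a f" "\<forall>t>0. emeasure (wmeasure k a) {x \<in> halfspace k. t < \<bar>f x\<bar>} < \<infinity>"
        "derivative_measure k f \<mu> \<nu>" for f \<mu> \<nu>
      by (rule sobolev_weighted_BV[OF assm that(1) _ that(3)]) (use that(2) in blast)
    fix c l :: real and x0 :: "real ^ 'n" and f assume l: "0 < l" and x0: "x0 $ k = 0"
      and "f = (\<lambda>x. c * extremal N k a (l *\<^sub>R (x - x0)))"
    then have f: "f = (\<lambda>x. c / halfball_mass N k a powr ((wdim k a - 1) / wdim k a)
        * indicator {x \<in> halfspace k. N (x - x0) \<le> 1 / l} x)"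
      by (simp only: extremal_dilate[OF assms(1) l x0])
    have r: "0 < 1 / l" using l by simp
    note E = assm x0 r f
    show "weighted_BV N k a f" by (rule halfball_function_weighted_BV[OF E])
    show "emeasure (wmeasure k a) {x \<in> halfspace k. t < \<bar>f x\<bar>} < \<infinity>" if "0 < t" for t
      by (rule halfball_function_level_sets[OF E that])
    show "weighted_Lp_norm (wdim k a / (wdim k a - 1)) k a f
        = ennreal (sobolev_const N k a) * weighted_variation N k a \<mu> \<nu>" if "derivative_measure k f \<mu> \<nu>" for \<mu> \<nu>
      by (rule halfball_function_equality[OF E that])
  qed
qed

end
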